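(* Let $S$ be a connected closed oriented surface with a simple triangulation $G$ with sets of vertices, edges and triangles $V,E,F$. Let $J\subset I\subset V$ be possibly empty subsets, let $\vec T=(T_v)_{v\in V}\in\partial_0^I\Omega_T$ and $\vec k(0)\in\partial^J\Omega_k$. Then the flow ray $\vec k(t)$, $t\ge0$, in $\partial^J\Omega_k$ with initial data $\vec k(0)$ of the combinatorial Ricci flow $$\frac{\mathrm d k_v(t)}{\mathrm d t}=-\big(T_v(\vec k(t))-T_v\big)\,k_v(t),\qquad v\in V\setminus J,$$ converges to $\widehat\Phi^{-1}(\vec T)\in\partial^I\Omega_k$ as $t\to+\infty$.
   Context: Generalized circles. A generalized circle of geodesic curvature $k\ge0$ in $\mathbb H^2$ is: for $k>1$ a circle of radius $r$, $k=\coth r$ (center: its usual center); for $k=1$ a horocycle (center: its ideal point); for $0<k<1$ a hypercycle, i.e. one component of the set of points at distance $r$ from a complete geodesic (its axis, also called its center), $k=\tanh r$; for $k=0$ a complete geodesic (its own center and axis). Its convex side is the closed disk, closed horoball, closed region bounded by the hypercycle containing its axis, or, for $k=0$, a chosen closed half-plane. Two generalized circles are externally tangent if they are tangent at a point of $\mathbb H^2$ and their convex sides have disjoint interiors; two geodesics ($k=0$) count as externally tangent if they are distinct, share an ideal endpoint (their tangency point) and their chosen half-planes have disjoint interiors. Triangles. For $(k_1,k_2,k_3)\in\mathbb R_{\ge0}^3$ there is, up to isometry, a unique triple of pairwise externally tangent generalized circles $C_1,C_2,C_3$, arranged counterclockwise, with $C_i$ of geodesic curvature $k_i$. The edge $e_{ij}$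 is the geodesic joining the centers of $C_i,C_j$ through their tangency point $t_{ij}$ (perpendicular to the axis of any of them with curvature $<1$; it degenerates to the ideal point $t_{ij}$ if $k_i=k_j=0$); the vertex $v_i$ is the center of $C_i$ if $k_i\ge1$ and the part of the axis of $C_i$ between the two edges if $k_i<1$. The (possibly degenerated) circle packed triangle is the closed polygon bounded by vertices and edges. If $k_i>0$ let $l_i$ be the length of the arc of $C_i$ inside this triangle joining its two tangency points, and $T_i(k_1,k_2,k_3)=k_il_i$; if $k_i=0$ put $T_i=0$. For $\vec k=(k_v)\in\mathbb R_{\ge0}^V$ and $f=(uvw)\in F$, realize $f$ as the circle packed triangle of curvature $(k_u,k_v,k_w)$, let $T_v^f(\vec k)$ be the total geodesic curvature of the arc at $v$ in it, and $T_v(\vec k)=\sum_{f\ni v}T_v^f(\vec k)$. Sets. $\overline\Omega_k=\mathbb R_{\ge0}^V$. For non-empty $I\subset V$, $F_I$ is the set of triangles with at least one vertex in $I$, and $\eta^I(\vec T)=\pi|F_I|-\sum_{i\in I}T_i$. $\widehat\Omega_T=\{\vec T\in\mathbb R_{\ge0}^V:\eta^I(\vec T)>0\ \forall\,\varnothing\ne I\subset V\}$. For $I\subset V$ (possibly empty), $\partial^I\Omega_k=\{\vec k\in\overline\Omega_k: k_i=0\iff i\in I\}$, $\partial_0^I\Omega_T=\{\vec T\in\widehat\Omega_T:T_i=0\iff i\in I\}$. Points of $\partial^J\Omega_k$ are written $(k_v)_{v\in V\setminus J}$, with $k_v=0$ understood for $v\in J$. $\widehat\Phi:\overline\Omega_k\to\widehat\Omega_T$,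 $\vec k\mapsto(T_v(\vec k))_{v\in V}$, is a homeomorphism mapping $\partial^I\Omega_k$ onto $\partial_0^I\Omega_T$ for each $I\subset V$. Convergence is in $\overline\Omega_k=\mathbb R_{\ge0}^V$. *)

theory Defs
  imports "HOL-Analysis.Analysis"
begin

section \<open>The hyperbolic plane\<close>

text \<open>We use the Poincare disk model: the hyperbolic plane is the open unit disk, its ideal points
  are the points of the unit circle, and closures in the complex plane add the ideal endpoints.\<close>

abbreviation hyp_plane :: "complex set" where
  "hyp_plane \<equiv> ball 0 1"

abbreviation ideal_points :: "complex set" where
  "ideal_points \<equiv> sphere 0 1"

definition hdist :: "complex \<Rightarrow> complex \<Rightarrow> real" where
  "hdist z w = arcosh (1 + 2 * (norm (z - w))\<^sup>2 / ((1 - (norm z)\<^sup>2) * (1 - (norm w)\<^sup>2)))"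

text \<open>Length of a piecewise smooth path for the metric \<open>2 |dz| / (1 - |z|^2)\<close>.\<close>

definition hlength :: "(real \<Rightarrow> complex) \<Rightarrow> real" where
  "hlength p = integral {0..1} (\<lambda>t. 2 * norm (vector_derivative p (at t)) / (1 - (norm (p t))\<^sup>2))"

definition geodesic :: "complex set \<Rightarrow> bool" where
  "geodesic g \<longleftrightarrow> g \<subseteq> hyp_plane \<and>
     (\<exists>\<gamma> :: real \<Rightarrow> complex. range \<gamma> = g \<and> (\<forall>s t. hdist (\<gamma> s) (\<gamma> t) = \<bar>s - t\<bar>))"

text \<open>The closed geodesic segment \<open>s\<close> of the complete geodesic \<open>g\<close> with endpoints \<open>a\<close> and \<open>b\<close>;
  the endpoints may be ideal.\<close>

definition hsegment :: "complex set \<Rightarrow> complex \<Rightarrow> complex \<Rightarrow> complex set \<Rightarrow> bool" where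
  "hsegment g a b s \<longleftrightarrow>
     (\<exists>p. arc p \<and> pathstart p = a \<and> pathfinish p = b \<and> path_image p = s \<and> s \<subseteq> closure g)"

definition tangent_vector :: "complex set \<Rightarrow> complex \<Rightarrow> complex \<Rightarrow> bool" where
  "tangent_vector A p v \<longleftrightarrow> v \<noteq> 0 \<and>
     (\<exists>\<gamma> :: real \<Rightarrow> complex. range \<gamma> \<subseteq> A \<and> \<gamma> 0 = p \<and> (\<gamma> has_vector_derivative v) (at 0))"

definition tangent_at :: "complex \<Rightarrow> complex set \<Rightarrow> complex set \<Rightarrow> bool" where
  "tangent_at p A B \<longleftrightarrow> (\<exists>v. tangent_vector A p v \<and> tangent_vector B p v)"

text \<open>The model is conformal, so Euclidean and hyperbolic right angles agree.\<close>

definition perpendicular_at :: "complex \<Rightarrow> complex set \<Rightarrow> complex set \<Rightarrow> bool" where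
  "perpendicular_at p A B \<longleftrightarrow>
     (\<exists>v w. tangent_vector A p v \<and> tangent_vector B p w \<and> v \<bullet> w = 0)"

section \<open>Generalized circles\<close>

text \<open>The field \<open>side\<close> is the convex side. The field \<open>center\<close> is a singleton for curvature
  at least 1 and the axis for curvature below 1.\<close>

record gcircle =
  curve :: "complex set"
  side :: "complex set"
  center :: "complex set"

text \<open>A horocycle at \<open>p\<close> is a Euclidean circle internally tangent to the unit circle at \<open>p\<close>,
  with \<open>p\<close> removed.\<close>

inductive gen_circle :: "real \<Rightarrow> gcircle \<Rightarrow> bool" where
  circle: "\<lbrakk>c \<in> hyp_plane; r > 0\<rbrakk> \<Longrightarrow>
    gen_circle (cosh r / sinh r)
      \<lparr>curve = {z \<in> hyp_plane. hdist c z = r}, side = {z \<in> hyp_plane. hdist c z \<le> r}, center = {c}\<rparr>"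
| horocycle: "\<lbrakk>p \<in> ideal_points; 0 < s; s < 1\<rbrakk> \<Longrightarrow>
    gen_circle 1
      \<lparr>curve = sphere ((1 - s) *\<^sub>R p) s - {p}, side = cball ((1 - s) *\<^sub>R p) s - {p}, center = {p}\<rparr>"
| hypercycle: "\<lbrakk>geodesic g; r > 0; C \<in> components {z \<in> hyp_plane. (INF w\<in>g. hdist z w) = r};
      K \<in> components (hyp_plane - C); g \<subseteq> K\<rbrakk> \<Longrightarrow>
    gen_circle (tanh r) \<lparr>curve = C, side = C \<union> K, center = g\<rparr>"
| line: "\<lbrakk>geodesic g; K \<in> components (hyp_plane - g)\<rbrakk> \<Longrightarrow>
    gen_circle 0 \<lparr>curve = g, side = g \<union> K, center = g\<rparr>"

text \<open>External tangency of generalized circles of curvatures \<open>k1\<close> and \<open>k2\<close>,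
  with tangency point \<open>t\<close>.\<close>

definition ext_tangent :: "real \<Rightarrow> gcircle \<Rightarrow> real \<Rightarrow> gcircle \<Rightarrow> complex \<Rightarrow> bool" where
  "ext_tangent k1 C1 k2 C2 t \<longleftrightarrow>
     interior (side C1) \<inter> interior (side C2) = {} \<and>
     (if k1 = 0 \<and> k2 = 0
      then curve C1 \<noteq> curve C2 \<and> t \<in> ideal_points \<inter> closure (curve C1) \<inter> closure (curve C2)
      else t \<in> hyp_plane \<and> tangent_at t (curve C1) (curve C2))"

section \<open>Circle packed triangles\<close>

text \<open>The edge \<open>e\<close> between two generalized circles with tangency point \<open>t\<close>. Its endpoints are
  \<open>a\<close> at the center of the first and \<open>b\<close> at the center of the second circle: the usual or ideal
  center if the curvature is at least 1, the foot of the perpendicular on the axis otherwise.\<close>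

definition cp_edge ::
  "real \<Rightarrow> gcircle \<Rightarrow> real \<Rightarrow> gcircle \<Rightarrow> complex \<Rightarrow> complex \<Rightarrow> complex \<Rightarrow> complex set \<Rightarrow> bool" where
  "cp_edge k1 C1 k2 C2 t a b e \<longleftrightarrow>
     (if k1 = 0 \<and> k2 = 0 then a = t \<and> b = t \<and> e = {t}
      else \<exists>g. geodesic g \<and> hsegment g a b e \<and> t \<in> e \<and> a \<in> center C1 \<and> b \<in> center C2 \<and>
             (k1 < 1 \<longrightarrow> perpendicular_at a g (center C1)) \<and>
             (k2 < 1 \<longrightarrow> perpendicular_at b g (center C2)))"

text \<open>The vertex \<open>v\<close> at a generalized circle at whose center the two edges end in \<open>a\<close> and \<open>b\<close>.\<close>

definition cp_vertex :: "real \<Rightarrow> gcircle \<Rightarrow> complex \<Rightarrow> complex \<Rightarrow> complex set \<Rightarrow> bool" where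
  "cp_vertex k C a b v \<longleftrightarrow> (if k \<ge> 1 then v = center C else hsegment (center C) a b v)"

text \<open>The circle packed triangle \<open>\<Delta>\<close> (including its ideal points) of the three pairwise
  externally tangent generalized circles. The counterclockwise arrangement is expressed through the
  tangency points \<open>t12\<close>, \<open>t23\<close>, \<open>t31\<close>: they lie on a Euclidean circle contained in the closed unit
  disk, so that their Euclidean orientation is invariant under orientation preserving isometries.\<close>

definition cp_triangle ::
  "real \<Rightarrow> real \<Rightarrow> real \<Rightarrow> gcircle \<Rightarrow> gcircle \<Rightarrow> gcircle \<Rightarrow>
   complex \<Rightarrow> complex \<Rightarrow> complex \<Rightarrow> complex set \<Rightarrow> bool" where
  "cp_triangle k1 k2 k3 C1 C2 C3 t12 t23 t31 \<Delta> \<longleftrightarrow>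
     gen_circle k1 C1 \<and> gen_circle k2 C2 \<and> gen_circle k3 C3 \<and>
     ext_tangent k1 C1 k2 C2 t12 \<and> ext_tangent k2 C2 k3 C3 t23 \<and> ext_tangent k3 C3 k1 C1 t31 \<and>
     Im (cnj (t23 - t12) * (t31 - t12)) > 0 \<and>
     (\<exists>a12 a21 a23 a32 a31 a13 e12 e23 e31 v1 v2 v3.
        cp_edge k1 C1 k2 C2 t12 a12 a21 e12 \<and>
        cp_edge k2 C2 k3 C3 t23 a23 a32 e23 \<and>
        cp_edge k3 C3 k1 C1 t31 a31 a13 e31 \<and>
        cp_vertex k1 C1 a12 a13 v1 \<and> cp_vertex k2 C2 a23 a21 v2 \<and> cp_vertex k3 C3 a31 a32 v3 \<and>
        (let B = e12 \<union> e23 \<union> e31 \<union> v1 \<union> v2 \<union> v3 in \<Delta> = B \<union> inside B))"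

text \<open>\<open>cp_arc_length k1 k2 k3 l\<close>: the arc of the first generalized circle inside the triangle has
  length \<open>l\<close>.\<close>

definition cp_arc_length :: "real \<Rightarrow> real \<Rightarrow> real \<Rightarrow> real \<Rightarrow> bool" where
  "cp_arc_length k1 k2 k3 l \<longleftrightarrow>
     (\<exists>C1 C2 C3 t12 t23 t31 \<Delta> p.
        cp_triangle k1 k2 k3 C1 C2 C3 t12 t23 t31 \<Delta> \<and>
        arc p \<and> valid_path p \<and> pathstart p = t12 \<and> pathfinish p = t31 \<and>
        path_image p \<subseteq> curve C1 \<inter> \<Delta> \<and> l = hlength p)"

text \<open>The function \<open>T\<^sub>1\<close>. Since a cyclic relabelling preserves the counterclockwise arrangement,
  \<open>T\<^sub>2 (k1, k2, k3) = T\<^sub>1 (k2, k3, k1)\<close> and \<open>T\<^sub>3 (k1, k2, k3) = T\<^sub>1 (k3, k1, k2)\<close>.\<close>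

definition tri_curv :: "real \<Rightarrow> real \<Rightarrow> real \<Rightarrow> real" where
  "tri_curv k1 k2 k3 = (if k1 = 0 then 0 else k1 * (THE l. cp_arc_length k1 k2 k3 l))"

section \<open>Triangulated surfaces\<close>

definition connected_closed_surface :: "'a topology \<Rightarrow> bool" where
  "connected_closed_surface S \<longleftrightarrow>
     topspace S \<noteq> {} \<and> connected_space S \<and> compact_space S \<and> Hausdorff_space S \<and>
     (\<forall>x \<in> topspace S. \<exists>U. openin S U \<and> x \<in> U \<and>
        subtopology S U homeomorphic_space top_of_set (ball (0::complex) 1))"

type_synonym 'a triangle = "'a \<times> 'a \<times> 'a"

fun tri_vertices :: "'a triangle \<Rightarrow> 'a set" where
  "tri_vertices (u, v, w) = {u, v, w}"

fun tri_edges :: "'a triangle \<Rightarrow> 'a set set" where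
  "tri_edges (u, v, w) = {{u, v}, {v, w}, {w, u}}"

fun tri_dir_edges :: "'a triangle \<Rightarrow> ('a \<times> 'a) set" where
  "tri_dir_edges (u, v, w) = {(u, v), (v, w), (w, u)}"

abbreviation std_triangle :: "complex set" where
  "std_triangle \<equiv> convex hull {0, 1, \<i>}"

text \<open>The map \<open>\<phi>\<close> realizes the triangle \<open>(u, v, w)\<close> in \<open>S\<close>, its sides being the arcs \<open>A\<close> of the
  graph.\<close>

fun tri_realization ::
  "'a topology \<Rightarrow> ('a set \<Rightarrow> 'a set) \<Rightarrow> (complex \<Rightarrow> 'a) \<Rightarrow> 'a triangle \<Rightarrow> bool" where
  "tri_realization S A \<phi> (u, v, w) \<longleftrightarrow>
     embedding_map (top_of_set std_triangle) S \<phi> \<and> \<phi> 0 = u \<and> \<phi> 1 = v \<and> \<phi> \<i> = w \<and>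
     \<phi> ` closed_segment 0 1 = A {u, v} \<and>
     \<phi> ` closed_segment 1 \<i> = A {v, w} \<and>
     \<phi> ` closed_segment \<i> 0 = A {w, u}"

text \<open>Simplicity of the triangulation (no loops, no multiple edges) is built into the encoding of an
  edge by the set of its two distinct endpoints. \<open>F\<close> contains each triangle exactly once, as an
  ordered triple of vertices representing a cyclic order. The orientation of \<open>S\<close> is given by these
  cyclic orders being coherent: two triangles traverse a common edge in opposite directions.\<close>

definition oriented_simple_triangulation ::
  "'a topology \<Rightarrow> 'a set \<Rightarrow> 'a set set \<Rightarrow> 'a triangle set \<Rightarrow> bool" where
  "oriented_simple_triangulation S V E F \<longleftrightarrow>
     finite V \<and> V \<subseteq> topspace S \<and>
     (\<forall>e \<in> E. e \<subseteq> V \<and> card e = 2) \<and>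
     (\<forall>f \<in> F. tri_vertices f \<subseteq> V \<and> tri_edges f \<subseteq> E) \<and>
     (\<forall>f \<in> F. \<forall>g \<in> F. f \<noteq> g \<longrightarrow> tri_dir_edges f \<inter> tri_dir_edges g = {}) \<and>
     (\<exists>A \<phi>.
        (\<forall>e \<in> E. A e \<inter> V = e \<and>
           (\<exists>p. embedding_map (top_of_set {0..1::real}) S p \<and> p ` {0..1} = A e \<and> {p 0, p 1} = e)) \<and>
        (\<forall>e \<in> E. \<forall>e' \<in> E. e \<noteq> e' \<longrightarrow> A e \<inter> A e' = e \<inter> e') \<and>
        (\<forall>f \<in> F. tri_realization S A (\<phi> f) f) \<and>
        (\<forall>f \<in> F. \<phi> f ` interior std_triangle \<inter> (V \<union> \<Union> (A ` E)) = {}) \<and>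
        (\<forall>f \<in> F. \<forall>g \<in> F. f \<noteq> g \<longrightarrow>
           \<phi> f ` interior std_triangle \<inter> \<phi> g ` interior std_triangle = {}) \<and>
        topspace S = (\<Union>f \<in> F. \<phi> f ` std_triangle))"

section \<open>Total geodesic curvatures and the flow\<close>

fun face_curv :: "('a \<Rightarrow> real) \<Rightarrow> 'a triangle \<Rightarrow> 'a \<Rightarrow> real" where
  "face_curv k (a, b, c) v =
     (if v = a then tri_curv (k a) (k b) (k c)
      else if v = b then tri_curv (k b) (k c) (k a)
      else if v = c then tri_curv (k c) (k a) (k b)
      else 0)"

definition vertex_curv :: "'a triangle set \<Rightarrow> ('a \<Rightarrow> real) \<Rightarrow> 'a \<Rightarrow> real" where
  "vertex_curv F k v = (\<Sum>f | f \<in> F \<and> v \<in> tri_vertices f. face_curv k f v)"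

text \<open>Elements of \<open>\<real>\<^sup>V\<close> are functions with value \<^term>\<open>undefined\<close> outside \<open>V\<close>.\<close>

definition Omega_k :: "'a set \<Rightarrow> ('a \<Rightarrow> real) set" where
  "Omega_k V = V \<rightarrow>\<^sub>E {0..}"

definition bd_Omega_k :: "'a set \<Rightarrow> 'a set \<Rightarrow> ('a \<Rightarrow> real) set" where
  "bd_Omega_k V I = {k \<in> Omega_k V. \<forall>i \<in> V. k i = 0 \<longleftrightarrow> i \<in> I}"

definition eta :: "'a triangle set \<Rightarrow> 'a set \<Rightarrow> ('a \<Rightarrow> real) \<Rightarrow> real" where
  "eta F I T = pi * real (card {f \<in> F. tri_vertices f \<inter> I \<noteq> {}}) - (\<Sum>i\<in>I. T i)"

definition Omega_T :: "'a set \<Rightarrow> 'a triangle set \<Rightarrow> ('a \<Rightarrow> real) set" where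
  "Omega_T V F = {T \<in> V \<rightarrow>\<^sub>E {0..}. \<forall>I. I \<noteq> {} \<and> I \<subseteq> V \<longrightarrow> eta F I T > 0}"

definition bd_Omega_T :: "'a set \<Rightarrow> 'a triangle set \<Rightarrow> 'a set \<Rightarrow> ('a \<Rightarrow> real) set" where
  "bd_Omega_T V F I = {T \<in> Omega_T V F. \<forall>i \<in> V. T i = 0 \<longleftrightarrow> i \<in> I}"

definition Phi :: "'a set \<Rightarrow> 'a triangle set \<Rightarrow> ('a \<Rightarrow> real) \<Rightarrow> ('a \<Rightarrow> real)" where
  "Phi V F k = (\<lambda>v\<in>V. vertex_curv F k v)"

definition Phi_inv :: "'a set \<Rightarrow> 'a triangle set \<Rightarrow> ('a \<Rightarrow> real) \<Rightarrow> ('a \<Rightarrow> real)" where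
  "Phi_inv V F = the_inv_into (Omega_k V) (Phi V F)"

definition flow_ray ::
  "'a set \<Rightarrow> 'a triangle set \<Rightarrow> 'a set \<Rightarrow> ('a \<Rightarrow> real) \<Rightarrow> ('a \<Rightarrow> real) \<Rightarrow> (real \<Rightarrow> 'a \<Rightarrow> real) \<Rightarrow> bool" where
  "flow_ray V F J T k0 k \<longleftrightarrow>
     k 0 = k0 \<and>
     (\<forall>t \<ge> 0. k t \<in> bd_Omega_k V J \<and>
        (\<forall>v \<in> V - J. ((\<lambda>s. k s v) has_real_derivative - (vertex_curv F (k t) v - T v) * k t v)
           (at t within {0..})))"

end

(* In the hyperboloid model a generalized circle of curvature k is the set <N, X> = k for a vector N
   with <N, N> = 1 - k^2, and two of them are externally tangent iff <N1, N2> = -1 - k1 k2. Linear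
   algebra in R^{2,1} then describes the circle packed triangles and gives
     T_1 = k1 * integral from 0 to 1/w of 2 / (1 + (k1^2 - 1) x^2) dx,  w^2 = 1 + k1 k2 + k2 k3 + k3 k1.
   Consequently T_1 increases in k1 and decreases in k2 and k3, T_1 + T_2 + T_3 increases in each
   variable, and a common scaling by a factor > 1 does not decrease T_1. As in Perron's method, the
   largest k with T_v(k) <= T_v for all v solves T_v(k) = T_v; it is the only solution and is monotone
   in the prescribed values. With K the solution for slightly larger (smaller) prescribed values, the
   maximum principle keeps the flow below (1 + C exp(-e t / 2)) K (above K divided by this factor),
   which forces convergence. *)

theory Submission
  imports Defs "HOL-Real_Asymp.Real_Asymp"
begin

section \<open>The hyperboloid model\<close>

text \<open>\<open>tri_curv\<close> is a definite description over arcs in a region given by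
  \<open>inside\<close>, so its value rests on existence and uniqueness of the arc length, and most
  of the geometry serves these two. The obstacle is a circle of curvature above 1: two of its arcs
  join the tangency points, and the one through the antipode of the first tangency point has to be
  excluded. Linear inequalities in R^{2,1} do this, since the triangle lies in every half-plane
  whose vector pairs nonpositively with the three circles.

  The prescribed values are perturbed because at a contact with a multiple of the exact solution the
  monotonicities give a weak inequality only, with which nothing forces the factor to tend to 1. A
  gap e makes it strict, at a rate that the factor can follow; continuity of the solution in the
  prescribed values then removes the gap. At a vertex of I - J, where k starts positive and tends to
  0, the upper barrier together with positivity of k is enough.\<close>

definition mink :: "complex \<times> real \<Rightarrow> complex \<times> real \<Rightarrow> real" where
  "mink N M = Re (fst N) * Re (fst M) + Im (fst N) * Im (fst M) - snd N * snd M"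

text \<open>A lift of the closed disk to R^{2,1}, proportional to the hyperboloid point. Without the
  denominator \<open>1 - (norm z)^2\<close> it stays finite at ideal points, where it is
  lightlike.\<close>

definition hvec :: "complex \<Rightarrow> complex \<times> real" where
  "hvec z = (2 * z, 1 + (norm z)\<^sup>2)"

text \<open>The inverse of \<open>hvec\<close> on rays. The square root normalises timelike vectors
  and vanishes on lightlike ones, so that one formula serves inner and ideal points.\<close>

definition hpr :: "complex \<times> real \<Rightarrow> complex" where
  "hpr Y = fst Y /\<^sub>R (snd Y + sqrt (- mink Y Y))"

lemma mink_commute: "mink N M = mink M N"
  by (simp add: mink_def algebra_simps)

lemma mink_add_left [simp]: "mink (N + N') M = mink N M + mink N' M"
  and mink_add_right [simp]: "mink M (N + N') = mink M N + mink M N'"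
  and mink_diff_left [simp]: "mink (N - N') M = mink N M - mink N' M"
  and mink_diff_right [simp]: "mink M (N - N') = mink M N - mink M N'"
  and mink_minus_left [simp]: "mink (- N) M = - mink N M"
  and mink_minus_right [simp]: "mink M (- N) = - mink M N"
  and mink_scale_left [simp]: "mink (c *\<^sub>R N) M = c * mink N M"
  and mink_scale_right [simp]: "mink M (c *\<^sub>R N) = c * mink M N"
  and mink_zero [simp]: "mink 0 M = 0" "mink M 0 = 0"
  by (simp_all add: mink_def algebra_simps)

lemma cmod_sq: "(norm (z::complex))\<^sup>2 = Re z * Re z + Im z * Im z"
  by (simp add: cmod_power2 flip: power2_eq_square)

lemma norm_sq_less_1: "z \<in> hyp_plane \<longleftrightarrow> (norm z)\<^sup>2 < 1"
  by (simp add: abs_square_less_1)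

lemma cf_pos [simp]: "z \<in> hyp_plane \<Longrightarrow> 0 < 1 - (norm z)\<^sup>2"
  by (simp add: abs_square_less_1)

lemma mink_hvec: "mink (hvec z) (hvec w) = - ((1 - (norm z)\<^sup>2) * (1 - (norm w)\<^sup>2) + 2 * (norm (z - w))\<^sup>2)"
  by (simp add: mink_def hvec_def cmod_sq algebra_simps)

lemma mink_hvec_self: "mink (hvec z) (hvec z) = - (1 - (norm z)\<^sup>2)\<^sup>2"
  by (simp add: mink_hvec power2_eq_square)

lemma hdist_nonneg: "z \<in> hyp_plane \<Longrightarrow> w \<in> hyp_plane \<Longrightarrow> 0 \<le> hdist z w"
  unfolding hdist_def
  using cf_pos[of z] cf_pos[of w] by (intro arcosh_nonneg_real) (simp del: mem_ball)

lemma cosh_hdist: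
  assumes "z \<in> hyp_plane" "w \<in> hyp_plane"
  shows "cosh (hdist z w) = - mink (hvec z) (hvec w) / ((1 - (norm z)\<^sup>2) * (1 - (norm w)\<^sup>2))"
proof -
  have p: "0 < 1 - (norm z)\<^sup>2" "0 < 1 - (norm w)\<^sup>2" using assms cf_pos by blast+
  then have "cosh (hdist z w) = 1 + 2 * (norm (z - w))\<^sup>2 / ((1 - (norm z)\<^sup>2) * (1 - (norm w)\<^sup>2))"
    unfolding hdist_def by (subst cosh_arcosh_real) auto
  then show ?thesis using p by (simp add: mink_hvec add_divide_distrib)
qed

lemma cosh_hdist_unit:
  assumes "z \<in> hyp_plane" "w \<in> hyp_plane"
  shows "cosh (hdist z w) = - mink (hvec z /\<^sub>R (1 - (norm z)\<^sup>2)) (hvec w /\<^sub>R (1 - (norm w)\<^sup>2))"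
  using cosh_hdist[OF assms] by (simp add: field_simps)

text \<open>The closed future cone without its apex; its rays are the points of the closed
  disk.\<close>

definition fcausal :: "complex \<times> real \<Rightarrow> bool" where
  "fcausal Y \<longleftrightarrow> mink Y Y \<le> 0 \<and> 0 < snd Y"

lemma fcausal_iff: "fcausal Y \<longleftrightarrow> norm (fst Y) \<le> snd Y \<and> 0 < snd Y"
proof -
  have "mink Y Y = (norm (fst Y))\<^sup>2 - (snd Y)\<^sup>2"
    unfolding mink_def cmod_sq by (simp add: power2_eq_square)
  then show ?thesis unfolding fcausal_def
    by (metis diff_le_0_iff_le norm_ge_zero order_less_imp_le power2_le_imp_le power_mono)
qed

lemma fcausal_add: "fcausal Y \<Longrightarrow> fcausal Z \<Longrightarrow> fcausal (Y + Z)"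
  unfolding fcausal_iff by (auto intro: norm_triangle_le)

lemma fcausal_scale: "fcausal Y \<Longrightarrow> 0 < c \<Longrightarrow> fcausal (c *\<^sub>R Y)"
  by (simp add: fcausal_def mult_nonneg_nonpos)

lemma fcausal_hvec: "z \<in> cball 0 1 \<Longrightarrow> fcausal (hvec z)"
  by (simp add: fcausal_def mink_hvec_self) (simp add: hvec_def add_pos_nonneg)

lemma fcausal_mink_nonpos: assumes "fcausal Y" "fcausal Z" shows "mink Y Z \<le> 0"
proof -
  have "Re (fst Y) * Re (fst Z) + Im (fst Y) * Im (fst Z) = fst Y \<bullet> fst Z" by (simp add: inner_complex_def)
  also have "\<dots> \<le> norm (fst Y) * norm (fst Z)" by (rule norm_cauchy_schwarz)
  also have "\<dots> \<le> snd Y * snd Z" using assms unfolding fcausal_iff by (intro mult_mono) auto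
  finally show ?thesis by (simp add: mink_def)
qed

lemma hpr_props:
  assumes "fcausal Y"
  shows "0 < snd Y + sqrt (- mink Y Y)"
    and "hvec (hpr Y) = (2 / (snd Y + sqrt (- mink Y Y))) *\<^sub>R Y"
    and "1 - (norm (hpr Y))\<^sup>2 = 2 * sqrt (- mink Y Y) / (snd Y + sqrt (- mink Y Y))"
    and "hpr Y \<in> cball 0 1"
    and "mink Y Y < 0 \<Longrightarrow> hpr Y \<in> hyp_plane"
proof -
  define s where "s = sqrt (- mink Y Y)"
  have s: "s\<^sup>2 = - mink Y Y" "0 \<le> s" using assms by (auto simp: s_def fcausal_def)
  have y: "0 < snd Y" using assms by (simp add: fcausal_def)
  then show p: "0 < snd Y + sqrt (- mink Y Y)" using s by (simp add: s_def add_pos_nonneg)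
  then have p': "0 < snd Y + s" by (simp add: s_def)
  have "(norm (fst Y))\<^sup>2 = (snd Y)\<^sup>2 - s\<^sup>2" unfolding s unfolding mink_def cmod_sq by (simp add: power2_eq_square)
  \<comment> \<open>All claims come from this factorisation: one factor cancels against the
    normalisation by \<open>snd Y + s\<close>.\<close>
  also have "\<dots> = (snd Y - s) * (snd Y + s)" by (simp add: power2_eq_square algebra_simps)
  finally have n: "(norm (fst Y))\<^sup>2 = (snd Y - s) * (snd Y + s)" .
  have h: "hpr Y = fst Y /\<^sub>R (snd Y + s)" by (simp add: hpr_def s_def)
  have nn: "(norm (hpr Y))\<^sup>2 = (snd Y - s) / (snd Y + s)"
    unfolding h using p' by (simp add: power_mult_distrib n) (simp add: power2_eq_square divide_simps)
  show "1 - (norm (hpr Y))\<^sup>2 = 2 * sqrt (- mink Y Y) / (snd Y + sqrt (- mink Y Y))"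
    unfolding nn s_def[symmetric] using p' by (simp add: field_simps)
  then have c: "1 - (norm (hpr Y))\<^sup>2 = 2 * s / (snd Y + s)" by (simp add: s_def)
  have "1 + (norm (hpr Y))\<^sup>2 = 2 / (snd Y + s) * snd Y" unfolding nn using p' by (simp add: field_simps)
  moreover have "2 * hpr Y = (2 / (snd Y + s)) *\<^sub>R fst Y" unfolding h using p'
    by (simp add: scaleR_conv_of_real field_simps)
  ultimately show "hvec (hpr Y) = (2 / (snd Y + sqrt (- mink Y Y))) *\<^sub>R Y"
    unfolding s_def[symmetric] by (simp add: hvec_def prod_eq_iff)
  have "0 \<le> 1 - (norm (hpr Y))\<^sup>2" unfolding c using p' s by simp
  then show "hpr Y \<in> cball 0 1" by (simp add: abs_square_le_1)
  show "hpr Y \<in> hyp_plane" if "mink Y Y < 0"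
  proof -
    have "0 < s" using that by (simp add: s_def)
    then have "0 < 1 - (norm (hpr Y))\<^sup>2" unfolding c using p' by simp
    then show ?thesis unfolding norm_sq_less_1 by simp
  qed
qed

lemma hpr_hvec: "z \<in> cball 0 1 \<Longrightarrow> hpr (hvec z) = z"
proof -
  assume "z \<in> cball 0 1"
  then have "sqrt (- mink (hvec z) (hvec z)) = 1 - (norm z)\<^sup>2"
    unfolding mink_hvec_self by (simp add: abs_square_le_1)
  then show ?thesis unfolding hpr_def by (simp add: hvec_def scaleR_conv_of_real)
qed

lemma hpr_scale: "0 < c \<Longrightarrow> hpr (c *\<^sub>R Y) = hpr Y"
proof -
  assume c: "0 < c"
  have "sqrt (- mink (c *\<^sub>R Y) (c *\<^sub>R Y)) = sqrt (c\<^sup>2 * (- mink Y Y))"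
    by (simp add: power2_eq_square)
  also have "\<dots> = c * sqrt (- mink Y Y)" using c by (simp only: real_sqrt_mult real_sqrt_abs abs_of_pos)
  finally have s: "sqrt (- mink (c *\<^sub>R Y) (c *\<^sub>R Y)) = c * sqrt (- mink Y Y)" .
  have "snd (c *\<^sub>R Y) + sqrt (- mink (c *\<^sub>R Y) (c *\<^sub>R Y)) = c * (snd Y + sqrt (- mink Y Y))"
    unfolding s by (simp add: distrib_left)
  then show ?thesis using c unfolding hpr_def by simp
qed

lemma hvec_inject: "z \<in> cball 0 1 \<Longrightarrow> w \<in> cball 0 1 \<Longrightarrow> hvec z = c *\<^sub>R hvec w \<Longrightarrow> 0 < c \<Longrightarrow> z = w"
  by (metis hpr_hvec hpr_scale)

section \<open>Determinants, Gram determinants and cross product in R^{2,1}\<close>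

definition det3 :: "complex \<times> real \<Rightarrow> complex \<times> real \<Rightarrow> complex \<times> real \<Rightarrow> real" where
  "det3 u v w = Re (fst u) * (Im (fst v) * snd w - snd v * Im (fst w))
     - Im (fst u) * (Re (fst v) * snd w - snd v * Re (fst w))
     + snd u * (Re (fst v) * Im (fst w) - Im (fst v) * Re (fst w))"

definition gram3 :: "complex \<times> real \<Rightarrow> complex \<times> real \<Rightarrow> complex \<times> real \<Rightarrow> real" where
  "gram3 u v w = mink u u * (mink v v * mink w w - (mink v w)\<^sup>2)
     - mink u v * (mink u v * mink w w - mink v w * mink u w)
     + mink u w * (mink u v * mink v w - mink v v * mink u w)"

text \<open>The sign is the determinant of the form, which has signature (2,1).\<close>

lemma det3_sq: "(det3 u v w)\<^sup>2 = - gram3 u v w"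
  unfolding det3_def gram3_def mink_def by algebra

text \<open>Cramer's rule: a nonzero Gram determinant makes the three vectors a basis, against which
  a nondegenerate form detects every vector. Later expansions are verified by pairing both sides
  with a basis.\<close>

lemma ortho_zero:
  assumes "gram3 u v w \<noteq> 0" "mink d u = 0" "mink d v = 0" "mink d w = 0"
  shows "d = 0"
proof -
  have D: "det3 u v w \<noteq> 0" using assms(1) det3_sq[of u v w] by auto
  have "det3 u v w * Re (fst d) = 0" "det3 u v w * Im (fst d) = 0" "det3 u v w * snd d = 0"
    using assms(2-4) unfolding det3_def mink_def by algebra+
  then show ?thesis using D by (simp add: prod_eq_iff complex_eq_iff)
qed

text \<open>The Euclidean cross product with the sign of the time coordinate reversed, which makes
  it orthogonal for the Lorentz form.\<close>

definition lcross :: "complex \<times> real \<Rightarrow> complex \<times> real \<Rightarrow> complex \<times> real" where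
  "lcross u v = (Complex (Im (fst u) * snd v - snd u * Im (fst v)) (snd u * Re (fst v) - Re (fst u) * snd v),
     - (Re (fst u) * Im (fst v) - Im (fst u) * Re (fst v)))"

lemma lcross_orth: "mink (lcross u v) u = 0" "mink (lcross u v) v = 0"
  unfolding lcross_def mink_def by (simp_all add: algebra_simps)

lemma lcross_self: "mink (lcross u v) (lcross u v) = (mink u v)\<^sup>2 - mink u u * mink v v"
  unfolding lcross_def mink_def by (simp add: algebra_simps power2_eq_square)

lemma frame_expand:
  assumes "mink e e = -1" "mink e' e' = 1" "mink N N = 1" "mink e e' = 0" "mink e N = 0" "mink e' N = 0"
  shows "X = (- mink X e) *\<^sub>R e + mink X e' *\<^sub>R e' + mink X N *\<^sub>R N"
proof -
  have s: "mink e' e = 0" "mink N e = 0" "mink N e' = 0" using assms mink_commute by metis+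
  have "gram3 e e' N \<noteq> 0" using assms by (simp add: gram3_def)
  then have "X - ((- mink X e) *\<^sub>R e + mink X e' *\<^sub>R e' + mink X N *\<^sub>R N) = 0"
    by (rule ortho_zero) (simp_all add: assms s)
  then show ?thesis by simp
qed

text \<open>The hyperboloid point over \<open>z\<close>. Distances and levels are read off here,
  while \<open>hvec\<close> is kept for statements that include ideal points.\<close>

definition uvec :: "complex \<Rightarrow> complex \<times> real" where
  "uvec z = hvec z /\<^sub>R (1 - (norm z)\<^sup>2)"

lemma hvec_uvec: "z \<in> hyp_plane \<Longrightarrow> hvec z = (1 - (norm z)\<^sup>2) *\<^sub>R uvec z"
  using cf_pos[of z] by (simp add: uvec_def del: mem_ball)

lemma uvec_self: "z \<in> hyp_plane \<Longrightarrow> mink (uvec z) (uvec z) = -1"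
  using cf_pos[of z] by (simp add: uvec_def mink_hvec_self del: mem_ball) (simp add: power2_eq_square divide_simps)

lemma fcausal_uvec: "z \<in> hyp_plane \<Longrightarrow> fcausal (uvec z)"
  unfolding uvec_def using cf_pos[of z] by (intro fcausal_scale fcausal_hvec) auto

lemma hpr_uvec: "z \<in> hyp_plane \<Longrightarrow> hpr (uvec z) = z"
  unfolding uvec_def using cf_pos[of z] by (subst hpr_scale) (auto intro!: hpr_hvec)

lemma hpr_unit:
  assumes "fcausal Y" "mink Y Y = -1"
  shows "hpr Y \<in> hyp_plane" "uvec (hpr Y) = Y"
proof -
  show "hpr Y \<in> hyp_plane" using hpr_props(5)[OF assms(1)] assms(2) by simp
  have p: "0 < snd Y + 1" using hpr_props(1)[OF assms(1)] assms(2) by simp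
  then show "uvec (hpr Y) = Y" unfolding uvec_def hpr_props(2,3)[OF assms(1)] assms(2)
    by (simp add: field_simps)
qed

lemma mink_hvec_uvec: "z \<in> hyp_plane \<Longrightarrow> mink N (hvec z) = (1 - (norm z)\<^sup>2) * mink N (uvec z)"
  by (simp add: hvec_uvec)

lemma cosh_hdist': "z \<in> hyp_plane \<Longrightarrow> w \<in> hyp_plane \<Longrightarrow> cosh (hdist z w) = - mink (uvec z) (uvec w)"
  using cosh_hdist_unit unfolding uvec_def by blast

lemma mink_uvec_le: "z \<in> hyp_plane \<Longrightarrow> w \<in> hyp_plane \<Longrightarrow> mink (uvec z) (uvec w) \<le> -1"
  using cosh_hdist'[of z w] cosh_real_ge_1[of "hdist z w"] by linarith

lemma mink_uvec_eq:
  assumes "z \<in> hyp_plane" "w \<in> hyp_plane" "mink (uvec z) (uvec w) = -1" shows "z = w"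
proof -
  have p: "0 < 1 - (norm z)\<^sup>2" "0 < 1 - (norm w)\<^sup>2" using assms cf_pos by blast+
  have "mink (hvec z) (hvec w) = - ((1 - (norm z)\<^sup>2) * (1 - (norm w)\<^sup>2))"
    using assms by (simp add: hvec_uvec algebra_simps)
  then show ?thesis by (simp add: mink_hvec)
qed

lemma hdist_eq_iff:
  assumes "z \<in> hyp_plane" "w \<in> hyp_plane" "0 \<le> r"
  shows "hdist z w = r \<longleftrightarrow> - mink (uvec z) (uvec w) = cosh r"
    and "hdist z w \<le> r \<longleftrightarrow> - mink (uvec z) (uvec w) \<le> cosh r"
  using cosh_hdist'[OF assms(1,2)] hdist_nonneg[OF assms(1,2)] assms(3)
  by (metis arcosh_cosh_real, metis cosh_real_nonneg_le_iff)

lemma mink_eq_norm: "mink Y Y = (norm (fst Y))\<^sup>2 - (snd Y)\<^sup>2"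
  unfolding mink_def cmod_sq by (simp add: power2_eq_square)

text \<open>A causal vector lies in the future or in the past cone, and the sign of its product with
  one future vector decides which.\<close>

lemma fcausalI_mink:
  assumes "mink Y Y \<le> 0" "fcausal Z" "mink Y Z < 0" shows "fcausal Y"
proof -
  have "snd Y \<noteq> 0"
  proof
    assume "snd Y = 0"
    then have "Y = 0" using assms(1) by (simp add: mink_eq_norm prod_eq_iff)
    then show False using assms(3) by simp
  qed
  moreover have "\<not> snd Y < 0"
  proof
    assume "snd Y < 0"
    then have "fcausal (- Y)" using assms(1) by (simp add: fcausal_def)
    from fcausal_mink_nonpos[OF this assms(2)] assms(3) show False by simp
  qed
  ultimately show ?thesis using assms(1) by (simp add: fcausal_def)
qed

section \<open>Fermi coordinates and geodesics as plane sections\<close>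

locale lorentz_frame =
  fixes e e' N :: "complex \<times> real"
  assumes ee: "mink e e = -1" and e'e': "mink e' e' = 1" and NN: "mink N N = 1"
    and ee': "mink e e' = 0" and eN: "mink e N = 0" and e'N: "mink e' N = 0"
    and fe: "0 < snd e"
begin

lemma sym: "mink e' e = 0" "mink N e = 0" "mink N e' = 0"
  using ee' eN e'N mink_commute by metis+

lemmas rels = ee e'e' NN ee' eN e'N sym

lemma fcausal_e: "fcausal e"
  using fe ee by (simp add: fcausal_def)

text \<open>Fermi coordinates along the geodesic spanned by \<open>e\<close> and \<open>e'\<close>: \<open>\<rho>\<close> is the signed distance from it.\<close>

definition fpt :: "real \<Rightarrow> real \<Rightarrow> complex \<times> real" where
  "fpt \<rho> \<tau> = cosh \<rho> *\<^sub>R (cosh \<tau> *\<^sub>R e + sinh \<tau> *\<^sub>R e') + sinh \<rho> *\<^sub>R N"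

lemma mink_fpt: "mink (fpt \<rho> \<tau>) (fpt \<rho>' \<tau>') = - cosh \<rho> * cosh \<rho>' * cosh (\<tau> - \<tau>') + sinh \<rho> * sinh \<rho>'"
  by (simp add: fpt_def rels cosh_diff algebra_simps)

lemma fpt_self: "mink (fpt \<rho> \<tau>) (fpt \<rho> \<tau>) = -1"
  using hyperbolic_pythagoras[of \<rho>] by (simp add: mink_fpt power2_eq_square)

lemma fcausal_fpt: "fcausal (fpt \<rho> \<tau>)"
proof (rule fcausalI_mink[OF _ fcausal_e])
  show "mink (fpt \<rho> \<tau>) e < 0" by (simp add: fpt_def rels)
qed (simp add: fpt_self)

lemma fpt_in: "hpr (fpt \<rho> \<tau>) \<in> hyp_plane" and uvec_fpt: "uvec (hpr (fpt \<rho> \<tau>)) = fpt \<rho> \<tau>"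
  using hpr_unit fcausal_fpt fpt_self by blast+

lemma mink_N_fpt: "mink N (fpt \<rho> \<tau>) = sinh \<rho>"
  by (simp add: fpt_def rels)

text \<open>The distance from the geodesic is recovered from the component along \<open>N\<close>,
  then the position of the foot from the component along \<open>e'\<close>; the component along
  \<open>e\<close> has the right sign because the point is future directed.\<close>

lemma fpt_cover:
  assumes "z \<in> hyp_plane"
  obtains \<tau> where "uvec z = fpt (arsinh (mink N (uvec z))) \<tau>"
proof -
  define X where "X = uvec z"
  define A B S where "A = - mink X e" and "B = mink X e'" and "S = mink N X"
  have X: "X = A *\<^sub>R e + B *\<^sub>R e' + S *\<^sub>R N"
    using frame_expand[OF ee e'e' NN ee' eN e'N, of X] by (simp add: A_def B_def S_def mink_commute[of N])
  have "mink X X = - A\<^sup>2 + B\<^sup>2 + S\<^sup>2"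
    by (subst (1 2) X) (simp add: rels power2_eq_square)
  then have q: "A\<^sup>2 = 1 + S\<^sup>2 + B\<^sup>2" using uvec_self[OF assms] by (simp add: X_def)
  have "0 \<le> A" using fcausal_mink_nonpos[OF fcausal_uvec[OF assms] fcausal_e] by (simp add: A_def X_def)
  define \<rho> where "\<rho> = arsinh S"
  have cr: "cosh \<rho> = sqrt (1 + S\<^sup>2)" by (simp add: \<rho>_def cosh_arsinh_real add.commute)
  have cp: "0 < cosh \<rho>" by simp
  have c2: "(cosh \<rho>)\<^sup>2 = 1 + S\<^sup>2" by (simp add: cr)
  define \<tau> where "\<tau> = arsinh (B / cosh \<rho>)"
  have "(cosh \<rho> * cosh \<tau>)\<^sup>2 = (cosh \<rho>)\<^sup>2 * (1 + (B / cosh \<rho>)\<^sup>2)"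
    by (simp add: \<tau>_def power_mult_distrib cosh_arsinh_real add.commute)
  also have "\<dots> = A\<^sup>2" using cp by (simp add: power_divide distrib_left) (simp add: q c2)
  finally have "cosh \<rho> * cosh \<tau> = A" using \<open>0 \<le> A\<close> cp
    by (metis cosh_real_nonneg less_imp_le mult_nonneg_nonneg power2_eq_imp_eq)
  moreover have "cosh \<rho> * sinh \<tau> = B" unfolding \<tau>_def sinh_arsinh_real using cp by (simp del: cosh_real_pos)
  ultimately have "X = fpt \<rho> \<tau>" by (simp add: fpt_def scaleR_add_right \<rho>_def) (simp add: X)
  then show ?thesis using that by (simp add: X_def \<rho>_def S_def)
qed

lemma continuous_fpt: "continuous_on UNIV (\<lambda>x. hpr (fpt (fst x) (snd x)))"
proof -
  have "hpr (fpt \<rho> \<tau>) = fst (fpt \<rho> \<tau>) /\<^sub>R (snd (fpt \<rho> \<tau>) + 1)" for \<rho> \<tau>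
    by (simp add: hpr_def fpt_self)
  moreover have "snd (fpt \<rho> \<tau>) + 1 \<noteq> 0" for \<rho> \<tau>
    using fcausal_fpt[of \<rho> \<tau>] by (simp add: fcausal_def)
  moreover have "continuous_on UNIV (\<lambda>x. fpt (fst x) (snd x))"
    unfolding fpt_def by (intro continuous_intros)
  ultimately show ?thesis by (auto intro!: continuous_intros)
qed

lemma geodesic_fpt: "geodesic {z \<in> hyp_plane. mink N (uvec z) = 0}"
  unfolding geodesic_def
proof (intro conjI exI[where x="\<lambda>\<tau>. hpr (fpt 0 \<tau>)"] allI)
  show "range (\<lambda>\<tau>. hpr (fpt 0 \<tau>)) = {z \<in> hyp_plane. mink N (uvec z) = 0}" (is "?A = ?B")
  proof
    show "?A \<subseteq> ?B" using fpt_in uvec_fpt mink_N_fpt by auto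
    show "?B \<subseteq> ?A"
    proof
      fix z assume z: "z \<in> ?B"
      then obtain \<tau> where "uvec z = fpt 0 \<tau>" using fpt_cover[of z] by auto
      then have "z = hpr (fpt 0 \<tau>)" using z hpr_uvec by (metis (mono_tags, lifting) mem_Collect_eq)
      then show "z \<in> ?A" by blast
    qed
  qed
  fix s t
  show "hdist (hpr (fpt 0 s)) (hpr (fpt 0 t)) = \<bar>s - t\<bar>"
    using hdist_eq_iff(1)[OF fpt_in fpt_in] by (simp add: uvec_fpt mink_fpt)
qed auto

end

lemma frame_ex:
  assumes "mink N N = 1"
  obtains e e' where "lorentz_frame e e' N"
proof -
  obtain b a where N: "N = (b, a)" by fastforce
  have nb: "Re b * Re b + Im b * Im b = 1 + a * a" using assms by (simp add: N mink_def)
  define n where "n = norm b"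
  have n2: "n * n = 1 + a * a" using nb cmod_sq[of b] by (simp add: n_def power2_eq_square)
  have "n \<noteq> 0" using n2 by (metis add_nonneg_eq_0_iff mult_zero_left zero_le_one zero_le_square zero_neq_one)
  then have n: "n > 0" by (simp add: n_def)
  \<comment> \<open>\<open>e\<close> lies in the plane spanned by \<open>N\<close> and the time
    axis, and \<open>e'\<close> is horizontal and orthogonal to that plane.\<close>
  define e where "e = (Complex (a * Re b / n) (a * Im b / n), n)"
  define e' where "e' = (Complex (- Im b / n) (Re b / n), 0::real)"
  have R: "Re b * Re b = 1 + a * a - Im b * Im b" using nb by simp
  have "lorentz_frame e e' N"
  proof
    have "mink e e = a * a * (Re b * Re b + Im b * Im b) / (n * n) - n * n"
      by (simp add: mink_def e_def add_divide_distrib algebra_simps)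
    also have "\<dots> = -1" using n by (simp add: nb n2[symmetric])  (simp add: n2)
    finally show "mink e e = -1" .
    have "mink e' e' = (Re b * Re b + Im b * Im b) / (n * n)"
      by (simp add: mink_def e'_def add_divide_distrib algebra_simps)
    then show "mink e' e' = 1" using n by (simp add: nb n2[symmetric])
    show "mink e e' = 0" by (simp add: mink_def e'_def e_def)
    have "mink e N = a * (Re b * Re b + Im b * Im b) / n - n * a"
      by (simp add: mink_def e_def N add_divide_distrib algebra_simps)
    also have "\<dots> = 0" using n by (simp add: nb n2[symmetric])
    finally show "mink e N = 0" .
    show "mink e' N = 0" by (simp add: mink_def e'_def N)
  qed (use n assms in \<open>auto simp: e_def\<close>)
  then show ?thesis by (rule that)
qed

lemma geodesic_mink: "mink N N = 1 \<Longrightarrow> geodesic {z \<in> hyp_plane. mink N (uvec z) = 0}"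
  by (metis frame_ex lorentz_frame.geodesic_fpt)

text \<open>The isometry condition gives all products \<open>mink (X s) (X t)\<close>. Gram-Schmidt
  on the points at times 0 and 1 yields a frame in which every \<open>X t\<close> has components
  \<open>cosh t\<close> and \<open>sinh t\<close>; the norm -1 then leaves no component along the
  normal.\<close>

lemma geodesicE:
  assumes "geodesic g"
  obtains N where "mink N N = 1" "g = {z \<in> hyp_plane. mink N (uvec z) = 0}"
proof -
  obtain \<gamma> where g: "g \<subseteq> hyp_plane" "range \<gamma> = g" and d: "\<And>s t. hdist (\<gamma> s) (\<gamma> t) = \<bar>s - t\<bar>"
    using assms unfolding geodesic_def by blast
  have in_D: "\<gamma> t \<in> hyp_plane" for t using g by blast
  define X where "X = (\<lambda>t. uvec (\<gamma> t))"
  have XX: "mink (X s) (X t) = - cosh (s - t)" for s t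
  proof -
    have "cosh (hdist (\<gamma> s) (\<gamma> t)) = - mink (X s) (X t)" using cosh_hdist' in_D by (simp add: X_def)
    then show ?thesis using d[of s t] by simp
  qed
  define e where "e = X 0"
  define e' where "e' = (X 1 - cosh 1 *\<^sub>R X 0) /\<^sub>R sinh 1"
  define N where "N = lcross e e'"
  have sh: "sinh (1::real) \<noteq> 0" by simp
  have py: "cosh (1::real) * cosh 1 = 1 + sinh 1 * sinh 1"
    using cosh_square_eq[of "1::real"] by (simp add: power2_eq_square)
  have 1: "mink e e = -1" by (simp add: e_def XX)
  have 2: "mink e e' = 0" by (simp add: e_def e'_def XX)
  have 3: "mink e' e' = 1"
    using sh by (simp add: e'_def XX field_simps) (simp add: py algebra_simps)
  have fr: "lorentz_frame e e' N"
  proof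
    show "mink N N = 1" unfolding N_def lcross_self by (simp add: 1 2 3)
    show "mink e N = 0" "mink e' N = 0" using lcross_orth mink_commute unfolding N_def by metis+
    show "0 < snd e" using fcausal_uvec[OF in_D[of 0]] by (simp add: e_def X_def fcausal_def)
  qed (fact 1 2 3)+
  interpret lorentz_frame e e' N by (fact fr)
  have "X t = fpt 0 t" for t
  proof -
    have a: "mink (X t) e = - cosh t" by (simp add: e_def XX)
    have b: "mink (X t) e' = sinh t"
    proof -
      have "cosh (t - 1) = cosh t * cosh 1 - sinh t * sinh 1" by (simp add: cosh_diff)
      then have "- cosh (t - 1) - - (cosh 1 * cosh t) = sinh t * sinh 1" by simp
      then show ?thesis using sh by (simp add: e'_def XX field_simps)
    qed
    have x: "X t = cosh t *\<^sub>R e + sinh t *\<^sub>R e' + mink (X t) N *\<^sub>R N"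
      using frame_expand[OF ee e'e' NN ee' eN e'N, of "X t"] by (simp add: a b)
    have "mink (X t) (X t) = - (cosh t)\<^sup>2 + (sinh t)\<^sup>2 + (mink (X t) N)\<^sup>2"
      by (subst (1 2) x) (simp add: rels power2_eq_square)
    then have "mink (X t) N = 0" using XX[of t t] cosh_square_eq[of t] by simp
    then show ?thesis using x by (simp add: fpt_def)
  qed
  then have "\<gamma> t = hpr (fpt 0 t)" for t using hpr_uvec in_D unfolding X_def by metis
  then have "g = range (\<lambda>t. hpr (fpt 0 t))" using g(2) by auto
  also have "\<dots> = {z \<in> hyp_plane. mink N (uvec z) = 0}"
  proof (intro set_eqI iffI)
    fix z assume z: "z \<in> {z \<in> hyp_plane. mink N (uvec z) = 0}"
    then obtain \<tau> where "uvec z = fpt 0 \<tau>" using fpt_cover[of z] by auto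
    then show "z \<in> range (\<lambda>t. hpr (fpt 0 t))" using z hpr_uvec[of z] by auto
  next
    fix z assume "z \<in> range (\<lambda>t. hpr (fpt 0 t))"
    then show "z \<in> {z \<in> hyp_plane. mink N (uvec z) = 0}" using fpt_in uvec_fpt mink_N_fpt by auto
  qed
  finally show ?thesis using that NN by blast
qed

section \<open>Level sets of \<open>mink N\<close> and their components\<close>

context lorentz_frame
begin

lemma connected_level:
  assumes "connected A"
  shows "connected {z \<in> hyp_plane. mink N (uvec z) \<in> A}"
proof -
  have "{z \<in> hyp_plane. mink N (uvec z) \<in> A} = (\<lambda>x. hpr (fpt (fst x) (snd x))) ` ((arsinh ` A) \<times> UNIV)"
    (is "?L = ?R")
  proof
    show "?L \<subseteq> ?R"
    proof
      fix z assume z: "z \<in> ?L"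
      then obtain \<tau> where "uvec z = fpt (arsinh (mink N (uvec z))) \<tau>" using fpt_cover[of z] by blast
      then have "z = hpr (fpt (arsinh (mink N (uvec z))) \<tau>)" using z hpr_uvec[of z] by auto
      then show "z \<in> ?R" using z by force
    qed
    show "?R \<subseteq> ?L" using fpt_in uvec_fpt mink_N_fpt by auto
  qed
  moreover have "connected ((arsinh ` A) \<times> (UNIV::real set))"
    using assms by (intro connected_Times connected_continuous_image connected_UNIV continuous_intros) auto
  ultimately show ?thesis
    by (simp only:) (rule connected_continuous_image[OF continuous_on_subset[OF continuous_fpt subset_UNIV]])
qed

lemma level_ex: "\<exists>z \<in> hyp_plane. mink N (uvec z) = a"
  by (intro bexI[of _ "hpr (fpt (arsinh a) 0)"]) (simp_all only: fpt_in uvec_fpt mink_N_fpt sinh_arsinh_real)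

end

lemma continuous_uvec: "continuous_on hyp_plane (\<lambda>z. mink N (uvec z))"
proof -
  have "continuous_on hyp_plane (\<lambda>z. (Re (fst N) * Re (2 * z) + Im (fst N) * Im (2 * z) - snd N * (1 + (norm z)\<^sup>2)) / (1 - (norm z)\<^sup>2))"
    using cf_pos by (intro continuous_intros) fastforce
  then show ?thesis
    by (rule continuous_on_eq) (simp add: uvec_def mink_def hvec_def divide_inverse algebra_simps)
qed

text \<open>In Fermi coordinates each of the two sets is a product of connected sets, and a
  connected set meeting both would have to take the missing value \<open>p\<close>.\<close>

lemma level_components:
  fixes A B :: "real set"
  assumes N: "mink N N = 1" and "connected A" "connected B" "A \<noteq> {}" "B \<noteq> {}"
    and lt: "\<And>a. a \<in> A \<Longrightarrow> a < p" "\<And>b. b \<in> B \<Longrightarrow> p < b"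
    and S: "S = {z \<in> hyp_plane. mink N (uvec z) \<in> A \<union> B}"
  shows "components S = {{z \<in> hyp_plane. mink N (uvec z) \<in> A}, {z \<in> hyp_plane. mink N (uvec z) \<in> B}}"
proof -
  let ?h = "\<lambda>z. mink N (uvec z)"
  let ?A = "{z \<in> hyp_plane. ?h z \<in> A}" and ?B = "{z \<in> hyp_plane. ?h z \<in> B}"
  obtain e e' where "lorentz_frame e e' N" by (rule frame_ex[OF N])
  then interpret lorentz_frame e e' N .
  have cA: "connected ?A" and cB: "connected ?B" using connected_level assms by blast+
  obtain a b where ab: "a \<in> A" "b \<in> B" using assms by blast
  have ne: "?A \<noteq> {}" "?B \<noteq> {}" using level_ex[of a] level_ex[of b] ab by auto
  have one: "T \<subseteq> ?A \<or> T \<subseteq> ?B" if "connected T" "T \<subseteq> S" for T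
  proof (rule ccontr)
    assume "\<not> (T \<subseteq> ?A \<or> T \<subseteq> ?B)"
    then obtain x y where xy: "x \<in> T" "x \<notin> ?A" "y \<in> T" "y \<notin> ?B" by blast
    then have "?h x \<in> B" "?h y \<in> A" using that S by auto
    then have l: "?h y < p" "p < ?h x" using lt by auto
    have "connected (?h ` T)"
      using that S by (intro connected_continuous_image continuous_on_subset[OF continuous_uvec]) auto
    then have "p \<in> ?h ` T" using l xy by (meson connectedD_interval imageI less_imp_le)
    then obtain t where t: "t \<in> T" "?h t = p" by blast
    then have "p \<in> A \<union> B" using that S by auto
    then show False using lt by force
  qed
  have disj: "?A \<inter> ?B = {}" using lt by force
  have AS: "?A \<subseteq> S" "?B \<subseteq> S" using S by auto
  have "?A \<in> components S"
    unfolding in_components_maximal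
  proof (intro conjI allI impI)
    fix d assume d: "d \<noteq> {} \<and> ?A \<subseteq> d \<and> d \<subseteq> S \<and> connected d"
    then have "d \<subseteq> ?A" using one[of d] ne disj by fast
    then show "d = ?A" using d by blast
  qed (use ne cA AS in auto)
  moreover have "?B \<in> components S"
    unfolding in_components_maximal
  proof (intro conjI allI impI)
    fix d assume d: "d \<noteq> {} \<and> ?B \<subseteq> d \<and> d \<subseteq> S \<and> connected d"
    then have "d \<subseteq> ?B" using one[of d] ne disj by fast
    then show "d = ?B" using d by blast
  qed (use ne cB AS in auto)
  moreover have "C = ?A \<or> C = ?B" if "C \<in> components S" for C
  proof -
    have c: "connected C" "C \<subseteq> S" "C \<noteq> {}"
      using in_components_connected[OF that] in_components_subset[OF that] in_components_nonempty[OF that] by auto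
    then show ?thesis using one[of C] components_maximal[OF that cA AS(1)] components_maximal[OF that cB AS(2)] by blast
  qed
  ultimately show ?thesis by blast
qed

text \<open>In Fermi coordinates the distance to the point of parameter \<tau>' has hyperbolic
  cosine \<open>cosh \<rho> * cosh (\<tau> - \<tau>')\<close>, which is minimal at the foot \<tau>'
  = \<tau>.\<close>

lemma dist_to_geodesic:
  assumes N: "mink N N = 1" and z: "z \<in> hyp_plane"
  shows "(INF w\<in>{w \<in> hyp_plane. mink N (uvec w) = 0}. hdist z w) = \<bar>arsinh (mink N (uvec z))\<bar>"
proof -
  obtain e e' where "lorentz_frame e e' N" by (rule frame_ex[OF N])
  then interpret lorentz_frame e e' N .
  define \<rho> where "\<rho> = arsinh (mink N (uvec z))"
  obtain \<tau> where t: "uvec z = fpt \<rho> \<tau>" using fpt_cover[OF z] unfolding \<rho>_def by blast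
  show ?thesis unfolding \<rho>_def[symmetric]
  proof (rule cInf_eq_minimum)
    have "hdist z (hpr (fpt 0 \<tau>)) = \<bar>\<rho>\<bar>"
      using hdist_eq_iff(1)[OF z fpt_in] by (simp add: t uvec_fpt mink_fpt)
    moreover have "hpr (fpt 0 \<tau>) \<in> {w \<in> hyp_plane. mink N (uvec w) = 0}"
      using fpt_in uvec_fpt mink_N_fpt by auto
    ultimately show "\<bar>\<rho>\<bar> \<in> hdist z ` {w \<in> hyp_plane. mink N (uvec w) = 0}" by force
    fix x assume "x \<in> hdist z ` {w \<in> hyp_plane. mink N (uvec w) = 0}"
    then obtain w where w: "x = hdist z w" "w \<in> hyp_plane" "mink N (uvec w) = 0" by blast
    obtain \<tau>' where t': "uvec w = fpt 0 \<tau>'" using fpt_cover[OF w(2)] w(3) by auto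
    have "cosh x = cosh \<rho> * cosh (\<tau> - \<tau>')"
      unfolding w(1) cosh_hdist'[OF z w(2)] by (simp add: t t' mink_fpt)
    also have "\<dots> \<ge> cosh \<rho> * 1" by (intro mult_left_mono cosh_real_ge_1) auto
    finally have "cosh \<bar>\<rho>\<bar> \<le> cosh x" by simp
    then show "\<bar>\<rho>\<bar> \<le> x" using hdist_nonneg[OF z w(2)] w(1) by (subst (asm) cosh_real_nonneg_le_iff) auto
  qed
qed

section \<open>Generalized circles as vectors\<close>

text \<open>The norm \<open>1 - k\<^sup>2\<close> makes the normal \<open>hgrad\<close> below a
  Euclidean unit vector along the curve, and the sign of \<open>N\<close> makes it point out of the
  convex side. Circles, horocycles and curves of curvature below 1 correspond to timelike, lightlike
  and spacelike vectors.\<close>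

definition gc_rep :: "real \<Rightarrow> gcircle \<Rightarrow> complex \<times> real \<Rightarrow> bool" where
  "gc_rep k C N \<longleftrightarrow> 0 \<le> k \<and> mink N N = 1 - k\<^sup>2 \<and>
     curve C = {z \<in> hyp_plane. mink N (uvec z) = k} \<and> side C = {z \<in> hyp_plane. mink N (uvec z) \<le> k} \<and>
     (if k \<ge> 1 then fcausal (- N) \<and> center C = {hpr (- N)}
      else center C = {z \<in> hyp_plane. mink N (uvec z) = 0})"

lemma gc_rep_circle:
  assumes c: "c \<in> hyp_plane" and r: "r > 0"
  shows "gc_rep (cosh r / sinh r)
      \<lparr>curve = {z \<in> hyp_plane. hdist c z = r}, side = {z \<in> hyp_plane. hdist c z \<le> r}, center = {c}\<rparr>
      (- ((1 / sinh r) *\<^sub>R uvec c))"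
proof -
  have s: "sinh r > 0" using r by simp
  have k: "cosh r / sinh r \<ge> 1" using s sinh_le_cosh_real[of r] by (simp add: field_simps)
  have "(sinh r)\<^sup>2 \<noteq> 0" using s by simp
  then have "- 1 / (sinh r)\<^sup>2 = 1 - (cosh r / sinh r)\<^sup>2"
    by (simp add: power_divide cosh_square_eq field_simps)
  then have "mink (- ((1 / sinh r) *\<^sub>R uvec c)) (- ((1 / sinh r) *\<^sub>R uvec c)) = 1 - (cosh r / sinh r)\<^sup>2"
    by (simp add: uvec_self[OF c] power2_eq_square)
  moreover have "hpr (- (- ((1 / sinh r) *\<^sub>R uvec c))) = c"
    unfolding minus_minus using s hpr_uvec[OF c] by (subst hpr_scale) auto
  moreover have "fcausal (- (- ((1 / sinh r) *\<^sub>R uvec c)))"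
    unfolding minus_minus using s fcausal_uvec[OF c] by (intro fcausal_scale) auto
  moreover have "hdist c z = r \<longleftrightarrow> mink (- ((1 / sinh r) *\<^sub>R uvec c)) (uvec z) = cosh r / sinh r"
     "hdist c z \<le> r \<longleftrightarrow> mink (- ((1 / sinh r) *\<^sub>R uvec c)) (uvec z) \<le> cosh r / sinh r"
    if "z \<in> hyp_plane" for z
    using hdist_eq_iff[OF c that, of r] r s by (simp_all add: field_simps)
  ultimately show ?thesis using k unfolding gc_rep_def by (auto cong: conj_cong)
qed

text \<open>Up to a positive factor, \<open>mink\<close> with this vector minus 1 is the power of
  \<open>z\<close> with respect to the Euclidean circle; the factor \<open>(1 - s) / s\<close> is
  what puts that circle at level 1.\<close>

lemma gc_rep_horocycle:
  assumes p: "p \<in> ideal_points" and s: "0 < s" "s < 1"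
  shows "gc_rep 1
      \<lparr>curve = sphere ((1 - s) *\<^sub>R p) s - {p}, side = cball ((1 - s) *\<^sub>R p) s - {p}, center = {p}\<rparr>
      (- (((1 - s) / s) *\<^sub>R (p, 1)))"
proof -
  let ?N = "- (((1 - s) / s) *\<^sub>R (p, 1))"
  have np: "norm p = 1" using p by simp
  then have pp: "Re p * Re p + Im p * Im p = 1" using cmod_sq[of p] by simp
  have hp: "hvec p = 2 *\<^sub>R (p, 1)" by (simp add: hvec_def np scaleR_conv_of_real)
  have s': "(1 - s) / s > 0" using s by simp
  have m0: "mink (p, 1) (p, 1) = 0" by (simp add: mink_def pp)
  have fc: "fcausal (p, 1)" by (simp add: fcausal_def m0)
  have hpr: "hpr (- ?N) = p"
  proof -
    have "hpr (- ?N) = hpr (hvec p)" unfolding minus_minus hp using s' by (simp add: hpr_scale del: scaleR_Pair)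
    then show ?thesis using hpr_hvec[of p] np by simp
  qed
  have D: "(norm (z - (1 - s) *\<^sub>R p))\<^sup>2 - s\<^sup>2 = (norm z)\<^sup>2 - 2 * (1 - s) * (Re p * Re z + Im p * Im z) + 1 - 2 * s" for z
  proof -
    have "(norm (z - (1 - s) *\<^sub>R p))\<^sup>2 - s\<^sup>2 =
      (norm z)\<^sup>2 - 2 * (1 - s) * (Re p * Re z + Im p * Im z) + (1 - s)\<^sup>2 * (Re p * Re p + Im p * Im p) - s\<^sup>2"
      unfolding cmod_sq by (simp add: algebra_simps power2_eq_square)
    then show ?thesis unfolding pp by (simp add: algebra_simps power2_eq_square)
  qed
  \<comment> \<open>The closed Euclidean disk meets the unit circle in \<open>p\<close> only, so
    removing \<open>p\<close> amounts to intersecting with the hyperbolic plane.\<close>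
  have in_D: "z \<in> hyp_plane \<and> z \<in> cball ((1 - s) *\<^sub>R p) s \<longleftrightarrow> z \<noteq> p \<and> z \<in> cball ((1 - s) *\<^sub>R p) s" for z
  proof (cases "z \<in> cball ((1 - s) *\<^sub>R p) s")
    case True
    then have n: "norm (z - (1 - s) *\<^sub>R p) \<le> s" by (simp add: dist_norm norm_minus_commute)
    have "norm z \<le> norm (z - (1 - s) *\<^sub>R p) + norm ((1 - s) *\<^sub>R p)" by (metis diff_add_cancel norm_triangle_ineq)
    then have le: "norm z \<le> 1" using n s np by simp
    have "z = p" if "norm z = 1"
    proof -
      have "(norm (z - (1 - s) *\<^sub>R p))\<^sup>2 \<le> s\<^sup>2" using n by (intro power_mono) auto
      then have "2 * (1 - s) * (1 - (Re p * Re z + Im p * Im z)) \<le> 0" using D[of z] that by (simp add: algebra_simps)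
      then have "1 - (Re p * Re z + Im p * Im z) \<le> 0" using s by (simp add: mult_le_0_iff)
      moreover have "(norm (z - p))\<^sup>2 = (norm z)\<^sup>2 + (norm p)\<^sup>2 - 2 * (Re p * Re z + Im p * Im z)"
        unfolding cmod_sq by (simp add: algebra_simps)
      ultimately have "(norm (z - p))\<^sup>2 \<le> 0" using that np by simp
      then show ?thesis by simp
    qed
    then show ?thesis using le np True by (cases "z = p") force+
  qed simp
  have M: "mink ?N (uvec z) - 1 = ((norm (z - (1 - s) *\<^sub>R p))\<^sup>2 - s\<^sup>2) / (s * (1 - (norm z)\<^sup>2))"
    if "z \<in> hyp_plane" for z
  proof -
    have d: "1 - (norm z)\<^sup>2 > 0" using that by (rule cf_pos)
    have "s * mink ?N (hvec z) - s * (1 - (norm z)\<^sup>2) = ((norm (z - (1 - s) *\<^sub>R p))\<^sup>2 - s\<^sup>2)"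
      unfolding D using s by (simp add: mink_def hvec_def field_simps)
    then have "s * (1 - (norm z)\<^sup>2) * (mink ?N (uvec z) - 1) = ((norm (z - (1 - s) *\<^sub>R p))\<^sup>2 - s\<^sup>2)"
      unfolding mink_hvec_uvec[OF that] by (simp add: algebra_simps)
    then show ?thesis using d s
      by (metis mult_pos_pos nonzero_mult_div_cancel_left order_less_irrefl)
  qed
  have S: "z \<in> cball ((1 - s) *\<^sub>R p) s \<longleftrightarrow> (norm (z - (1 - s) *\<^sub>R p))\<^sup>2 - s\<^sup>2 \<le> 0"
          "z \<in> sphere ((1 - s) *\<^sub>R p) s \<longleftrightarrow> (norm (z - (1 - s) *\<^sub>R p))\<^sup>2 - s\<^sup>2 = 0" for z
    using s by (auto simp: dist_norm norm_minus_commute)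
  have M1: "mink ?N (uvec z) \<le> 1 \<longleftrightarrow> z \<in> cball ((1 - s) *\<^sub>R p) s"
    and M2: "mink ?N (uvec z) = 1 \<longleftrightarrow> z \<in> sphere ((1 - s) *\<^sub>R p) s" if "z \<in> hyp_plane" for z
  proof -
    have d: "s * (1 - (norm z)\<^sup>2) > 0" using cf_pos[OF that] s by simp
    have "mink ?N (uvec z) \<le> 1 \<longleftrightarrow> mink ?N (uvec z) - 1 \<le> 0" by linarith
    also have "\<dots> \<longleftrightarrow> z \<in> cball ((1 - s) *\<^sub>R p) s"
      unfolding M[OF that] S using d by (metis divide_le_0_iff order_less_imp_le not_less)
    finally show "mink ?N (uvec z) \<le> 1 \<longleftrightarrow> z \<in> cball ((1 - s) *\<^sub>R p) s" .
    have "mink ?N (uvec z) = 1 \<longleftrightarrow> mink ?N (uvec z) - 1 = 0" by linarith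
    also have "\<dots> \<longleftrightarrow> z \<in> sphere ((1 - s) *\<^sub>R p) s"
      unfolding M[OF that] S using d by (metis divide_eq_0_iff order_less_irrefl)
    finally show "mink ?N (uvec z) = 1 \<longleftrightarrow> z \<in> sphere ((1 - s) *\<^sub>R p) s" .
  qed
  have sc: "sphere ((1 - s) *\<^sub>R p) s \<subseteq> cball ((1 - s) *\<^sub>R p) s" by auto
  have "cball ((1 - s) *\<^sub>R p) s - {p} = {z \<in> hyp_plane. mink ?N (uvec z) \<le> 1}" using in_D M1 by blast
  moreover have "sphere ((1 - s) *\<^sub>R p) s - {p} = {z \<in> hyp_plane. mink ?N (uvec z) = 1}" using in_D M2 sc by blast
  moreover have "fcausal (- ?N)" unfolding minus_minus using fc s' by (rule fcausal_scale)
  moreover have "mink ?N ?N = 0" unfolding mink_minus_left mink_minus_right mink_scale_left mink_scale_right m0 by simp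
  ultimately show ?thesis unfolding gc_rep_def using hpr by simp
qed

lemma unit_levels:
  assumes N: "mink N N = 1"
  shows "components ({z \<in> hyp_plane. mink N (uvec z) \<noteq> a}) =
     {{z \<in> hyp_plane. mink N (uvec z) < a}, {z \<in> hyp_plane. mink N (uvec z) > a}}"
    and "0 < a \<Longrightarrow> components {z \<in> hyp_plane. \<bar>mink N (uvec z)\<bar> = a} =
     {{z \<in> hyp_plane. mink N (uvec z) = - a}, {z \<in> hyp_plane. mink N (uvec z) = a}}"
proof -
  have "{z \<in> hyp_plane. mink N (uvec z) \<noteq> a} = {z \<in> hyp_plane. mink N (uvec z) \<in> {..<a} \<union> {a<..}}" by auto
  from level_components[OF N _ _ _ _ _ _ this, of a]
  show "components ({z \<in> hyp_plane. mink N (uvec z) \<noteq> a}) =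
     {{z \<in> hyp_plane. mink N (uvec z) < a}, {z \<in> hyp_plane. mink N (uvec z) > a}}" by simp
  assume a: "0 < a"
  have "{z \<in> hyp_plane. \<bar>mink N (uvec z)\<bar> = a} = {z \<in> hyp_plane. mink N (uvec z) \<in> {-a} \<union> {a}}" using a by auto
  from level_components[OF N _ _ _ _ _ _ this, of 0] a
  show "components {z \<in> hyp_plane. \<bar>mink N (uvec z)\<bar> = a} =
     {{z \<in> hyp_plane. mink N (uvec z) = - a}, {z \<in> hyp_plane. mink N (uvec z) = a}}" by simp
qed

lemma equidistant:
  assumes N: "mink N N = 1" and r: "r > 0"
  shows "{z \<in> hyp_plane. (INF w\<in>{w \<in> hyp_plane. mink N (uvec w) = 0}. hdist z w) = r}
    = {z \<in> hyp_plane. \<bar>mink N (uvec z)\<bar> = sinh r}"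
proof -
  have "\<bar>arsinh x\<bar> = r \<longleftrightarrow> \<bar>x\<bar> = sinh r" for x :: real
  proof -
    have "\<bar>arsinh x\<bar> = arsinh \<bar>x\<bar>" by (auto simp: abs_if arsinh_minus_real)
    moreover have "arsinh \<bar>x\<bar> = r \<longleftrightarrow> \<bar>x\<bar> = sinh r" by (metis arsinh_sinh_real sinh_arsinh_real)
    ultimately show ?thesis by simp
  qed
  then show ?thesis using dist_to_geodesic[OF N] by auto
qed

lemma one_minus_tanh_sq: "1 - (tanh (r::real))\<^sup>2 = 1 / (cosh r)\<^sup>2"
proof -
  have "(cosh r)\<^sup>2 / (cosh r)\<^sup>2 = 1" by simp
  then have "1 - (tanh r)\<^sup>2 = ((cosh r)\<^sup>2 - (sinh r)\<^sup>2) / (cosh r)\<^sup>2"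
    unfolding tanh_def power_divide by (simp only: diff_divide_distrib)
  then show ?thesis by (simp add: hyperbolic_pythagoras)
qed

lemma gc_rep_hypercycle:
  assumes N: "mink N N = 1" and r: "r > 0"
  shows "gc_rep (tanh r) \<lparr>curve = {z \<in> hyp_plane. mink N (uvec z) = sinh r},
    side = {z \<in> hyp_plane. mink N (uvec z) = sinh r} \<union> {z \<in> hyp_plane. mink N (uvec z) < sinh r},
    center = {z \<in> hyp_plane. mink N (uvec z) = 0}\<rparr> ((1 / cosh r) *\<^sub>R N)"
proof -
  have "mink ((1 / cosh r) *\<^sub>R N) ((1 / cosh r) *\<^sub>R N) = 1 - (tanh r)\<^sup>2"
    unfolding one_minus_tanh_sq by (simp add: N power2_eq_square)
  moreover have "tanh r < 1" by (rule tanh_real_lt_1)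
  moreover have "0 \<le> tanh r" using r by simp
  moreover have "\<not> cosh r < 0" using cosh_real_pos[of r] by linarith
  then have "x / cosh r = tanh r \<longleftrightarrow> x = sinh r" "x / cosh r \<le> tanh r \<longleftrightarrow> x \<le> sinh r" for x
    by (simp_all add: tanh_def divide_le_cancel)
  ultimately show ?thesis unfolding gc_rep_def by auto
qed

lemma gc_rep_line:
  assumes N: "mink N N = 1"
  shows "gc_rep 0 \<lparr>curve = {z \<in> hyp_plane. mink N (uvec z) = 0},
    side = {z \<in> hyp_plane. mink N (uvec z) = 0} \<union> {z \<in> hyp_plane. mink N (uvec z) < 0},
    center = {z \<in> hyp_plane. mink N (uvec z) = 0}\<rparr> N"
  using N unfolding gc_rep_def by auto

lemma gen_circle_rep:
  assumes "gen_circle k C" obtains N where "gc_rep k C N"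
  using assms
proof cases
  case (circle c r)
  then show ?thesis using gc_rep_circle that by blast
next
  case (horocycle p s)
  then show ?thesis using gc_rep_horocycle that by blast
next
  case (hypercycle g r C' K)
  obtain N where N: "mink N N = 1" and g: "g = {z \<in> hyp_plane. mink N (uvec z) = 0}"
    using hypercycle(3) by (rule geodesicE)
  have sr: "sinh r > 0" using hypercycle by simp
  \<comment> \<open>\<open>M\<close> is \<open>N\<close> or \<open>- N\<close>, chosen so that the
    given component is the positive level. The side containing the axis is then the one below that
    level.\<close>
  obtain M where M: "mink M M = 1" and gM: "g = {z \<in> hyp_plane. mink M (uvec z) = 0}"
    and C': "C' = {z \<in> hyp_plane. mink M (uvec z) = sinh r}"
  proof -
    have "C' = {z \<in> hyp_plane. mink N (uvec z) = - sinh r} \<or> C' = {z \<in> hyp_plane. mink N (uvec z) = sinh r}"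
      using hypercycle(5) unfolding g equidistant[OF N hypercycle(4)] unit_levels(2)[OF N sr] by blast
    then show ?thesis
    proof
      assume "C' = {z \<in> hyp_plane. mink N (uvec z) = - sinh r}"
      then show ?thesis using N by (intro that[of "- N"]) (auto simp: g)
    qed (use that[of N] N g in auto)
  qed
  have "hyp_plane - C' = {z \<in> hyp_plane. mink M (uvec z) \<noteq> sinh r}" using C' by auto
  then have K: "K = {z \<in> hyp_plane. mink M (uvec z) < sinh r} \<or> K = {z \<in> hyp_plane. mink M (uvec z) > sinh r}"
    using hypercycle(6) unit_levels(1)[OF M, of "sinh r"] by auto
  obtain e e' where "lorentz_frame e e' M" by (rule frame_ex[OF M])
  then obtain z where "z \<in> g" using lorentz_frame.level_ex[of e e' M 0] gM by auto
  then have "K = {z \<in> hyp_plane. mink M (uvec z) < sinh r}" using K hypercycle(7) gM sr by fastforce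
  then show ?thesis using that gc_rep_hypercycle[OF M hypercycle(4)] hypercycle C' gM by simp
next
  case (line g K)
  obtain N where N: "mink N N = 1" and g: "g = {z \<in> hyp_plane. mink N (uvec z) = 0}"
    using line(3) by (rule geodesicE)
  have "hyp_plane - g = {z \<in> hyp_plane. mink N (uvec z) \<noteq> 0}" using g by auto
  then have K: "K = {z \<in> hyp_plane. mink N (uvec z) < 0} \<or> K = {z \<in> hyp_plane. mink N (uvec z) > 0}"
    using line(4) unit_levels(1)[OF N, of 0] by auto
  then show ?thesis
  proof
    assume "K = {z \<in> hyp_plane. mink N (uvec z) < 0}"
    then show ?thesis using that gc_rep_line[OF N] line g by simp
  next
    assume "K = {z \<in> hyp_plane. mink N (uvec z) > 0}"
    then show ?thesis using that gc_rep_line[of "- N"] N line g by simp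
  qed
qed

text \<open>Converse of \<open>gen_circle_rep\<close>, needed to realise a configuration that is
  prescribed by its Gram matrix.\<close>

lemma gen_circle_of_vec:
  assumes k: "0 \<le> k" and N: "mink N N = 1 - k\<^sup>2" and f: "k \<ge> 1 \<Longrightarrow> fcausal (- N)"
  obtains C where "gen_circle k C" "gc_rep k C N"
proof -
  consider "k > 1" | "k = 1" | "0 < k" "k < 1" | "k = 0" using k by linarith
  then show ?thesis
  proof cases
    case 1
    define q where "q = sqrt (k\<^sup>2 - 1)"
    have k2: "k\<^sup>2 - 1 > 0" using 1 by (simp add: power2_eq_square less_1_mult)
    then have q: "q > 0" "q\<^sup>2 = k\<^sup>2 - 1" by (auto simp: q_def)
    \<comment> \<open>If k = coth r, then k^2 - 1 = 1 / sinh^2 r.\<close>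
    define r where "r = arsinh (1 / q)"
    have sr: "sinh r = 1 / q" by (simp add: r_def)
    then have r: "r > 0" using q by (metis sinh_real_pos_iff zero_less_divide_1_iff)
    have "(cosh r)\<^sup>2 = (1 / q)\<^sup>2 + 1" using cosh_square_eq[of r] sr by simp
    also have "\<dots> = (1 + q\<^sup>2) / q\<^sup>2" using q(1) by (simp add: power_divide add_divide_distrib)
    finally have "(cosh r)\<^sup>2 = (k / q)\<^sup>2" using q(2) by (simp add: power_divide)
    moreover have "0 \<le> k / q" using q(1) 1 by simp
    ultimately have "cosh r = k / q" by (metis cosh_real_nonneg power2_eq_imp_eq)
    then have kr: "cosh r / sinh r = k" using q by (simp add: sr)
    have fc: "fcausal (- N)" using 1 f by simp
    have "fcausal ((1 / q) *\<^sub>R (- N))" by (rule fcausal_scale[OF fc]) (use q in simp)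
    moreover have m: "mink ((1 / q) *\<^sub>R (- N)) ((1 / q) *\<^sub>R (- N)) = -1"
      unfolding mink_scale_left mink_scale_right mink_minus_left mink_minus_right N using q
      by (simp add: field_simps power2_eq_square)
    ultimately have c: "hpr ((1 / q) *\<^sub>R (- N)) \<in> hyp_plane"
      "uvec (hpr ((1 / q) *\<^sub>R (- N))) = (1 / q) *\<^sub>R (- N)" using hpr_unit by blast+
    have "- ((1 / sinh r) *\<^sub>R uvec (hpr ((1 / q) *\<^sub>R (- N)))) = N"
      unfolding c(2) sr using q by simp
    then show ?thesis using that gen_circle.circle[OF c(1) r] gc_rep_circle[OF c(1) r] by (simp add: kr)
  next
    case 2
    obtain x x0 where X: "- N = (x, x0)" by (rule prod.exhaust)
    have fc: "fcausal (x, x0)" using f 2 X by simp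
    then have x0: "x0 > 0" by (simp add: fcausal_def)
    have "mink (- N) (- N) = 0" using N 2 by simp
    then have "(norm x)\<^sup>2 = x0\<^sup>2" unfolding X by (simp add: mink_eq_norm)
    then have nx: "norm x = x0" using x0 by simp
    define p where "p = x /\<^sub>R x0"
    \<comment> \<open>Solves \<open>(1 - s) / s = x0\<close>, the scale of the lightlike vector in
      \<open>gc_rep_horocycle\<close>.\<close>
    define s where "s = 1 / (1 + x0)"
    have "(1 - s) / s = x0" using x0 by (simp add: s_def field_simps)
    then have "- (((1 - s) / s) *\<^sub>R (p, 1)) = - (x, x0)" using x0 by (simp add: p_def)
    then have NN: "- (((1 - s) / s) *\<^sub>R (p, 1)) = N" using X by (metis minus_minus)
    have p: "p \<in> ideal_points" using nx x0 by (simp add: p_def)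
    have s: "0 < s" "s < 1" using x0 by (auto simp: s_def field_simps)
    show ?thesis using that gen_circle.horocycle[OF p s] gc_rep_horocycle[OF p s] unfolding NN 2 by blast
  next
    case 3
    define q where "q = sqrt (1 - k\<^sup>2)"
    have "1 - k\<^sup>2 > 0" using 3 by (simp add: power_less_one_iff abs_square_less_1)
    then have q: "q > 0" "q\<^sup>2 = 1 - k\<^sup>2" by (auto simp: q_def)
    define r where "r = arsinh (k / q)"
    have "(cosh r)\<^sup>2 = (1 / q)\<^sup>2"
      unfolding cosh_square_eq r_def sinh_arsinh_real power_divide using q by (simp add: field_simps)
    then have "cosh r = 1 / q" using q(1)
      by (metis cosh_real_nonneg power2_eq_imp_eq less_imp_le zero_less_divide_1_iff)
    then have r: "tanh r = k" using q(1) by (simp add: tanh_def r_def)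
    then have r0: "r > 0" using 3 by (metis tanh_real_pos_iff)
    define M where "M = cosh r *\<^sub>R N"
    have "1 - k\<^sup>2 = 1 / (cosh r)\<^sup>2"
      unfolding r[symmetric] by (simp add: one_minus_tanh_sq)
    then have M: "mink M M = 1" by (simp add: M_def N power2_eq_square)
    have sr: "sinh r > 0" using r0 by simp
    let ?g = "{z \<in> hyp_plane. mink M (uvec z) = 0}"
    let ?C = "{z \<in> hyp_plane. mink M (uvec z) = sinh r}" and ?K = "{z \<in> hyp_plane. mink M (uvec z) < sinh r}"
    have "?C \<in> components {z \<in> hyp_plane. (INF w\<in>?g. hdist z w) = r}"
      unfolding equidistant[OF M r0] unit_levels(2)[OF M sr] by blast
    moreover have "hyp_plane - ?C = {z \<in> hyp_plane. mink M (uvec z) \<noteq> sinh r}" by auto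
    then have "?K \<in> components (hyp_plane - ?C)" using unit_levels(1)[OF M, of "sinh r"] by simp
    moreover have "?g \<subseteq> ?K" using sr by auto
    ultimately have "gen_circle (tanh r) \<lparr>curve = ?C, side = ?C \<union> ?K, center = ?g\<rparr>"
      by (rule gen_circle.hypercycle[OF geodesic_mink[OF M] r0])
    moreover have "(1 / cosh r) *\<^sub>R M = N" by (simp add: M_def)
    ultimately show ?thesis using that gc_rep_hypercycle[OF M r0] r by simp
  next
    case 4
    have M: "mink N N = 1" using N 4 by simp
    let ?g = "{z \<in> hyp_plane. mink N (uvec z) = 0}" and ?K = "{z \<in> hyp_plane. mink N (uvec z) < 0}"
    have "hyp_plane - ?g = {z \<in> hyp_plane. mink N (uvec z) \<noteq> 0}" by auto
    then have "?K \<in> components (hyp_plane - ?g)" using unit_levels(1)[OF M, of 0] by simp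
    then have "gen_circle 0 \<lparr>curve = ?g, side = ?g \<union> ?K, center = ?g\<rparr>"
      by (rule gen_circle.line[OF geodesic_mink[OF M]])
    then show ?thesis using that gc_rep_line[OF M] 4 by simp
  qed
qed

section \<open>External tangency\<close>

text \<open>Half of the Euclidean gradient of the function \<open>hlev\<close> at
  \<open>z\<close>.\<close>

definition hgrad :: "complex \<times> real \<Rightarrow> real \<Rightarrow> complex \<Rightarrow> complex" where
  "hgrad N k z = fst N - (snd N - k) *\<^sub>R z"

text \<open>The condition \<open>mink N (uvec z) = k\<close> with its denominator cleared: the
  equation of a Euclidean circle or line, meaningful on the whole complex plane and in particular at
  ideal points.\<close>

definition hlev :: "complex \<times> real \<Rightarrow> real \<Rightarrow> complex \<Rightarrow> real" where
  "hlev N k z = mink N (hvec z) - k * (1 - (norm z)\<^sup>2)"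

lemma hlev_eq_0: "z \<in> hyp_plane \<Longrightarrow> hlev N k z = 0 \<longleftrightarrow> mink N (uvec z) = k"
  and hlev_le_0: "z \<in> hyp_plane \<Longrightarrow> hlev N k z \<le> 0 \<longleftrightarrow> mink N (uvec z) \<le> k"
  and hlev_less_0: "z \<in> hyp_plane \<Longrightarrow> hlev N k z < 0 \<longleftrightarrow> mink N (uvec z) < k"
proof -
  assume z: "z \<in> hyp_plane"
  have p: "0 < 1 - (norm z)\<^sup>2" by (rule cf_pos[OF z])
  have e: "hlev N k z = (1 - (norm z)\<^sup>2) * (mink N (uvec z) - k)"
    by (simp add: hlev_def mink_hvec_uvec[OF z] algebra_simps)
  show "hlev N k z = 0 \<longleftrightarrow> mink N (uvec z) = k" using p by (simp add: e)
  show "hlev N k z \<le> 0 \<longleftrightarrow> mink N (uvec z) \<le> k" using p by (simp add: e mult_le_0_iff)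
  show "hlev N k z < 0 \<longleftrightarrow> mink N (uvec z) < k" using p by (simp add: e mult_less_0_iff)
qed

lemma hlev_add: "hlev N k (z + v) = hlev N k z + 2 * (hgrad N k z \<bullet> v) - (snd N - k) * (norm v)\<^sup>2"
  unfolding hlev_def mink_def hvec_def hgrad_def inner_complex_def cmod_sq
  by (simp add: algebra_simps)

text \<open>Conformality in algebraic form: at a common point the Lorentz product of two vectors,
  shifted by \<open>k * k'\<close>, is the Euclidean product of the normals. Tangency and
  perpendicularity thereby become equations for \<open>mink\<close>.\<close>

lemma hgrad_inner:
  assumes "hlev N k z = 0" "hlev N' k' z = 0"
  shows "hgrad N k z \<bullet> hgrad N' k' z = mink N N' + k * k'"
  using assms unfolding hlev_def mink_def hvec_def hgrad_def inner_complex_def cmod_sq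
  by simp algebra

lemma hgrad_norm:
  assumes "hlev N k z = 0" shows "(norm (hgrad N k z))\<^sup>2 = mink N N + k\<^sup>2"
  unfolding power2_norm_eq_inner hgrad_inner[OF assms assms] by (simp add: power2_eq_square)

lemma continuous_hlev: "continuous_on A (\<lambda>z. hlev N k z)"
  unfolding hlev_def mink_def hvec_def by (intro continuous_intros)

lemma open_level: "open {z \<in> hyp_plane. mink N (uvec z) < k}"
proof -
  have "{z \<in> hyp_plane. mink N (uvec z) < k} = hyp_plane \<inter> {z. hlev N k z < 0}" using hlev_less_0 by blast
  moreover have "open {z. hlev N k z < 0}" by (intro open_Collect_less continuous_hlev continuous_intros)
  ultimately show ?thesis by (simp add: open_Int)
qed

lemma tangent_vectorD:
  assumes "tangent_vector {z \<in> hyp_plane. mink N (uvec z) = k} z v"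
  shows "v \<noteq> 0" "z \<in> hyp_plane" "hlev N k z = 0" "hgrad N k z \<bullet> v = 0"
proof -
  obtain \<gamma> where v: "v \<noteq> 0" and r: "range \<gamma> \<subseteq> {z \<in> hyp_plane. mink N (uvec z) = k}" and 0: "\<gamma> 0 = z"
    and d: "(\<gamma> has_vector_derivative v) (at (0::real))"
    using assms unfolding tangent_vector_def by blast
  show "v \<noteq> 0" by fact
  have g: "\<gamma> s \<in> hyp_plane" "hlev N k (\<gamma> s) = 0" for s using r hlev_eq_0 by blast+
  then show "z \<in> hyp_plane" "hlev N k z = 0" using 0 by blast+
  have d': "(\<gamma> has_derivative (\<lambda>h. h *\<^sub>R v)) (at 0)" using d by (simp add: has_vector_derivative_def)
  have "((\<lambda>s. 2 * (hgrad N k z \<bullet> (\<gamma> s - z)) - (snd N - k) * ((\<gamma> s - z) \<bullet> (\<gamma> s - z)))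
    has_derivative (\<lambda>h. 2 * (hgrad N k z \<bullet> (h *\<^sub>R v)))) (at 0)"
    by (rule derivative_eq_intros d' refl | simp add: 0)+
  moreover have "(\<lambda>s. 2 * (hgrad N k z \<bullet> (\<gamma> s - z)) - (snd N - k) * ((\<gamma> s - z) \<bullet> (\<gamma> s - z))) = (\<lambda>s. 0)"
    using hlev_add[of N k z "\<gamma> _ - z"] g(2) 0 by (auto simp: power2_norm_eq_inner)
  ultimately have "(\<lambda>h. 2 * (hgrad N k z \<bullet> (h *\<^sub>R v))) = (\<lambda>h. 0)"
    by (metis has_derivative_const has_derivative_unique)
  then show "hgrad N k z \<bullet> v = 0" by (metis mult_eq_0_iff scaleR_one zero_neq_numeral)
qed

lemma tangent_vector_scale:
  assumes "tangent_vector A z v" "c \<noteq> 0" shows "tangent_vector A z (c *\<^sub>R v)"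
proof -
  obtain \<gamma> where v: "v \<noteq> 0" and r: "range \<gamma> \<subseteq> A" and 0: "\<gamma> 0 = z"
    and d: "(\<gamma> has_vector_derivative v) (at (0::real))"
    using assms unfolding tangent_vector_def by blast
  have "((\<lambda>s. \<gamma> (c * s)) has_vector_derivative c *\<^sub>R v) (at 0)"
  proof -
    have "((\<lambda>s. c * s) has_vector_derivative c) (at 0)"
      unfolding has_real_derivative_iff_has_vector_derivative[symmetric] by (auto intro!: derivative_eq_intros)
    from vector_diff_chain_at[OF this, of \<gamma> v] d show ?thesis by (simp add: o_def)
  qed
  then show ?thesis unfolding tangent_vector_def using v r 0 assms(2)
    by (intro conjI exI[of _ "\<lambda>s. \<gamma> (c * s)"]) auto
qed

lemma tangent_vectorI:
  assumes z: "z \<in> hyp_plane" and h: "hlev N k z = 0" and n: "hgrad N k z \<noteq> 0" and c: "c \<noteq> 0"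
  shows "tangent_vector {z \<in> hyp_plane. mink N (uvec z) = k} z (c *\<^sub>R (\<i> * hgrad N k z))"
proof -
  define n where "n = hgrad N k z"
  define q where "q = (snd N - k) / 2"
  \<comment> \<open>A Moebius parametrisation of the Euclidean circle \<open>hlev N k = 0\<close> (a
    line if \<open>q = 0\<close>), relative to its point \<open>z\<close> and with velocity
    \<open>\<i> * n\<close> at 0.\<close>
  define V where "V = (\<lambda>u. (\<i> * n * of_real u) / (1 + \<i> * of_real (q * u)))"
  have nz: "1 + \<i> * of_real (q * u) \<noteq> 0" for u
    by (metis Complex_eq add_cancel_left_left complex.sel(1) one_complex.sel(1) zero_complex.sel(1) zero_neq_one of_real_1)
  have onz: "1 + (q * u)\<^sup>2 \<noteq> 0" for u by (metis add.commute power_one sum_power2_eq_zero_iff zero_neq_one)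
  have vq: "V u = ((u / (1 + (q * u)\<^sup>2)) *\<^sub>R (\<i> * n) + (q * u\<^sup>2 / (1 + (q * u)\<^sup>2)) *\<^sub>R n)" for u
  proof -
    have "(u *\<^sub>R (\<i> * n) + (q * u\<^sup>2) *\<^sub>R n) * (1 + \<i> * of_real (q * u)) = (\<i> * n * of_real u) * of_real (1 + (q * u)\<^sup>2)"
      by (simp add: scaleR_conv_of_real algebra_simps power2_eq_square)
    then have "V u = (u *\<^sub>R (\<i> * n) + (q * u\<^sup>2) *\<^sub>R n) / of_real (1 + (q * u)\<^sup>2)"
      unfolding V_def using nz[of u] onz[of u] by (simp add: frac_eq_eq del: of_real_add of_real_power)
    then show ?thesis by (simp add: scaleR_conv_of_real add_divide_distrib)
  qed
  have lev: "hlev N k (z + V u) = 0" for u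
  proof -
    have i0: "n \<bullet> (\<i> * n) = 0" "(\<i> * n) \<bullet> n = 0" "(\<i> * n) \<bullet> (\<i> * n) = n \<bullet> n" by (simp_all add: inner_complex_def)
    define D where "D = 1 + (q * u)\<^sup>2"
    have D: "D \<noteq> 0" using onz by (simp add: D_def)
    have vq': "V u = (u / D) *\<^sub>R (\<i> * n) + (q * u\<^sup>2 / D) *\<^sub>R n" using vq by (simp add: D_def)
    have "n \<bullet> V u = q * u\<^sup>2 / D * (n \<bullet> n)" unfolding vq' by (simp add: inner_add_right i0)
    moreover have "V u \<bullet> V u = ((u / D)\<^sup>2 + (q * u\<^sup>2 / D)\<^sup>2) * (n \<bullet> n)"
      unfolding vq' by (simp add: inner_add_right inner_add_left i0 power2_eq_square algebra_simps)
    moreover have "(u / D)\<^sup>2 + (q * u\<^sup>2 / D)\<^sup>2 = u\<^sup>2 / D"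
    proof -
      have "(u / D)\<^sup>2 + (q * u\<^sup>2 / D)\<^sup>2 = u\<^sup>2 * D / D\<^sup>2"
        by (simp add: power_divide add_divide_distrib[symmetric] D_def power2_eq_square algebra_simps)
      then show ?thesis using D by (simp add: power2_eq_square)
    qed
    ultimately show ?thesis unfolding hlev_add h n_def[symmetric] power2_norm_eq_inner by (simp add: q_def)
  qed
  have "isCont (\<lambda>u. z + V u) 0" unfolding V_def by (intro continuous_intros) (use nz[of 0] in auto)
  then have "((\<lambda>u. z + V u) \<longlongrightarrow> z) (at 0)" unfolding isCont_def by (simp add: V_def)
  moreover have "open hyp_plane" by simp
  ultimately have "\<forall>\<^sub>F u in at 0. z + V u \<in> hyp_plane" using z by (rule topological_tendstoD)
  then obtain \<delta> where \<delta>: "\<delta> > 0" and in_D: "\<And>u. u \<noteq> 0 \<Longrightarrow> \<bar>u\<bar> < \<delta> \<Longrightarrow> z + V u \<in> hyp_plane"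
    unfolding eventually_at by (auto simp: dist_norm simp del: mem_ball mem_ball_0)
  have in_D: "z + V u \<in> hyp_plane" if "\<bar>u\<bar> < \<delta>" for u
    using in_D[OF _ that] z by (cases "u = 0") (auto simp: V_def)
  \<comment> \<open>\<open>tangent_vector\<close> asks for a curve defined on all of the reals
    inside the set. This function passes through 0 with slope \<delta> and stays in the interval
    where \<open>z + V u\<close> lies in the disk.\<close>
  define U where "U = (\<lambda>s::real. \<delta> * s / (1 + s\<^sup>2))"
  have s1: "1 + s\<^sup>2 > 0" for s :: real by (simp add: add_pos_nonneg)
  have U: "\<bar>U s\<bar> < \<delta>" for s
  proof -
    have "0 < 1 + s\<^sup>2 - \<bar>s\<bar>"
    proof -
      have "0 \<le> (\<bar>s\<bar> - 1/2)\<^sup>2" by simp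
      then show ?thesis by (simp add: power2_eq_square algebra_simps)
    qed
    then have "\<delta> * \<bar>s\<bar> < \<delta> * (1 + s\<^sup>2)" using \<delta> by (intro mult_strict_left_mono) auto
    then show ?thesis unfolding U_def abs_divide abs_mult using \<delta> s1[of s] by (simp add: pos_divide_less_eq)
  qed
  have "((\<lambda>s. z + V (U s)) has_vector_derivative (\<delta> *\<^sub>R (\<i> * n))) (at 0)"
  proof -
    have dU: "(U has_real_derivative \<delta>) (at 0)"
      unfolding U_def by (rule derivative_eq_intros refl | simp)+
    have "((\<lambda>x. (\<i> * n * x) / (1 + \<i> * (of_real q * x))) has_field_derivative (\<i> * n)) (at (0::complex))"
      by (rule derivative_eq_intros refl | simp)+
    then have "((\<lambda>x. z + (\<i> * n * x) / (1 + \<i> * (of_real q * x))) has_field_derivative (\<i> * n)) (at (of_real (U 0)))"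
      unfolding U_def by (auto intro!: derivative_eq_intros)
    moreover have "((\<lambda>s. complex_of_real (U s)) has_vector_derivative of_real \<delta>) (at 0)"
      using dU by (rule has_vector_derivative_of_real)
    ultimately have "((\<lambda>x. z + (\<i> * n * x) / (1 + \<i> * (of_real q * x))) \<circ> (\<lambda>s. complex_of_real (U s))
       has_vector_derivative (of_real \<delta> * (\<i> * n))) (at 0)"
      by (intro field_vector_diff_chain_at)
    then show ?thesis by (simp add: o_def V_def scaleR_conv_of_real)
  qed
  moreover have "n \<noteq> 0" using n by (simp add: n_def)
  moreover have "range (\<lambda>s. z + V (U s)) \<subseteq> {z \<in> hyp_plane. mink N (uvec z) = k}"
    using in_D[OF U] lev hlev_eq_0 by blast
  ultimately have t: "tangent_vector {z \<in> hyp_plane. mink N (uvec z) = k} z (\<delta> *\<^sub>R (\<i> * n))"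
    unfolding tangent_vector_def using \<delta>
    by (intro conjI exI[of _ "\<lambda>s. z + V (U s)"]) (auto simp: U_def V_def)
  have "tangent_vector {z \<in> hyp_plane. mink N (uvec z) = k} z ((c / \<delta>) *\<^sub>R (\<delta> *\<^sub>R (\<i> * n)))"
    by (rule tangent_vector_scale[OF t]) (use c \<delta> in auto)
  then show ?thesis using \<delta> by (simp add: n_def)
qed

lemma complex_orthE:
  assumes "n \<bullet> v = 0" "v \<noteq> (0::complex)" obtains \<alpha> where "n = \<alpha> *\<^sub>R (\<i> * v)"
proof -
  define \<alpha> where "\<alpha> = (n \<bullet> (\<i> * v)) / (v \<bullet> v)"
  have "v \<bullet> v \<noteq> 0" using assms by simp
  have "(v \<bullet> v) *\<^sub>R n = (n \<bullet> (\<i> * v)) *\<^sub>R (\<i> * v)"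
    using assms(1) unfolding inner_complex_def complex_eq_iff by simp algebra
  then have "n = \<alpha> *\<^sub>R (\<i> * v)" unfolding \<alpha>_def using \<open>v \<bullet> v \<noteq> 0\<close>
    by (metis (no_types, lifting) divide_inverse mult.commute real_vector.scale_one
        real_vector.scale_scale right_inverse mult.left_commute mult_1_right scaleR_left_imp_eq scaleR_scaleR)
  then show ?thesis by (rule that)
qed

lemma perpendicularD:
  assumes "perpendicular_at a {z \<in> hyp_plane. mink G (uvec z) = 0} {z \<in> hyp_plane. mink N (uvec z) = 0}"
  shows "a \<in> hyp_plane" "mink G (uvec a) = 0" "mink N (uvec a) = 0" "mink G N = 0"
proof -
  obtain v w where v: "tangent_vector {z \<in> hyp_plane. mink G (uvec z) = 0} a v"
    and w: "tangent_vector {z \<in> hyp_plane. mink N (uvec z) = 0} a w" and vw: "v \<bullet> w = 0"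
    using assms unfolding perpendicular_at_def by blast
  note v = tangent_vectorD[OF v] and w = tangent_vectorD[OF w]
  show "a \<in> hyp_plane" "mink G (uvec a) = 0" "mink N (uvec a) = 0" using v w hlev_eq_0 by blast+
  obtain \<alpha> where a: "hgrad G 0 a = \<alpha> *\<^sub>R (\<i> * v)" using complex_orthE[OF v(4,1)] .
  obtain \<beta> where b: "hgrad N 0 a = \<beta> *\<^sub>R (\<i> * w)" using complex_orthE[OF w(4,1)] .
  have "mink G N = hgrad G 0 a \<bullet> hgrad N 0 a" using hgrad_inner[OF v(3) w(3)] by simp
  also have "\<dots> = \<alpha> * \<beta> * (v \<bullet> w)" unfolding a b by (simp add: inner_complex_def algebra_simps)
  finally show "mink G N = 0" using vw by simp
qed

lemma perpendicularI:
  assumes "a \<in> hyp_plane" "mink G (uvec a) = 0" "mink N (uvec a) = 0" "mink G N = 0"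
    and "mink G G > 0" "mink N N > 0"
  shows "perpendicular_at a {z \<in> hyp_plane. mink G (uvec z) = 0} {z \<in> hyp_plane. mink N (uvec z) = 0}"
proof -
  have h: "hlev G 0 a = 0" "hlev N 0 a = 0" using assms hlev_eq_0 by blast+
  have n: "hgrad G 0 a \<noteq> 0" "hgrad N 0 a \<noteq> 0" using hgrad_norm[OF h(1)] hgrad_norm[OF h(2)] assms by auto
  have "(1 *\<^sub>R (\<i> * hgrad G 0 a)) \<bullet> (1 *\<^sub>R (\<i> * hgrad N 0 a)) = hgrad G 0 a \<bullet> hgrad N 0 a" by (simp add: inner_complex_def)
  also have "\<dots> = 0" using hgrad_inner[OF h] assms by simp
  finally show ?thesis unfolding perpendicular_at_def
    using tangent_vectorI[OF assms(1) h(1) n(1) one_neq_zero] tangent_vectorI[OF assms(1) h(2) n(2) one_neq_zero] by blast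
qed

text \<open>A short step against the outward normal enters the first convex side, and also the
  second one if that has the same normal or already contains \<open>z\<close> in its interior. This
  contradicts disjoint interiors in the wrong cases of tangency.\<close>

lemma small_step:
  assumes z: "z \<in> hyp_plane" and "hlev N1 k1 z = 0" "hgrad N1 k1 z = n" "n \<noteq> 0"
    and "hlev N2 k2 z = 0 \<and> hgrad N2 k2 z = n \<or> hlev N2 k2 z < 0"
  shows "\<exists>w \<in> hyp_plane. mink N1 (uvec w) < k1 \<and> mink N2 (uvec w) < k2"
proof -
  have *: "\<forall>\<^sub>F s in at_right 0. hlev N k (z + (- s) *\<^sub>R n) < 0" if "hlev N k z = 0" "hgrad N k z = n" for N k
  proof -
    have e: "hlev N k (z + (- s) *\<^sub>R n) = s * (- 2 * (n \<bullet> n) - (snd N - k) * s * (n \<bullet> n))" for s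
      unfolding hlev_add that power2_norm_eq_inner by (simp add: algebra_simps)
    have "\<forall>\<^sub>F s in at_right 0. - 2 * (n \<bullet> n) - (snd N - k) * s * (n \<bullet> n) < 0"
    proof (rule order_tendstoD(2))
      have "((\<lambda>s. - 2 * (n \<bullet> n) - (snd N - k) * s * (n \<bullet> n)) \<longlongrightarrow> - 2 * (n \<bullet> n) - (snd N - k) * 0 * (n \<bullet> n)) (at_right 0)"
        by (intro tendsto_intros)
      then show "((\<lambda>s. - 2 * (n \<bullet> n) - (snd N - k) * s * (n \<bullet> n)) \<longlongrightarrow> - 2 * (n \<bullet> n)) (at_right 0)" by simp
    qed (use assms(4) in simp)
    moreover have "\<forall>\<^sub>F s in at_right 0. 0 < (s::real)" by (rule eventually_at_right_less)
    ultimately show ?thesis unfolding e by eventually_elim (rule mult_pos_neg)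
  qed
  have lim: "((\<lambda>s. z + (- s) *\<^sub>R n) \<longlongrightarrow> z) (at_right 0)"
    by (rule tendsto_eq_intros refl | simp)+
  have "\<forall>\<^sub>F s in at_right 0. z + (- s) *\<^sub>R n \<in> hyp_plane"
    using lim z by (intro topological_tendstoD) auto
  moreover have "\<forall>\<^sub>F s in at_right 0. hlev N2 k2 (z + (- s) *\<^sub>R n) < 0"
    using assms(5)
  proof
    assume l: "hlev N2 k2 z < 0"
    have "isCont (hlev N2 k2) z" using continuous_hlev[of UNIV N2 k2] by (simp add: continuous_on_eq_continuous_at)
    then have "((\<lambda>s. hlev N2 k2 (z + (- s) *\<^sub>R n)) \<longlongrightarrow> hlev N2 k2 z) (at_right 0)"
      using lim by (rule isCont_tendsto_compose)
    then show ?thesis using l by (rule order_tendstoD(2))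
  next
    assume "hlev N2 k2 z = 0 \<and> hgrad N2 k2 z = n"
    then show ?thesis by (intro *) auto
  qed
  moreover have "\<forall>\<^sub>F s in at_right 0. hlev N1 k1 (z + (- s) *\<^sub>R n) < 0" by (rule *[OF assms(2,3)])
  ultimately have "\<forall>\<^sub>F s in at_right 0. z + (- s) *\<^sub>R n \<in> hyp_plane \<and> hlev N1 k1 (z + (- s) *\<^sub>R n) < 0 \<and> hlev N2 k2 (z + (- s) *\<^sub>R n) < 0"
    by (intro eventually_conj)
  then obtain s where "z + (- s) *\<^sub>R n \<in> hyp_plane" "hlev N1 k1 (z + (- s) *\<^sub>R n) < 0" "hlev N2 k2 (z + (- s) *\<^sub>R n) < 0"
    by (blast dest: eventually_happens'[OF trivial_limit_at_right_real])
  then show ?thesis using hlev_less_0 by blast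
qed

lemma interior_side:
  assumes "gc_rep k C N" shows "{w \<in> hyp_plane. mink N (uvec w) < k} \<subseteq> interior (side C)"
  using assms open_level[of N k] by (intro interior_maximal) (auto simp: gc_rep_def)

text \<open>At the tangency point the two unit normals are parallel. Equal normals would make the
  interiors overlap, so they are opposite, and then both components of \<open>N1 + N2\<close> are
  forced to be those of a multiple of the lift of \<open>t\<close>.\<close>

lemma ext_tangent_vec:
  assumes r: "gc_rep k1 C1 N1" "gc_rep k2 C2 N2" and k: "k1 + k2 > 0"
    and e: "ext_tangent k1 C1 k2 C2 t"
  shows "t \<in> hyp_plane" "N1 + N2 = - ((k1 + k2) *\<^sub>R uvec t)"
proof -
  have k0: "0 \<le> k1" "0 \<le> k2" using r by (auto simp: gc_rep_def)
  have dis: "interior (side C1) \<inter> interior (side C2) = {}" and t: "t \<in> hyp_plane"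
    and tan: "tangent_at t (curve C1) (curve C2)"
    using e k k0 unfolding ext_tangent_def by (auto split: if_splits)
  show "t \<in> hyp_plane" by fact
  obtain v where v: "tangent_vector {z \<in> hyp_plane. mink N1 (uvec z) = k1} t v"
     "tangent_vector {z \<in> hyp_plane. mink N2 (uvec z) = k2} t v"
    using tan r unfolding tangent_at_def gc_rep_def by auto
  note v1 = tangent_vectorD[OF v(1)] and v2 = tangent_vectorD[OF v(2)]
  define n1 n2 where "n1 = hgrad N1 k1 t" and "n2 = hgrad N2 k2 t"
  have u1: "n1 \<bullet> n1 = 1" "n2 \<bullet> n2 = 1"
    using hgrad_inner[OF v1(3) v1(3)] hgrad_inner[OF v2(3) v2(3)] r
    by (auto simp: n1_def n2_def gc_rep_def power2_eq_square)
  obtain \<alpha> where a: "n1 = \<alpha> *\<^sub>R (\<i> * v)" using complex_orthE[OF v1(4,1)] unfolding n1_def .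
  obtain \<beta> where b: "n2 = \<beta> *\<^sub>R (\<i> * v)" using complex_orthE[OF v2(4,1)] unfolding n2_def .
  define q where "q = (\<i> * v) \<bullet> (\<i> * v)"
  have "\<alpha> * \<alpha> * q = 1" "\<beta> * \<beta> * q = 1" using u1 unfolding a b by (simp_all add: q_def)
  then have "\<alpha> * \<alpha> = \<beta> * \<beta>" by (metis mult_cancel_right mult_zero_right zero_neq_one)
  then have "\<alpha> = \<beta> \<or> \<alpha> = - \<beta>" by (metis square_eq_iff)
  moreover have "\<alpha> \<noteq> \<beta>"
  proof
    assume "\<alpha> = \<beta>"
    then have "n1 = n2" using a b by simp
    moreover have "n1 \<noteq> 0" using u1 by auto
    ultimately have "\<exists>w \<in> hyp_plane. mink N1 (uvec w) < k1 \<and> mink N2 (uvec w) < k2"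
      using small_step[OF t v1(3), of n1 N2 k2] v2(3) by (simp add: n1_def n2_def)
    then show False using interior_side r dis by blast
  qed
  ultimately have n: "n1 = - n2" using a b by simp
  have p: "1 - (norm t)\<^sup>2 > 0" by (rule cf_pos[OF t])
  define A K R where "A = snd N1 + snd N2" and "K = k1 + k2" and "R = (norm t)\<^sup>2"
  have R: "R = Re t * Re t + Im t * Im t" by (simp add: R_def cmod_sq)
  have f: "fst N1 + fst N2 = (A - K) *\<^sub>R t"
    using n unfolding n1_def n2_def hgrad_def A_def K_def by (simp add: algebra_simps)
  have "mink (N1 + N2) (hvec t) = K * (1 - R)"
    using v1(3) v2(3) by (simp add: hlev_def K_def R_def algebra_simps)
  then have "2 * (Re ((A - K) *\<^sub>R t) * Re t + Im ((A - K) *\<^sub>R t) * Im t) - A * (1 + R) = K * (1 - R)"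
    unfolding f[symmetric] by (simp add: mink_def hvec_def A_def R_def algebra_simps)
  then have "2 * (A - K) * R - A * (1 + R) = K * (1 - R)" unfolding R by (simp add: algebra_simps)
  then have A: "(1 - R) * A = - K * (1 + R)" by (simp add: algebra_simps)
  have AK: "(1 - R) * (A - K) = - 2 * K" using A by (simp add: algebra_simps)
  have "(1 - R) *\<^sub>R (N1 + N2) = - (K *\<^sub>R hvec t)"
  proof (intro prod_eqI)
    have "fst ((1 - R) *\<^sub>R (N1 + N2)) = ((1 - R) * (A - K)) *\<^sub>R t" by (simp add: f)
    then show "fst ((1 - R) *\<^sub>R (N1 + N2)) = fst (- (K *\<^sub>R hvec t))"
      unfolding AK by (simp add: hvec_def scaleR_conv_of_real)
    show "snd ((1 - R) *\<^sub>R (N1 + N2)) = snd (- (K *\<^sub>R hvec t))"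
      using A by (simp add: hvec_def A_def R_def)
  qed
  also have "\<dots> = (1 - R) *\<^sub>R (- (K *\<^sub>R uvec t))"
    unfolding hvec_uvec[OF t] R_def by simp
  finally show "N1 + N2 = - ((k1 + k2) *\<^sub>R uvec t)" using p unfolding R_def K_def by (metis less_irrefl scaleR_left_imp_eq)
qed

lemma fst_snd_simps: "mink N (t, 1) = fst N \<bullet> t - snd N"
  by (simp add: mink_def inner_complex_def)

text \<open>A unit vector orthogonal to the lightlike \<open>(t, 1)\<close> has the form
  \<open>a *\<^sub>R (t, 1) + c *\<^sub>R (\<i> * t, 0)\<close> with c = 1 or c = -1. Equal signs
  \<open>c\<close> would nest the half-planes, so the sum is a multiple of \<open>(t, 1)\<close>;
  its coefficient is not 0 because the geodesics differ and not positive because the interiors are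
  disjoint.\<close>

lemma ext_tangent_ideal_vec:
  assumes r: "gc_rep 0 C1 N1" "gc_rep 0 C2 N2" and e: "ext_tangent 0 C1 0 C2 t"
  shows "norm t = 1" "\<exists>c>0. N1 + N2 = - (c *\<^sub>R hvec t)"
proof -
  have dis: "interior (side C1) \<inter> interior (side C2) = {}" and ne: "curve C1 \<noteq> curve C2"
    and t: "norm t = 1" and cl: "t \<in> closure (curve C1)" "t \<in> closure (curve C2)"
    using e unfolding ext_tangent_def by auto
  show "norm t = 1" by fact
  have n: "mink N1 N1 = 1" "mink N2 N2 = 1" using r by (auto simp: gc_rep_def)
  have c: "curve C1 = {z \<in> hyp_plane. mink N1 (uvec z) = 0}" "curve C2 = {z \<in> hyp_plane. mink N2 (uvec z) = 0}"
    using r by (auto simp: gc_rep_def)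
  have cl0: "hlev N 0 t = 0" if "t \<in> closure {z \<in> hyp_plane. mink N (uvec z) = 0}" for N
  proof -
    have "closed {z. hlev N 0 z = 0}" by (intro closed_Collect_eq continuous_hlev continuous_intros)
    moreover have "{z \<in> hyp_plane. mink N (uvec z) = 0} \<subseteq> {z. hlev N 0 z = 0}" using hlev_eq_0 by blast
    ultimately show ?thesis using that closure_minimal by blast
  qed
  have hp: "hvec t = 2 *\<^sub>R (t, 1)" by (simp add: hvec_def t scaleR_conv_of_real)
  have tt: "t \<bullet> t = 1" using t by (simp add: dot_square_norm)
  have tI: "Re t * Re t + Im t * Im t = 1" using tt by (simp add: inner_complex_def)
  have form: "\<exists>a c. N = a *\<^sub>R (t, 1) + c *\<^sub>R (\<i> * t, 0) \<and> c * c = 1" if "hlev N 0 t = 0" "mink N N = 1" for N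
  proof -
    define c where "c = fst N \<bullet> (\<i> * t)"
    have a: "fst N \<bullet> t = snd N" using that(1) by (simp add: hlev_def hp fst_snd_simps del: scaleR_Pair)
    have "fst N = (fst N \<bullet> t) *\<^sub>R t + c *\<^sub>R (\<i> * t)"
      using tI unfolding c_def inner_complex_def complex_eq_iff by simp algebra
    then have f: "fst N = snd N *\<^sub>R t + c *\<^sub>R (\<i> * t)" using a by simp
    then have "N = snd N *\<^sub>R (t, 1) + c *\<^sub>R (\<i> * t, 0)" by (simp add: prod_eq_iff)
    moreover have "c * c = 1"
    proof -
      have "mink N N = fst N \<bullet> fst N - snd N * snd N" by (simp add: mink_def inner_complex_def)
      also have "\<dots> = c * c * (t \<bullet> t) + snd N * snd N * (t \<bullet> t) - snd N * snd N"
        by (subst (1 2) f) (simp add: inner_complex_def algebra_simps)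
      finally show ?thesis using that(2) tt by simp
    qed
    ultimately show ?thesis by blast
  qed
  obtain a1 c1 where 1: "N1 = a1 *\<^sub>R (t, 1) + c1 *\<^sub>R (\<i> * t, 0)" "c1 * c1 = 1"
    using form[OF cl0 n(1)] cl c by auto
  obtain a2 c2 where 2: "N2 = a2 *\<^sub>R (t, 1) + c2 *\<^sub>R (\<i> * t, 0)" "c2 * c2 = 1"
    using form[OF cl0 n(2)] cl c by auto
  have neg: "mink (t, 1) (uvec z) < 0" if z: "z \<in> hyp_plane" for z
  proof -
    have "t \<bullet> (2 * z) \<le> 2 * norm z" using norm_cauchy_schwarz[of t "2 * z"] t by (simp add: norm_mult)
    moreover have "0 < (1 - norm z)\<^sup>2" using z by simp
    then have "2 * norm z < 1 + (norm z)\<^sup>2" by (simp add: power2_eq_square algebra_simps)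
    ultimately have "mink (t, 1) (hvec z) < 0" by (simp add: mink_def hvec_def inner_complex_def algebra_simps)
    then show ?thesis unfolding mink_hvec_uvec[OF z] using cf_pos[OF z] by (metis mult_less_0_iff order_less_asym)
  qed
  have no: "\<not> (\<exists>w \<in> hyp_plane. mink N1 (uvec w) < 0 \<and> mink N2 (uvec w) < 0)"
    using interior_side r dis by blast
  have lev: "\<exists>z \<in> hyp_plane. mink N (uvec z) = a" if "mink N N = 1" for N a
    by (metis frame_ex[OF that] lorentz_frame.level_ex)
  have "c1 = c2 \<or> c1 = - c2" using 1 2 by (metis square_eq_iff)
  moreover have "c1 \<noteq> c2"
  proof
    assume "c1 = c2"
    then have "N1 - N2 = (a1 - a2) *\<^sub>R (t, 1)" unfolding 1 2 by (simp add: algebra_simps)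
    then have d: "mink N1 (uvec z) - mink N2 (uvec z) = (a1 - a2) * mink (t, 1) (uvec z)" for z
      by (metis mink_diff_left mink_scale_left)
    show False
    proof (cases "a1 \<ge> a2")
      case True
      obtain z where z: "z \<in> hyp_plane" "mink N2 (uvec z) = -1" using lev n by blast
      have "(a1 - a2) * mink (t, 1) (uvec z) \<le> 0" using neg[OF z(1)] True by (simp add: mult_nonneg_nonpos)
      then have "mink N1 (uvec z) < 0 \<and> mink N2 (uvec z) < 0" using d[of z] z(2) by linarith
      then show False using z(1) no by blast
    next
      case False
      obtain z where z: "z \<in> hyp_plane" "mink N1 (uvec z) = -1" using lev n by blast
      have "(a1 - a2) * mink (t, 1) (uvec z) \<ge> 0" using neg[OF z(1)] False by (simp add: mult_nonpos_nonpos)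
      then have "mink N1 (uvec z) < 0 \<and> mink N2 (uvec z) < 0" using d[of z] z(2) by linarith
      then show False using z(1) no by blast
    qed
  qed
  ultimately have "N1 + N2 = (a1 + a2) *\<^sub>R (t, 1)" unfolding 1 2 by (simp add: algebra_simps)
  then have s: "mink N1 (uvec z) + mink N2 (uvec z) = (a1 + a2) * mink (t, 1) (uvec z)" for z
    by (metis mink_add_left mink_scale_left)
  have "a1 + a2 < 0"
  proof (rule ccontr)
    assume "\<not> a1 + a2 < 0"
    then consider "a1 + a2 = 0" | "a1 + a2 > 0" by linarith
    then show False
    proof cases
      case 1
      then have "mink N1 (uvec z) = 0 \<longleftrightarrow> mink N2 (uvec z) = 0" for z using s[of z] by auto
      then show False using ne c by simp
    next
      case 2
      obtain z where z: "z \<in> hyp_plane" "mink N1 (uvec z) = 0" using lev n by blast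
      then have h: "hlev N1 0 z = 0" using hlev_eq_0 by blast
      have "mink N2 (uvec z) < 0" using s[of z] z(2) neg[OF z(1)] 2 by (simp add: mult_pos_neg)
      then have "hlev N2 0 z < 0" using hlev_less_0 z by blast
      moreover have "hgrad N1 0 z \<noteq> 0" using hgrad_norm[OF h] n by auto
      ultimately show False using small_step[OF z(1) h refl] no by blast
    qed
  qed
  moreover have "(- (a1 + a2) / 2) * 2 = - (a1 + a2)" by simp
  then have "N1 + N2 = - ((- (a1 + a2) / 2) *\<^sub>R hvec t)"
    unfolding hp \<open>N1 + N2 = _\<close> scaleR_scaleR by (simp only: scaleR_minus_left minus_minus)
  ultimately show "\<exists>c>0. N1 + N2 = - (c *\<^sub>R hvec t)" by (intro exI[of _ "- (a1 + a2) / 2"]) simp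
qed

lemma mink_of_sum:
  assumes "gc_rep k1 C1 N1" "gc_rep k2 C2 N2" "mink (N1 + N2) (N1 + N2) = - (k1 + k2)\<^sup>2"
  shows "mink N1 N2 = -1 - k1 * k2"
  using assms mink_commute[of N1 N2] by (simp add: gc_rep_def power2_eq_square algebra_simps)

text \<open>In both kinds of tangency the sum has norm \<open>- (k1 + k2)\<^sup>2\<close>, which
  determines the mixed product. The last claim uses \<open>hvec\<close> instead of
  \<open>uvec\<close> because \<open>t\<close> may be ideal.\<close>

lemma ext_tangent_gram:
  assumes r: "gc_rep k1 C1 N1" "gc_rep k2 C2 N2" and e: "ext_tangent k1 C1 k2 C2 t"
  shows "mink N1 N2 = -1 - k1 * k2" "t \<in> cball 0 1" "\<exists>c>0. N1 + N2 = - (c *\<^sub>R hvec t)"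
proof -
  have k0: "0 \<le> k1" "0 \<le> k2" using r by (auto simp: gc_rep_def)
  have "mink N1 N2 = -1 - k1 * k2 \<and> t \<in> cball 0 1 \<and> (\<exists>c>0. N1 + N2 = - (c *\<^sub>R hvec t))"
  proof (cases "k1 + k2 > 0")
    case True
    note E = ext_tangent_vec[OF r True e]
    have "mink (N1 + N2) (N1 + N2) = - (k1 + k2)\<^sup>2"
      unfolding E(2) using uvec_self[OF E(1)] by (simp add: power2_eq_square)
    moreover have "N1 + N2 = - (((k1 + k2) / (1 - (norm t)\<^sup>2)) *\<^sub>R hvec t)"
      unfolding E(2) uvec_def by (simp add: divide_inverse)
    moreover have "(k1 + k2) / (1 - (norm t)\<^sup>2) > 0" using True cf_pos[OF E(1)] by (rule divide_pos_pos)
    moreover have "t \<in> cball 0 1" using E(1) by simp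
    ultimately show ?thesis using mink_of_sum[OF r] by blast
  next
    case False
    then have 0: "k1 = 0" "k2 = 0" using k0 by auto
    obtain c where t: "norm t = 1" and c: "c > 0" "N1 + N2 = - (c *\<^sub>R hvec t)"
      using ext_tangent_ideal_vec[of C1 N1 C2 N2 t] assms unfolding 0 by auto
    have "mink (N1 + N2) (N1 + N2) = 0" unfolding c by (simp add: mink_hvec_self t)
    then show ?thesis using mink_of_sum[OF r] 0 t c by auto
  qed
  then show "mink N1 N2 = -1 - k1 * k2" "t \<in> cball 0 1" "\<exists>c>0. N1 + N2 = - (c *\<^sub>R hvec t)" by blast+
qed

section \<open>Convexity of circle packed triangles\<close>

lemma closure_geodesic: "closure {z \<in> hyp_plane. mink G (uvec z) = 0} \<subseteq> {z \<in> cball 0 1. mink G (hvec z) = 0}"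
proof (rule closure_minimal)
  have "{z \<in> cball 0 1. mink G (hvec z) = 0} = cball 0 1 \<inter> {z. hlev G 0 z = 0}" by (auto simp: hlev_def)
  moreover have "closed {z. hlev G 0 z = 0}" by (intro closed_Collect_eq continuous_hlev continuous_intros)
  ultimately show "closed {z \<in> cball 0 1. mink G (hvec z) = 0}" by (simp add: closed_Int)
  show "{z \<in> hyp_plane. mink G (uvec z) = 0} \<subseteq> {z \<in> cball 0 1. mink G (hvec z) = 0}"
    by (auto simp: mink_hvec_uvec)
qed

text \<open>In the Klein model the closure of a geodesic is a straight chord, on which \<open>mink M\<close> is affine.\<close>

lemma hsegment_half:
  assumes G: "mink G G = 1" and s: "hsegment {z \<in> hyp_plane. mink G (uvec z) = 0} a b s"
    and a: "0 \<le> mink M (hvec a)" and b: "0 \<le> mink M (hvec b)"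
  shows "s \<subseteq> {z \<in> cball 0 1. 0 \<le> mink M (hvec z)}"
proof -
  obtain p where p: "arc p" "pathstart p = a" "pathfinish p = b" "path_image p = s"
    and sub: "s \<subseteq> closure {z \<in> hyp_plane. mink G (uvec z) = 0}"
    using s unfolding hsegment_def by blast
  have in_g: "p x \<in> cball 0 1" "mink G (hvec (p x)) = 0" if "x \<in> {0..1}" for x
    using sub closure_geodesic[of G] p(4) that unfolding path_image_def by blast+
  define \<kappa> where "\<kappa> = (\<lambda>z::complex. (2 / (1 + (norm z)\<^sup>2)) *\<^sub>R z)"
  \<comment> \<open>The position along the chord, whose Euclidean direction is
    \<open>\<i> * fst G\<close>.\<close>
  define \<phi> where "\<phi> = (\<lambda>z. \<kappa> z \<bullet> (\<i> * fst G))"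
  have np: "1 + (norm z)\<^sup>2 > 0" for z :: complex by (simp add: add_pos_nonneg)
  have hk: "hvec z = (1 + (norm z)\<^sup>2) *\<^sub>R (\<kappa> z, 1)" for z
  proof -
    have "(1 + (norm z)\<^sup>2) * (2 / (1 + (norm z)\<^sup>2)) = 2"
      using np[of z] by (metis less_irrefl nonzero_mult_div_cancel_left times_divide_eq_right)
    then have "(1 + (norm z)\<^sup>2) *\<^sub>R \<kappa> z = 2 *\<^sub>R z" unfolding \<kappa>_def scaleR_scaleR by (simp only:)
    then show ?thesis by (simp add: hvec_def prod_eq_iff scaleR_conv_of_real)
  qed
  define q where "q = fst G \<bullet> fst G"
  have q: "q > 0"
  proof -
    have "q = 1 + (snd G)\<^sup>2" using G by (simp add: mink_def q_def inner_complex_def power2_eq_square)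
    then show ?thesis by (simp add: add_pos_nonneg)
  qed
  have kap: "q *\<^sub>R \<kappa> z = snd G *\<^sub>R fst G + \<phi> z *\<^sub>R (\<i> * fst G)" if "mink G (hvec z) = 0" for z
  proof -
    have "mink G (\<kappa> z, 1) = 0" using that np[of z] unfolding hk mink_scale_right by simp
    then have "fst G \<bullet> \<kappa> z = snd G" by (simp add: fst_snd_simps)
    moreover have "q *\<^sub>R \<kappa> z = (fst G \<bullet> \<kappa> z) *\<^sub>R fst G + \<phi> z *\<^sub>R (\<i> * fst G)"
      unfolding q_def \<phi>_def inner_complex_def complex_eq_iff by simp algebra
    ultimately show ?thesis by simp
  qed
  \<comment> \<open>An arc on a chord is injective in this coordinate, hence monotone, so it stays
    between its endpoints; there an affine function is bounded below by its smaller end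
    value.\<close>
  have inj: "inj_on (\<lambda>x. \<phi> (p x)) {0..1}"
  proof (rule inj_onI)
    fix x y assume xy: "x \<in> {0..1}" "y \<in> {0..1}" "\<phi> (p x) = \<phi> (p y)"
    have "q *\<^sub>R \<kappa> (p x) = q *\<^sub>R \<kappa> (p y)" using kap[OF in_g(2)] xy by simp
    then have "\<kappa> (p x) = \<kappa> (p y)" using q by simp
    then have "hvec (p x) = ((1 + (norm (p x))\<^sup>2) / (1 + (norm (p y))\<^sup>2)) *\<^sub>R hvec (p y)"
      unfolding hk using np[of "p y"] by simp
    moreover have "(1 + (norm (p x))\<^sup>2) / (1 + (norm (p y))\<^sup>2) > 0" using np by simp
    ultimately have "p x = p y" using hvec_inject in_g xy by blast
    then show "x = y" using p(1) xy by (auto simp: arc_def inj_on_def)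
  qed
  have cont: "continuous_on {0..1} (\<lambda>x. \<phi> (p x))"
  proof -
    have "continuous_on {0..1} p" using p(1) by (simp add: arc_def path_def)
    moreover have "1 + (norm (p x))\<^sup>2 \<noteq> 0" for x using np[of "p x"] by simp
    ultimately show ?thesis unfolding \<phi>_def \<kappa>_def by (intro continuous_intros) auto
  qed
  define A B where "A = snd G * (fst M \<bullet> fst G) / q - snd M" and "B = (fst M \<bullet> (\<i> * fst G)) / q"
  have aff: "mink M (hvec z) = (1 + (norm z)\<^sup>2) * (A + B * \<phi> z)" if "mink G (hvec z) = 0" for z
  proof -
    have "\<kappa> z = (1 / q) *\<^sub>R (snd G *\<^sub>R fst G + \<phi> z *\<^sub>R (\<i> * fst G))"
      unfolding kap[OF that, symmetric] using q by simp
    then have "fst M \<bullet> \<kappa> z = (1 / q) * (snd G * (fst M \<bullet> fst G) + \<phi> z * (fst M \<bullet> (\<i> * fst G)))"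
      by (simp add: inner_add_right)
    then have "mink M (\<kappa> z, 1) = A + B * \<phi> z" by (simp add: fst_snd_simps A_def B_def add_divide_distrib)
    then show ?thesis unfolding hk mink_scale_right by simp
  qed
  have sgn: "0 \<le> mink M (hvec z) \<longleftrightarrow> 0 \<le> A + B * \<phi> z" if "mink G (hvec z) = 0" for z
    unfolding aff[OF that] using np[of z] by (simp add: zero_le_mult_iff)
  have ends: "0 \<le> A + B * \<phi> (p 0)" "0 \<le> A + B * \<phi> (p 1)"
    using sgn[OF in_g(2), of 0] sgn[OF in_g(2), of 1] a b p by (auto simp: pathstart_def pathfinish_def)
  have "0 \<le> mink M (hvec (p x))" if x: "x \<in> {0..1}" for x
  proof -
    have "x = 0 \<or> x = 1 \<or> (\<phi> (p 0) < \<phi> (p x) \<and> \<phi> (p x) < \<phi> (p 1)) \<or> (\<phi> (p 1) < \<phi> (p x) \<and> \<phi> (p x) < \<phi> (p 0))"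
    proof (cases "0 < x \<and> x < 1")
      case True
      then show ?thesis using continuous_inj_imp_mono[OF _ _ cont inj, of x] by blast
    qed (use x in auto)
    moreover have "0 \<le> A + B * c" if "\<phi> (p 0) < c \<and> c < \<phi> (p 1) \<or> \<phi> (p 1) < c \<and> c < \<phi> (p 0)" for c
    proof (cases "B \<ge> 0")
      case True
      then have "B * c \<ge> B * \<phi> (p 0) \<or> B * c \<ge> B * \<phi> (p 1)" using that by (meson less_imp_le mult_left_mono)
      then show ?thesis using ends by linarith
    next
      case False
      then have "B * c \<ge> B * \<phi> (p 0) \<or> B * c \<ge> B * \<phi> (p 1)" using that by (meson less_imp_le mult_left_mono_neg not_le)
      then show ?thesis using ends by linarith
    qed
    ultimately have "0 \<le> A + B * \<phi> (p x)" using ends by blast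
    then show ?thesis using sgn[OF in_g(2)[OF x]] by simp
  qed
  then show ?thesis using in_g p(4) unfolding path_image_def by blast
qed

lemma hsegment_ends: "hsegment g a b s \<Longrightarrow> a \<in> s \<and> b \<in> s \<and> s \<subseteq> closure g"
  unfolding hsegment_def by (metis pathstart_in_path_image pathfinish_in_path_image)

text \<open>The line of an edge is orthogonal to the vector of either circle at its ends: it passes
  through the center if \<open>k \<ge> 1\<close> and meets the axis at a right angle if
  \<open>k < 1\<close>. The case distinction on curvatures is absorbed in this one equation.\<close>

lemma center_point:
  assumes r: "gc_rep k C N" and G: "mink G G = 1" and a: "a \<in> center C"
    and cl: "a \<in> closure {z \<in> hyp_plane. mink G (uvec z) = 0}"
    and perp: "k < 1 \<longrightarrow> perpendicular_at a {z \<in> hyp_plane. mink G (uvec z) = 0} (center C)"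
  shows "a \<in> cball 0 1" "mink G N = 0" "mink G (hvec a) = 0"
    "k \<ge> 1 \<Longrightarrow> \<exists>\<mu>>0. hvec a = - (\<mu> *\<^sub>R N)" "k < 1 \<Longrightarrow> mink N (hvec a) = 0"
proof -
  show 1: "a \<in> cball 0 1" "mink G (hvec a) = 0" using cl closure_geodesic by blast+
  show 2: "\<exists>\<mu>>0. hvec a = - (\<mu> *\<^sub>R N)" if "k \<ge> 1"
  proof -
    have f: "fcausal (- N)" and "a = hpr (- N)" using r a that by (auto simp: gc_rep_def)
    then have "hvec a = (2 / (snd (- N) + sqrt (- mink (- N) (- N)))) *\<^sub>R (- N)" using hpr_props(2)[OF f] by simp
    moreover have "2 / (snd (- N) + sqrt (- mink (- N) (- N))) > 0" using hpr_props(1)[OF f] by simp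
    ultimately show ?thesis by (metis scaleR_minus_right)
  qed
  have 3: "mink G N = 0 \<and> mink N (hvec a) = 0" if "k < 1"
    using perpendicularD[of a G N] perp r that by (auto simp: gc_rep_def mink_hvec_uvec)
  then show "k < 1 \<Longrightarrow> mink N (hvec a) = 0" by blast
  show "mink G N = 0"
  proof (cases "k < 1")
    case False
    then obtain \<mu> where "\<mu> > 0" "hvec a = - (\<mu> *\<^sub>R N)" using 2 by auto
    then show ?thesis using 1 by auto
  qed (use 3 in blast)
qed

lemma span2:
  assumes G: "mink G G = 1" "mink G u = 0" "mink G v = 0" "mink G a = 0"
    and d: "D = mink u u * mink v v - (mink u v)\<^sup>2" "D \<noteq> 0"
  shows "D *\<^sub>R a = (mink a u * mink v v - mink a v * mink u v) *\<^sub>R u + (mink a v * mink u u - mink a u * mink u v) *\<^sub>R v"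
proof -
  have "gram3 G u v \<noteq> 0" using assms by (simp add: gram3_def)
  then have "D *\<^sub>R a - ((mink a u * mink v v - mink a v * mink u v) *\<^sub>R u + (mink a v * mink u u - mink a u * mink u v) *\<^sub>R v) = 0"
    by (rule ortho_zero) (simp_all add: G mink_commute[of _ G] mink_commute[of v u] d(1) power2_eq_square algebra_simps)
  then show ?thesis by simp
qed

text \<open>In the plane of \<open>N1\<close> and \<open>N2\<close>, orthogonality to
  \<open>N1\<close> fixes the foot up to a factor, and the product with the tangency point fixes the
  sign of the factor. Nonpositive coefficients let the inequalities \<open>mink M N1 \<le> 0\<close>
  and \<open>mink M N2 \<le> 0\<close> pass to the foot.\<close>

lemma foot_cone:
  assumes G: "mink G G = 1" "mink G N1 = 0" "mink G N2 = 0" "mink G A = 0"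
    and n: "mink N1 N1 = 1 - k1\<^sup>2" "mink N2 N2 = 1 - k2\<^sup>2" "mink N1 N2 = -1 - k1 * k2"
    and k: "0 \<le> k1" "k1 < 1" "0 \<le> k2" "0 < k1 + k2" and A: "mink N1 A = 0"
    and T: "N1 + N2 = - (c *\<^sub>R T)" "c > 0" "mink T A \<le> 0"
  shows "\<exists>\<alpha> \<beta>. \<alpha> \<le> 0 \<and> \<beta> \<le> 0 \<and> A = \<alpha> *\<^sub>R N1 + \<beta> *\<^sub>R N2"
proof -
  define D where "D = (k1 + k2)\<^sup>2"
  have D: "D > 0" using k by (simp add: D_def)
  have Dm: "- D = mink N1 N1 * mink N2 N2 - (mink N1 N2)\<^sup>2"
    unfolding n D_def by (simp add: power2_eq_square algebra_simps)
  define m where "m = mink A N2"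
  have "mink (N1 + N2) A = m" using A by (simp add: m_def mink_commute)
  then have "m = - c * mink T A" unfolding T by simp
  then have m: "m \<ge> 0" using T by (simp add: mult_nonneg_nonpos)
  have "(- D) *\<^sub>R A = (- m * mink N1 N2) *\<^sub>R N1 + (m * mink N1 N1) *\<^sub>R N2"
    using span2[OF G Dm] D A by (simp add: m_def mink_commute)
  then have "A = (1 / (- D)) *\<^sub>R ((- m * mink N1 N2) *\<^sub>R N1 + (m * mink N1 N1) *\<^sub>R N2)"
    using D by (metis divide_self_if less_irrefl neg_equal_0_iff_equal nonzero_divide_eq_eq scaleR_one scaleR_scaleR)
  moreover have "(1 / (- D)) * (- m * mink N1 N2) = m * mink N1 N2 / D" "(1 / (- D)) * (m * mink N1 N1) = - m * mink N1 N1 / D"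
    using D by simp_all
  ultimately have "A = (m * mink N1 N2 / D) *\<^sub>R N1 + (- m * mink N1 N1 / D) *\<^sub>R N2"
    unfolding scaleR_add_right scaleR_scaleR by (simp only:)
  moreover have "m * mink N1 N2 / D \<le> 0" using m k D unfolding n
    by (intro divide_nonpos_pos mult_nonneg_nonpos) (auto intro: order_trans[of _ 0])
  moreover have "k1\<^sup>2 \<le> 1" using k by (simp add: power_le_one)
  then have "- m * mink N1 N1 / D \<le> 0" using m D unfolding n
    by (intro divide_nonpos_pos) (auto simp: mult_nonneg_nonneg)
  ultimately show ?thesis by blast
qed

lemma edge_end_half:
  assumes r: "gc_rep k1 C1 N1" "gc_rep k2 C2 N2" and g: "mink N1 N2 = -1 - k1 * k2"
    and t: "t \<in> cball 0 1" "c > 0" "N1 + N2 = - (c *\<^sub>R hvec t)" and k: "0 < k1 + k2"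
    and M: "mink M N1 \<le> 0" "mink M N2 \<le> 0"
    and G: "mink G G = 1" "mink G N2 = 0" and a: "a \<in> center C1"
    and cl: "a \<in> closure {z \<in> hyp_plane. mink G (uvec z) = 0}"
    and perp: "k1 < 1 \<longrightarrow> perpendicular_at a {z \<in> hyp_plane. mink G (uvec z) = 0} (center C1)"
  shows "0 \<le> mink M (hvec a)"
proof (cases "k1 < 1")
  case True
  note c = center_point[OF r(1) G(1) a cl perp]
  have "\<exists>\<alpha> \<beta>. \<alpha> \<le> 0 \<and> \<beta> \<le> 0 \<and> hvec a = \<alpha> *\<^sub>R N1 + \<beta> *\<^sub>R N2"
  proof (rule foot_cone)
    show "mink (hvec t) (hvec a) \<le> 0" using fcausal_mink_nonpos fcausal_hvec t c by blast
    show "mink G (hvec a) = 0" "mink G N1 = 0" "mink N1 (hvec a) = 0" using c True by blast+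
    show "mink N1 N1 = 1 - k1\<^sup>2" "mink N2 N2 = 1 - k2\<^sup>2" "0 \<le> k1" "0 \<le> k2" using r by (auto simp: gc_rep_def)
  qed (fact G g k t True)+
  then obtain \<alpha> \<beta> where "\<alpha> \<le> 0" "\<beta> \<le> 0" "hvec a = \<alpha> *\<^sub>R N1 + \<beta> *\<^sub>R N2" by blast
  then show ?thesis using M by (simp add: mult_nonpos_nonpos)
next
  case False
  then obtain \<mu> where "\<mu> > 0" "hvec a = - (\<mu> *\<^sub>R N1)" using center_point(4)[OF r(1) G(1) a cl perp] by auto
  then show ?thesis using M by (simp add: mult_nonneg_nonpos)
qed

lemma edge_half:
  assumes r: "gc_rep k1 C1 N1" "gc_rep k2 C2 N2" and g: "mink N1 N2 = -1 - k1 * k2"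
    and t: "t \<in> cball 0 1" "c > 0" "N1 + N2 = - (c *\<^sub>R hvec t)"
    and M: "mink M N1 \<le> 0" "mink M N2 \<le> 0" and e: "cp_edge k1 C1 k2 C2 t a b e"
  shows "e \<subseteq> {z \<in> cball 0 1. 0 \<le> mink M (hvec z)}" "a \<in> e" "b \<in> e"
proof -
  have k0: "0 \<le> k1" "0 \<le> k2" using r by (auto simp: gc_rep_def)
  have "e \<subseteq> {z \<in> cball 0 1. 0 \<le> mink M (hvec z)} \<and> a \<in> e \<and> b \<in> e"
  proof (cases "k1 = 0 \<and> k2 = 0")
    case True
    then have e: "a = t" "b = t" "e = {t}" using e by (auto simp: cp_edge_def)
    have "mink M (N1 + N2) = - c * mink M (hvec t)" unfolding t by simp
    then have "c * mink M (hvec t) \<ge> 0" using M by simp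
    then show ?thesis using e t by (simp add: zero_le_mult_iff)
  next
    case False
    then obtain g' where g': "geodesic g'" "hsegment g' a b e" "a \<in> center C1" "b \<in> center C2"
      "k1 < 1 \<longrightarrow> perpendicular_at a g' (center C1)" "k2 < 1 \<longrightarrow> perpendicular_at b g' (center C2)"
      using e unfolding cp_edge_def by (simp only: if_False) blast
    obtain G where G: "mink G G = 1" and gG: "g' = {z \<in> hyp_plane. mink G (uvec z) = 0}" using g'(1) by (rule geodesicE)
    have en: "a \<in> e" "b \<in> e" "a \<in> closure g'" "b \<in> closure g'" using hsegment_ends[OF g'(2)] by auto
    note a = center_point[OF r(1) G g'(3) en(3)[unfolded gG] g'(5)[unfolded gG]]
    note b = center_point[OF r(2) G g'(4) en(4)[unfolded gG] g'(6)[unfolded gG]]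
    have k: "0 < k1 + k2" using False k0 by linarith
    have "0 \<le> mink M (hvec a)"
      by (rule edge_end_half[OF r g t k M G b(2) g'(3) en(3)[unfolded gG] g'(5)[unfolded gG]])
    moreover have "0 \<le> mink M (hvec b)"
    proof (rule edge_end_half[OF r(2,1) _ t(1,2) _ _ M(2,1) G a(2) g'(4) en(4)[unfolded gG] g'(6)[unfolded gG]])
      show "mink N2 N1 = -1 - k2 * k1" using g by (simp add: mink_commute)
      show "N2 + N1 = - (c *\<^sub>R hvec t)" using t(3) by (simp add: add.commute)
    qed (use k in simp)
    ultimately show ?thesis using hsegment_half[OF G g'(2)[unfolded gG]] en by blast
  qed
  then show "e \<subseteq> {z \<in> cball 0 1. 0 \<le> mink M (hvec z)}" "a \<in> e" "b \<in> e" by blast+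
qed

lemma vertex_half:
  assumes r: "gc_rep k C N" and M: "mink M N \<le> 0" and v: "cp_vertex k C a b v"
    and a: "0 \<le> mink M (hvec a)" and b: "0 \<le> mink M (hvec b)"
  shows "v \<subseteq> {z \<in> cball 0 1. 0 \<le> mink M (hvec z)}"
proof (cases "k \<ge> 1")
  case True
  then have f: "fcausal (- N)" and v: "v = {hpr (- N)}" using r v by (auto simp: gc_rep_def cp_vertex_def)
  have "mink M (hvec (hpr (- N))) = (2 / (snd (- N) + sqrt (- mink (- N) (- N)))) * (- mink M N)"
    unfolding hpr_props(2)[OF f] by simp
  also have "\<dots> \<ge> 0" using hpr_props(1)[OF f] M by (intro mult_nonneg_nonneg) auto
  finally show ?thesis using v hpr_props(4)[OF f] by simp
next
  case False
  then have k: "0 \<le> k" "k < 1" using r by (auto simp: gc_rep_def)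
  then have p: "1 - k\<^sup>2 > 0" by (simp add: abs_square_less_1)
  define G where "G = (1 / sqrt (1 - k\<^sup>2)) *\<^sub>R N"
  have "mink G G = 1" using p r by (simp add: G_def gc_rep_def)
  moreover have "center C = {z \<in> hyp_plane. mink G (uvec z) = 0}"
    using r k p by (auto simp: G_def gc_rep_def)
  ultimately show ?thesis using hsegment_half[of G a b v M] v False a b by (simp add: cp_vertex_def)
qed

text \<open>From a point on the negative side one can walk to infinity without meeting
  \<open>B\<close>, staying on the negative side or outside the closed disk. Hence it lies in the
  unbounded part of the complement.\<close>

lemma inside_half:
  assumes B: "B \<subseteq> {z \<in> cball 0 1. 0 \<le> mink M (hvec z)}" and M: "mink M M > 0"
    and q: "q \<in> cball 0 1" "mink M (hvec q) < 0"
  shows "q \<notin> inside B"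
proof
  assume "q \<in> inside B"
  then have bd: "bounded (connected_component_set (- B) q)" by (simp add: inside_def)
  have escape: False if W: "connected W" "q \<in> W" "W \<inter> B = {}" "\<not> bounded W" for W
  proof -
    have "W \<subseteq> connected_component_set (- B) q" using W by (intro connected_component_maximal) auto
    then show False using bd W(4) bounded_subset by blast
  qed
  obtain b a where M': "M = (b, a)" by fastforce
  \<comment> \<open>The negative of \<open>hgrad M 0 q\<close>, along which
    \<open>mink M (hvec z)\<close> decreases at first; for \<open>a \<ge> 0\<close> it never
    increases again, so that the whole ray escapes.\<close>
  define d where "d = a *\<^sub>R q - b"
  have mb: "b \<bullet> b - a * a > 0" using M by (simp add: M' mink_def inner_complex_def)
  have Q: "mink M (hvec (q + s *\<^sub>R d)) = mink M (hvec q) - s * (2 + a * s) * (d \<bullet> d)" for s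
  proof -
    have g: "hgrad M 0 q = - d" by (simp add: hgrad_def d_def M')
    have "hlev M 0 (q + s *\<^sub>R d) = hlev M 0 q + 2 * (- d \<bullet> s *\<^sub>R d) - a * (norm (s *\<^sub>R d))\<^sup>2"
      unfolding hlev_add g by (simp add: M')
    then show ?thesis unfolding power2_norm_eq_inner by (simp add: hlev_def algebra_simps)
  qed
  have d0: "d \<noteq> 0"
  proof
    assume "d = 0"
    then have "b = a *\<^sub>R q" by (simp add: d_def)
    then have "b \<bullet> b = a * a * (q \<bullet> q)" by simp
    moreover have "q \<bullet> q \<le> 1" using q by (simp add: dot_square_norm abs_square_le_1)
    then have "a * a * (q \<bullet> q) \<le> a * a * 1" by (intro mult_left_mono) auto
    ultimately show False using mb by simp
  qed
  have unb: "\<not> bounded ((\<lambda>s. x + s *\<^sub>R y) ` {0..})" if "y \<noteq> 0" for x y :: complex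
  proof
    assume "bounded ((\<lambda>s. x + s *\<^sub>R y) ` {0..})"
    then obtain K where "\<And>s. s \<ge> 0 \<Longrightarrow> norm (x + s *\<^sub>R y) \<le> K" by (auto simp: bounded_iff)
    moreover define s where "s = (\<bar>K\<bar> + norm x + 1) / norm y"
    ultimately have "norm (x + s *\<^sub>R y) \<le> K" by simp
    moreover have "norm (s *\<^sub>R y) = \<bar>K\<bar> + norm x + 1" using that by (simp add: s_def)
    moreover have "norm (s *\<^sub>R y) \<le> norm (x + s *\<^sub>R y) + norm x" by (metis add_diff_cancel_left' norm_triangle_ineq4)
    ultimately show False by linarith
  qed
  have ray: "connected ((\<lambda>s. x + s *\<^sub>R y) ` {0..})" for x y :: complex
    by (intro connected_continuous_image continuous_intros) auto
  show False
  proof (cases "a \<ge> 0")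
    case True
    let ?W = "(\<lambda>s. q + s *\<^sub>R d) ` {0..}"
    have "mink M (hvec (q + s *\<^sub>R d)) < 0" if "s \<ge> 0" for s
    proof -
      have "s * (2 + a * s) * (d \<bullet> d) \<ge> 0" using that True by (intro mult_nonneg_nonneg) auto
      then show ?thesis using Q[of s] q by linarith
    qed
    then have "?W \<inter> B = {}" using B by force
    moreover have "q \<in> ?W" by (rule image_eqI[of _ _ 0]) auto
    ultimately show False using escape[OF ray _ _ unb[OF d0]] by blast
  next
    case False
    then have a: "a < 0" by simp
    \<comment> \<open>The Euclidean center of the circle that carries the geodesic of
      \<open>M\<close>. For \<open>a < 0\<close> the negative side is the interior of that circle;
      its center lies outside the closed unit disk, and from there the radial ray escapes.\<close>
    define p where "p = b /\<^sub>R a"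
    have e: "q + (- (1 / a)) *\<^sub>R d = p" using a by (simp add: d_def p_def scaleR_diff_right divide_inverse)
    have "p \<bullet> p = (b \<bullet> b) / (a * a)" by (simp add: p_def divide_inverse)
    moreover have "(b \<bullet> b) / (a * a) > 1" using mb a by (simp add: less_divide_eq)
    ultimately have p1: "norm p > 1" by (simp add: dot_square_norm) (metis norm_ge_zero not_less power_le_one)
    let ?W1 = "(\<lambda>s. q + s *\<^sub>R d) ` {0..- (1/a)}"
    let ?W2 = "(\<lambda>s. p + s *\<^sub>R p) ` {0..}"
    have "mink M (hvec (q + s *\<^sub>R d)) < 0" if "s \<in> {0..- (1/a)}" for s
    proof -
      have "a * s \<ge> a * (- (1/a))" using that a by (intro mult_left_mono_neg) auto
      then have "2 + a * s \<ge> 0" using a by simp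
      then have "s * (2 + a * s) * (d \<bullet> d) \<ge> 0" using that by (intro mult_nonneg_nonneg) auto
      then show ?thesis using Q[of s] q by linarith
    qed
    then have 1: "?W1 \<inter> B = {}" using B by force
    have "norm (p + s *\<^sub>R p) > 1" if "s \<ge> 0" for s
    proof -
      have "p + s *\<^sub>R p = (1 + s) *\<^sub>R p" by (simp add: scaleR_add_left)
      then have "norm (p + s *\<^sub>R p) = (1 + s) * norm p" using that by (simp only: norm_scaleR)
      also have "\<dots> \<ge> 1 * norm p" using that by (intro mult_right_mono) auto
      finally show ?thesis using p1 by simp
    qed
    then have 2: "?W2 \<inter> B = {}" using B by (force simp: not_le)
    have p12: "p \<in> ?W1" "p \<in> ?W2" using a e by (auto intro: image_eqI[of _ _ "- (1/a)"] image_eqI[of _ _ 0])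
    have W1: "connected ?W1" by (intro connected_continuous_image continuous_intros) auto
    have "?W1 \<inter> ?W2 \<noteq> {}" using p12 by (meson disjoint_iff)
    from connected_Un[OF W1 ray this] have "connected (?W1 \<union> ?W2)" .
    moreover have "q \<in> ?W1" using a by (intro image_eqI[of _ _ 0]) auto
    moreover have "p \<noteq> 0" using p1 by auto
    then have "\<not> bounded (?W1 \<union> ?W2)" using unb[of p p] by (simp add: bounded_Un)
    ultimately show False using escape[of "?W1 \<union> ?W2"] 1 2 by blast
  qed
qed

text \<open>Convexity of the triangle. Edges and vertices lie in the half-plane because their
  endpoints do, and \<open>inside_half\<close> extends this to the enclosed region.\<close>

lemma triangle_half:
  assumes tr: "cp_triangle k1 k2 k3 C1 C2 C3 t12 t23 t31 \<Delta>"
    and r: "gc_rep k1 C1 N1" "gc_rep k2 C2 N2" "gc_rep k3 C3 N3"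
    and M: "mink M M > 0" "mink M N1 \<le> 0" "mink M N2 \<le> 0" "mink M N3 \<le> 0"
    and z: "z \<in> \<Delta>" "z \<in> hyp_plane"
  shows "0 \<le> mink M (hvec z)"
proof -
  have t: "ext_tangent k1 C1 k2 C2 t12" "ext_tangent k2 C2 k3 C3 t23" "ext_tangent k3 C3 k1 C1 t31"
    using tr unfolding cp_triangle_def by blast+
  obtain a12 a21 a23 a32 a31 a13 e12 e23 e31 v1 v2 v3 where e:
    "cp_edge k1 C1 k2 C2 t12 a12 a21 e12" "cp_edge k2 C2 k3 C3 t23 a23 a32 e23" "cp_edge k3 C3 k1 C1 t31 a31 a13 e31"
    and v: "cp_vertex k1 C1 a12 a13 v1" "cp_vertex k2 C2 a23 a21 v2" "cp_vertex k3 C3 a31 a32 v3"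
    and D: "\<Delta> = (e12 \<union> e23 \<union> e31 \<union> v1 \<union> v2 \<union> v3) \<union> inside (e12 \<union> e23 \<union> e31 \<union> v1 \<union> v2 \<union> v3)"
    using tr unfolding cp_triangle_def Let_def by blast
  let ?H = "{z \<in> cball 0 1. 0 \<le> mink M (hvec z)}"
  have *: "e \<subseteq> ?H \<and> a \<in> ?H \<and> b \<in> ?H" if h: "cp_edge k C k' C' t a b e" "ext_tangent k C k' C' t"
      "gc_rep k C N" "gc_rep k' C' N'" "mink M N \<le> 0" "mink M N' \<le> 0" for k C k' C' t a b e N N'
  proof -
    obtain c where "mink N N' = -1 - k * k'" "t \<in> cball 0 1" "c > 0" "N + N' = - (c *\<^sub>R hvec t)"
      using ext_tangent_gram[OF h(3,4,2)] by blast
    from edge_half[OF h(3,4) this h(5,6,1)] show ?thesis by blast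
  qed
  note E = *[OF e(1) t(1) r(1,2) M(2,3)] *[OF e(2) t(2) r(2,3) M(3,4)] *[OF e(3) t(3) r(3,1) M(4,2)]
  have V: "v1 \<subseteq> ?H" "v2 \<subseteq> ?H" "v3 \<subseteq> ?H"
    using vertex_half[OF r(1) M(2) v(1)] vertex_half[OF r(2) M(3) v(2)] vertex_half[OF r(3) M(4) v(3)] E by blast+
  have B: "e12 \<union> e23 \<union> e31 \<union> v1 \<union> v2 \<union> v3 \<subseteq> ?H" using E V by blast
  show ?thesis
  proof (rule ccontr)
    assume "\<not> 0 \<le> mink M (hvec z)"
    then have n: "mink M (hvec z) < 0" by simp
    moreover have zc: "z \<in> cball 0 1" using z(2) by simp
    ultimately show False using inside_half[OF B M(1) zc] z(1) B unfolding D by fastforce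
  qed
qed

section \<open>Arc lengths\<close>

text \<open>The coordinate \<open>ccoord\<close> is the stereographic parameter of the curve of curvature \<open>k\<close> seen from its
  point \<open>a\<close>: a Moebius map that is real on the curve and sends \<open>a\<close> to \<open>0\<close>.\<close>

definition cden :: "complex \<Rightarrow> complex \<Rightarrow> real \<Rightarrow> complex \<Rightarrow> complex" where
  "cden a n k z = n * (1 - cnj a * z) + of_real k * (z - a)"

definition ccoord :: "complex \<Rightarrow> complex \<Rightarrow> real \<Rightarrow> complex \<Rightarrow> complex" where
  "ccoord a n k z = \<i> * (z - a) / cden a n k z"

lemma cmod_one_minus: "(norm (1 - cnj a * z))\<^sup>2 = (1 - (norm a)\<^sup>2) * (1 - (norm z)\<^sup>2) + (norm (z - a))\<^sup>2"
  unfolding cmod_sq by (simp add: algebra_simps)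

locale curve_base =
  fixes N :: "complex \<times> real" and k :: real and a n :: complex
  assumes NN: "mink N N = 1 - k\<^sup>2" and k0: "0 \<le> k" and a: "a \<in> hyp_plane"
    and ha: "mink N (uvec a) = k" and n: "n = hgrad N k a"
begin

lemma hlev_a: "hlev N k a = 0"
  using ha hlev_eq_0[OF a] by simp

lemma n_norm: "Re n * Re n + Im n * Im n = 1"
  using hgrad_norm[OF hlev_a] NN unfolding n cmod_sq by simp

lemma n_nz: "n \<noteq> 0"
  using n_norm by auto

text \<open>The equation of the curve seen from its point \<open>a\<close>: after division by
  \<open>(norm (1 - cnj a * z))\<^sup>2\<close> the normal is paired with the Moebius image of
  \<open>z\<close> that moves \<open>a\<close> to 0.\<close>

lemma hlev_expand:
  "(1 - (norm a)\<^sup>2) * hlev N k z = 2 * (n \<bullet> ((z - a) * cnj (1 - cnj a * z)) + k * (norm (z - a))\<^sup>2)"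
proof -
  obtain b0 b1 \<alpha> where N: "N = (Complex b0 b1, \<alpha>)" by (metis complex_surj prod.exhaust)
  obtain a0 a1 where A: "a = Complex a0 a1" by (metis complex_surj)
  obtain z0 z1 where Z: "z = Complex z0 z1" by (metis complex_surj)
  have "2 * (b0 * a0 + b1 * a1) - \<alpha> * (1 + (a0 * a0 + a1 * a1)) - k * (1 - (a0 * a0 + a1 * a1)) = 0"
    using hlev_a unfolding hlev_def mink_def hvec_def cmod_sq N A by (simp add: algebra_simps)
  then show ?thesis unfolding n hlev_def hgrad_def mink_def hvec_def cmod_sq N A Z inner_complex_def
    by simp algebra
qed

lemma on_curve:
  assumes "z \<in> hyp_plane" "mink N (uvec z) = k"
  shows "n \<bullet> ((z - a) * cnj (1 - cnj a * z)) = - k * (norm (z - a))\<^sup>2"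
    and "(norm (cden a n k z))\<^sup>2 = (norm (1 - cnj a * z))\<^sup>2 - k\<^sup>2 * (norm (z - a))\<^sup>2"
proof -
  have "hlev N k z = 0" using assms hlev_eq_0 by blast
  then show 1: "n \<bullet> ((z - a) * cnj (1 - cnj a * z)) = - k * (norm (z - a))\<^sup>2" using hlev_expand[of z] by simp
  have "(norm (cden a n k z))\<^sup>2 = (norm n)\<^sup>2 * (norm (1 - cnj a * z))\<^sup>2
    + 2 * k * (n \<bullet> ((z - a) * cnj (1 - cnj a * z))) + k\<^sup>2 * (norm (z - a))\<^sup>2"
    unfolding cden_def cmod_sq inner_complex_def by simp algebra
  also have "(norm n)\<^sup>2 = 1" using n_norm unfolding cmod_sq by simp
  finally show "(norm (cden a n k z))\<^sup>2 = (norm (1 - cnj a * z))\<^sup>2 - k\<^sup>2 * (norm (z - a))\<^sup>2"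
    unfolding 1 by (simp add: power2_eq_square)
qed

lemma ccoord_real:
  assumes "z \<in> hyp_plane" "mink N (uvec z) = k"
  shows "Im (ccoord a n k z) = 0"
proof -
  have "Im (\<i> * (z - a) * cnj (cden a n k z)) = n \<bullet> ((z - a) * cnj (1 - cnj a * z)) + k * (norm (z - a))\<^sup>2"
    unfolding cden_def cmod_sq inner_complex_def by simp algebra
  then have "Im (\<i> * (z - a) * cnj (cden a n k z)) = 0" using on_curve(1)[OF assms] by simp
  moreover have "ccoord a n k z = (\<i> * (z - a) * cnj (cden a n k z)) / of_real ((norm (cden a n k z))\<^sup>2)"
    unfolding ccoord_def complex_norm_square by (cases "cden a n k z = 0") (auto simp: field_simps)
  ultimately show ?thesis by (simp only: Im_divide_of_real div_0)
qed

lemma ccoord_sq: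
  assumes "z \<in> hyp_plane" "mink N (uvec z) = k"
  shows "(Re (ccoord a n k z))\<^sup>2 = (norm (z - a))\<^sup>2 / (norm (cden a n k z))\<^sup>2"
proof -
  have "(Re (ccoord a n k z))\<^sup>2 = (norm (ccoord a n k z))\<^sup>2"
    using ccoord_real[OF assms] unfolding cmod_sq by (simp add: power2_eq_square)
  then show ?thesis by (simp add: ccoord_def norm_divide norm_mult power_divide)
qed

lemma cden_nz_low:
  assumes "z \<in> hyp_plane" "mink N (uvec z) = k" "k \<le> 1"
  shows "cden a n k z \<noteq> 0"
proof -
  have p: "(1 - (norm a)\<^sup>2) * (1 - (norm z)\<^sup>2) > 0" using cf_pos a assms by (meson mult_pos_pos)
  have "k\<^sup>2 \<le> 1" using k0 assms by (simp add: power_le_one)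
  then have "k\<^sup>2 * (norm (z - a))\<^sup>2 \<le> 1 * (norm (z - a))\<^sup>2" by (rule mult_right_mono) simp
  then have "(norm (cden a n k z))\<^sup>2 > 0" unfolding on_curve(2)[OF assms(1,2)] cmod_one_minus using p by linarith
  then show ?thesis by auto
qed

text \<open>Computes the denominator of the hyperbolic length element in the coordinate
  \<open>ccoord\<close>, where it depends on the curvature only.\<close>

lemma density:
  assumes "z \<in> hyp_plane" "mink N (uvec z) = k" "cden a n k z \<noteq> 0"
  shows "1 + (k\<^sup>2 - 1) * (Re (ccoord a n k z))\<^sup>2 = (1 - (norm a)\<^sup>2) * (1 - (norm z)\<^sup>2) / (norm (cden a n k z))\<^sup>2"
    and "1 + (k\<^sup>2 - 1) * (Re (ccoord a n k z))\<^sup>2 > 0"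
proof -
  have d: "(norm (cden a n k z))\<^sup>2 > 0" using assms by simp
  have "1 + (k\<^sup>2 - 1) * (Re (ccoord a n k z))\<^sup>2 = ((norm (cden a n k z))\<^sup>2 + (k\<^sup>2 - 1) * (norm (z - a))\<^sup>2) / (norm (cden a n k z))\<^sup>2"
    unfolding ccoord_sq[OF assms(1,2)] using d by (simp add: field_simps)
  also have "(norm (cden a n k z))\<^sup>2 + (k\<^sup>2 - 1) * (norm (z - a))\<^sup>2 = (1 - (norm a)\<^sup>2) * (1 - (norm z)\<^sup>2)"
    unfolding on_curve(2)[OF assms(1,2)] cmod_one_minus by (simp add: algebra_simps)
  finally show 1: "1 + (k\<^sup>2 - 1) * (Re (ccoord a n k z))\<^sup>2 = (1 - (norm a)\<^sup>2) * (1 - (norm z)\<^sup>2) / (norm (cden a n k z))\<^sup>2" .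
  have "(1 - (norm a)\<^sup>2) * (1 - (norm z)\<^sup>2) > 0" using cf_pos a assms by (meson mult_pos_pos)
  then show "1 + (k\<^sup>2 - 1) * (Re (ccoord a n k z))\<^sup>2 > 0" unfolding 1 using d by simp
qed

lemma ccoord_inj:
  assumes "cden a n k z \<noteq> 0" "cden a n k w \<noteq> 0" "ccoord a n k z = ccoord a n k w"
  shows "z = w"
proof -
  have "(z - a) * cden a n k w = (w - a) * cden a n k z"
    using assms by (simp add: ccoord_def frac_eq_eq)
  then have "n * (1 - cnj a * a) * (z - w) = 0" unfolding cden_def by (simp add: algebra_simps)
  moreover have "1 - cnj a * a \<noteq> 0"
  proof
    assume "1 - cnj a * a = 0"
    then have "Re (1 - cnj a * a) = 0" by simp
    then have "(norm a)\<^sup>2 = 1" unfolding cmod_sq by simp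
    then show False using cf_pos[OF a] by simp
  qed
  ultimately show ?thesis using n_nz by simp
qed

lemma ccoord_deriv:
  assumes "cden a n k z \<noteq> 0"
  shows "(ccoord a n k has_field_derivative (\<i> * n * of_real (1 - (norm a)\<^sup>2) / (cden a n k z)\<^sup>2)) (at z)"
proof -
  have "((\<lambda>z. \<i> * (z - a) / (n * (1 - cnj a * z) + of_real k * (z - a))) has_field_derivative
    (\<i> * (n * (1 - cnj a * z) + of_real k * (z - a)) - \<i> * (z - a) * (n * (- cnj a) + of_real k)) /
      ((n * (1 - cnj a * z) + of_real k * (z - a)) * (n * (1 - cnj a * z) + of_real k * (z - a)))) (at z)"
    using assms unfolding cden_def by (auto intro!: derivative_eq_intros)
  moreover have "\<i> * (n * (1 - cnj a * z) + of_real k * (z - a)) - \<i> * (z - a) * (n * (- cnj a) + of_real k)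
    = \<i> * n * (1 - a * cnj a)" by (simp add: algebra_simps)
  moreover have "1 - a * cnj a = of_real (1 - (norm a)\<^sup>2)" by (simp only: complex_norm_square[symmetric] of_real_diff of_real_1)
  ultimately show ?thesis unfolding ccoord_def[abs_def] cden_def[abs_def] by (simp add: power2_eq_square)
qed

text \<open>In the real coordinate an injective path is strictly monotone, so its length is the
  integral of the density over the coordinate interval, whatever the parametrisation. The assumption
  on \<open>cden\<close> keeps the path away from the pole of the coordinate, for
  \<open>k > 1\<close> the point of the circle opposite to \<open>a\<close>.\<close>

lemma arc_length:
  assumes p: "arc p" "valid_path p" "pathstart p = a"
    and im: "path_image p \<subseteq> {z \<in> hyp_plane. mink N (uvec z) = k}"
    and nz: "\<And>z. z \<in> path_image p \<Longrightarrow> cden a n k z \<noteq> 0"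
  shows "hlength p = integral {0..\<bar>Re (ccoord a n k (pathfinish p))\<bar>} (\<lambda>x. 2 / (1 + (k\<^sup>2 - 1) * x\<^sup>2))"
proof -
  define g where "g = (\<lambda>x::real. 2 / (1 + (k\<^sup>2 - 1) * x\<^sup>2))"
  define u where "u = (\<lambda>t. Re (ccoord a n k (p t)))"
  have onc: "p t \<in> hyp_plane" "mink N (uvec (p t)) = k" "cden a n k (p t) \<noteq> 0" if "t \<in> {0..1}" for t
    using im nz that unfolding path_image_def by blast+
  have uc: "ccoord a n k (p t) = of_real (u t)" if "t \<in> {0..1}" for t
    using ccoord_real[OF onc(1,2)[OF that]] by (simp add: u_def complex_eq_iff)
  have cont: "continuous_on {0..1} u"
  proof -
    have "continuous_on {0..1} p" using p(1) by (simp add: arc_def path_def)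
    then show ?thesis unfolding u_def ccoord_def cden_def using onc(3) unfolding cden_def
      by (intro continuous_intros) auto
  qed
  have inj: "inj_on u {0..1}"
  proof (rule inj_onI)
    fix x y assume xy: "x \<in> {0..1}" "y \<in> {0..1}" "u x = u y"
    then have "p x = p y" using ccoord_inj onc(3) uc by metis
    then show "x = y" using p(1) xy by (auto simp: arc_def inj_on_def)
  qed
  have u0: "u 0 = 0" using p(3) by (simp add: u_def ccoord_def pathstart_def)
  \<comment> \<open>The path may leave \<open>a\<close> in either direction; \<sigma> reflects the
    coordinate so that \<open>v\<close> increases from 0.\<close>
  define \<sigma> where "\<sigma> = (if u 1 > 0 then 1 else -1 :: real)"
  have \<sigma>: "\<sigma> * \<sigma> = 1" "\<bar>\<sigma>\<bar> = 1" by (auto simp: \<sigma>_def)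
  define v where "v = (\<lambda>t. \<sigma> * u t)"
  have "u 1 \<noteq> 0" using inj u0 by (metis atLeastAtMost_iff inj_on_def order_refl zero_le_one zero_neq_one)
  then have v1: "v 1 > 0" and v1a: "v 1 = \<bar>u 1\<bar>" by (auto simp: v_def \<sigma>_def)
  have v0: "v 0 = 0" using u0 by (simp add: v_def)
  have vc: "continuous_on {0..1} v" unfolding v_def by (intro continuous_intros cont)
  have vi: "inj_on v {0..1}" using inj \<sigma> by (auto simp: inj_on_def v_def)
  have incr: "v x < v y" if xy: "0 \<le> x" "x < y" "y \<le> 1" for x y
  proof -
    have yp: "v t > 0" if "0 < t" "t \<le> 1" for t
    proof (cases "t = 1")
      case False
      then show ?thesis using continuous_inj_imp_mono[OF _ _ vc vi, of t] that v1 v0 by auto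
    qed (use v1 in simp)
    show ?thesis
    proof (cases "x = 0")
      case False
      have "{0..y} \<subseteq> {0..1}" using xy by auto
      then have "continuous_on {0..y} v" "inj_on v {0..y}"
        using continuous_on_subset[OF vc] inj_on_subset[OF vi] by blast+
      moreover have "0 < x" "x < y" "v 0 < v y" using False xy v0 yp[of y] by auto
      ultimately show ?thesis using continuous_inj_imp_mono[of 0 x y v] by linarith
    qed (use yp[of y] xy v0 in auto)
  qed
  have mono: "mono_on {0..1} v" 
  proof (rule mono_onI)
    fix r s assume "r \<in> {0..1}" "s \<in> {0..1}" "r \<le> (s::real)"
    then show "v r \<le> v s" using incr[of r s] by (cases "r = s") auto
  qed
  have vr: "v t \<in> {0..v 1}" if "t \<in> {0..1}" for t using mono that v0 by (metis atLeastAtMost_iff mono_onD order_refl zero_le_one)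
  have surj: "\<exists>t\<in>{0..1}. v t = x" if "x \<in> {0..v 1}" for x
    using IVT'[of v 0 x 1] that v0 vc by auto
  \<comment> \<open>For \<open>k < 1\<close> this denominator vanishes further out, so its
    positivity is taken from the points of the path, which reach every value up to
    \<open>v 1\<close>.\<close>
  have gpos: "1 + (k\<^sup>2 - 1) * x\<^sup>2 > 0" if x: "x \<in> {0..v 1}" for x
  proof -
    obtain t where t: "t \<in> {0..1}" "v t = x" using surj x by blast
    have "x\<^sup>2 = (u t)\<^sup>2" using t \<sigma> by (auto simp: v_def power_mult_distrib power2_eq_square)
    then show ?thesis using density(2)[OF onc[OF t(1)]] by (simp add: u_def)
  qed
  have gc: "continuous_on {0..v 1} g" unfolding g_def using gpos by (intro continuous_intros) force
  define A where "A = (\<lambda>x. integral {0..x} g)"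
  have dA: "(A has_real_derivative g x) (at x within {0..v 1})" if "x \<in> {0..v 1}" for x
    unfolding A_def by (rule integral_has_real_derivative[OF gc that])
  have Ac: "continuous_on {0..v 1} A"
    using dA by (meson DERIV_continuous continuous_on_eq_continuous_within)
  obtain S where S: "finite S" "p C1_differentiable_on ({0..1} - S)"
    using p(2) unfolding valid_path_def piecewise_C1_differentiable_on_def by blast
  have der: "((\<lambda>t. A (v t)) has_vector_derivative (2 * norm (vector_derivative p (at t)) / (1 - (norm (p t))\<^sup>2))) (at t)"
    if t: "t \<in> {0<..<1} - S" for t
  proof -
    have t01: "t \<in> {0..1}" "t \<in> {0..1} - S" using t by auto
    define d where "d = vector_derivative p (at t)"
    have "p differentiable (at t)" using S(2) t01 by (simp add: C1_differentiable_on_eq)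
    then have dp: "(p has_vector_derivative d) (at t)" unfolding d_def by (simp add: vector_derivative_works)
    define U' where "U' = \<i> * n * of_real (1 - (norm a)\<^sup>2) / (cden a n k (p t))\<^sup>2"
    have "((ccoord a n k \<circ> p) has_vector_derivative d * U') (at t)"
      unfolding U'_def by (rule field_vector_diff_chain_at[OF dp ccoord_deriv[OF onc(3)[OF t01(1)]]])
    then have dc: "((\<lambda>t. ccoord a n k (p t)) has_vector_derivative d * U') (at t)" by (simp add: o_def)
    then have du: "(u has_real_derivative Re (d * U')) (at t)"
      unfolding u_def has_real_derivative_iff_has_vector_derivative
      by (rule bounded_linear.has_vector_derivative[OF bounded_linear_Re])
    have "((\<lambda>t. Im (ccoord a n k (p t))) has_vector_derivative Im (d * U')) (at t)"
      by (rule bounded_linear.has_vector_derivative[OF bounded_linear_Im dc])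
    moreover have "((\<lambda>t. Im (ccoord a n k (p t))) has_vector_derivative 0) (at t)"
    proof (rule has_vector_derivative_transform_within_open[where f="\<lambda>_. 0"])
      show "open {0<..<1::real}" "t \<in> {0<..<1}" using t by auto
      show "\<And>x. x \<in> {0<..<1} \<Longrightarrow> 0 = Im (ccoord a n k (p x))" using ccoord_real onc by force
    qed simp
    ultimately have im0: "Im (d * U') = 0" by (rule vector_derivative_unique_at)
    have dv: "(v has_real_derivative \<sigma> * Re (d * U')) (at t)"
      unfolding v_def using du by (rule DERIV_cmult)
    have nn: "0 \<le> \<sigma> * Re (d * U')"
      by (rule mono_on_imp_deriv_nonneg[OF mono dv]) (use t in auto)
    have "\<sigma> * Re (d * U') = \<bar>Re (d * U')\<bar>" using nn \<sigma> by (metis abs_mult abs_of_nonneg mult_1)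
    also have "\<dots> = norm (d * U')" using im0 by (simp add: cmod_def)
    also have "\<dots> = norm d * ((1 - (norm a)\<^sup>2) / (norm (cden a n k (p t)))\<^sup>2)"
    proof -
      have "norm n = 1" using n_norm by (simp add: cmod_def power2_eq_square)
      moreover have "\<bar>1 - (norm a)\<^sup>2\<bar> = 1 - (norm a)\<^sup>2" using cf_pos[OF a] by simp
      ultimately show ?thesis by (simp add: U'_def norm_mult norm_divide norm_power del: of_real_diff of_real_power)
    qed
    finally have sv: "\<sigma> * Re (d * U') = norm d * ((1 - (norm a)\<^sup>2) / (norm (cden a n k (p t)))\<^sup>2)" .
    have v2: "(v t)\<^sup>2 = (u t)\<^sup>2" using \<sigma> by (auto simp: v_def power_mult_distrib power2_eq_square)
    have "g (v t) * (\<sigma> * Re (d * U')) = 2 * norm d / (1 - (norm (p t))\<^sup>2)"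
    proof -
      have pos: "1 - (norm a)\<^sup>2 > 0" "1 - (norm (p t))\<^sup>2 > 0" "(norm (cden a n k (p t)))\<^sup>2 > 0"
        using cf_pos[OF a] cf_pos[OF onc(1)[OF t01(1)]] onc(3)[OF t01(1)] by auto
      have gv: "g (v t) = 2 / ((1 - (norm a)\<^sup>2) * (1 - (norm (p t))\<^sup>2) / (norm (cden a n k (p t)))\<^sup>2)"
        unfolding g_def v2 using density(1)[OF onc[OF t01(1)]] by (simp add: u_def)
      have aux: "2 / (\<alpha> * \<beta> / \<gamma>) * (\<delta> * (\<alpha> / \<gamma>)) = 2 * \<delta> / \<beta>" if "\<alpha> > 0" "\<beta> > 0" "\<gamma> > 0" for \<alpha> \<beta> \<gamma> \<delta> :: real
        using that by (simp add: field_simps)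
      show ?thesis unfolding sv gv by (rule aux[OF pos])
    qed
    moreover have "((\<lambda>t. A (v t)) has_real_derivative g (v t) * (\<sigma> * Re (d * U'))) (at t within {0..1})"
    proof (rule DERIV_image_chain[where g=v, unfolded o_def])
      show "(v has_real_derivative \<sigma> * Re (d * U')) (at t within {0..1})" using dv by (rule has_field_derivative_at_within)
      show "(A has_real_derivative g (v t)) (at (v t) within v ` {0..1})"
        using dA[OF vr[OF t01(1)]] by (rule DERIV_subset) (use vr in blast)
    qed
    ultimately have "((\<lambda>t. A (v t)) has_real_derivative (2 * norm d / (1 - (norm (p t))\<^sup>2))) (at t within {0..1})" by (simp only:)
    moreover have "at t within {0..1} = at t" by (rule at_within_interior) (use t in auto)
    ultimately show ?thesis by (simp only: has_real_derivative_iff_has_vector_derivative d_def)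
  qed
  have "((\<lambda>t. 2 * norm (vector_derivative p (at t)) / (1 - (norm (p t))\<^sup>2)) has_integral (A (v 1) - A (v 0))) {0..1}"
  proof (rule fundamental_theorem_of_calculus_interior_strong[OF S(1)])
    show "continuous_on {0..1} (\<lambda>t. A (v t))"
      by (rule continuous_on_compose2[OF Ac vc]) (use vr in auto)
  qed (use der in auto)
  then have "hlength p = A (v 1) - A (v 0)" unfolding hlength_def by (rule integral_unique)
  then show ?thesis unfolding v0 v1a by (simp add: A_def g_def[abs_def] u_def pathfinish_def)
qed

end

text \<open>\<open>1 / tri_w\<close> is the absolute coordinate of one tangency point seen from the
  other on the same circle, the same number for all three circles. The Gram determinant of their
  vectors is -4 times its square.\<close>

definition tri_w :: "real \<Rightarrow> real \<Rightarrow> real \<Rightarrow> real" where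
  "tri_w k1 k2 k3 = sqrt (1 + k1 * k2 + k2 * k3 + k3 * k1)"

lemma tri_w_sq: "0 \<le> k1 \<Longrightarrow> 0 \<le> k2 \<Longrightarrow> 0 \<le> k3 \<Longrightarrow> (tri_w k1 k2 k3)\<^sup>2 = 1 + k1 * k2 + k2 * k3 + k3 * k1"
  by (simp add: tri_w_def)

lemma tri_w_ge_1: "0 \<le> k1 \<Longrightarrow> 0 \<le> k2 \<Longrightarrow> 0 \<le> k3 \<Longrightarrow> 1 \<le> tri_w k1 k2 k3"
  by (simp add: tri_w_def)

text \<open>Up to a factor, the rows of the inverse Gram matrix of three pairwise externally tangent
  generalized circles: \<open>dual_row\<close> is orthogonal to \<open>Nb\<close> and \<open>Nc\<close>.\<close>

definition dual_row :: "real \<Rightarrow> real \<Rightarrow> real \<Rightarrow> complex \<times> real \<Rightarrow> complex \<times> real \<Rightarrow> complex \<times> real \<Rightarrow> complex \<times> real" where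
  "dual_row ka kb kc Na Nb Nc = (- (kb + kc)\<^sup>2) *\<^sub>R Na
     + (2 + ka * kb + kb * kc + kc * ka - kc\<^sup>2) *\<^sub>R Nb + (2 + ka * kb + kb * kc + kc * ka - kb\<^sup>2) *\<^sub>R Nc"

lemma dual_row_mink:
  assumes "mink Na Na = 1 - ka\<^sup>2" "mink Nb Nb = 1 - kb\<^sup>2" "mink Nc Nc = 1 - kc\<^sup>2"
    and "mink Na Nb = -1 - ka * kb" "mink Nb Nc = -1 - kb * kc" "mink Nc Na = -1 - kc * ka"
  shows "mink (dual_row ka kb kc Na Nb Nc) Na = - 4 * (1 + ka * kb + kb * kc + kc * ka)"
    and "mink (dual_row ka kb kc Na Nb Nc) Nb = 0" and "mink (dual_row ka kb kc Na Nb Nc) Nc = 0"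
    and "mink (dual_row ka kb kc Na Nb Nc) (dual_row ka kb kc Na Nb Nc)
      = 4 * (kb + kc)\<^sup>2 * (1 + ka * kb + kb * kc + kc * ka)"
proof -
  have s: "mink Nb Na = -1 - ka * kb" "mink Nc Nb = -1 - kb * kc" "mink Na Nc = -1 - kc * ka"
    using assms mink_commute by metis+
  show 1: "mink (dual_row ka kb kc Na Nb Nc) Na = - 4 * (1 + ka * kb + kb * kc + kc * ka)"
    unfolding dual_row_def mink_add_left mink_scale_left assms s by algebra
  show 2: "mink (dual_row ka kb kc Na Nb Nc) Nb = 0"
    unfolding dual_row_def mink_add_left mink_scale_left assms s by algebra
  show 3: "mink (dual_row ka kb kc Na Nb Nc) Nc = 0"
    unfolding dual_row_def mink_add_left mink_scale_left assms s by algebra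
  show "mink (dual_row ka kb kc Na Nb Nc) (dual_row ka kb kc Na Nb Nc)
      = 4 * (kb + kc)\<^sup>2 * (1 + ka * kb + kb * kc + kc * ka)"
  proof -
    have "mink (dual_row ka kb kc Na Nb Nc) (dual_row ka kb kc Na Nb Nc) = mink (dual_row ka kb kc Na Nb Nc)
      ((- (kb + kc)\<^sup>2) *\<^sub>R Na + (2 + ka * kb + kb * kc + kc * ka - kc\<^sup>2) *\<^sub>R Nb
       + (2 + ka * kb + kb * kc + kc * ka - kb\<^sup>2) *\<^sub>R Nc)" by (simp only: dual_row_def)
    then show ?thesis unfolding mink_add_right mink_scale_right 1 2 3 by algebra
  qed
qed

lemma mink_uvec_dist:
  assumes "z \<in> hyp_plane" "w \<in> hyp_plane"
  shows "mink (uvec z) (uvec w) = - (1 + 2 * (norm (z - w))\<^sup>2 / ((1 - (norm z)\<^sup>2) * (1 - (norm w)\<^sup>2)))"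
proof -
  have "0 < 1 - (norm z)\<^sup>2" "0 < 1 - (norm w)\<^sup>2" using assms cf_pos by blast+
  then show ?thesis using cosh_hdist'[OF assms] cosh_hdist[OF assms] unfolding mink_hvec
    by (simp add: add_divide_distrib)
qed

text \<open>A zero of \<open>cden\<close> is the reflection of \<open>a\<close> in the center of the
  circle. The right hand side is shown to be a unit future vector whose product with
  \<open>uvec z\<close> is -1, and only equal points have that product.\<close>

lemma (in curve_base) antipode:
  assumes z: "z \<in> hyp_plane" "mink N (uvec z) = k" and d: "cden a n k z = 0" and k: "k > 1"
  shows "uvec z = (- (2 * k / (k\<^sup>2 - 1))) *\<^sub>R N - uvec a"
proof -
  define b where "b = k\<^sup>2 - 1"
  have b: "b > 0" using k by (simp add: b_def power2_eq_square less_1_mult)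
  have kb: "k * k = b + 1" by (simp add: b_def power2_eq_square)
  define E where "E = (1 - (norm z)\<^sup>2) * (1 - (norm a)\<^sup>2)"
  have E: "E > 0" unfolding E_def using cf_pos a z by (meson mult_pos_pos)
  define D where "D = (norm (z - a))\<^sup>2"
  have "E = b * D" using on_curve(2)[OF z] d unfolding cmod_one_minus by (simp add: E_def b_def D_def algebra_simps)
  moreover have "D \<noteq> 0" using calculation E by auto
  ultimately have "2 * D / E = 2 / b" by simp
  then have za: "mink (uvec z) (uvec a) = - (1 + 2 / b)"
    unfolding mink_uvec_dist[OF z(1) a] by (simp add: D_def E_def)
  define Y where "Y = (- (2 * k / b)) *\<^sub>R N - uvec a"
  have NN': "mink N N = - b" using NN by (simp add: b_def)
  have "mink Y Y = (2 * k / b) * (2 * k / b) * (- b) + 2 * (2 * k / b) * k - 1"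
    unfolding Y_def by (simp add: NN' uvec_self[OF a] ha mink_commute[of "uvec a" N] algebra_simps)
  also have "\<dots> = 2 * (2 * k / b) * k - 4 * (k * k) / b - 1" using b by (simp add: field_simps)
  also have "\<dots> = 4 * (k * k) / b - 4 * (k * k) / b - 1" by simp
  finally have YY: "mink Y Y = -1" by simp
  have "mink Y (uvec z) = - (2 * k * k / b) + (1 + 2 / b)"
    unfolding Y_def using za by (simp add: z mink_commute[of "uvec a"])
  also have "\<dots> = - (2 * (k * k) / b) + (1 + 2 / b)" by simp
  also have "\<dots> = -1" unfolding kb using b by (simp add: field_simps)
  finally have Yz: "mink Y (uvec z) = -1" .
  have f: "fcausal Y" by (rule fcausalI_mink[OF _ fcausal_uvec[OF z(1)]]) (auto simp: YY Yz)
  from hpr_unit[OF f YY] have h: "hpr Y \<in> hyp_plane" "uvec (hpr Y) = Y" .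
  then have "hpr Y = z" using mink_uvec_eq[OF h(1) z(1)] Yz by simp
  then show ?thesis using h by (simp add: Y_def b_def)
qed

text \<open>The Gram matrix determines the product of the two tangency points and thereby the
  absolute coordinate \<open>1 / w\<close> of the second seen from the first. What remains is that
  the arc avoids the pole of that coordinate.\<close>

lemma cp_arc_length_unique:
  assumes l: "cp_arc_length k1 k2 k3 l" and k1: "k1 > 0"
  shows "l = integral {0..1 / tri_w k1 k2 k3} (\<lambda>x. 2 / (1 + (k1\<^sup>2 - 1) * x\<^sup>2))"
proof -
  obtain C1 C2 C3 t12 t23 t31 \<Delta> p where tr: "cp_triangle k1 k2 k3 C1 C2 C3 t12 t23 t31 \<Delta>"
    and p: "arc p" "valid_path p" "pathstart p = t12" "pathfinish p = t31"
    and im: "path_image p \<subseteq> curve C1 \<inter> \<Delta>" and l: "l = hlength p"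
    using l unfolding cp_arc_length_def by blast
  have g: "gen_circle k1 C1" "gen_circle k2 C2" "gen_circle k3 C3"
    and t: "ext_tangent k1 C1 k2 C2 t12" "ext_tangent k2 C2 k3 C3 t23" "ext_tangent k3 C3 k1 C1 t31"
    using tr unfolding cp_triangle_def by blast+
  obtain N1 where r1: "gc_rep k1 C1 N1" using gen_circle_rep[OF g(1)] .
  obtain N2 where r2: "gc_rep k2 C2 N2" using gen_circle_rep[OF g(2)] .
  obtain N3 where r3: "gc_rep k3 C3 N3" using gen_circle_rep[OF g(3)] .
  have k0: "0 \<le> k2" "0 \<le> k3" using r2 r3 by (auto simp: gc_rep_def)
  have nn: "mink N1 N1 = 1 - k1\<^sup>2" "mink N2 N2 = 1 - k2\<^sup>2" "mink N3 N3 = 1 - k3\<^sup>2"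
    using r1 r2 r3 by (auto simp: gc_rep_def)
  note gr = ext_tangent_gram(1)[OF r1 r2 t(1)] ext_tangent_gram(1)[OF r2 r3 t(2)] ext_tangent_gram(1)[OF r3 r1 t(3)]
  have gs: "mink N2 N1 = -1 - k1 * k2" "mink N3 N2 = -1 - k2 * k3" "mink N1 N3 = -1 - k3 * k1"
    using gr mink_commute by metis+
  have s: "k1 + k2 > 0" "k3 + k1 > 0" using k1 k0 by auto
  note T = ext_tangent_vec[OF r1 r2 s(1) t(1)] ext_tangent_vec[OF r3 r1 s(2) t(3)]
  have "(k1 + k2) * mink N1 (uvec t12) = - mink N1 (N1 + N2)" unfolding T by simp
  also have "\<dots> = (k1 + k2) * k1" by (simp add: nn gr power2_eq_square algebra_simps)
  finally have c12: "mink N1 (uvec t12) = k1" using s by simp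
  have "(k3 + k1) * mink N1 (uvec t31) = - mink N1 (N3 + N1)" unfolding T by simp
  also have "\<dots> = (k3 + k1) * k1" by (simp add: nn gs power2_eq_square algebra_simps)
  finally have c31: "mink N1 (uvec t31) = k1" using s by simp
  define P where "P = (k1 + k2) * (k3 + k1)"
  have P: "P > 0" using s by (simp add: P_def)
  define w where "w = tri_w k1 k2 k3"
  have w2: "w\<^sup>2 = 1 + k1 * k2 + k2 * k3 + k3 * k1" unfolding w_def using tri_w_sq k0 k1 by simp
  have w1: "w \<ge> 1" unfolding w_def using tri_w_ge_1 k0 k1 by simp
  have wP: "w\<^sup>2 = P + 1 - k1\<^sup>2" unfolding w2 P_def by algebra
  define nv where "nv = hgrad N1 k1 t12"
  interpret curve_base N1 k1 t12 nv
    by unfold_locales (use nn k1 T c12 in \<open>auto simp: nv_def\<close>)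
  have "P * mink (uvec t12) (uvec t31) = mink (N1 + N2) (N3 + N1)" unfolding T P_def by simp
  also have "\<dots> = - 2 - P" by (simp add: nn gs gr P_def power2_eq_square algebra_simps)
  finally have m: "mink (uvec t31) (uvec t12) = - (1 + 2 / P)" using P by (simp add: field_simps mink_commute)
  define E where "E = (1 - (norm t12)\<^sup>2) * (1 - (norm t31)\<^sup>2)"
  have E: "E > 0" unfolding E_def using cf_pos T by (meson mult_pos_pos)
  have "2 * (norm (t31 - t12))\<^sup>2 / E = 2 / P"
    using mink_uvec_dist[OF T(3,1)] m by (simp add: E_def mult.commute)
  then have D: "(norm (t31 - t12))\<^sup>2 = E / P" using E P by (simp add: field_simps)
  have "(norm (cden t12 nv k1 t31))\<^sup>2 = E + E / P - k1\<^sup>2 * (E / P)"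
    unfolding on_curve(2)[OF T(3) c31] cmod_one_minus D E_def[symmetric] ..
  also have "\<dots> = E / P * w\<^sup>2" unfolding wP using P by (simp add: field_simps)
  finally have "(Re (ccoord t12 nv k1 t31))\<^sup>2 = (E / P) / (E / P * w\<^sup>2)"
    unfolding ccoord_sq[OF T(3) c31] D by (simp only:)
  also have "\<dots> = (1 / w)\<^sup>2" using E P w1 by (simp add: power_divide)
  finally have "\<bar>Re (ccoord t12 nv k1 t31)\<bar> = \<bar>1 / w\<bar>" by (metis abs_eq_iff power2_eq_iff)
  then have "\<bar>Re (ccoord t12 nv k1 t31)\<bar> = 1 / w" using w1 by simp
  moreover have cur: "curve C1 = {z \<in> hyp_plane. mink N1 (uvec z) = k1}" using r1 by (simp add: gc_rep_def)
  have nz: "cden t12 nv k1 z \<noteq> 0" if z: "z \<in> path_image p" for z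
  proof (cases "k1 \<le> 1")
    case True
    then show ?thesis using cden_nz_low im z cur by blast
  next
    case False
    show ?thesis
    proof
      assume d: "cden t12 nv k1 z = 0"
      have zc: "z \<in> hyp_plane" "mink N1 (uvec z) = k1" "z \<in> \<Delta>" using im z cur by auto
      \<comment> \<open>Orthogonal to \<open>N3\<close> and \<open>N1\<close>, hence the vector of
        the line through the edge between the third and first circle. The triangle lies on its
        nonnegative side, \<open>t12\<close> strictly so, and the antipode of \<open>t12\<close>
        strictly on the other side.\<close>
      define M where "M = dual_row k2 k3 k1 N2 N3 N1"
      note mm = dual_row_mink[OF nn(2,3,1) gr(2,3,1), folded M_def]
      have w': "1 + k2 * k3 + k3 * k1 + k1 * k2 = w\<^sup>2" by (simp add: w2)
      have wp: "w\<^sup>2 > 0" using w1 by simp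
      have "0 \<le> mink M (hvec z)"
      proof (rule triangle_half[OF tr r1 r2 r3 _ _ _ _ zc(3,1)])
        show "mink M M > 0" unfolding mm w' using s wp by simp
        show "mink M N2 \<le> 0" unfolding mm w' using wp by simp
      qed (simp_all add: mm)
      then have 1: "0 \<le> mink M (uvec z)" unfolding mink_hvec_uvec[OF zc(1)] using cf_pos[OF zc(1)]
        by (metis mult_less_cancel_left_pos mult_zero_right not_less)
      have "mink M (uvec z) = - mink M (uvec t12)"
        unfolding antipode[OF zc(1,2) d False[unfolded not_le]] by (simp add: mm)
      moreover have "(k1 + k2) * mink M (uvec t12) = - mink M (N1 + N2)" unfolding T by simp
      then have "(k1 + k2) * mink M (uvec t12) = 4 * w\<^sup>2" by (simp add: mm w')
      then have "mink M (uvec t12) > 0" using s wp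
        by (metis mult_pos_pos zero_less_mult_pos zero_less_numeral)
      ultimately show False using 1 by simp
    qed
  qed
  have "hlength p = integral {0..\<bar>Re (ccoord t12 nv k1 (pathfinish p))\<bar>} (\<lambda>x. 2 / (1 + (k1\<^sup>2 - 1) * x\<^sup>2))"
    by (rule arc_length[OF p(1-3) _ nz]) (use im cur in auto)
  ultimately show ?thesis by (simp add: l p(4) w_def)
qed

section \<open>Ideal endpoints of geodesics\<close>

lemma fcausal_mink_neg: assumes "fcausal Y" "fcausal Z" "mink Z Z < 0" shows "mink Y Z < 0"
proof -
  have z: "norm (fst Z) < snd Z" using assms unfolding mink_eq_norm fcausal_iff
    by (metis diff_less_0_iff_less norm_ge_zero order_less_imp_le power2_less_imp_less)
  have y: "norm (fst Y) \<le> snd Y" "0 < snd Y" using assms(1) unfolding fcausal_iff by auto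
  have "Re (fst Y) * Re (fst Z) + Im (fst Y) * Im (fst Z) = fst Y \<bullet> fst Z" by (simp add: inner_complex_def)
  also have "\<dots> \<le> norm (fst Y) * norm (fst Z)" by (rule norm_cauchy_schwarz)
  also have "\<dots> \<le> snd Y * norm (fst Z)" using y by (intro mult_right_mono) auto
  also have "\<dots> < snd Y * snd Z" using y z by simp
  finally show ?thesis by (simp add: mink_def)
qed

lemma continuous_hpr: "continuous_on {Y. fcausal Y} hpr"
proof -
  have "snd Y + sqrt (- mink Y Y) \<noteq> 0" if "fcausal Y" for Y using hpr_props(1)[OF that] by simp
  then show ?thesis unfolding hpr_def mink_def by (intro continuous_intros) auto
qed

lemma closure_geodesic_eq:
  assumes G: "mink G G = 1"
  shows "closure {z \<in> hyp_plane. mink G (uvec z) = 0} = {z \<in> cball 0 1. mink G (hvec z) = 0}"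
proof (rule subset_antisym[OF closure_geodesic], rule subsetI)
  fix z assume z: "z \<in> {z \<in> cball 0 1. mink G (hvec z) = 0}"
  obtain e e' where "lorentz_frame e e' G" by (rule frame_ex[OF G])
  then interpret lorentz_frame e e' G .
  have fz: "fcausal (hvec z)" using fcausal_hvec z by blast
  \<comment> \<open>Adding a small multiple of the timelike \<open>e\<close>, which is orthogonal to
    \<open>G\<close>, makes a lightlike vector timelike without leaving the plane of the
    geodesic.\<close>
  define f where "f = (\<lambda>n::nat. hvec z + (1 / Suc n) *\<^sub>R e)"
  have ff: "fcausal (f n)" for n unfolding f_def by (intro fcausal_add fz fcausal_scale fcausal_e) simp
  have neg: "mink (hvec z) e < 0" using fcausal_mink_neg[OF fz fcausal_e] ee by simp
  have "mink (f n) (f n) < 0" for n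
  proof -
    have "mink (hvec z + r *\<^sub>R e) (hvec z + r *\<^sub>R e) = mink (hvec z) (hvec z) + 2 * r * mink (hvec z) e - r * r" for r
      by (simp add: ee mink_commute[of e "hvec z"] algebra_simps)
    from this[of "1 / Suc n"]
    have "mink (f n) (f n) = mink (hvec z) (hvec z) + 2 * (1 / Suc n) * mink (hvec z) e - (1 / Suc n) * (1 / Suc n)"
      unfolding f_def .
    moreover have "2 * (1 / Suc n) * mink (hvec z) e < 0" using neg by (intro mult_pos_neg) auto
    moreover have "mink (hvec z) (hvec z) \<le> 0" using fz by (simp add: fcausal_def)
    moreover have "0 < (1 / real (Suc n)) * (1 / Suc n)" by simp
    ultimately show ?thesis by linarith
  qed
  then have D: "hpr (f n) \<in> hyp_plane" for n using hpr_props(5)[OF ff] by blast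
  moreover have "mink G (f n) = 0" for n using z by (simp add: f_def sym)
  then have "mink G (hvec (hpr (f n))) = 0" for n unfolding hpr_props(2)[OF ff] by simp
  then have "mink G (uvec (hpr (f n))) = 0" for n by (simp add: uvec_def)
  ultimately have "\<forall>n. hpr (f n) \<in> {z \<in> hyp_plane. mink G (uvec z) = 0}" by blast
  moreover have "(\<lambda>n. hpr (f n)) \<longlonglongrightarrow> hpr (hvec z)"
  proof (rule continuous_on_tendsto_compose[OF continuous_hpr])
    have "(\<lambda>n. hvec z + (1 / real (Suc n)) *\<^sub>R e) \<longlonglongrightarrow> hvec z + 0 *\<^sub>R e"
      by (intro tendsto_intros LIMSEQ_Suc lim_1_over_n)
    then show "f \<longlonglongrightarrow> hvec z" by (simp add: f_def)
  qed (use fz ff in auto)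
  ultimately show "z \<in> closure {z \<in> hyp_plane. mink G (uvec z) = 0}"
    using hpr_hvec[of z] z closure_sequential by fastforce
qed

section \<open>Existence of circle packed triangles\<close>

text \<open>A geodesic segment as the projection of a straight segment in R^{2,1}. Its endpoints may
  be ideal, and the vectors matter only up to positive factors.\<close>

definition seg :: "complex \<times> real \<Rightarrow> complex \<times> real \<Rightarrow> complex set" where
  "seg A B = (\<lambda>s. hpr ((1 - s) *\<^sub>R A + s *\<^sub>R B)) ` {0..1}"

lemma fcausal_cone:
  assumes "fcausal A" "fcausal B" "0 \<le> l" "0 \<le> m" "l + m > 0"
  shows "fcausal (l *\<^sub>R A + m *\<^sub>R B)"
proof -
  consider "l = 0" "m > 0" | "l > 0" "m = 0" | "l > 0" "m > 0" using assms by linarith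
  then show ?thesis by cases (auto intro!: fcausal_add fcausal_scale assms)
qed

lemma seg_cone:
  assumes "0 \<le> l" "0 \<le> m" "l + m > 0"
  shows "hpr (l *\<^sub>R A + m *\<^sub>R B) \<in> seg A B"
proof -
  define s where "s = m / (l + m)"
  have s: "s \<in> {0..1}" "(l + m) * (1 - s) = l" "(l + m) * s = m" using assms by (auto simp: s_def field_simps)
  then have "l *\<^sub>R A + m *\<^sub>R B = (l + m) *\<^sub>R ((1 - s) *\<^sub>R A + s *\<^sub>R B)" by (simp only: scaleR_add_right scaleR_scaleR)
  then have "hpr (l *\<^sub>R A + m *\<^sub>R B) = hpr ((1 - s) *\<^sub>R A + s *\<^sub>R B)" using assms hpr_scale by metis
  then show ?thesis using s unfolding seg_def by blast
qed

lemma seg_self: "fcausal A \<Longrightarrow> seg A A = {hpr A}"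
  by (simp add: seg_def scaleR_add_left[symmetric] image_constant_conv)

lemma hpr_eqD:
  assumes "fcausal X" "fcausal Y" "hpr X = hpr Y" obtains c where "c > 0" "X = c *\<^sub>R Y"
proof -
  define x y where "x = snd X + sqrt (- mink X X)" and "y = snd Y + sqrt (- mink Y Y)"
  have p: "x > 0" "y > 0" using hpr_props(1) assms unfolding x_def y_def by blast+
  have "(2 / x) *\<^sub>R X = (2 / y) *\<^sub>R Y"
    using hpr_props(2)[OF assms(1)] hpr_props(2)[OF assms(2)] assms(3) by (simp add: x_def y_def)
  then have "(x / 2) *\<^sub>R (2 / x) *\<^sub>R X = (x / 2) *\<^sub>R (2 / y) *\<^sub>R Y" by simp
  then have "X = (x / y) *\<^sub>R Y" using p by simp
  then show ?thesis using that p by (metis divide_pos_pos)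
qed

lemma hsegment_seg:
  assumes G: "mink G G = 1" "mink G A = 0" "mink G B = 0" and f: "fcausal A" "fcausal B"
    and ne: "\<And>r. r > 0 \<Longrightarrow> B \<noteq> r *\<^sub>R A"
  shows "hsegment {z \<in> hyp_plane. mink G (uvec z) = 0} (hpr A) (hpr B) (seg A B)"
proof -
  define p where "p = (\<lambda>s. hpr ((1 - s) *\<^sub>R A + s *\<^sub>R B))"
  have fc: "fcausal ((1 - s) *\<^sub>R A + s *\<^sub>R B)" if "s \<in> {0..1}" for s
    using that by (intro fcausal_cone f) auto
  have "continuous_on {0..1} p" unfolding p_def
    by (rule continuous_on_compose2[OF continuous_hpr]) (use fc in \<open>auto intro!: continuous_intros\<close>)
  moreover have "inj_on p {0..1}"
  proof (rule inj_onI)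
    fix s s' assume s: "s \<in> {0..1}" "s' \<in> {0..1}" "p s = p s'"
    then obtain c where c: "c > 0" and e: "(1 - s) *\<^sub>R A + s *\<^sub>R B = c *\<^sub>R ((1 - s') *\<^sub>R A + s' *\<^sub>R B)"
      using hpr_eqD[OF fc fc] unfolding p_def by metis
    have e': "(1 - s - c * (1 - s')) *\<^sub>R A = (c * s' - s) *\<^sub>R B"
    proof -
      have "(1 - s - c * (1 - s')) *\<^sub>R A - (c * s' - s) *\<^sub>R B
        = ((1 - s) *\<^sub>R A + s *\<^sub>R B) - c *\<^sub>R ((1 - s') *\<^sub>R A + s' *\<^sub>R B)"
        by (simp add: algebra_simps)
      then show ?thesis using e by simp
    qed
    have sA: "snd A > 0" "snd B > 0" using f by (auto simp: fcausal_def)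
    have "c * s' - s = 0"
    proof (rule ccontr)
      assume q: "c * s' - s \<noteq> 0"
      define r where "r = (1 - s - c * (1 - s')) / (c * s' - s)"
      have B: "B = r *\<^sub>R A" using e' q by (metis (no_types, lifting) r_def divide_inverse_commute real_vector.scale_left_imp_eq scaleR_scaleR nonzero_mult_div_cancel_left times_divide_eq_right)
      then have "snd B = r * snd A" by (metis snd_scaleR real_scaleR_def)
      then have "r > 0" using sA by (metis zero_less_mult_pos2)
      then show False using ne B by blast
    qed
    moreover have "(1 - s - c * (1 - s')) * snd A = 0" using e' calculation by (metis mult_zero_left real_scaleR_def snd_scaleR)
    then have "1 - s - c * (1 - s') = 0" using sA by simp
    ultimately have "c = 1" by (simp add: algebra_simps)
    then show "s = s'" using \<open>c * s' - s = 0\<close> by simp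
  qed
  ultimately have "arc p" by (simp add: arc_def path_def)
  moreover have "pathstart p = hpr A" "pathfinish p = hpr B" by (simp_all add: p_def pathstart_def pathfinish_def)
  moreover have "path_image p = seg A B" by (simp add: path_image_def p_def seg_def)
  moreover have "seg A B \<subseteq> closure {z \<in> hyp_plane. mink G (uvec z) = 0}"
  proof
    fix z assume "z \<in> seg A B"
    then obtain s where s: "s \<in> {0..1}" "z = hpr ((1 - s) *\<^sub>R A + s *\<^sub>R B)" unfolding seg_def by blast
    have "mink G (hvec z) = 0" unfolding s(2) hpr_props(2)[OF fc[OF s(1)]] by (simp add: G)
    then show "z \<in> closure {z \<in> hyp_plane. mink G (uvec z) = 0}"
      unfolding closure_geodesic_eq[OF G(1)] using hpr_props(4)[OF fc[OF s(1)]] s(2) by simp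
  qed
  ultimately show ?thesis unfolding hsegment_def by blast
qed

text \<open>The point at which the edge from \<open>Na\<close> to \<open>Nb\<close> ends on the side of \<open>Na\<close>.\<close>

definition foot :: "real \<Rightarrow> real \<Rightarrow> complex \<times> real \<Rightarrow> complex \<times> real \<Rightarrow> complex \<times> real" where
  "foot ka kb Na Nb = (if ka \<ge> 1 then - Na else - ((1 + ka * kb) *\<^sub>R Na + (1 - ka\<^sup>2) *\<^sub>R Nb))"

text \<open>External tangency reduced to linear algebra. Since a pair and its negative have the same
  Gram matrix, the causality assumptions are what selects the vectors that represent
  circles.\<close>

locale tangent_pair =
  fixes k1 k2 N1 N2
  assumes k: "0 \<le> k1" "0 \<le> k2"
    and n1: "mink N1 N1 = 1 - k1\<^sup>2" and n2: "mink N2 N2 = 1 - k2\<^sup>2" and n12: "mink N1 N2 = -1 - k1 * k2"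
    and f12: "fcausal (- (N1 + N2))" and f1: "k1 \<ge> 1 \<Longrightarrow> fcausal (- N1)" and f2: "k2 \<ge> 1 \<Longrightarrow> fcausal (- N2)"
begin

lemma n21: "mink N2 N1 = -1 - k1 * k2"
  using n12 mink_commute by metis

lemmas nn = n1 n2 n12 n21

lemma swap: "tangent_pair k2 k1 N2 N1"
  by unfold_locales (use k nn f12 f1 f2 in \<open>simp_all add: add.commute mult.commute\<close>)

definition tpt :: complex where "tpt = hpr (- (N1 + N2))"

lemma mink_sum: "mink (N1 + N2) (N1 + N2) = - (k1 + k2)\<^sup>2"
  by (simp add: nn power2_eq_square algebra_simps)

lemma tpt_in: "k1 + k2 > 0 \<Longrightarrow> tpt \<in> hyp_plane"
  unfolding tpt_def by (rule hpr_props(5)[OF f12]) (simp only: mink_minus_left mink_minus_right minus_minus mink_sum, simp)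

lemma uvec_tpt: "k1 + k2 > 0 \<Longrightarrow> N1 + N2 = - ((k1 + k2) *\<^sub>R uvec tpt)"
proof -
  assume s: "k1 + k2 > 0"
  let ?Y = "(1 / (k1 + k2)) *\<^sub>R (- (N1 + N2))"
  have f: "fcausal ?Y" by (rule fcausal_scale[OF f12]) (use s in simp)
  have "mink ?Y ?Y = (1 / (k1 + k2)) * (1 / (k1 + k2)) * mink (N1 + N2) (N1 + N2)"
    by (simp only: mink_scale_left mink_scale_right mink_minus_left mink_minus_right minus_minus mult.assoc)
  also have "\<dots> = -1" unfolding mink_sum using s by (simp add: power2_eq_square)
  finally have "uvec (hpr ?Y) = ?Y" by (rule hpr_unit(2)[OF f])
  moreover have "hpr ?Y = tpt" unfolding tpt_def by (rule hpr_scale) (use s in simp)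
  ultimately have "uvec tpt = ?Y" by simp
  then show ?thesis using s by simp
qed

lemma tpt_curve: "k1 + k2 > 0 \<Longrightarrow> mink N1 (uvec tpt) = k1"
proof -
  assume s: "k1 + k2 > 0"
  have "(k1 + k2) * mink N1 (uvec tpt) = - mink N1 (N1 + N2)" unfolding uvec_tpt[OF s] by simp
  also have "\<dots> = (k1 + k2) * k1" by (simp add: nn power2_eq_square algebra_simps)
  finally show ?thesis using s by simp
qed

lemma ext_tangent_tpt:
  assumes r1: "gc_rep k1 C1 N1" and r2: "gc_rep k2 C2 N2"
  shows "ext_tangent k1 C1 k2 C2 tpt"
proof -
  have cur: "curve C1 = {z \<in> hyp_plane. mink N1 (uvec z) = k1}" "curve C2 = {z \<in> hyp_plane. mink N2 (uvec z) = k2}"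
    and sid: "side C1 = {z \<in> hyp_plane. mink N1 (uvec z) \<le> k1}" "side C2 = {z \<in> hyp_plane. mink N2 (uvec z) \<le> k2}"
    using r1 r2 by (auto simp: gc_rep_def)
  show ?thesis
  proof (cases "k1 + k2 > 0")
    case True
    note t = tpt_in[OF True] and u = uvec_tpt[OF True]
    \<comment> \<open>Adding the two inequalities bounds the product with \<open>uvec tpt\<close>
      from below by -1. Since products of hyperboloid points are at most -1, equality holds and the
      point is \<open>tpt\<close>.\<close>
    have "side C1 \<inter> side C2 \<subseteq> {tpt}"
    proof
      fix z assume "z \<in> side C1 \<inter> side C2"
      then have z: "z \<in> hyp_plane" "mink N1 (uvec z) \<le> k1" "mink N2 (uvec z) \<le> k2" using sid by auto
      have "mink (N1 + N2) (uvec z) \<le> (k1 + k2) * 1" using z by simp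
      then have "(k1 + k2) * (- mink (uvec tpt) (uvec z)) \<le> (k1 + k2) * 1" unfolding u by simp
      then have "- mink (uvec tpt) (uvec z) \<le> 1" using True by (simp only: mult_le_cancel_left_pos)
      then have "mink (uvec tpt) (uvec z) = -1" using mink_uvec_le[OF t z(1)] by simp
      then show "z \<in> {tpt}" using mink_uvec_eq[OF t z(1)] by simp
    qed
    then have "interior (side C1 \<inter> side C2) \<subseteq> interior {tpt}" by (rule interior_mono)
    then have int: "interior (side C1) \<inter> interior (side C2) = {}" by simp
    have h: "hlev N1 k1 tpt = 0" "hlev N2 k2 tpt = 0"
      using tpt_curve[OF True] tangent_pair.tpt_curve[OF swap] True t hlev_eq_0
      by (auto simp: tangent_pair.tpt_def[OF swap] tpt_def add.commute)
    have n: "hgrad N1 k1 tpt \<noteq> 0" "hgrad N2 k2 tpt \<noteq> 0"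
      using hgrad_norm[OF h(1)] hgrad_norm[OF h(2)] by (auto simp: nn)
    have "hgrad N1 k1 tpt + hgrad N2 k2 tpt = hgrad (N1 + N2) (k1 + k2) tpt"
      by (simp add: hgrad_def algebra_simps)
    also have "\<dots> = 0"
    proof -
      define R where "R = (norm tpt)\<^sup>2"
      have R: "1 - R > 0" unfolding R_def by (rule cf_pos[OF t])
      have "snd (N1 + N2) - (k1 + k2) = - (k1 + k2) * ((1 + R) / (1 - R) + 1)"
        unfolding u by (simp add: uvec_def hvec_def R_def divide_inverse algebra_simps)
      also have "(1 + R) / (1 - R) + 1 = 2 / (1 - R)" using R by (simp add: field_simps)
      finally have sn: "snd (N1 + N2) - (k1 + k2) = - (k1 + k2) * (2 / (1 - R))" .
      have "fst (hvec tpt) = 2 *\<^sub>R tpt" by (simp add: hvec_def scaleR_conv_of_real)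
      then have "fst (N1 + N2) = - ((k1 + k2) *\<^sub>R inverse (1 - R) *\<^sub>R 2 *\<^sub>R tpt)"
        unfolding u by (simp only: uvec_def R_def fst_uminus fst_scaleR)
      then have "fst (N1 + N2) = (- (k1 + k2) * (2 / (1 - R))) *\<^sub>R tpt"
        by (simp only: divide_inverse scaleR_scaleR mult_minus_left mult_minus_right scaleR_minus_left mult.commute mult.left_commute)
      then show ?thesis unfolding hgrad_def sn by simp
    qed
    finally have g: "hgrad N2 k2 tpt = - hgrad N1 k1 tpt" by (simp add: eq_neg_iff_add_eq_0 add.commute)
    have "tangent_vector (curve C1) tpt (1 *\<^sub>R (\<i> * hgrad N1 k1 tpt))"
      unfolding cur by (rule tangent_vectorI[OF t h(1) n(1)]) simp
    moreover have "tangent_vector (curve C2) tpt ((-1) *\<^sub>R (\<i> * hgrad N2 k2 tpt))"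
      unfolding cur by (rule tangent_vectorI[OF t h(2) n(2)]) simp
    ultimately have "tangent_at tpt (curve C1) (curve C2)" unfolding tangent_at_def g by auto
    then show ?thesis unfolding ext_tangent_def using int t True by auto
  next
    case False
    then have 0: "k1 = 0" "k2 = 0" using k by auto
    have neg: "mink N1 (uvec z) + mink N2 (uvec z) > 0" if "z \<in> hyp_plane" for z
      using fcausal_mink_neg[OF f12 fcausal_uvec[OF that]] uvec_self[OF that] by simp
    have "side C1 \<inter> side C2 = {}"
    proof (rule ccontr)
      assume "side C1 \<inter> side C2 \<noteq> {}"
      then obtain z where "z \<in> side C1" "z \<in> side C2" by blast
      then have "z \<in> hyp_plane" "mink N1 (uvec z) \<le> 0" "mink N2 (uvec z) \<le> 0" using sid 0 by auto
      then show False using neg[of z] by linarith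
    qed
    then have int: "interior (side C1) \<inter> interior (side C2) = {}" using interior_subset by blast
    have m1: "mink N1 N1 = 1" "mink N2 N2 = 1" using nn 0 by auto
    obtain e e' where "lorentz_frame e e' N1" by (rule frame_ex[OF m1(1)])
    then obtain z where z: "z \<in> hyp_plane" "mink N1 (uvec z) = 0" using lorentz_frame.level_ex[of e e' N1 0] by blast
    have ne: "curve C1 \<noteq> curve C2"
    proof
      assume "curve C1 = curve C2"
      then have "z \<in> curve C2" using z cur 0 by auto
      then show False using neg[OF z(1)] z cur 0 by simp
    qed
    have nt: "1 - (norm tpt)\<^sup>2 = 0" unfolding tpt_def hpr_props(3)[OF f12] using mink_sum 0 by simp
    have hv: "mink N (hvec tpt) = 0" if "mink N (N1 + N2) = 0" for N
      unfolding tpt_def hpr_props(2)[OF f12] using that by simp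
    have "tpt \<in> closure (curve C1)" "tpt \<in> closure (curve C2)"
      unfolding cur 0 closure_geodesic_eq[OF m1(1)] closure_geodesic_eq[OF m1(2)]
      using hpr_props(4)[OF f12] hv[of N1] hv[of N2] by (auto simp: nn 0 tpt_def)
    moreover have "tpt \<in> ideal_points" using nt by (simp add: power2_eq_1_iff)
      (metis norm_ge_zero neg_0_le_iff_le not_one_le_zero)
    ultimately show ?thesis unfolding ext_tangent_def using int ne 0 by simp
  qed
qed

abbreviation "A \<equiv> foot k1 k2 N1 N2"
abbreviation "B \<equiv> foot k2 k1 N2 N1"

lemma foot_alt: "\<exists>\<alpha> \<beta>. A = - (\<alpha> *\<^sub>R N1 + \<beta> *\<^sub>R N2) \<and> \<alpha> > 0 \<and> 0 \<le> \<beta> \<and> \<beta> \<le> \<alpha> \<and> (k1 < 1 \<longrightarrow> \<alpha> = 1 + k1 * k2 \<and> \<beta> = 1 - k1\<^sup>2)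
   \<and> (k1 \<ge> 1 \<longrightarrow> \<alpha> = 1 \<and> \<beta> = 0) \<and> (k1 + k2 > 0 \<longrightarrow> \<beta> < \<alpha> \<or> k1 = 0)"
proof (cases "k1 \<ge> 1")
  case True
  then show ?thesis by (intro exI[of _ 1] exI[of _ 0]) (auto simp: foot_def)
next
  case False
  then have k1: "k1 < 1" by simp
  have p: "k1\<^sup>2 \<le> 1" "0 \<le> k1 * k2" "0 \<le> k1\<^sup>2" "k1 \<noteq> 0 \<Longrightarrow> 0 < k1\<^sup>2"
    using False k by (auto simp: power_le_one)
  have "0 < 1 + k1 * k2" "0 \<le> 1 - k1\<^sup>2" "1 - k1\<^sup>2 \<le> 1 + k1 * k2" "1 - k1\<^sup>2 < 1 + k1 * k2 \<or> k1 = 0"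
    using p by linarith+
  moreover have "A = - ((1 + k1 * k2) *\<^sub>R N1 + (1 - k1\<^sup>2) *\<^sub>R N2)" using False by (simp add: foot_def)
  ultimately show ?thesis using k1 not_le by blast
qed

lemma foot_props:
  shows "fcausal A" and "k1 < 1 \<Longrightarrow> mink N1 A = 0" and "k1 < 1 \<Longrightarrow> k1 + k2 > 0 \<Longrightarrow> mink A A < 0"
proof -
  have low: "mink N1 A = 0 \<and> mink A A = - (1 - k1\<^sup>2) * (k1 + k2)\<^sup>2 \<and> mink A (- (N1 + N2)) = - (k1 + k2)\<^sup>2" if "k1 < 1"
    using that unfolding foot_def by (simp add: nn) algebra
  show "k1 < 1 \<Longrightarrow> mink N1 A = 0" using low by blast
  have q: "1 - k1\<^sup>2 > 0" if "k1 < 1" using that k by (simp add: abs_square_less_1)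
  then show "k1 < 1 \<Longrightarrow> k1 + k2 > 0 \<Longrightarrow> mink A A < 0" using low by (simp add: mult_neg_pos)
  show "fcausal A"
  proof (cases "k1 \<ge> 1")
    case True
    then show ?thesis using f1 by (simp add: foot_def)
  next
    case False
    show ?thesis
    proof (cases "k1 + k2 > 0")
      case True
      then show ?thesis using low q False by (intro fcausalI_mink[OF _ f12]) (auto simp: mult_nonpos_nonneg)
    next
      case F: False
      then have "k1 = 0" "k2 = 0" using k by auto
      then show ?thesis using f12 by (simp add: foot_def)
    qed
  qed
qed

text \<open>The last inequality says that the feet are linearly independent when \<open>N1\<close>
  and \<open>N2\<close> are. The comparisons of \<beta> with \<alpha> and of \<delta> with \<gamma>
  place the tangency point between them, as \<open>(\<gamma> - \<delta>) *\<^sub>R A + (\<alpha> -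
  \<beta>) *\<^sub>R B\<close> is a positive multiple of \<open>- (N1 + N2)\<close>.\<close>

lemma feetE:
  assumes True: "k1 + k2 > 0"
  obtains \<alpha> \<beta> \<gamma> \<delta> where "A = - (\<alpha> *\<^sub>R N1 + \<beta> *\<^sub>R N2)" "\<beta> \<le> \<alpha>"
    "k1 < 1 \<longrightarrow> \<alpha> = 1 + k1 * k2 \<and> \<beta> = 1 - k1\<^sup>2" "k1 \<ge> 1 \<longrightarrow> \<alpha> = 1 \<and> \<beta> = 0"
    "B = - (\<gamma> *\<^sub>R N2 + \<delta> *\<^sub>R N1)" "\<delta> \<le> \<gamma>"
    "k2 < 1 \<longrightarrow> \<gamma> = 1 + k2 * k1 \<and> \<delta> = 1 - k2\<^sup>2" "k2 \<ge> 1 \<longrightarrow> \<gamma> = 1 \<and> \<delta> = 0"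
    "\<beta> < \<alpha> \<or> \<delta> < \<gamma>" "\<alpha> * \<gamma> > \<beta> * \<delta>"
proof -
  obtain \<alpha> \<beta> where a: "A = - (\<alpha> *\<^sub>R N1 + \<beta> *\<^sub>R N2)" "\<alpha> > 0" "0 \<le> \<beta>" "\<beta> \<le> \<alpha>"
    "k1 < 1 \<longrightarrow> \<alpha> = 1 + k1 * k2 \<and> \<beta> = 1 - k1\<^sup>2" "k1 \<ge> 1 \<longrightarrow> \<alpha> = 1 \<and> \<beta> = 0" "\<beta> < \<alpha> \<or> k1 = 0" using foot_alt True by blast
  obtain \<gamma> \<delta> where b: "B = - (\<gamma> *\<^sub>R N2 + \<delta> *\<^sub>R N1)" "\<gamma> > 0" "0 \<le> \<delta>" "\<delta> \<le> \<gamma>"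
    "k2 < 1 \<longrightarrow> \<gamma> = 1 + k2 * k1 \<and> \<delta> = 1 - k2\<^sup>2" "k2 \<ge> 1 \<longrightarrow> \<gamma> = 1 \<and> \<delta> = 0" "\<delta> < \<gamma> \<or> k2 = 0"
    using tangent_pair.foot_alt[OF swap] True by (metis add.commute)
  have strict: "\<beta> < \<alpha> \<or> \<delta> < \<gamma>" using a(7) b(7) True by auto
  have det: "\<alpha> * \<gamma> > \<beta> * \<delta>"
  proof -
    have "\<beta> * \<delta> \<le> \<alpha> * \<delta>" "\<alpha> * \<delta> \<le> \<alpha> * \<gamma>" "\<beta> * \<delta> \<le> \<beta> * \<gamma>" "\<beta> * \<gamma> \<le> \<alpha> * \<gamma>"
      using a(2-4) b(2-4) by (auto intro: mult_left_mono mult_right_mono)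
    moreover have "\<beta> < \<alpha> \<Longrightarrow> \<beta> * \<gamma> < \<alpha> * \<gamma>" using b(2) by simp
    moreover have "\<delta> < \<gamma> \<Longrightarrow> \<alpha> * \<delta> < \<alpha> * \<gamma>" using a(2) by simp
    ultimately show ?thesis using strict by linarith
  qed
  show ?thesis by (rule that[OF a(1,4,5,6) b(1,4,5,6) strict det])
qed

lemma cp_edge_seg:
  assumes r1: "gc_rep k1 C1 N1" and r2: "gc_rep k2 C2 N2"
  shows "cp_edge k1 C1 k2 C2 tpt (hpr A) (hpr B) (seg A B)"
proof (cases "k1 + k2 > 0")
  case False
  then have 0: "k1 = 0" "k2 = 0" using k by auto
  have "A = - (N1 + N2)" "B = - (N1 + N2)" by (simp_all add: foot_def 0)
  then show ?thesis unfolding cp_edge_def using seg_self[OF f12] 0 by (simp add: tpt_def)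
next
  case True
  note fA = foot_props and fB = tangent_pair.foot_props[OF swap]
  define G where "G = (1 / (k1 + k2)) *\<^sub>R lcross N1 N2"
  have G: "mink G G = 1"
  proof -
    have "mink (lcross N1 N2) (lcross N1 N2) = (k1 + k2) * (k1 + k2)" unfolding lcross_self nn by algebra
    then show ?thesis unfolding G_def mink_scale_left mink_scale_right using True by simp
  qed
  have GN: "mink G N1 = 0" "mink G N2 = 0" by (simp_all add: G_def lcross_orth)
  obtain \<alpha> \<beta> \<gamma> \<delta> where a: "A = - (\<alpha> *\<^sub>R N1 + \<beta> *\<^sub>R N2)" "\<beta> \<le> \<alpha>" and b: "B = - (\<gamma> *\<^sub>R N2 + \<delta> *\<^sub>R N1)" "\<delta> \<le> \<gamma>"
    and strict: "\<beta> < \<alpha> \<or> \<delta> < \<gamma>" and det: "\<alpha> * \<gamma> > \<beta> * \<delta>"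
    using feetE[OF True] by metis
  have GA: "mink G A = 0" "mink G B = 0" using a(1) b(1) GN by simp_all
  have ne: "B \<noteq> r *\<^sub>R A" for r
  proof
    assume "B = r *\<^sub>R A"
    then have e: "(\<delta> - r * \<alpha>) *\<^sub>R N1 + (\<gamma> - r * \<beta>) *\<^sub>R N2 = 0"
      unfolding a(1) b(1) by (simp add: algebra_simps)
    let ?x = "\<delta> - r * \<alpha>" and ?y = "\<gamma> - r * \<beta>"
    have "mink (?x *\<^sub>R N1 + ?y *\<^sub>R N2) N1 = 0" "mink (?x *\<^sub>R N1 + ?y *\<^sub>R N2) N2 = 0" unfolding e by simp_all
    then have "?x * (1 - k1\<^sup>2) + ?y * (-1 - k1 * k2) = 0" "?x * (-1 - k1 * k2) + ?y * (1 - k2\<^sup>2) = 0"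
      by (simp_all add: nn)
    then have "?x * (k1 + k2)\<^sup>2 = 0" "?y * (k1 + k2)\<^sup>2 = 0" by algebra+
    then have "?x = 0" "?y = 0" using True by auto
    then have "\<alpha> * \<gamma> = \<beta> * \<delta>" by algebra
    then show False using det by simp
  qed
  let ?g = "{z \<in> hyp_plane. mink G (uvec z) = 0}"
  have seg: "hsegment ?g (hpr A) (hpr B) (seg A B)"
    by (rule hsegment_seg[OF G GA fA(1) fB(1) ne])
  have "(\<gamma> - \<delta>) *\<^sub>R A + (\<alpha> - \<beta>) *\<^sub>R B = (\<alpha> * \<gamma> - \<beta> * \<delta>) *\<^sub>R (- (N1 + N2))"
    unfolding a(1) b(1) by (simp add: algebra_simps)
  then have "hpr ((\<gamma> - \<delta>) *\<^sub>R A + (\<alpha> - \<beta>) *\<^sub>R B) = tpt" unfolding tpt_def using det hpr_scale by simp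
  moreover have "hpr ((\<gamma> - \<delta>) *\<^sub>R A + (\<alpha> - \<beta>) *\<^sub>R B) \<in> seg A B"
    using a(2) b(2) strict by (intro seg_cone) linarith+
  ultimately have t: "tpt \<in> seg A B" by simp
  have cen: "hpr (foot ka kb Na Nb) \<in> center C \<and> (ka < 1 \<longrightarrow> perpendicular_at (hpr (foot ka kb Na Nb)) ?g (center C))"
    if r: "gc_rep ka C Na" and tp: "tangent_pair ka kb Na Nb" and s: "ka + kb > 0"
      and g: "mink G Na = 0" "mink G Nb = 0" for ka kb Na Nb C
  proof (cases "ka \<ge> 1")
    case True
    then show ?thesis using r by (simp add: gc_rep_def foot_def)
  next
    case False
    interpret X: tangent_pair ka kb Na Nb by (fact tp)
    let ?A = "foot ka kb Na Nb"
    have l: "ka < 1" using False by simp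
    have q: "1 - ka\<^sup>2 > 0" using l X.k by (simp add: abs_square_less_1)
    have aD: "hpr ?A \<in> hyp_plane" using hpr_props(5) X.foot_props(1,3) l s by blast
    have u: "mink M (uvec (hpr ?A)) = 0" if "mink M ?A = 0" for M
      unfolding uvec_def hpr_props(2)[OF X.foot_props(1)] using that by simp
    have "mink G ?A = 0" using l g by (simp add: foot_def)
    then have 1: "mink G (uvec (hpr ?A)) = 0" "mink Na (uvec (hpr ?A)) = 0" using u X.foot_props(2)[OF l] by auto
    have c: "center C = {z \<in> hyp_plane. mink Na (uvec z) = 0}" using r l by (simp add: gc_rep_def)
    have "perpendicular_at (hpr ?A) ?g (center C)"
      unfolding c by (rule perpendicularI[OF aD 1 g(1)]) (use G q X.n1 in auto)
    then show ?thesis using c aD 1 by simp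
  qed
  have s': "k2 + k1 > 0" using True by simp
  have "\<not> (k1 = 0 \<and> k2 = 0)" using True by auto
  then show ?thesis
    unfolding cp_edge_def using geodesic_mink[OF G] seg t cen[OF r1 tangent_pair_axioms True GN] cen[OF r2 swap s' GN(2,1)]
    by (simp only: if_False) blast
qed

end

text \<open>An unbounded component of the complement of \<open>B\<close> cannot stay in the bounded
  \<open>U\<close>, so one that meets \<open>U\<close> crosses its frontier. This yields points of
  \<open>inside B\<close> without a Jordan curve argument.\<close>

lemma inside_frontier:
  fixes U B :: "complex set"
  assumes "bounded U" "frontier U \<subseteq> B" shows "U \<subseteq> B \<union> inside B"
proof
  fix q assume q: "q \<in> U"
  show "q \<in> B \<union> inside B"
  proof (rule ccontr)
    assume n: "q \<notin> B \<union> inside B"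
    let ?K = "connected_component_set (- B) q"
    have "\<not> bounded ?K" using n by (auto simp: inside_def)
    then have "?K - U \<noteq> {}" using assms(1) bounded_subset by blast
    moreover have "q \<in> ?K" using n by simp
    then have "?K \<inter> U \<noteq> {}" using q by blast
    ultimately have "?K \<inter> frontier U \<noteq> {}" by (intro connected_Int_frontier) auto
    then show False using assms(2) connected_component_subset by fast
  qed
qed

section \<open>Tangent triples and the polygon they bound\<close>

locale tangent_triple =
  fixes k1 k2 k3 N1 N2 N3
  assumes p12: "tangent_pair k1 k2 N1 N2" and p23: "tangent_pair k2 k3 N2 N3" and p31: "tangent_pair k3 k1 N3 N1"
begin

lemma rot: "tangent_triple k2 k3 k1 N2 N3 N1"
  by (rule tangent_triple.intro[OF p23 p31 p12])

lemma k: "0 \<le> k1" "0 \<le> k2" "0 \<le> k3"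
  using tangent_pair.k[OF p12] tangent_pair.k[OF p23] by auto

lemmas gr = tangent_pair.nn[OF p12] tangent_pair.nn[OF p23] tangent_pair.nn[OF p31]

definition "e2 = 1 + k1 * k2 + k2 * k3 + k3 * k1"
definition "M1 = dual_row k1 k2 k3 N1 N2 N3"
definition "M2 = dual_row k2 k3 k1 N2 N3 N1"
definition "M3 = dual_row k3 k1 k2 N3 N1 N2"

lemma e2: "e2 \<ge> 1"
  using k by (simp add: e2_def)

lemma M_N:
  "mink M1 N1 = - 4 * e2" "mink M1 N2 = 0" "mink M1 N3 = 0"
  "mink M2 N1 = 0" "mink M2 N2 = - 4 * e2" "mink M2 N3 = 0"
  "mink M3 N1 = 0" "mink M3 N2 = 0" "mink M3 N3 = - 4 * e2"
  using dual_row_mink[of N1 k1 N2 k2 N3 k3] dual_row_mink[of N2 k2 N3 k3 N1 k1] dual_row_mink[of N3 k3 N1 k1 N2 k2]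
  by (simp_all add: gr M1_def M2_def M3_def e2_def algebra_simps)

text \<open>Up to the factor \<open>- 4 * e2\<close> the vectors \<open>M1\<close>,
  \<open>M2\<close>, \<open>M3\<close> are the dual basis of \<open>N1\<close>, \<open>N2\<close>,
  \<open>N3\<close>. Sign conditions on the products with the former thus become signs of
  coordinates with respect to the latter.\<close>

lemma expand: "(4 * e2) *\<^sub>R X = - (mink M1 X *\<^sub>R N1 + mink M2 X *\<^sub>R N2 + mink M3 X *\<^sub>R N3)"
proof -
  have e0: "e2 \<noteq> 0" using e2 by simp
  \<comment> \<open>The Gram matrix leads back from the \<open>M\<close> to the \<open>N\<close> up
    to the factor \<open>- 4 * e2\<close>, so orthogonality to the former is orthogonality to a
    basis.\<close>
  have red: "mink d N1 = 0 \<and> mink d N2 = 0 \<and> mink d N3 = 0"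
    if "mink d M1 = 0" "mink d M2 = 0" "mink d M3 = 0" for d
  proof -
    have "(- 4 * e2) * mink d N1 = (1 - k1\<^sup>2) * mink d M1 + (-1 - k1 * k2) * mink d M2 + (-1 - k3 * k1) * mink d M3"
      "(- 4 * e2) * mink d N2 = (-1 - k1 * k2) * mink d M1 + (1 - k2\<^sup>2) * mink d M2 + (-1 - k2 * k3) * mink d M3"
      "(- 4 * e2) * mink d N3 = (-1 - k3 * k1) * mink d M1 + (-1 - k2 * k3) * mink d M2 + (1 - k3\<^sup>2) * mink d M3"
      unfolding M1_def M2_def M3_def dual_row_def mink_add_right mink_scale_right e2_def by algebra+
    then show ?thesis using that e0 by simp
  qed
  have "gram3 N1 N2 N3 = - 4 * e2" unfolding gram3_def gr(1-4) gr(5-8) gr(9-12) e2_def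
    by algebra
  then have g: "gram3 N1 N2 N3 \<noteq> 0" using e0 by simp
  define d where "d = (4 * e2) *\<^sub>R X + (mink M1 X *\<^sub>R N1 + mink M2 X *\<^sub>R N2 + mink M3 X *\<^sub>R N3)"
  have "mink d M1 = 0" "mink d M2 = 0" "mink d M3 = 0"
    unfolding d_def by (simp_all add: M_N mink_commute[of _ M1] mink_commute[of _ M2] mink_commute[of _ M3])
  then have "d = 0" using red ortho_zero[OF g] by blast
  then show ?thesis unfolding d_def by (simp only: eq_neg_iff_add_eq_0)
qed

lemma hvec_expandE:
  obtains a b c where "a = mink M1 (hvec z) / (4 * e2)" "b = mink M2 (hvec z) / (4 * e2)" "c = mink M3 (hvec z) / (4 * e2)"
    "hvec z = - (a *\<^sub>R N1 + b *\<^sub>R N2 + c *\<^sub>R N3)"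
proof -
  have "hvec z = (1 / (4 * e2)) *\<^sub>R ((4 * e2) *\<^sub>R hvec z)" using e2 by simp
  also have "\<dots> = - ((mink M1 (hvec z) / (4 * e2)) *\<^sub>R N1 + (mink M2 (hvec z) / (4 * e2)) *\<^sub>R N2 + (mink M3 (hvec z) / (4 * e2)) *\<^sub>R N3)"
    unfolding expand by (simp add: scaleR_add_right scaleR_diff_right)
  finally show ?thesis using that by blast
qed

lemma hvec_nz: "hvec z \<noteq> 0"
proof
  assume "hvec z = 0"
  then have "snd (hvec z) = 0" by simp
  moreover have "snd (hvec z) > 0" by (simp add: hvec_def add_pos_nonneg)
  ultimately show False by simp
qed

text \<open>On the line of the edge a point is a combination of \<open>N1\<close> and
  \<open>N2\<close> alone. The signs of its products with these two say that it does not lie beyond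
  the feet, which is nonnegativity of its coefficients with respect to the feet.\<close>

lemma edge_case:
  assumes z: "z \<in> cball 0 1" and x: "0 \<le> mink M1 (hvec z)" "0 \<le> mink M2 (hvec z)" "mink M3 (hvec z) = 0"
    and y: "0 \<le> mink N1 (hvec z)" "0 \<le> mink N2 (hvec z)"
  shows "z \<in> seg (foot k1 k2 N1 N2) (foot k2 k1 N2 N1)"
proof -
  interpret P: tangent_pair k1 k2 N1 N2 by (fact p12)
  obtain a b c where abc: "a = mink M1 (hvec z) / (4 * e2)" "b = mink M2 (hvec z) / (4 * e2)" "c = mink M3 (hvec z) / (4 * e2)"
    "hvec z = - (a *\<^sub>R N1 + b *\<^sub>R N2 + c *\<^sub>R N3)" by (rule hvec_expandE)
  have a: "0 \<le> a" and b: "0 \<le> b" unfolding abc(1-3) using x e2 by simp_all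
  have X: "hvec z = - (a *\<^sub>R N1 + b *\<^sub>R N2)" using abc(3,4) x(3) by simp
  have y1: "0 \<le> b * (1 + k1 * k2) - a * (1 - k1\<^sup>2)" and y2: "0 \<le> a * (1 + k1 * k2) - b * (1 - k2\<^sup>2)"
    using y unfolding X by (simp_all add: gr algebra_simps)
  have "\<exists>l m. 0 \<le> l \<and> 0 \<le> m \<and> hvec z = l *\<^sub>R P.A + m *\<^sub>R P.B"
  proof (cases "k1 + k2 > 0")
    case True
    obtain \<alpha> \<beta> \<gamma> \<delta> where A: "P.A = - (\<alpha> *\<^sub>R N1 + \<beta> *\<^sub>R N2)"
      "k1 < 1 \<longrightarrow> \<alpha> = 1 + k1 * k2 \<and> \<beta> = 1 - k1\<^sup>2" "k1 \<ge> 1 \<longrightarrow> \<alpha> = 1 \<and> \<beta> = 0"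
      and B: "P.B = - (\<gamma> *\<^sub>R N2 + \<delta> *\<^sub>R N1)"
      "k2 < 1 \<longrightarrow> \<gamma> = 1 + k2 * k1 \<and> \<delta> = 1 - k2\<^sup>2" "k2 \<ge> 1 \<longrightarrow> \<gamma> = 1 \<and> \<delta> = 0"
      and D: "\<alpha> * \<gamma> > \<beta> * \<delta>" using P.feetE[OF True] by metis
    define d where "d = \<alpha> * \<gamma> - \<beta> * \<delta>"
    have d: "d > 0" using D by (simp add: d_def)
    have m: "0 \<le> b * \<alpha> - a * \<beta>" using y1 A b by (cases "k1 < 1") auto
    have l: "0 \<le> a * \<gamma> - b * \<delta>" using y2 B a by (cases "k2 < 1") (auto simp: mult.commute)
    define L M where "L = (a * \<gamma> - b * \<delta>) / d" and "M = (b * \<alpha> - a * \<beta>) / d"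
    have la: "a = L * \<alpha> + M * \<delta>" and lb: "b = L * \<beta> + M * \<gamma>"
      using d unfolding L_def M_def by (simp_all add: field_simps) (simp_all add: d_def algebra_simps)
    have "hvec z = L *\<^sub>R P.A + M *\<^sub>R P.B"
      unfolding A(1) B(1) X la lb by (simp add: algebra_simps)
    moreover have "0 \<le> L" "0 \<le> M" using m l d by (auto simp: L_def M_def)
    ultimately show ?thesis by blast
  next
    case False
    then have 0: "k1 = 0" "k2 = 0" using k by auto
    then have "a = b" using y1 y2 by simp
    then have "hvec z = a *\<^sub>R P.A + 0 *\<^sub>R P.B" unfolding X by (simp add: foot_def 0 algebra_simps)
    then show ?thesis using a by blast
  qed
  then obtain l m where lm: "0 \<le> l" "0 \<le> m" "hvec z = l *\<^sub>R P.A + m *\<^sub>R P.B" by blast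
  then have "l + m > 0" using hvec_nz[of z] by (cases "l = 0 \<and> m = 0") auto
  then have "hpr (hvec z) \<in> seg P.A P.B" unfolding lm(3) by (intro seg_cone lm)
  then show ?thesis using hpr_hvec[OF z] by simp
qed

definition "vtx = (if k1 \<ge> 1 then {hpr (- N1)} else seg (foot k1 k2 N1 N2) (foot k1 k3 N1 N3))"

text \<open>For \<open>k1 \<ge> 1\<close> the equation \<open>mink N1 (hvec z) = 0\<close> equates a
  nonpositive and a nonnegative quantity, which leaves the center only. For \<open>k1 < 1\<close> it
  allows the coefficient of \<open>N1\<close> to be distributed over the two feet.\<close>

lemma vertex_case:
  assumes z: "z \<in> cball 0 1" and x: "0 \<le> mink M1 (hvec z)" "0 \<le> mink M2 (hvec z)" "0 \<le> mink M3 (hvec z)"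
    and y: "mink N1 (hvec z) = 0"
  shows "z \<in> vtx"
proof -
  obtain a b c where abc: "a = mink M1 (hvec z) / (4 * e2)" "b = mink M2 (hvec z) / (4 * e2)" "c = mink M3 (hvec z) / (4 * e2)"
    "hvec z = - (a *\<^sub>R N1 + b *\<^sub>R N2 + c *\<^sub>R N3)" by (rule hvec_expandE)
  have p: "0 \<le> a" "0 \<le> b" "0 \<le> c" unfolding abc(1-3) using x e2 by simp_all
  note X = abc(4)
  have y: "a * (1 - k1\<^sup>2) = b * (1 + k1 * k2) + c * (1 + k1 * k3)"
    using y unfolding X by (simp add: gr algebra_simps)
  have kk: "1 + k1 * k2 \<ge> 1" "1 + k1 * k3 \<ge> 1" using k by auto
  show ?thesis
  proof (cases "k1 \<ge> 1")
    case True
    then have "1 - k1\<^sup>2 \<le> 0" by simp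
    then have "a * (1 - k1\<^sup>2) \<le> 0" using p by (simp add: mult_nonneg_nonpos)
    moreover have "b * 1 \<le> b * (1 + k1 * k2)" "c * 1 \<le> c * (1 + k1 * k3)" by (intro mult_left_mono kk p)+
    ultimately have "b = 0" "c = 0" using y p by auto
    then have h: "hvec z = a *\<^sub>R (- N1)" using X by simp
    then have "a > 0" using hvec_nz[of z] p by (cases "a = 0") auto
    then have "hpr (hvec z) = hpr (- N1)" unfolding h by (rule hpr_scale)
    then show ?thesis using hpr_hvec[OF z] True by (simp add: vtx_def)
  next
    case False
    define q where "q = 1 - k1\<^sup>2"
    have q: "q > 0" using False k by (simp add: abs_square_less_1 q_def)
    define L M where "L = b / q" and "M = c / q"
    have LM: "b = L * q" "c = M * q" "0 \<le> L" "0 \<le> M" using p q by (auto simp: L_def M_def)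
    have "q * a = q * (L * (1 + k1 * k2) + M * (1 + k1 * k3))"
      using y unfolding LM q_def[symmetric] by (simp add: algebra_simps)
    then have a: "a = L * (1 + k1 * k2) + M * (1 + k1 * k3)" using q by simp
    have h: "hvec z = L *\<^sub>R foot k1 k2 N1 N2 + M *\<^sub>R foot k1 k3 N1 N3"
      unfolding X a LM(1,2) foot_def q_def[symmetric] using False by (simp add: algebra_simps)
    then have "L + M > 0" using hvec_nz[of z] LM(3,4) by (cases "L = 0 \<and> M = 0") auto
    then have "hpr (hvec z) \<in> seg (foot k1 k2 N1 N2) (foot k1 k3 N1 N3)"
      unfolding h by (intro seg_cone LM)
    then show ?thesis using hpr_hvec[OF z] False by (simp add: vtx_def)
  qed
qed

lemma cp_vertex_vtx:
  assumes r: "gc_rep k1 C1 N1"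
  shows "cp_vertex k1 C1 (hpr (foot k1 k2 N1 N2)) (hpr (foot k1 k3 N1 N3)) vtx"
proof (cases "k1 \<ge> 1")
  case True
  then show ?thesis using r by (simp add: cp_vertex_def gc_rep_def vtx_def)
next
  case False
  then have l: "k1 < 1" by simp
  define q where "q = 1 - k1\<^sup>2"
  have q: "q > 0" using False k by (simp add: abs_square_less_1 q_def)
  define G where "G = (1 / sqrt q) *\<^sub>R N1"
  have G: "mink G G = 1" using q by (simp add: G_def gr q_def[symmetric])
  have c: "center C1 = {z \<in> hyp_plane. mink G (uvec z) = 0}" using r False q by (auto simp: G_def gc_rep_def)
  interpret P: tangent_pair k1 k2 N1 N2 by (fact p12)
  interpret R: tangent_pair k1 k3 N1 N3 by (rule tangent_pair.swap[OF p31])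
  have "hsegment (center C1) (hpr P.A) (hpr R.A) (seg P.A R.A)"
    unfolding c
  proof (rule hsegment_seg[OF G _ _ P.foot_props(1) R.foot_props(1)])
    show "mink G P.A = 0" "mink G R.A = 0" using P.foot_props(2)[OF l] R.foot_props(2)[OF l] by (simp_all add: G_def)
    fix r :: real assume r: "r > 0"
    \<comment> \<open>\<open>M2\<close> separates the feet: it is orthogonal to \<open>N1\<close>
      and \<open>N3\<close>, hence to \<open>R.A\<close>, but not to \<open>P.A\<close>.\<close>
    show "R.A \<noteq> r *\<^sub>R P.A"
    proof
      assume "R.A = r *\<^sub>R P.A"
      then have "mink M2 R.A = r * mink M2 P.A" by simp
      then show False using r l q e2 by (simp add: foot_def M_N q_def[symmetric])
    qed
  qed
  then show ?thesis using False by (simp add: cp_vertex_def vtx_def)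
qed

text \<open>The open polygon between the lines of the edges, given by the \<open>M\<close>, and the
  axes, given by the \<open>N\<close>. Inequalities are easier to verify on an arc than membership
  in \<open>inside bdry\<close>.\<close>

definition "region = {z \<in> hyp_plane. 0 < mink M1 (hvec z) \<and> 0 < mink M2 (hvec z) \<and> 0 < mink M3 (hvec z) \<and>
   0 < mink N1 (hvec z) \<and> 0 < mink N2 (hvec z) \<and> 0 < mink N3 (hvec z)}"

lemma rot_M: "tangent_triple.M1 k2 k3 k1 N2 N3 N1 = M2" "tangent_triple.M2 k2 k3 k1 N2 N3 N1 = M3"
  "tangent_triple.M3 k2 k3 k1 N2 N3 N1 = M1" "tangent_triple.M1 k3 k1 k2 N3 N1 N2 = M3"
  "tangent_triple.M2 k3 k1 k2 N3 N1 N2 = M1" "tangent_triple.M3 k3 k1 k2 N3 N1 N2 = M2"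
  using tangent_triple.M1_def[OF rot] tangent_triple.M2_def[OF rot] tangent_triple.M3_def[OF rot]
    tangent_triple.M1_def[OF tangent_triple.rot[OF rot]] tangent_triple.M2_def[OF tangent_triple.rot[OF rot]]
    tangent_triple.M3_def[OF tangent_triple.rot[OF rot]]
  by (simp_all add: M1_def M2_def M3_def)

definition "bdry = seg (foot k1 k2 N1 N2) (foot k2 k1 N2 N1) \<union> seg (foot k2 k3 N2 N3) (foot k3 k2 N3 N2)
  \<union> seg (foot k3 k1 N3 N1) (foot k1 k3 N1 N3) \<union> vtx \<union> tangent_triple.vtx k2 k3 k1 N2 N3 N1
  \<union> tangent_triple.vtx k3 k1 k2 N3 N1 N2"

lemma region_boundary: "frontier region \<subseteq> bdry"
proof
  have cont: "continuous_on UNIV (\<lambda>z. mink M (hvec z))" for M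
    unfolding mink_def hvec_def by (intro continuous_intros)
  have "region = hyp_plane \<inter> {z. 0 < mink M1 (hvec z)} \<inter> {z. 0 < mink M2 (hvec z)} \<inter> {z. 0 < mink M3 (hvec z)}
     \<inter> {z. 0 < mink N1 (hvec z)} \<inter> {z. 0 < mink N2 (hvec z)} \<inter> {z. 0 < mink N3 (hvec z)}"
    by (auto simp: region_def)
  moreover have "open {z. 0 < mink M (hvec z)}" for M by (intro open_Collect_less cont continuous_intros)
  ultimately have op: "open region" by (simp add: open_Int)
  let ?K = "cball 0 1 \<inter> {z. 0 \<le> mink M1 (hvec z)} \<inter> {z. 0 \<le> mink M2 (hvec z)} \<inter> {z. 0 \<le> mink M3 (hvec z)}
     \<inter> {z. 0 \<le> mink N1 (hvec z)} \<inter> {z. 0 \<le> mink N2 (hvec z)} \<inter> {z. 0 \<le> mink N3 (hvec z)}"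
  have "closed {z. 0 \<le> mink M (hvec z)}" for M by (intro closed_Collect_le cont continuous_intros)
  then have "closed ?K" by (simp add: closed_Int)
  moreover have "region \<subseteq> ?K" by (auto simp: region_def)
  ultimately have cl: "closure region \<subseteq> ?K" by (rule closure_minimal[rotated])
  fix z assume "z \<in> frontier region"
  then have z: "z \<in> ?K" "z \<notin> region" using cl op by (auto simp: frontier_def interior_open)
  then have zc: "z \<in> cball 0 1" and x: "0 \<le> mink M1 (hvec z)" "0 \<le> mink M2 (hvec z)" "0 \<le> mink M3 (hvec z)"
    and y: "0 \<le> mink N1 (hvec z)" "0 \<le> mink N2 (hvec z)" "0 \<le> mink N3 (hvec z)" by auto
  interpret R1: tangent_triple k2 k3 k1 N2 N3 N1 by (fact rot)
  interpret R2: tangent_triple k3 k1 k2 N3 N1 N2 by (rule R1.rot)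
  have "mink M1 (hvec z) = 0 \<or> mink M2 (hvec z) = 0 \<or> mink M3 (hvec z) = 0 \<or>
     mink N1 (hvec z) = 0 \<or> mink N2 (hvec z) = 0 \<or> mink N3 (hvec z) = 0"
  proof (cases "z \<in> hyp_plane")
    case True
    then show ?thesis using z(2) x y unfolding region_def by force
  next
    case False
    then have "norm z = 1" using zc by simp
    then have 0: "mink (hvec z) (hvec z) = 0" by (simp add: mink_hvec_self)
    \<comment> \<open>At an ideal point this norm vanishes, and it expands into products that are
      all nonnegative. One factor is therefore 0, so that the closed polygon reaches infinity only
      along its edges and vertices.\<close>
    have "(4 * e2) * mink (hvec z) (hvec z) = mink (hvec z) ((4 * e2) *\<^sub>R hvec z)" by simp
    also have "\<dots> = - (mink M1 (hvec z) * mink N1 (hvec z) + mink M2 (hvec z) * mink N2 (hvec z) + mink M3 (hvec z) * mink N3 (hvec z))"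
      unfolding expand by (simp add: mink_commute[of "hvec z"])
    finally have "mink M1 (hvec z) * mink N1 (hvec z) + mink M2 (hvec z) * mink N2 (hvec z) + mink M3 (hvec z) * mink N3 (hvec z) = 0"
      using 0 by simp
    moreover have "0 \<le> mink M1 (hvec z) * mink N1 (hvec z)" "0 \<le> mink M2 (hvec z) * mink N2 (hvec z)"
      "0 \<le> mink M3 (hvec z) * mink N3 (hvec z)" using x y by auto
    ultimately have "mink M1 (hvec z) * mink N1 (hvec z) = 0" by linarith
    then show ?thesis by auto
  qed
  then consider "mink M1 (hvec z) = 0" | "mink M2 (hvec z) = 0" | "mink M3 (hvec z) = 0"
    | "mink N1 (hvec z) = 0" | "mink N2 (hvec z) = 0" | "mink N3 (hvec z) = 0" by blast
  then show "z \<in> bdry"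
  proof cases
    case 1
    then show ?thesis using R1.edge_case[OF zc, unfolded rot_M] x y by (simp add: bdry_def)
  next
    case 2
    then show ?thesis using R2.edge_case[OF zc, unfolded rot_M] x y by (simp add: bdry_def)
  next
    case 3
    then show ?thesis using edge_case[OF zc] x y by (simp add: bdry_def)
  next
    case 4
    then show ?thesis using vertex_case[OF zc] x by (simp add: bdry_def)
  next
    case 5
    then show ?thesis using R1.vertex_case[OF zc, unfolded rot_M] x by (simp add: bdry_def)
  next
    case 6
    then show ?thesis using R2.vertex_case[OF zc, unfolded rot_M] x by (simp add: bdry_def)
  qed
qed

lemma region_inside: "region \<subseteq> bdry \<union> inside bdry"
proof (rule inside_frontier[OF _ region_boundary])
  have "region \<subseteq> hyp_plane" by (auto simp: region_def)
  then show "bounded region" using bounded_ball bounded_subset by blast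
qed

end

text \<open>The arc of the first circle inside the triangle is a rational quadratic Bezier curve whose
  middle control point \<open>Q\<close> is the intersection of the tangents at the two tangency points.\<close>

lemma (in tangent_triple) arc_exists:
  assumes kp: "k1 > 0"
  obtains p where "arc p" "valid_path p" "pathstart p = tangent_pair.tpt N1 N2" "pathfinish p = tangent_pair.tpt N3 N1"
    "path_image p \<subseteq> {z \<in> hyp_plane. mink N1 (uvec z) = k1}"
    "path_image p \<subseteq> region \<union> {tangent_pair.tpt N1 N2, tangent_pair.tpt N3 N1}"
proof -
  interpret P: tangent_pair k1 k2 N1 N2 by (fact p12)
  interpret R: tangent_pair k3 k1 N3 N1 by (fact p31)
  have s: "k1 + k2 > 0" "k3 + k1 > 0" using kp k by auto
  define x y where "x = uvec P.tpt" and "y = uvec R.tpt"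
  have x: "N1 + N2 = - ((k1 + k2) *\<^sub>R x)" "mink x x = -1" "P.tpt \<in> hyp_plane"
    and y: "N3 + N1 = - ((k3 + k1) *\<^sub>R y)" "mink y y = -1" "R.tpt \<in> hyp_plane"
    using P.uvec_tpt P.tpt_in R.uvec_tpt R.tpt_in s uvec_self by (auto simp: x_def y_def)
  have xm: "(k1 + k2) * mink M x = - (mink M N1 + mink M N2)" for M
    using arg_cong[OF x(1), of "mink M"] by simp
  have ym: "(k3 + k1) * mink M y = - (mink M N3 + mink M N1)" for M
    using arg_cong[OF y(1), of "mink M"] by simp
  have solve: "m = c" if "r * m = r * c" "r > 0" for m c r :: real using that by simp
  have c: "(k1 + k2) * (2 / (k1 + k2)) = 2" "(k3 + k1) * (2 / (k3 + k1)) = 2"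
    using s by (metis less_irrefl nonzero_mult_div_cancel_left times_divide_eq_right)+
  have x1: "mink N1 x = k1" by (rule solve[OF _ s(1)], unfold xm gr) algebra
  have x2: "mink N2 x = k2" by (rule solve[OF _ s(1)], unfold xm gr) algebra
  have x3: "mink N3 x = k3 + 2 / (k1 + k2)" by (rule solve[OF _ s(1)], unfold xm gr distrib_left c) algebra
  have y1: "mink N1 y = k1" by (rule solve[OF _ s(2)], unfold ym gr) algebra
  have y3: "mink N3 y = k3" by (rule solve[OF _ s(2)], unfold ym gr) algebra
  have y2: "mink N2 y = k2 + 2 / (k3 + k1)" by (rule solve[OF _ s(2)], unfold ym gr distrib_left c) algebra
  \<comment> \<open>The solution of \<open>mink Ni Q = ki\<close> for all three circles, found with
    the inverse Gram matrix. It pairs to -1 with both tangency points.\<close>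
  define Q where "Q = - ((1 / (2 * e2)) *\<^sub>R ((k2 + k3) *\<^sub>R N1 + (k3 + k1) *\<^sub>R N2 + (k1 + k2) *\<^sub>R N3))"
  have e2p: "e2 > 0" using e2 by simp
  have Qm: "(2 * e2) * mink M Q = - ((k2 + k3) * mink M N1 + (k3 + k1) * mink M N2 + (k1 + k2) * mink M N3)" for M
    unfolding Q_def mink_minus_right mink_scale_right mink_add_right using e2p by simp
  have e2p': "2 * e2 > 0" using e2p by simp
  have Q1: "mink N1 Q = k1" by (rule solve[OF _ e2p'], unfold Qm, unfold gr e2_def) algebra
  have Q2: "mink N2 Q = k2" by (rule solve[OF _ e2p'], unfold Qm, unfold gr e2_def) algebra
  have Q3: "mink N3 Q = k3" by (rule solve[OF _ e2p'], unfold Qm, unfold gr e2_def) algebra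
  have QQ: "mink Q Q = - (e2 - 1) / e2"
  proof -
    have "(2 * e2) * mink Q Q = - ((k2 + k3) * k1 + (k3 + k1) * k2 + (k1 + k2) * k3)"
      unfolding Qm by (simp add: Q1 Q2 Q3 mink_commute[of Q])
    also have "\<dots> = - 2 * (e2 - 1)" unfolding e2_def by algebra
    finally show ?thesis using e2p by (simp add: field_simps)
  qed
  have MQ: "mink M1 Q \<ge> 0" "mink M2 Q \<ge> 0" "mink M3 Q \<ge> 0"
  proof -
    have "(2 * e2) * mink M1 Q = (2 * e2) * (2 * (k2 + k3))" "(2 * e2) * mink M2 Q = (2 * e2) * (2 * (k3 + k1))"
      "(2 * e2) * mink M3 Q = (2 * e2) * (2 * (k1 + k2))" unfolding Qm by (simp_all add: M_N)
    then have "mink M1 Q = 2 * (k2 + k3)" "mink M2 Q = 2 * (k3 + k1)" "mink M3 Q = 2 * (k1 + k2)"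
      using e2p' by (auto intro: solve)
    then show "mink M1 Q \<ge> 0" "mink M2 Q \<ge> 0" "mink M3 Q \<ge> 0" using k by auto
  qed
  have Mx: "mink M1 x > 0" "mink M2 x > 0" "mink M3 x = 0" and My: "mink M1 y > 0" "mink M2 y = 0" "mink M3 y > 0"
  proof -
    have "(k1 + k2) * mink M1 x > 0" "(k1 + k2) * mink M2 x > 0" "(k1 + k2) * mink M3 x = 0"
      "(k3 + k1) * mink M1 y > 0" "(k3 + k1) * mink M2 y = 0" "(k3 + k1) * mink M3 y > 0"
      unfolding xm ym by (simp_all add: M_N e2p)
    then show "mink M1 x > 0" "mink M2 x > 0" "mink M3 x = 0" "mink M1 y > 0" "mink M2 y = 0" "mink M3 y > 0"
      using s by (auto simp: zero_less_mult_iff)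
  qed
  define P' where "P' = (k1 + k2) * (k3 + k1)"
  have P': "P' > 0" using s by (simp add: P'_def)
  have xy: "mink x y = - (1 + 2 / P')"
  proof -
    have "(k1 + k2) * mink y x = - (k1 + (k2 + 2 / (k3 + k1)))" unfolding xm by (simp add: y1 y2 mink_commute[of y])
    moreover have "P' * mink y x = (k3 + k1) * ((k1 + k2) * mink y x)" by (simp add: P'_def)
    ultimately have "P' * mink y x = (k3 + k1) * (- (k1 + (k2 + 2 / (k3 + k1))))" by (simp only:)
    also have "\<dots> = - (P' + (k3 + k1) * (2 / (k3 + k1)))" unfolding P'_def by (simp only: algebra_simps minus_add_distrib mult_minus_left mult_minus_right)
    also have "\<dots> = - (P' + P' * (2 / P'))" unfolding c using P' by simp
    also have "\<dots> = P' * (- (1 + 2 / P'))" by (simp only: algebra_simps minus_add_distrib mult_minus_left mult_minus_right)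
    finally have "P' * mink y x = P' * (- (1 + 2 / P'))" .
    then show ?thesis using solve[OF _ P'] mink_commute by metis
  qed
  have xQ: "mink x Q = -1" "mink y Q = -1"
  proof -
    have "(k1 + k2) * mink Q x = (k1 + k2) * (-1)" unfolding xm by (simp add: Q1 Q2 mink_commute[of Q])
    then show "mink x Q = -1" using solve[OF _ s(1)] mink_commute by metis
    have "(k3 + k1) * mink Q y = (k3 + k1) * (-1)" unfolding ym by (simp add: Q1 Q3 mink_commute[of Q])
    then show "mink y Q = -1" using solve[OF _ s(2)] mink_commute by metis
  qed
  \<comment> \<open>The weight for which \<open>mink (Y t) (Y t)\<close> becomes
    \<open>- (S t)\<^sup>2\<close>, so that the curve lies on the hyperboloid after division by
    \<open>S t\<close>.\<close>
  define \<beta> where "\<beta> = sqrt (e2 / P')"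
  have \<beta>: "\<beta> \<ge> 0" "\<beta> * \<beta> = e2 / P'" using e2p P' by (auto simp: \<beta>_def)
  define Y where "Y = (\<lambda>t::real. (1 - t)\<^sup>2 *\<^sub>R x + (2 * t * (1 - t) * \<beta>) *\<^sub>R Q + t\<^sup>2 *\<^sub>R y)"
  define S where "S = (\<lambda>t::real. (1 - t)\<^sup>2 + 2 * t * (1 - t) * \<beta> + t\<^sup>2)"
  have Ym: "mink M (Y t) = (1 - t)\<^sup>2 * mink M x + (2 * t * (1 - t) * \<beta>) * mink M Q + t\<^sup>2 * mink M y" for M t
    by (simp add: Y_def)
  have S: "S t > 0" if "t \<in> {0..1}" for t
  proof -
    have "0 \<le> 2 * t * (1 - t) * \<beta>" using that \<beta> by auto
    moreover have "0 < (1 - t)\<^sup>2 + t\<^sup>2" by (metis add_0 diff_zero power_zero_numeral sum_power2_gt_zero_iff zero_neq_one)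
    ultimately show ?thesis unfolding S_def by linarith
  qed
  have YY: "mink (Y t) (Y t) = - (S t)\<^sup>2" for t
  proof -
    define a b c where "a = (1 - t)\<^sup>2" and "b = 2 * t * (1 - t) * \<beta>" and "c = t\<^sup>2"
    have Yt: "Y t = a *\<^sub>R x + b *\<^sub>R Q + c *\<^sub>R y" by (simp add: Y_def a_def b_def c_def)
    have "mink (Y t) (Y t) = - (a + b + c)\<^sup>2 + b * b / e2 - 4 * a * c / P'"
      unfolding Yt using e2p P' by (simp add: x y QQ xy xQ mink_commute[of Q x] mink_commute[of Q y] mink_commute[of y x])
        (simp add: field_simps power2_eq_square)
    also have "b * b / e2 = 4 * a * c / P'"
    proof -
      have "b * b = 4 * a * c * (\<beta> * \<beta>)" by (simp add: a_def b_def c_def power2_eq_square)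
      then show ?thesis unfolding \<beta>(2) using e2p by simp
    qed
    finally show ?thesis by (simp add: S_def a_def b_def c_def)
  qed
  have fY: "fcausal (Y t)" if t: "t \<in> {0..1}" for t
  proof (rule fcausalI_mink)
    show "mink (Y t) (Y t) \<le> 0" by (simp add: YY)
    show "fcausal x" using fcausal_uvec x(3) by (simp add: x_def)
    have "0 \<le> 2 * t * (1 - t) * \<beta>" using t \<beta> by auto
    moreover have "t\<^sup>2 * (1 + 2 / P') \<ge> t\<^sup>2 * 1" using P' by (intro mult_left_mono) auto
    moreover have "mink x (Y t) = - ((1 - t)\<^sup>2 + 2 * t * (1 - t) * \<beta> + t\<^sup>2 * (1 + 2 / P'))"
      unfolding Ym x xy xQ by (simp add: algebra_simps)
    ultimately show "mink (Y t) x < 0" using S[OF t] by (simp add: mink_commute[of "Y t"] S_def)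
  qed
  define p where "p = (\<lambda>t. fst (Y t) /\<^sub>R (snd (Y t) + S t))"
  have ph: "p t = hpr (Y t)" if "t \<in> {0..1}" for t
    using S[OF that] by (simp add: p_def hpr_def YY)
  have up: "p t \<in> hyp_plane" "uvec (p t) = (1 / S t) *\<^sub>R Y t" if t: "t \<in> {0..1}" for t
  proof -
    have f: "fcausal ((1 / S t) *\<^sub>R Y t)" using fcausal_scale[OF fY[OF t]] S[OF t] by simp
    have "mink ((1 / S t) *\<^sub>R Y t) ((1 / S t) *\<^sub>R Y t) = -1"
      using S[OF t] by (simp add: YY power2_eq_square)
    note h = hpr_unit[OF f this]
    have "hpr ((1 / S t) *\<^sub>R Y t) = p t" unfolding ph[OF t] using S[OF t] by (intro hpr_scale) simp
    then show "p t \<in> hyp_plane" "uvec (p t) = (1 / S t) *\<^sub>R Y t" using h by auto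
  qed
  have den: "snd (Y t) + S t > 0" if "t \<in> {0..1}" for t
    using fY[OF that] S[OF that] by (simp add: fcausal_def add_pos_pos)
  have C1: "p C1_differentiable_on {0..1}"
  proof -
    define u where "u = (\<lambda>t. fst (Y t))"
    define v where "v = (\<lambda>t. snd (Y t) + S t)"
    define u' where "u' = (\<lambda>t::real. (- 2 * (1 - t)) *\<^sub>R fst x + ((2 * (1 - t) - 2 * t) * \<beta>) *\<^sub>R fst Q + (2 * t) *\<^sub>R fst y)"
    define v' where "v' = (\<lambda>t::real. (- 2 * (1 - t)) * (snd x + 1) + ((2 * (1 - t) - 2 * t) * \<beta>) * (snd Q + 1) + (2 * t) * (snd y + 1))"
    have du: "(u has_vector_derivative u' t) (at t)" for t
      unfolding u_def u'_def Y_def fst_add fst_scaleR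
      by (rule derivative_eq_intros refl | simp add: algebra_simps)+
    have dv: "(v has_real_derivative v' t) (at t)" for t
      unfolding v_def v'_def Y_def S_def snd_add snd_scaleR
      by (rule derivative_eq_intros refl | simp)+ (simp add: algebra_simps)
    have v0: "v t \<noteq> 0" if "t \<in> {0..1}" for t using den[OF that] by (simp add: v_def)
    have "(p has_vector_derivative (inverse (v t) *\<^sub>R u' t + (- (inverse (v t) * v' t * inverse (v t))) *\<^sub>R u t)) (at t)"
      if t: "t \<in> {0..1}" for t
    proof -
      have "((\<lambda>t. inverse (v t)) has_real_derivative (- (inverse (v t) * v' t * inverse (v t)))) (at t)"
        by (rule DERIV_inverse'[OF dv v0[OF t]])
      from has_vector_derivative_scaleR[OF this du]
      show ?thesis unfolding p_def u_def v_def .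
    qed
    moreover have "continuous_on {0..1} (\<lambda>t. inverse (v t) *\<^sub>R u' t + (- (inverse (v t) * v' t * inverse (v t))) *\<^sub>R u t)"
    proof -
      have "continuous_on {0..1} u" "continuous_on {0..1} v"
        using has_vector_derivative_continuous[OF du] DERIV_isCont[OF dv]
        by (auto intro: continuous_at_imp_continuous_on)
      moreover have "continuous_on {0..1} u'" "continuous_on {0..1} v'" unfolding u'_def v'_def by (intro continuous_intros)+
      ultimately show ?thesis using v0 by (intro continuous_intros) auto
    qed
    ultimately show ?thesis unfolding C1_differentiable_on_def
      by (intro exI[of _ "\<lambda>t. inverse (v t) *\<^sub>R u' t + (- (inverse (v t) * v' t * inverse (v t))) *\<^sub>R u t"] conjI ballI)
  qed
  have val: "valid_path p" unfolding valid_path_def by (rule C1_differentiable_imp_piecewise[OF C1])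
  have Y0: "Y 0 = x" "Y 1 = y" by (simp_all add: Y_def)
  have ends: "p 0 = P.tpt" "p 1 = R.tpt"
    using ph[of 0] ph[of 1] hpr_uvec[OF x(3)] hpr_uvec[OF y(3)] unfolding Y0 x_def y_def by simp_all
  have inj: "inj_on p {0..1}"
  proof (rule inj_onI)
    fix t t' assume t: "t \<in> {0..1}" "t' \<in> {0..1}" "p t = p t'"
    then obtain c where c: "c > 0" and e: "Y t = c *\<^sub>R Y t'" using hpr_eqD[OF fY fY] ph by metis
    \<comment> \<open>\<open>f\<close> vanishes on \<open>Q\<close> and \<open>y\<close>, and
      \<open>g\<close> on \<open>Q\<close> and \<open>x\<close>. They isolate the coefficients
      \<open>(1 - t)\<^sup>2\<close> and \<open>t\<^sup>2\<close>, whose ratio determines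
      \<open>t\<close>.\<close>
    define f where "f = k3 *\<^sub>R N1 - k1 *\<^sub>R N3"
    define g where "g = k2 *\<^sub>R N1 - k1 *\<^sub>R N2"
    have f0: "mink f Q = 0" "mink f y = 0" "mink f x = - (2 * k1 / (k1 + k2))"
      by (simp_all add: f_def Q1 Q3 y1 y3 x1 x3 algebra_simps)
    have g0: "mink g Q = 0" "mink g x = 0" "mink g y = - (2 * k1 / (k3 + k1))"
      by (simp_all add: g_def Q1 Q2 x1 x2 y1 y2 algebra_simps)
    have nz: "mink f x \<noteq> 0" "mink g y \<noteq> 0" unfolding f0 g0 using kp s by auto
    have "mink f (Y t) = c * mink f (Y t')" "mink g (Y t) = c * mink g (Y t')" unfolding e by simp_all
    then have "(1 - t)\<^sup>2 * mink f x = c * (1 - t')\<^sup>2 * mink f x" "t\<^sup>2 * mink g y = c * t'\<^sup>2 * mink g y"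
      unfolding Ym f0(1,2) g0(1,2) by simp_all
    then have q: "(1 - t)\<^sup>2 = c * (1 - t')\<^sup>2" "t\<^sup>2 = c * t'\<^sup>2" using nz by auto
    then have "sqrt ((1 - t)\<^sup>2) = sqrt c * sqrt ((1 - t')\<^sup>2)" "sqrt (t\<^sup>2) = sqrt c * sqrt (t'\<^sup>2)"
      by (simp_all only: real_sqrt_mult)
    then have h: "1 - t = sqrt c * (1 - t')" "t = sqrt c * t'" using t by auto
    then have "sqrt c = 1" by (simp add: algebra_simps)
    then show "t = t'" using h by simp
  qed
  have "continuous_on {0..1} p" using val valid_path_imp_path by (auto simp: path_def)
  then have arc: "arc p" using inj by (simp add: arc_def path_def)
  have cur: "mink N1 (uvec (p t)) = k1" if t: "t \<in> {0..1}" for t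
  proof -
    have "mink N1 (Y t) = S t * k1" unfolding Ym x1 y1 Q1 S_def by (simp add: algebra_simps)
    then show ?thesis unfolding up(2)[OF t] using S[OF t] by simp
  qed
  have reg: "p t \<in> region" if t: "t \<in> {0<..<1}" for t
  proof -
    have t': "t \<in> {0..1}" using t by auto
    \<comment> \<open>The Bezier coefficients are nonnegative and those of the endpoints positive,
      so signs at the three control points decide all six inequalities of
      \<open>region\<close>.\<close>
    have pos: "0 < mink M (hvec (p t))" if M: "0 \<le> mink M x" "0 \<le> mink M y" "0 \<le> mink M Q" "0 < mink M x \<or> 0 < mink M y" for M
    proof -
      have "0 \<le> 2 * t * (1 - t) * \<beta> * mink M Q" using M(3) t \<beta> by (intro mult_nonneg_nonneg) auto
      moreover have "0 \<le> (1 - t)\<^sup>2 * mink M x" "0 \<le> t\<^sup>2 * mink M y" using M by auto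
      moreover have "0 < (1 - t)\<^sup>2 * mink M x \<or> 0 < t\<^sup>2 * mink M y" using M(4) t by auto
      ultimately have "0 < mink M (Y t)" unfolding Ym by linarith
      then have "0 < mink M (uvec (p t))" unfolding up(2)[OF t'] using S[OF t'] by simp
      then show ?thesis unfolding mink_hvec_uvec[OF up(1)[OF t']] using cf_pos[OF up(1)[OF t']] by (rule mult_pos_pos[rotated])
    qed
    have "2 / (k1 + k2) > 0" "2 / (k3 + k1) > 0" using s by auto
    then have d: "k3 + 2 / (k1 + k2) > 0" "k2 + 2 / (k3 + k1) > 0" using k by linarith+
    show ?thesis unfolding region_def using up(1)[OF t'] k kp d less_imp_le[OF d(1)] less_imp_le[OF d(2)]
      by (auto intro!: pos simp: Mx My MQ x1 x2 x3 y1 y2 y3 Q1 Q2 Q3 less_imp_le[OF Mx(1)] less_imp_le[OF Mx(2)]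
          less_imp_le[OF My(1)] less_imp_le[OF My(3)] simp del: mem_ball mem_ball_0)
  qed
  show ?thesis
  proof (rule that[OF arc val])
    show "pathstart p = P.tpt" "pathfinish p = R.tpt" using ends by (simp_all add: pathstart_def pathfinish_def)
    show "path_image p \<subseteq> {z \<in> hyp_plane. mink N1 (uvec z) = k1}" using up(1) cur unfolding path_image_def by blast
    show "path_image p \<subseteq> region \<union> {P.tpt, R.tpt}"
    proof
      fix z assume "z \<in> path_image p"
      then obtain t where t: "t \<in> {0..1}" "z = p t" unfolding path_image_def by blast
      then consider "t = 0" | "t = 1" | "t \<in> {0<..<1}" by fastforce
      then show "z \<in> region \<union> {P.tpt, R.tpt}" using ends reg t by cases auto
    qed
  qed
qed

section \<open>Realisation of prescribed curvatures\<close>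

lemma tangent_triple_exists:
  assumes k: "0 < k1" "0 \<le> k2" "0 \<le> k3"
  obtains N1 N2 N3 where "tangent_triple k1 k2 k3 N1 N2 N3"
    "Im (cnj (tangent_pair.tpt N2 N3 - tangent_pair.tpt N1 N2) * (tangent_pair.tpt N3 N1 - tangent_pair.tpt N1 N2)) > 0"
proof -
  define s where "s = k1 + k2"
  have s: "s > 0" using k by (simp add: s_def)
  define w where "w = tri_w k1 k2 k3"
  have w2: "w\<^sup>2 = 1 + k1 * k2 + k2 * k3 + k3 * k1" and w1: "w \<ge> 1"
    unfolding w_def using tri_w_sq tri_w_ge_1 k by auto
  \<comment> \<open>The first two circles are placed with their tangency point at the origin and
    normals along the real axis. The Gram equations for the third vector are linear in \<beta> and
    \<alpha> and leave a sign for \<gamma>; the negative one is counterclockwise.\<close>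
  define \<beta> \<gamma> \<alpha> where "\<beta> = (k1 - k2) / s" and "\<gamma> = - (2 * w / s)" and "\<alpha> = - k3 - 2 / s"
  have b: "s * \<beta> = k1 - k2" and c: "s * \<gamma> = - 2 * w" and a: "s * \<alpha> = - s * k3 - 2"
  proof -
    have *: "s * (x / s) = x" for x using s by simp
    show "s * \<beta> = k1 - k2" unfolding \<beta>_def by (rule *)
    show "s * \<gamma> = - 2 * w" using *[of "2 * w"] by (simp add: \<gamma>_def)
    show "s * \<alpha> = - s * k3 - 2" using *[of 2] by (simp add: \<alpha>_def algebra_simps)
  qed
  define N1 N2 N3 where "N1 = (Complex 1 0, - k1)" and "N2 = (Complex (-1) 0, - k2)" and "N3 = (Complex \<beta> \<gamma>, \<alpha>)"
  have n1: "mink N1 N1 = 1 - k1\<^sup>2" and n2: "mink N2 N2 = 1 - k2\<^sup>2" and n12: "mink N1 N2 = -1 - k1 * k2"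
    by (simp_all add: N1_def N2_def mink_def power2_eq_square)
  have solve: "m = c" if "r * m = r * c" "r \<noteq> 0" for m c r :: real using that by simp
  have n3: "mink N3 N3 = 1 - k3\<^sup>2"
  proof (rule solve)
    have "s\<^sup>2 * mink N3 N3 = (s * \<beta>)\<^sup>2 + (s * \<gamma>)\<^sup>2 - (s * \<alpha>)\<^sup>2"
      by (simp add: N3_def mink_def power2_eq_square algebra_simps)
    also have "\<dots> = s\<^sup>2 * (1 - k3\<^sup>2)" unfolding a b c using w2 s_def by algebra
    finally show "s\<^sup>2 * mink N3 N3 = s\<^sup>2 * (1 - k3\<^sup>2)" .
  qed (use s in simp)
  have n13: "mink N3 N1 = -1 - k3 * k1"
  proof (rule solve)
    have "s * mink N3 N1 = s * \<beta> + k1 * (s * \<alpha>)" by (simp add: N3_def N1_def mink_def algebra_simps)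
    also have "\<dots> = s * (-1 - k3 * k1)" unfolding a b using s_def by algebra
    finally show "s * mink N3 N1 = s * (-1 - k3 * k1)" .
  qed (use s in simp)
  have n23: "mink N2 N3 = -1 - k2 * k3"
  proof (rule solve)
    have "s * mink N2 N3 = - (s * \<beta>) + k2 * (s * \<alpha>)" by (simp add: N3_def N2_def mink_def algebra_simps)
    also have "\<dots> = s * (-1 - k2 * k3)" unfolding a b using s_def by algebra
    finally show "s * mink N2 N3 = s * (-1 - k2 * k3)" .
  qed (use s in simp)
  have sq: "1 - x\<^sup>2 \<le> 0" if "x \<ge> 1" for x :: real using that by simp
  have sn: "snd N1 = - k1" "snd N2 = - k2" "snd N3 = - k3 - 2 / s" by (simp_all add: N1_def N2_def N3_def \<alpha>_def)
  have s2: "2 / s > 0" using s by simp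
  have fc: "fcausal (- N)" if "mink N N = 1 - x\<^sup>2" "x \<ge> 1" "snd N \<le> - x" for N x
    using that sq[of x] by (simp add: fcausal_def)
  have f: "k1 \<ge> 1 \<Longrightarrow> fcausal (- N1)" "k2 \<ge> 1 \<Longrightarrow> fcausal (- N2)" "k3 \<ge> 1 \<Longrightarrow> fcausal (- N3)"
    using fc[OF n1] fc[OF n2] fc[OF n3] sn s2 by auto
  have fs: "fcausal (- (N + M))" if "mink N N = 1 - x\<^sup>2" "mink M M = 1 - y\<^sup>2" "mink N M = -1 - x * y" "snd N + snd M < 0" for N M x y
  proof -
    have "mink (- (N + M)) (- (N + M)) = - (x + y)\<^sup>2"
      using that mink_commute[of M N] by (simp add: power2_eq_square algebra_simps)
    then show ?thesis using that(4) unfolding fcausal_def by simp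
  qed
  have f12: "fcausal (- (N1 + N2))" and f23: "fcausal (- (N2 + N3))" and f31: "fcausal (- (N3 + N1))"
  proof -
    have "snd N1 + snd N2 < 0" "snd N2 + snd N3 < 0" "snd N3 + snd N1 < 0"
      using sn s2 k by linarith+
    then show "fcausal (- (N1 + N2))" "fcausal (- (N2 + N3))" "fcausal (- (N3 + N1))"
      using fs[OF n1 n2 n12] fs[OF n2 n3 n23] fs[OF n3 n1 n13] by blast+
  qed
  have p12: "tangent_pair k1 k2 N1 N2" by unfold_locales (use k n1 n2 n12 f f12 in auto)
  have p23: "tangent_pair k2 k3 N2 N3" by unfold_locales (use k n2 n3 n23 f f23 in auto)
  have p31: "tangent_pair k3 k1 N3 N1" by unfold_locales (use k n3 n1 n13 f f31 in auto)
  have t12: "tangent_pair.tpt N1 N2 = 0"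
    unfolding tangent_pair.tpt_def[OF p12] hpr_def by (simp add: N1_def N2_def complex_eq_iff)
  have pos: "\<exists>r>0. hpr X = r *\<^sub>R fst X" if "fcausal X" for X
    using hpr_props(1)[OF that] unfolding hpr_def by (metis positive_imp_inverse_positive)
  obtain r where r: "r > 0" "tangent_pair.tpt N2 N3 = r *\<^sub>R fst (- (N2 + N3))"
    using pos[OF f23] tangent_pair.tpt_def[OF p23] by auto
  obtain q where q: "q > 0" "tangent_pair.tpt N3 N1 = q *\<^sub>R fst (- (N3 + N1))"
    using pos[OF f31] tangent_pair.tpt_def[OF p31] by auto
  have "Im (cnj (tangent_pair.tpt N2 N3 - tangent_pair.tpt N1 N2) * (tangent_pair.tpt N3 N1 - tangent_pair.tpt N1 N2)) = r * q * (- 2 * \<gamma>)"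
    unfolding t12 r(2) q(2) by (simp add: N1_def N2_def N3_def algebra_simps)
  moreover have "- 2 * \<gamma> > 0" using w1 s by (simp add: \<gamma>_def)
  ultimately have "Im (cnj (tangent_pair.tpt N2 N3 - tangent_pair.tpt N1 N2) * (tangent_pair.tpt N3 N1 - tangent_pair.tpt N1 N2)) > 0"
    using r q by (metis mult_pos_pos)
  with tangent_triple.intro[OF p12 p23 p31] show ?thesis by (rule that)
qed

lemma cp_arc_length_exists:
  assumes k: "0 < k1" "0 \<le> k2" "0 \<le> k3" shows "\<exists>l. cp_arc_length k1 k2 k3 l"
proof -
  obtain N1 N2 N3 where tri: "tangent_triple k1 k2 k3 N1 N2 N3"
    and im: "Im (cnj (tangent_pair.tpt N2 N3 - tangent_pair.tpt N1 N2) * (tangent_pair.tpt N3 N1 - tangent_pair.tpt N1 N2)) > 0"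
    using tangent_triple_exists[OF k] .
  interpret T: tangent_triple k1 k2 k3 N1 N2 N3 by (fact tri)
  interpret T2: tangent_triple k2 k3 k1 N2 N3 N1 by (rule T.rot)
  interpret T3: tangent_triple k3 k1 k2 N3 N1 N2 by (rule T2.rot)
  interpret P12: tangent_pair k1 k2 N1 N2 by (rule T.p12)
  interpret P23: tangent_pair k2 k3 N2 N3 by (rule T.p23)
  interpret P31: tangent_pair k3 k1 N3 N1 by (rule T.p31)
  obtain C1 where C1: "gen_circle k1 C1" "gc_rep k1 C1 N1" using gen_circle_of_vec[OF P12.k(1) P12.n1 P12.f1] by blast
  obtain C2 where C2: "gen_circle k2 C2" "gc_rep k2 C2 N2" using gen_circle_of_vec[OF P23.k(1) P23.n1 P23.f1] by blast
  obtain C3 where C3: "gen_circle k3 C3" "gc_rep k3 C3 N3" using gen_circle_of_vec[OF P31.k(1) P31.n1 P31.f1] by blast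
  obtain p where p: "arc p" "valid_path p" "pathstart p = P12.tpt" "pathfinish p = P31.tpt"
    "path_image p \<subseteq> {z \<in> hyp_plane. mink N1 (uvec z) = k1}" "path_image p \<subseteq> T.region \<union> {P12.tpt, P31.tpt}"
    using T.arc_exists[OF k(1)] .
  note E = P12.cp_edge_seg[OF C1(2) C2(2)] P23.cp_edge_seg[OF C2(2) C3(2)] P31.cp_edge_seg[OF C3(2) C1(2)]
  have tr: "cp_triangle k1 k2 k3 C1 C2 C3 P12.tpt P23.tpt P31.tpt (T.bdry \<union> inside T.bdry)"
    unfolding cp_triangle_def Let_def
    by (intro conjI C1(1) C2(1) C3(1) im exI) (fact P12.ext_tangent_tpt[OF C1(2) C2(2)] P23.ext_tangent_tpt[OF C2(2) C3(2)]
      P31.ext_tangent_tpt[OF C3(2) C1(2)] E T.cp_vertex_vtx[OF C1(2)] T2.cp_vertex_vtx[OF C2(2)] T3.cp_vertex_vtx[OF C3(2)]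
      | simp only: T.bdry_def)+
  have "P12.tpt \<in> T.bdry" "P31.tpt \<in> T.bdry"
  proof -
    have "t \<in> e" if "cp_edge a C b D t x y e" for a C b D t x y e
      using that unfolding cp_edge_def by (auto split: if_splits)
    then show "P12.tpt \<in> T.bdry" "P31.tpt \<in> T.bdry" using E unfolding T.bdry_def by blast+
  qed
  then have "path_image p \<subseteq> curve C1 \<inter> (T.bdry \<union> inside T.bdry)"
    using p(5,6) T.region_inside C1(2) unfolding gc_rep_def by blast
  then have "cp_arc_length k1 k2 k3 (hlength p)"
    unfolding cp_arc_length_def using tr p by blast
  then show ?thesis ..
qed

definition arc_int :: "real \<Rightarrow> real \<Rightarrow> real \<Rightarrow> real" where
  "arc_int k1 k2 k3 = integral {0..1 / tri_w k1 k2 k3} (\<lambda>x. 2 / (1 + (k1\<^sup>2 - 1) * x\<^sup>2))"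

text \<open>Existence and uniqueness of the arc length make \<open>THE\<close> meaningful. The
  geometry enters the analysis of the flow through this formula alone.\<close>

theorem tri_curv_eq:
  assumes "0 \<le> k1" "0 \<le> k2" "0 \<le> k3"
  shows "tri_curv k1 k2 k3 = k1 * arc_int k1 k2 k3"
proof (cases "k1 = 0")
  case False
  then have k: "0 < k1" using assms by simp
  obtain l where l: "cp_arc_length k1 k2 k3 l" using cp_arc_length_exists[OF k assms(2,3)] by blast
  have "(THE l. cp_arc_length k1 k2 k3 l) = arc_int k1 k2 k3"
    using cp_arc_length_unique[OF _ k] l unfolding arc_int_def by (metis the_equality)
  then show ?thesis using False by (simp add: tri_curv_def)
qed (simp add: tri_curv_def)

section \<open>Curvatures of a single triangle\<close>

definition ctri :: "real \<Rightarrow> real \<Rightarrow> real \<Rightarrow> real" where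
  "ctri a b c = a * arc_int a b c"

lemma tri_w_sym: "tri_w a b c = tri_w a c b" "tri_w b c a = tri_w a b c" "tri_w c a b = tri_w a b c"
  by (simp_all add: tri_w_def algebra_simps)

lemma ctri_sym: "ctri a b c = ctri a c b"
  by (simp add: ctri_def arc_int_def tri_w_sym(1))

lemma arc_den_pos:
  fixes a x :: real assumes "a > 0" "0 \<le> x" "x \<le> 1"
  shows "1 + (a\<^sup>2 - 1) * x\<^sup>2 > 0"
proof -
  have x2: "x\<^sup>2 \<le> 1" using assms by (simp add: power_le_one)
  have "1 + (a\<^sup>2 - 1) * x\<^sup>2 = (1 - x\<^sup>2) + a\<^sup>2 * x\<^sup>2" by (simp add: algebra_simps)
  moreover have "0 \<le> a\<^sup>2 * x\<^sup>2" by simp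
  moreover have "x \<noteq> 0 \<Longrightarrow> 0 < a\<^sup>2 * x\<^sup>2" using assms by simp
  ultimately show ?thesis using x2 by (cases "x = 0") (auto intro: add_nonneg_pos)
qed

lemma arc_cont: "a > 0 \<Longrightarrow> continuous_on {0..1} (\<lambda>x. 2 / (1 + (a\<^sup>2 - 1) * x\<^sup>2) :: real)"
  using arc_den_pos[of a] by (intro continuous_intros) fastforce

lemma arc_int_on: "a > 0 \<Longrightarrow> 0 \<le> y \<Longrightarrow> y \<le> 1 \<Longrightarrow> (\<lambda>x. 2 / (1 + (a\<^sup>2 - 1) * x\<^sup>2) :: real) integrable_on {0..y}"
  by (rule integrable_continuous_real) (rule continuous_on_subset[OF arc_cont], auto)

lemma inv_w: "0 \<le> a \<Longrightarrow> 0 \<le> b \<Longrightarrow> 0 \<le> c \<Longrightarrow> 0 < 1 / tri_w a b c \<and> 1 / tri_w a b c \<le> 1"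
  using tri_w_ge_1[of a b c] by simp

lemma integral_pos:
  fixes f :: "real \<Rightarrow> real"
  assumes "y > 0" "continuous_on {0..y} f" "\<And>x. x \<in> {0..y} \<Longrightarrow> f x \<ge> 0" "\<And>x. x \<in> {0<..<y} \<Longrightarrow> f x > 0"
  shows "integral {0..y} f > 0"
proof -
  have int: "f integrable_on {0..y}" by (rule integrable_continuous_real[OF assms(2)])
  have "integral {0..y} f \<noteq> 0"
  proof
    assume "integral {0..y} f = 0"
    then have "(f has_integral 0) (cbox 0 y)" using int by (simp add: has_integral_integral)
    then have "f (y / 2) = 0"
      using assms by (intro has_integral_0_cbox_imp_0[of 0 y f "y / 2"]) auto
    then show False using assms(1) assms(4)[of "y / 2"] by simp
  qed
  moreover have "integral {0..y} f \<ge> 0" by (rule integral_nonneg[OF int assms(3)])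
  ultimately show ?thesis by linarith
qed

lemma ctri_zero [simp]: "ctri 0 b c = 0"
  by (simp add: ctri_def)

lemma ctri_pos: assumes "a > 0" "b \<ge> 0" "c \<ge> 0" shows "ctri a b c > 0"
proof -
  have w: "0 < 1 / tri_w a b c" "1 / tri_w a b c \<le> 1" using inv_w[of a b c] assms by auto
  have "arc_int a b c > 0" unfolding arc_int_def
  proof (rule integral_pos[OF w(1)])
    show "continuous_on {0..1 / tri_w a b c} (\<lambda>x. 2 / (1 + (a\<^sup>2 - 1) * x\<^sup>2))"
      by (rule continuous_on_subset[OF arc_cont]) (use assms w in auto)
  next
    fix x assume "x \<in> {0..1 / tri_w a b c}"
    then have "0 \<le> x" "x \<le> 1" using w(2) by (simp, metis atLeastAtMost_iff order_trans)
    then have "1 + (a\<^sup>2 - 1) * x\<^sup>2 > 0" by (intro arc_den_pos assms)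
    then show "2 / (1 + (a\<^sup>2 - 1) * x\<^sup>2) \<ge> 0" by simp
  next
    fix x assume "x \<in> {0<..<1 / tri_w a b c}"
    then have "0 \<le> x" "x \<le> 1" using w(2) by (simp, metis greaterThanLessThan_iff order_trans less_imp_le)
    then have "1 + (a\<^sup>2 - 1) * x\<^sup>2 > 0" by (intro arc_den_pos assms)
    then show "2 / (1 + (a\<^sup>2 - 1) * x\<^sup>2) > 0" by simp
  qed
  then show ?thesis using assms by (simp add: ctri_def)
qed

lemma ctri_nonneg: assumes "a \<ge> 0" "b \<ge> 0" "c \<ge> 0" shows "ctri a b c \<ge> 0"
  using ctri_pos[of a b c] assms by (cases "a = 0") auto

lemma tri_w_mono: "0 \<le> a \<Longrightarrow> 0 \<le> b \<Longrightarrow> 0 \<le> c \<Longrightarrow> b \<le> b' \<Longrightarrow> tri_w a b c \<le> tri_w a b' c"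
  unfolding tri_w_def by (intro real_sqrt_le_mono add_mono mult_left_mono mult_right_mono) auto

lemma ctri_antimono:
  assumes "0 \<le> a" "0 \<le> b" "0 \<le> c" "b \<le> b'" shows "ctri a b' c \<le> ctri a b c"
proof (cases "a = 0")
  case False
  then have a: "a > 0" using assms by simp
  have w: "0 < 1 / tri_w a b c" "1 / tri_w a b c \<le> 1" "0 < 1 / tri_w a b' c" "1 / tri_w a b' c \<le> 1"
    using inv_w[of a b c] inv_w[of a b' c] assms by auto
  have "1 / tri_w a b' c \<le> 1 / tri_w a b c"
    using tri_w_mono[OF assms] tri_w_ge_1[OF assms(1-3)] by (intro divide_left_mono) auto
  moreover have "2 / (1 + (a\<^sup>2 - 1) * x\<^sup>2) \<ge> 0" if "x \<in> {0..1 / tri_w a b c}" for x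
  proof -
    have "0 \<le> x" "x \<le> 1" using that w(2) by (simp, metis atLeastAtMost_iff order_trans)
    then show ?thesis using arc_den_pos[OF a, of x] by (simp add: less_imp_le)
  qed
  ultimately have "arc_int a b' c \<le> arc_int a b c" unfolding arc_int_def
    by (intro integral_subset_le arc_int_on a less_imp_le[OF w(1)] less_imp_le[OF w(3)] w(2,4)) auto
  then show ?thesis unfolding ctri_def using assms by (intro mult_left_mono)
qed simp

section \<open>Derivatives of the curvatures of a triangle\<close>

lemma arc_upper_deriv:
  assumes a: "a > 0" and y: "0 < y" "y < 1"
  shows "((\<lambda>y. integral {0..y} (\<lambda>x. 2 / (1 + (a\<^sup>2 - 1) * x\<^sup>2))) has_real_derivative (2 / (1 + (a\<^sup>2 - 1) * y\<^sup>2))) (at y)"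
proof -
  have "((\<lambda>y. integral {0..y} (\<lambda>x. 2 / (1 + (a\<^sup>2 - 1) * x\<^sup>2))) has_real_derivative (2 / (1 + (a\<^sup>2 - 1) * y\<^sup>2))) (at y within {0..1})"
    by (rule integral_has_real_derivative[OF arc_cont[OF a]]) (use y in auto)
  moreover have "at y within {0..1} = at y" by (rule at_within_interior) (use y in auto)
  ultimately show ?thesis by simp
qed

lemma tri_w_gt_1: "0 < a \<Longrightarrow> 0 < b \<Longrightarrow> 0 \<le> c \<Longrightarrow> 1 < tri_w a b c"
  unfolding tri_w_def by (simp add: add_pos_nonneg)

lemma tri_w_deriv:
  assumes "0 < a" "0 \<le> b" "0 \<le> c"
  shows "((\<lambda>a. tri_w a b c) has_real_derivative ((b + c) / (2 * tri_w a b c))) (at a)"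
proof -
  have p: "1 + a * b + b * c + c * a > 0" using assms by (simp add: add_pos_nonneg)
  have d: "((\<lambda>a. 1 + a * b + b * c + c * a) has_real_derivative (b + c)) (at a)"
    by (auto intro!: derivative_eq_intros)
  have e: "inverse r / 2 * y = y / (2 * r)" for r y :: real by (cases "r = 0") (simp_all add: field_simps)
  show ?thesis unfolding tri_w_def
    by (rule DERIV_cong[OF DERIV_chain2[OF DERIV_real_sqrt[OF p] d] e])
qed

text \<open>Only the upper limit \<open>1 / w\<close> of the integral depends on \<open>a\<close>.
  Because \<open>w\<^sup>2 + b\<^sup>2 - 1\<close> factors as \<open>(a + b) * (b + c)\<close>, the
  factor \<open>b + c\<close> cancels and \<open>c\<close> remains only inside
  \<open>w\<close>.\<close>

lemma ctri_deriv_other: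
  assumes a: "0 < a" and b: "0 < b" and c: "0 \<le> c"
  shows "((\<lambda>a. ctri b c a) has_real_derivative (- b / (tri_w a b c * (a + b)))) (at a)"
proof -
  define w where "w = tri_w a b c"
  have w: "w > 1" unfolding w_def by (rule tri_w_gt_1[OF a b c])
  have w2: "w\<^sup>2 = 1 + a * b + b * c + c * a" unfolding w_def using tri_w_sq a b c by simp
  have y: "0 < 1 / w" "1 / w < 1" using w by auto
  have dw: "((\<lambda>a. 1 / tri_w a b c) has_real_derivative (- ((b + c) / (2 * w)) / w\<^sup>2)) (at a)"
    using w by (auto intro!: derivative_eq_intros tri_w_deriv a c less_imp_le[OF b] simp: w_def[symmetric] power2_eq_square)
  have P: "w\<^sup>2 + (b\<^sup>2 - 1) = (a + b) * (b + c)" unfolding w2 by algebra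
  have "((\<lambda>a. integral {0..1 / tri_w a b c} (\<lambda>x. 2 / (1 + (b\<^sup>2 - 1) * x\<^sup>2))) has_real_derivative
    (2 / (1 + (b\<^sup>2 - 1) * (1 / w)\<^sup>2) * (- ((b + c) / (2 * w)) / w\<^sup>2))) (at a)"
    using DERIV_chain2[OF arc_upper_deriv[OF b y, unfolded w_def] dw] by (simp add: w_def)
  moreover have "2 / (1 + (b\<^sup>2 - 1) * (1 / w)\<^sup>2) * (- ((b + c) / (2 * w)) / w\<^sup>2) = - 1 / (w * (a + b))"
  proof -
    have "1 + (b\<^sup>2 - 1) * (1 / w)\<^sup>2 = (w\<^sup>2 + (b\<^sup>2 - 1)) / w\<^sup>2" using w by (simp add: field_simps)
    then have e: "1 + (b\<^sup>2 - 1) * (1 / w)\<^sup>2 = ((a + b) * (b + c)) / w\<^sup>2" unfolding P .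
    have "2 / ((p * q) / v) * (- (q / (2 * u)) / v) = - 1 / (u * p)" if "p > 0" "q > 0" "u > 0" "v > 0" for p q u v :: real
      using that by (simp add: field_simps)
    from this[of "a + b" "b + c" w "w\<^sup>2"] show ?thesis unfolding e using a b c w by simp
  qed
  ultimately have "((\<lambda>a. integral {0..1 / tri_w a b c} (\<lambda>x. 2 / (1 + (b\<^sup>2 - 1) * x\<^sup>2))) has_real_derivative (- 1 / (w * (a + b)))) (at a)"
    by (simp only:)
  then have "((\<lambda>a. b * integral {0..1 / tri_w a b c} (\<lambda>x. 2 / (1 + (b\<^sup>2 - 1) * x\<^sup>2))) has_real_derivative b * (- 1 / (w * (a + b)))) (at a)"
    by (rule DERIV_cmult)
  moreover have "(\<lambda>a. ctri b c a) = (\<lambda>a. b * integral {0..1 / tri_w a b c} (\<lambda>x. 2 / (1 + (b\<^sup>2 - 1) * x\<^sup>2)))"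
    by (simp add: ctri_def arc_int_def tri_w_sym(2))
  ultimately show ?thesis by (simp add: w_def)
qed

text \<open>The arc integral with \<open>w\<close> as an independent variable. It is differentiated
  along two different functions \<open>w = W a\<close>: one for a single varying curvature, one for
  a common scaling.\<close>

definition arcw :: "real \<Rightarrow> real \<Rightarrow> real" where
  "arcw a w = integral {0..1 / w} (\<lambda>x. 2 / (1 + (a\<^sup>2 - 1) * x\<^sup>2))"

lemma ctri_arcw: "ctri a b c = a * arcw a (tri_w a b c)"
  by (simp add: ctri_def arc_int_def arcw_def)

text \<open>Moves the dependence on \<open>w\<close> from the limit into the integrand, so that one
  can differentiate under the integral over a fixed interval.\<close>

lemma arcw_rescale:
  assumes a: "0 < a" and w: "w \<ge> 1"
  shows "arcw a w = integral {0..1} (\<lambda>s. 2 * w / (w\<^sup>2 + (a\<^sup>2 - 1) * s\<^sup>2))"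
proof -
  define f where "f = (\<lambda>x::real. 2 / (1 + (a\<^sup>2 - 1) * x\<^sup>2))"
  have "f integrable_on {0..1 / w}" unfolding f_def using arc_int_on[OF a] w by simp
  then have "(f has_integral arcw a w) {0..1 / w}"
    unfolding arcw_def f_def[symmetric] by (simp add: has_integral_integral)
  from has_integral_stretch_real[OF this, of "1 / w"] w
  have "((\<lambda>s. f (1 / w * s)) has_integral w * arcw a w) ((\<lambda>x. x / (1 / w)) ` {0..1 / w})" by simp
  moreover have "(\<lambda>x. x / (1 / w)) ` {0..1 / w} = {0..1}"
    using w image_divide_atLeastAtMost[of "1 / w" 0 "1 / w"] by simp
  ultimately have "((\<lambda>s. f (1 / w * s)) has_integral w * arcw a w) {0..1}" by simp
  from has_integral_mult_right[OF this, of "1 / w"] w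
  have "((\<lambda>s. 1 / w * f (1 / w * s)) has_integral arcw a w) {0..1}" by simp
  moreover have "1 / w * f (1 / w * s) = 2 * w / (w\<^sup>2 + (a\<^sup>2 - 1) * s\<^sup>2)" for s
  proof -
    have "1 + (a\<^sup>2 - 1) * (1 / w * s)\<^sup>2 = (w\<^sup>2 + (a\<^sup>2 - 1) * s\<^sup>2) / w\<^sup>2"
      using w by (simp add: power_divide add_divide_distrib)
    then have "1 / w * f (1 / w * s) = 1 / w * (2 / ((w\<^sup>2 + (a\<^sup>2 - 1) * s\<^sup>2) / w\<^sup>2))" by (simp only: f_def)
    then show ?thesis using w by (simp add: power2_eq_square)
  qed
  ultimately show ?thesis by (simp add: integral_unique)
qed

lemma den_pos:
  fixes a w s :: real assumes "a > 0" "w \<ge> 1" "0 \<le> s" "s \<le> 1"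
  shows "w\<^sup>2 + (a\<^sup>2 - 1) * s\<^sup>2 > 0"
proof -
  have "1 \<le> w\<^sup>2" using assms by simp
  then show ?thesis using arc_den_pos[OF assms(1,3,4)] by linarith
qed

text \<open>By Gauss-Bonnet \<open>csum\<close>, the sum of the three curvatures, is pi minus the
  area of the gap between the circles; this is the rate at which that area shrinks when one
  curvature grows.\<close>

definition darea :: "real \<Rightarrow> real \<Rightarrow> real" where
  "darea a w = integral {0..1} (\<lambda>s. 2 * s\<^sup>2 / (w * (w\<^sup>2 + (a\<^sup>2 - 1) * s\<^sup>2)))"

lemma darea_cont:
  fixes a w :: real
  assumes "0 < a" "w \<ge> 1"
  shows "continuous_on {0..1} (\<lambda>s. 2 * s\<^sup>2 / (w * (w\<^sup>2 + (a\<^sup>2 - 1) * s\<^sup>2)))"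
proof -
  have "w * (w\<^sup>2 + (a\<^sup>2 - 1) * s\<^sup>2) \<noteq> 0" if "s \<in> {0..1}" for s
    using den_pos[OF assms, of s] that assms(2) by auto
  then show ?thesis by (intro continuous_intros) blast
qed

lemma darea_pos:
  assumes "0 < a" "w \<ge> 1" shows "darea a w > 0"
proof -
  have d: "w * (w\<^sup>2 + (a\<^sup>2 - 1) * s\<^sup>2) > 0" if "s \<in> {0..1}" for s
    using den_pos[OF assms, of s] that assms(2) by (intro mult_pos_pos) auto
  show ?thesis unfolding darea_def
  proof (rule integral_pos[OF _ darea_cont[OF assms]])
    fix s :: real assume "s \<in> {0..1}"
    from d[OF this] show "0 \<le> 2 * s\<^sup>2 / (w * (w\<^sup>2 + (a\<^sup>2 - 1) * s\<^sup>2))" by (intro divide_nonneg_pos) auto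
  next
    fix s :: real assume s: "s \<in> {0<..<1}"
    then have "s \<in> {0..1}" by simp
    from d[OF this] s show "0 < 2 * s\<^sup>2 / (w * (w\<^sup>2 + (a\<^sup>2 - 1) * s\<^sup>2))" by (intro divide_pos_pos) auto
  qed simp
qed

text \<open>The integrand of the derivative is that of \<open>darea\<close> plus the exact derivative in \<open>s\<close> of
  \<open>((2 w - 2 a w') s - 2 s^3 / w) / (w^2 + (a^2 - 1) s^2)\<close>.\<close>

lemma arcw_deriv:
  assumes a: "0 < a" and W1: "\<And>x. x > 0 \<Longrightarrow> W x \<ge> 1" and dW: "\<And>x. x > 0 \<Longrightarrow> (W has_real_derivative W' x) (at x)"
    and W'c: "continuous_on {0<..} W'"
  shows "((\<lambda>x. x * arcw x (W x)) has_real_derivative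
    (darea a (W a) + (2 * W a - 2 * a * W' a - 2 / W a) / ((W a)\<^sup>2 + a\<^sup>2 - 1))) (at a)"
proof -
  define D where "D = (\<lambda>a s. (W a)\<^sup>2 + (a\<^sup>2 - 1) * s\<^sup>2)"
  define f where "f = (\<lambda>a s. 2 * a * W a / D a s)"
  define fx where "fx = (\<lambda>a s. ((2 * W a + 2 * a * W' a) * D a s - 2 * a * W a * (2 * W a * W' a + 2 * a * s\<^sup>2)) / (D a s)\<^sup>2)"
  have Dp: "D x s > 0" if "x > 0" "s \<in> {0..1}" for x s unfolding D_def using den_pos[OF that(1) W1[OF that(1)], of s] that by auto
  have df: "((\<lambda>x. f x s) has_real_derivative fx x s) (at x)" if x: "x > 0" and s: "s \<in> {0..1}" for x s
  proof -
    have dD: "((\<lambda>x. D x s) has_real_derivative (2 * W x * W' x + 2 * x * s\<^sup>2)) (at x)"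
      unfolding D_def by (rule derivative_eq_intros dW[OF x] refl | simp)+
    have dn: "((\<lambda>x. 2 * x * W x) has_real_derivative (2 * W x + 2 * x * W' x)) (at x)"
      by (rule derivative_eq_intros dW[OF x] refl | simp)+
    show ?thesis unfolding f_def fx_def power2_eq_square[of "D x s"]
      by (rule DERIV_divide[OF dn dD]) (use Dp[OF x s] in simp)
  qed
  have ceq: "x * arcw x (W x) = integral (cbox 0 1) (f x)" if "x > 0" for x
  proof -
    have "f x = (\<lambda>s. x * (2 * W x / D x s))" by (simp add: f_def fun_eq_iff)
    then have "integral (cbox 0 1) (f x) = x * integral (cbox 0 1) (\<lambda>s. 2 * W x / D x s)" by (simp only: integral_mult_right)
    then show ?thesis unfolding arcw_rescale[OF that W1[OF that]] D_def by simp
  qed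
  have L: "((\<lambda>x. integral (cbox 0 1) (f x)) has_real_derivative integral (cbox 0 1) (fx a)) (at a within {0<..})"
  proof (rule leibniz_rule_field_derivative)
    fix x t :: real assume "x \<in> {0<..}" "t \<in> cbox 0 1"
    then show "((\<lambda>x. f x t) has_field_derivative fx x t) (at x within {0<..})"
      using df by (auto intro: has_field_derivative_at_within)
  next
    fix x :: real assume x: "x \<in> {0<..}"
    have "continuous_on (cbox 0 1) (f x)" unfolding f_def D_def
      using Dp[of x] x by (intro continuous_intros) (force simp: D_def)
    then show "f x integrable_on cbox 0 1" by (rule integrable_continuous)
  next
    have "continuous_on {0<..} W" using dW by (auto intro!: continuous_at_imp_continuous_on DERIV_isCont)
    then have cW: "continuous_on ({0<..} \<times> cbox 0 1) (\<lambda>x. W (fst x))"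
      by (rule continuous_on_compose2) (auto intro!: continuous_intros)
    have cW': "continuous_on ({0<..} \<times> cbox 0 1) (\<lambda>x. W' (fst x))"
      using W'c by (rule continuous_on_compose2) (auto intro!: continuous_intros)
    have "D (fst x) (snd x) \<noteq> 0" if "x \<in> {0<..} \<times> cbox 0 1" for x
      using Dp[of "fst x" "snd x"] that by auto
    then show "continuous_on ({0<..} \<times> cbox 0 1) (\<lambda>(x, t). fx x t)"
      unfolding fx_def split_beta D_def by (intro continuous_intros cW cW') auto
  qed (use a in auto)
  have "((\<lambda>x. x * arcw x (W x)) has_real_derivative integral (cbox 0 1) (fx a)) (at a within {0<..})"
    by (rule has_field_derivative_transform_within[OF L zero_less_one]) (use a ceq in auto)
  moreover have "at a within {0<..} = at a" by (rule at_within_open) (use a in auto)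
  ultimately have d: "((\<lambda>x. x * arcw x (W x)) has_real_derivative integral {0..1} (fx a)) (at a)" by simp
  define w w' where "w = W a" and "w' = W' a"
  have w: "w \<ge> 1" unfolding w_def by (rule W1[OF a])
  define G where "G = (\<lambda>s. ((2 * w - 2 * a * w') * s - 2 * s ^ 3 / w) / D a s)"
  define G' where "G' = (\<lambda>s. (((2 * w - 2 * a * w') - 6 * s\<^sup>2 / w) * D a s - ((2 * w - 2 * a * w') * s - 2 * s ^ 3 / w) * (2 * (a\<^sup>2 - 1) * s)) / (D a s)\<^sup>2)"
  have dG: "(G has_real_derivative G' s) (at s)" if s: "s \<in> {0..1}" for s
  proof -
    have d1: "(D a has_real_derivative (2 * (a\<^sup>2 - 1) * s)) (at s)"
      unfolding D_def by (rule derivative_eq_intros refl | simp)+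
    have d2: "((\<lambda>s. (2 * w - 2 * a * w') * s - 2 * s ^ 3 / w) has_real_derivative ((2 * w - 2 * a * w') - 6 * s\<^sup>2 / w)) (at s)"
      using w by (auto intro!: derivative_eq_intros)
    show ?thesis unfolding G_def G'_def power2_eq_square[of "D a s"]
      by (rule DERIV_divide[OF d2 d1]) (use Dp[OF a s] in simp)
  qed
  have "(G' has_integral (G 1 - G 0)) {0..1}"
    by (rule fundamental_theorem_of_calculus)
      (auto simp: has_real_derivative_iff_has_vector_derivative[symmetric] intro!: has_field_derivative_at_within dG)
  moreover have "((\<lambda>s. 2 * s\<^sup>2 / (w * D a s)) has_integral darea a w) {0..1}"
    using integrable_continuous_real[OF darea_cont[OF a w]]
    unfolding darea_def D_def w_def by (simp add: has_integral_integral)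
  ultimately have "((\<lambda>s. 2 * s\<^sup>2 / (w * D a s) + G' s) has_integral (darea a w + (G 1 - G 0))) {0..1}"
    using has_integral_add by blast
  moreover have "2 * s\<^sup>2 / (w * D a s) + G' s = fx a s" if s: "s \<in> {0..1}" for s
  proof -
    define d where "d = D a s"
    have d: "d > 0" "d = w\<^sup>2 + (a\<^sup>2 - 1) * s\<^sup>2" using Dp[OF a s] by (auto simp: d_def D_def w_def)
    have wi: "w * (1 / w) = 1" using w by simp
    define v where "v = 1 / w"
    have wv: "w * v = 1" using w by (simp add: v_def)
    have 1: "2 * s\<^sup>2 / (w * d) = (2 * s\<^sup>2 * v * d) / d\<^sup>2" using d(1) w by (simp add: v_def power2_eq_square)
    have dv: "6 * s\<^sup>2 / w = 6 * s\<^sup>2 * v" "2 * s ^ 3 / w = 2 * s ^ 3 * v" by (simp_all add: v_def)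
    \<comment> \<open>With denominators cleared and \<open>v\<close> for \<open>1 / w\<close>, the
      claim is a polynomial identity modulo \<open>w * v = 1\<close>.\<close>
    have key: "2 * s\<^sup>2 * v * d + (((2 * w - 2 * a * w') - 6 * s\<^sup>2 * v) * d - ((2 * w - 2 * a * w') * s - 2 * s ^ 3 * v) * (2 * (a\<^sup>2 - 1) * s))
      = (2 * w + 2 * a * w') * d - 2 * a * w * (2 * w * w' + 2 * a * s\<^sup>2)"
      using wv unfolding d(2) by algebra
    show ?thesis unfolding G'_def fx_def d_def[symmetric] 1 w_def[symmetric] w'_def[symmetric] dv
      by (simp only: add_divide_distrib[symmetric] key)
  qed
  ultimately have "(fx a has_integral (darea a w + (G 1 - G 0))) {0..1}"
    using has_integral_cong[of "{0..1}" "\<lambda>s. 2 * s\<^sup>2 / (w * D a s) + G' s" "fx a"] by blast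
  then have I: "integral {0..1} (fx a) = darea a w + (G 1 - G 0)" by (rule integral_unique)
  have "D a 1 = w\<^sup>2 + a\<^sup>2 - 1" unfolding D_def w_def[symmetric] by simp
  then have "G 1 - G 0 = (2 * w - 2 * a * w' - 2 / w) / (w\<^sup>2 + a\<^sup>2 - 1)" by (simp add: G_def)
  then show ?thesis using d unfolding I w_def w'_def by simp
qed

text \<open>The boundary term of \<open>arcw_deriv\<close> simplifies since
  \<open>w\<^sup>2 + a\<^sup>2 - 1 = (a + b) * (a + c)\<close>. Its two summands are the negatives
  of the derivatives of the other two curvatures.\<close>

lemma ctri_deriv_own:
  assumes a: "0 < a" and b: "0 \<le> b" and c: "0 \<le> c"
  shows "((\<lambda>a. ctri a b c) has_real_derivative
    (darea a (tri_w a b c) + (b / (a + b) + c / (a + c)) / tri_w a b c)) (at a)"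
proof -
  define W where "W = (\<lambda>a. tri_w a b c)"
  define W' where "W' = (\<lambda>a. (b + c) / (2 * W a))"
  have W1: "W x \<ge> 1" if "x > 0" for x unfolding W_def using tri_w_ge_1 that b c by simp
  have dW: "(W has_real_derivative W' x) (at x)" if "x > 0" for x
    unfolding W_def W'_def using tri_w_deriv[OF that b c] by (simp add: W_def)
  have "continuous_on {0<..} W" using dW by (auto intro!: continuous_at_imp_continuous_on DERIV_isCont)
  moreover have "2 * W x \<noteq> 0" if "x > 0" for x using W1[OF that] by simp
  ultimately have c': "continuous_on {0<..} W'" unfolding W'_def by (intro continuous_intros) auto
  define w w' where "w = W a" and "w' = W' a"
  have w: "w \<ge> 1" unfolding w_def by (rule W1[OF a])
  have ww': "2 * w * w' = b + c" using w by (simp add: w'_def W'_def w_def)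
  have w2: "w\<^sup>2 = 1 + a * b + b * c + c * a" unfolding w_def W_def using tri_w_sq a b c by simp
  have "(2 * w - 2 * a * w' - 2 / w) / (w\<^sup>2 + a\<^sup>2 - 1) = (b / (a + b) + c / (a + c)) / w"
  proof -
    have P: "w\<^sup>2 + a\<^sup>2 - 1 = (a + b) * (a + c)" unfolding w2 by algebra
    have "w * (2 * w - 2 * a * w' - 2 / w) = 2 * w\<^sup>2 - a * (b + c) - 2"
      using w unfolding ww'[symmetric] by (simp add: algebra_simps power2_eq_square)
    also have "\<dots> = b * (a + c) + c * (a + b)" unfolding w2 by algebra
    finally have n: "2 * w - 2 * a * w' - 2 / w = (b * (a + c) + c * (a + b)) / w"
      using w by (metis nonzero_mult_div_cancel_left not_one_le_zero)
    have "(p * q' + r * p') / u / (p' * q') = (p / p' + r / q') / u" if "p' > 0" "q' > 0" for p q' r p' u :: real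
      using that by (simp add: field_simps)
    from this[of "a + b" "a + c" b c w] show ?thesis using a b c by (simp add: P n)
  qed
  then show ?thesis using arcw_deriv[OF a W1 dW c'] unfolding ctri_arcw w_def w'_def W_def by simp
qed

section \<open>Behaviour at curvature 0 and continuity\<close>

lemma ctri_upper:
  assumes a: "0 < a" "a < 1" and b: "0 \<le> b" "0 \<le> c"
  shows "ctri a b c \<le> - (2 * a * ln (a\<^sup>2)) / (1 - a\<^sup>2)"
proof -
  define q where "q = 1 - a\<^sup>2"
  have a2: "0 < a\<^sup>2" "a\<^sup>2 < 1" using a by (auto simp: power_less_one_iff abs_square_less_1)
  have q: "0 < q" "q < 1" using a2 by (auto simp: q_def)
  have w: "0 < 1 / tri_w a b c" "1 / tri_w a b c \<le> 1" using inv_w[of a b c] a b by auto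
  have nn: "2 / (1 + (a\<^sup>2 - 1) * x\<^sup>2) \<ge> 0" if "x \<in> {0..1}" for x
    using arc_den_pos[OF a(1), of x] that by (simp add: less_imp_le)
  have "arc_int a b c \<le> integral {0..1} (\<lambda>x. 2 / (1 + (a\<^sup>2 - 1) * x\<^sup>2))"
    unfolding arc_int_def
  proof (rule integral_subset_le)
    show "{0..1 / tri_w a b c} \<subseteq> {0..1}" using w by auto
    show "(\<lambda>x. 2 / (1 + (a\<^sup>2 - 1) * x\<^sup>2)) integrable_on {0..1 / tri_w a b c}"
      by (rule arc_int_on[OF a(1) less_imp_le[OF w(1)] w(2)])
    show "(\<lambda>x. 2 / (1 + (a\<^sup>2 - 1) * x\<^sup>2)) integrable_on {0..1}" using arc_int_on[OF a(1), of 1] by simp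
  qed (use nn in blast)
  also have "\<dots> \<le> - (2 * ln (a\<^sup>2)) / q"
  proof (rule has_integral_le)
    show "((\<lambda>x. 2 / (1 + (a\<^sup>2 - 1) * x\<^sup>2)) has_integral integral {0..1} (\<lambda>x. 2 / (1 + (a\<^sup>2 - 1) * x\<^sup>2))) {0..1}"
      using arc_int_on[OF a(1), of 1] by (simp add: has_integral_integral)
    \<comment> \<open>Replacing \<open>x\<^sup>2\<close> by \<open>x\<close> gives a majorant with
      elementary primitive. It is logarithmic in \<open>a\<close>, and the prefactor
      \<open>a\<close> still forces the limit 0.\<close>
    have "((\<lambda>x. 2 / (1 - q * x)) has_integral (- (2 / q) * ln (1 - q * 1) - (- (2 / q) * ln (1 - q * 0)))) {0..1}"
    proof (rule fundamental_theorem_of_calculus)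
      fix x :: real assume x: "x \<in> {0..1}"
      have "q * x \<le> q * 1" using x q by (intro mult_left_mono) auto
      then have p: "1 - q * x > 0" using q by linarith
      have "((\<lambda>x. - (2 / q) * ln (1 - q * x)) has_real_derivative (2 / (1 - q * x))) (at x within {0..1})"
        using p q by (auto intro!: derivative_eq_intros simp: field_simps)
      then show "((\<lambda>x. - (2 / q) * ln (1 - q * x)) has_vector_derivative (2 / (1 - q * x))) (at x within {0..1})"
        by (simp add: has_real_derivative_iff_has_vector_derivative)
    qed simp
    then show "((\<lambda>x. 2 / (1 - q * x)) has_integral (- (2 * ln (a\<^sup>2)) / q)) {0..1}" by (simp add: q_def)
    fix x :: real assume x: "x \<in> {0..1}"
    have "x\<^sup>2 \<le> x" using x by (simp add: power2_eq_square mult_left_le)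
    then have "q * x\<^sup>2 \<le> q * x" using q by simp
    moreover have "q * x \<le> q * 1" using x q by (intro mult_left_mono) auto
    ultimately have le: "1 - q * x > 0" "1 - q * x \<le> 1 - q * x\<^sup>2" using q by linarith+
    have eq: "1 + (a\<^sup>2 - 1) * x\<^sup>2 = 1 - q * x\<^sup>2" by (simp add: q_def algebra_simps)
    show "2 / (1 + (a\<^sup>2 - 1) * x\<^sup>2) \<le> 2 / (1 - q * x)"
      unfolding eq using le by (intro divide_left_mono mult_pos_pos) linarith+
  qed
  finally have "a * arc_int a b c \<le> a * (- (2 * ln (a\<^sup>2)) / q)" using a by (intro mult_left_mono) auto
  also have "\<dots> = - (2 * a * ln (a\<^sup>2)) / (1 - a\<^sup>2)" by (simp add: q_def mult.left_commute mult.assoc)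
  finally show ?thesis by (simp only: ctri_def)
qed

lemma ctri_tendsto_0: assumes "0 \<le> b" "0 \<le> c" shows "((\<lambda>a. ctri a b c) \<longlongrightarrow> 0) (at_right 0)"
proof (rule tendsto_sandwich)
  have ev: "\<forall>\<^sub>F a in at_right (0::real). a \<in> {0<..<1}" by (rule eventually_at_rightI[of 0 1]) auto
  show "\<forall>\<^sub>F a in at_right 0. 0 \<le> ctri a b c"
    using ev by (rule eventually_mono) (use assms ctri_nonneg in auto)
  show "\<forall>\<^sub>F a in at_right 0. ctri a b c \<le> - (2 * a * ln (a\<^sup>2)) / (1 - a\<^sup>2)"
    using ev by (rule eventually_mono) (use assms ctri_upper in auto)
  show "((\<lambda>a. - (2 * a * ln (a\<^sup>2)) / (1 - a\<^sup>2)) \<longlongrightarrow> (0::real)) (at_right 0)" by real_asymp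
qed simp

lemma ctri_cont_own:
  assumes "0 \<le> b" "0 \<le> c" shows "continuous_on {0..} (\<lambda>a. ctri a b c)"
proof (clarsimp simp: continuous_on_eq_continuous_within)
  fix a :: real assume a: "0 \<le> a"
  show "continuous (at a within {0..}) (\<lambda>a. ctri a b c)"
  proof (cases "a = 0")
    case True
    have "at 0 within {0::real..} = at_right 0" by (rule at_within_Ici_at_right)
    then show ?thesis using ctri_tendsto_0[OF assms] True by (simp add: continuous_within)
  next
    case False
    then have "0 < a" using a by simp
    from DERIV_isCont[OF ctri_deriv_own[OF this assms]] show ?thesis by (rule continuous_at_imp_continuous_at_within)
  qed
qed

lemma ctri_cont_other:
  assumes b: "0 \<le> b" and c: "0 \<le> c" shows "continuous_on {0..} (\<lambda>a. ctri b c a)"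
proof (cases "b = 0")
  case False
  then have b: "0 < b" using assms by simp
  have w: "1 \<le> tri_w b c a" if "a \<ge> 0" for a using tri_w_ge_1 that b c by simp
  have "continuous_on {0..} (\<lambda>a. 1 / tri_w b c a)"
    unfolding tri_w_def using b c by (intro continuous_intros) (auto simp: add_nonneg_eq_0_iff)
  moreover have i: "continuous_on {0..1} (\<lambda>y. integral {0..y} (\<lambda>x. 2 / (1 + (b\<^sup>2 - 1) * x\<^sup>2)))"
    by (rule indefinite_integral_continuous_1[OF arc_int_on[OF b]]) auto
  moreover have "(\<lambda>a. 1 / tri_w b c a) ` {0..} \<subseteq> {0..1}"
  proof
    fix y assume "y \<in> (\<lambda>a. 1 / tri_w b c a) ` {0..}"
    then obtain a where a: "0 \<le> a" "y = 1 / tri_w b c a" by auto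
    have "0 < y \<and> y \<le> 1" unfolding a(2) by (rule inv_w) (use a b c in auto)
    then show "y \<in> {0..1}" by simp
  qed
  ultimately have "continuous_on {0..} (\<lambda>a. integral {0..1 / tri_w b c a} (\<lambda>x. 2 / (1 + (b\<^sup>2 - 1) * x\<^sup>2)))"
    by (intro continuous_on_compose2[OF i])
  then show ?thesis unfolding ctri_def arc_int_def by (intro continuous_intros)
qed simp

section \<open>Monotonicity of the sum and of single curvatures\<close>

definition csum :: "real \<Rightarrow> real \<Rightarrow> real \<Rightarrow> real" where
  "csum a b c = ctri a b c + ctri b c a + ctri c a b"

lemma csum_rot: "csum b c a = csum a b c"
  by (simp add: csum_def)

text \<open>The mixed terms of the own derivative cancel against the derivatives of the other two
  curvatures and leave the positive \<open>darea\<close>.\<close>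

lemma csum_deriv:
  assumes a: "0 < a" and b: "0 \<le> b" and c: "0 \<le> c"
  shows "((\<lambda>a. csum a b c) has_real_derivative darea a (tri_w a b c)) (at a)"
proof -
  have w: "tri_w a b c \<ge> 1" using tri_w_ge_1 a b c by simp
  have "((\<lambda>a. ctri b c a) has_real_derivative (- b / (tri_w a b c * (a + b)))) (at a)" if "0 \<le> b" "0 \<le> c" for b c
    using ctri_deriv_other[OF a, of b c] that by (cases "b = 0") auto
  note * = this
  have eq: "ctri c x b = ctri c b x" for x by (rule ctri_sym)
  have c': "((\<lambda>a. ctri c a b) has_real_derivative (- c / (tri_w a c b * (a + c)))) (at a)"
    unfolding eq using *[OF c b] .
  have e: "(darea a (tri_w a b c) + (b / (a + b) + c / (a + c)) / tri_w a b c) + (- b / (tri_w a b c * (a + b))) + (- c / (tri_w a c b * (a + c))) = darea a (tri_w a b c)"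
    unfolding tri_w_sym(1)[of a c b] using w a b c by (simp add: add_divide_distrib mult.commute)
  show ?thesis unfolding csum_def
    by (rule DERIV_cong[OF DERIV_add[OF DERIV_add[OF ctri_deriv_own[OF a b c] *[OF b c]] c'] e])
qed

lemma csum_strict:
  assumes "0 \<le> a" "a < a'" "0 \<le> b" "0 \<le> c" shows "csum a b c < csum a' b c"
proof (rule DERIV_pos_imp_increasing_open[OF assms(2)])
  fix x assume "a < x" "x < a'"
  then have "0 < x" using assms by simp
  then show "\<exists>y. ((\<lambda>a. csum a b c) has_real_derivative y) (at x) \<and> 0 < y"
    using csum_deriv darea_pos tri_w_ge_1 assms by (meson less_imp_le)
next
  have eq: "ctri c x b = ctri c b x" for x by (rule ctri_sym)
  have "continuous_on {0..} (\<lambda>a. ctri c a b)" unfolding eq using ctri_cont_other assms by blast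
  then have "continuous_on {0..} (\<lambda>a. csum a b c)" unfolding csum_def
    using ctri_cont_own ctri_cont_other assms by (intro continuous_on_add) blast+
  then show "continuous_on {a..a'} (\<lambda>a. csum a b c)" by (rule continuous_on_subset) (use assms in auto)
qed

lemma csum_mono:
  assumes "0 \<le> a" "0 \<le> b" "0 \<le> c" "a \<le> a'" "b \<le> b'" "c \<le> c'"
  shows "csum a b c \<le> csum a' b' c'" and "a < a' \<or> b < b' \<or> c < c' \<Longrightarrow> csum a b c < csum a' b' c'"
proof -
  have le: "csum x y z \<le> csum x' y z" if "0 \<le> x" "0 \<le> y" "0 \<le> z" "x \<le> x'" for x y z x'
    using csum_strict[of x x' y z] that by (cases "x = x'") auto
  have 1: "csum a b c \<le> csum a' b c" using le assms by blast
  have 2: "csum a' b c \<le> csum a' b' c" using le[of b c a' b'] csum_rot[of b c a'] csum_rot[of b' c a'] assms by simp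
  have 3: "csum a' b' c \<le> csum a' b' c'" using le[of c a' b' c'] csum_rot[of a' b' c] csum_rot[of a' b' c'] assms by simp
  show "csum a b c \<le> csum a' b' c'" using 1 2 3 by simp
  assume "a < a' \<or> b < b' \<or> c < c'"
  moreover have "a < a' \<Longrightarrow> csum a b c < csum a' b c" using csum_strict assms by blast
  moreover have "b < b' \<Longrightarrow> csum a' b c < csum a' b' c"
    using csum_strict[of b b' c a'] csum_rot[of b c a'] csum_rot[of b' c a'] assms by simp
  moreover have "c < c' \<Longrightarrow> csum a' b' c < csum a' b' c'"
    using csum_strict[of c c' a' b'] csum_rot[of a' b' c] csum_rot[of a' b' c'] assms by simp
  ultimately show "csum a b c < csum a' b' c'" using 1 2 3 by linarith
qed

lemma ctri_antimono2:
  assumes "0 \<le> a" "0 \<le> b" "0 \<le> c" "b \<le> b'" "c \<le> c'" shows "ctri a b' c' \<le> ctri a b c"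
proof -
  have "ctri a b' c' \<le> ctri a b c'" using ctri_antimono[of a b c' b'] assms by simp
  also have "\<dots> \<le> ctri a b c" using ctri_antimono[of a c b c'] assms ctri_sym by simp
  finally show ?thesis .
qed

text \<open>The sum of the three grows while the other two summands shrink.\<close>

lemma ctri_mono_own:
  assumes "0 \<le> a" "a \<le> a'" "0 \<le> b" "0 \<le> c" shows "ctri a b c \<le> ctri a' b c"
proof -
  have "csum a b c \<le> csum a' b c" using csum_mono assms by simp
  moreover have "ctri b c a' \<le> ctri b c a" "ctri c a' b \<le> ctri c a b" using ctri_antimono2 assms by auto
  ultimately show ?thesis unfolding csum_def by linarith
qed

text \<open>Along the ray, \<open>W x = sqrt (1 + x\<^sup>2 * \<tau>)\<close> satisfies W - x W' = 1
  / W. The boundary term of \<open>arcw_deriv\<close> therefore vanishes and the derivative is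
  exactly the positive \<open>darea\<close>.\<close>

lemma ctri_scale:
  assumes "0 \<le> a" "0 \<le> b" "0 \<le> c" "1 \<le> r" shows "ctri a b c \<le> ctri (r * a) (r * b) (r * c)"
proof (cases "a = 0")
  case False
  then have a: "0 < a" using assms by auto
  define \<tau> where "\<tau> = (a * b + b * c + c * a) / a\<^sup>2"
  have t: "0 \<le> \<tau>" using assms by (simp add: \<tau>_def)
  define W where "W = (\<lambda>x. sqrt (1 + x\<^sup>2 * \<tau>))"
  define W' where "W' = (\<lambda>x. x * \<tau> / W x)"
  have W: "W (s * a) = tri_w (s * a) (s * b) (s * c)" for s
    using a by (simp add: W_def tri_w_def \<tau>_def power_mult_distrib add.assoc) (simp add: power2_eq_square algebra_simps)
  have W1: "W x \<ge> 1" for x using t by (simp add: W_def)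
  have W2: "(W x)\<^sup>2 = 1 + x\<^sup>2 * \<tau>" for x using t by (simp add: W_def)
  have dW: "(W has_real_derivative W' x) (at x)" for x
  proof -
    have "1 + x\<^sup>2 * \<tau> > 0" using t by (simp add: add_pos_nonneg)
    moreover have "((\<lambda>x. 1 + x\<^sup>2 * \<tau>) has_real_derivative (2 * x * \<tau>)) (at x)"
      by (auto intro!: derivative_eq_intros)
    ultimately have "(W has_real_derivative inverse (sqrt (1 + x\<^sup>2 * \<tau>)) / 2 * (2 * x * \<tau>)) (at x)"
      unfolding W_def by (rule DERIV_chain2[OF DERIV_real_sqrt])
    moreover have "inverse u / 2 * (2 * x * \<tau>) = x * \<tau> / u" for u by (simp add: field_simps)
    ultimately show ?thesis unfolding W'_def W_def by (simp only:)
  qed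
  have "continuous_on {0<..} W" unfolding W_def by (intro continuous_intros)
  moreover have "W x \<noteq> 0" for x using W1[of x] by simp
  ultimately have c: "continuous_on {0<..} W'" unfolding W'_def by (intro continuous_intros) auto
  have "a * arcw a (W a) \<le> (r * a) * arcw (r * a) (W (r * a))"
  proof (cases "r = 1")
    case False
    have "(\<lambda>x. x * arcw x (W x)) a < (\<lambda>x. x * arcw x (W x)) (r * a)"
    proof (rule DERIV_pos_imp_increasing[where f = "\<lambda>x. x * arcw x (W x)"])
      show "a < r * a" using False assms a by simp
      fix x assume "a \<le> x"
      then have x: "x > 0" using a by simp
      have "W x * (2 * W x - 2 * x * W' x - 2 / W x) = 2 * (W x)\<^sup>2 - 2 * x\<^sup>2 * \<tau> - 2"
        using W1[of x] by (simp add: W'_def right_diff_distrib power2_eq_square)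
      also have "\<dots> = 0" unfolding W2 by simp
      finally have "2 * W x - 2 * x * W' x - 2 / W x = 0" using W1[of x] by (simp only: mult_eq_0_iff) auto
      then have "((\<lambda>x. x * arcw x (W x)) has_real_derivative darea x (W x)) (at x)"
        using arcw_deriv[OF x W1 dW c] by simp
      then show "\<exists>y. ((\<lambda>x. x * arcw x (W x)) has_real_derivative y) (at x) \<and> 0 < y" using darea_pos[OF x W1] by blast
    qed
    then show ?thesis by simp
  qed simp
  then show ?thesis unfolding ctri_arcw W using W[of 1] by (simp add: mult.commute)
qed simp

section \<open>Limits for large curvatures\<close>

lemma ctri_high:
  assumes "1 < a" "0 \<le> b" "0 \<le> c"
  shows "ctri a b c = 2 * a / sqrt (a\<^sup>2 - 1) * arctan (sqrt (a\<^sup>2 - 1) / tri_w a b c)"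
proof -
  define q where "q = sqrt (a\<^sup>2 - 1)"
  have "a\<^sup>2 - 1 > 0" using assms by simp
  then have q: "q > 0" "q\<^sup>2 = a\<^sup>2 - 1" by (auto simp: q_def)
  define w where "w = tri_w a b c"
  have w: "w \<ge> 1" unfolding w_def using tri_w_ge_1 assms by simp
  have "((\<lambda>x. 2 / (1 + (a\<^sup>2 - 1) * x\<^sup>2)) has_integral (2 / q * arctan (q * (1 / w)) - 2 / q * arctan (q * 0))) {0..1 / w}"
  proof (rule fundamental_theorem_of_calculus)
    fix x assume "x \<in> {0..1 / w}"
    have "1 + (q * x)\<^sup>2 \<noteq> 0" by (metis add.commute power_one sum_power2_eq_zero_iff zero_neq_one)
    then have "((\<lambda>x. 2 / q * arctan (q * x)) has_real_derivative (2 / (1 + (a\<^sup>2 - 1) * x\<^sup>2))) (at x within {0..1 / w})"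
      using q(1) unfolding q(2)[symmetric]
      by (auto intro!: derivative_eq_intros simp: power_mult_distrib divide_inverse)
    then show "((\<lambda>x. 2 / q * arctan (q * x)) has_vector_derivative (2 / (1 + (a\<^sup>2 - 1) * x\<^sup>2))) (at x within {0..1 / w})"
      by (simp add: has_real_derivative_iff_has_vector_derivative)
  qed (use w in simp)
  then have "arc_int a b c = 2 / q * arctan (q / w)" unfolding arc_int_def w_def[symmetric] by (simp add: integral_unique)
  then show ?thesis by (simp add: ctri_def q_def w_def)
qed

text \<open>The three cases are the possible numbers of large curvatures in a triangle. The
  arctangents tend to pi/2, pi/4 and pi/6, so the curvatures at the large vertices always add up to
  pi.\<close>

lemma ctri_limits:
  assumes B0: "0 < B"
  shows "((\<lambda>x. ctri x B B) \<longlongrightarrow> pi) at_top"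
    and "((\<lambda>x. ctri x x B + ctri x B x) \<longlongrightarrow> pi) at_top"
    and "((\<lambda>x. ctri x x x + ctri x x x + ctri x x x) \<longlongrightarrow> pi) at_top"
proof -
  have ev: "\<forall>\<^sub>F x in at_top. 1 < (x::real)" by (rule eventually_gt_at_top)
  have B: "0 \<le> B" using B0 by simp
  have "((\<lambda>x. 2 * x / sqrt (x\<^sup>2 - 1) * arctan (sqrt (x\<^sup>2 - 1) / sqrt (1 + x * B + B * B + B * x))) \<longlongrightarrow> pi) at_top"
    using B0 by real_asymp
  then show "((\<lambda>x. ctri x B B) \<longlongrightarrow> pi) at_top"
    by (rule Lim_transform_eventually) (use ev in \<open>eventually_elim, simp add: ctri_high B tri_w_def\<close>)
  have "((\<lambda>x. 2 * (2 * x / sqrt (x\<^sup>2 - 1) * arctan (sqrt (x\<^sup>2 - 1) / sqrt (1 + x * x + x * B + B * x)))) \<longlongrightarrow> 2 * (2 * arctan 1)) at_top"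
  proof -
    have l1: "((\<lambda>x::real. sqrt (x\<^sup>2 - 1) / sqrt (1 + x * x + x * B + B * x)) \<longlongrightarrow> 1) at_top" using B0 by real_asymp
    have l2: "((\<lambda>x::real. 2 * x / sqrt (x\<^sup>2 - 1)) \<longlongrightarrow> 2) at_top" by real_asymp
    show ?thesis by (intro tendsto_mult[OF tendsto_const] tendsto_mult[OF l2 tendsto_arctan[OF l1]])
  qed
  then have "((\<lambda>x. 2 * (2 * x / sqrt (x\<^sup>2 - 1) * arctan (sqrt (x\<^sup>2 - 1) / sqrt (1 + x * x + x * B + B * x)))) \<longlongrightarrow> pi) at_top"
    by (simp add: arctan_one)
  then show "((\<lambda>x. ctri x x B + ctri x B x) \<longlongrightarrow> pi) at_top"
    by (rule Lim_transform_eventually) (use ev in \<open>eventually_elim, simp add: ctri_sym[of _ B] ctri_high B tri_w_def\<close>)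
  have "((\<lambda>x. 3 * (2 * x / sqrt (x\<^sup>2 - 1) * arctan (sqrt (x\<^sup>2 - 1) / sqrt (1 + x * x + x * x + x * x)))) \<longlongrightarrow> 3 * (2 * arctan (1 / sqrt 3))) at_top"
  proof -
    have "((\<lambda>x::real. sqrt (x\<^sup>2 - 1) / sqrt (1 + x * x + x * x + x * x)) \<longlongrightarrow> inverse (3 powr (1 / 2))) at_top"
      by real_asymp
    moreover have "inverse (3 powr (1 / 2)) = 1 / sqrt (3::real)" by (simp add: powr_half_sqrt inverse_eq_divide)
    ultimately have l1: "((\<lambda>x::real. sqrt (x\<^sup>2 - 1) / sqrt (1 + x * x + x * x + x * x)) \<longlongrightarrow> 1 / sqrt 3) at_top"
      by (simp only:)
    have l2: "((\<lambda>x::real. 2 * x / sqrt (x\<^sup>2 - 1)) \<longlongrightarrow> 2) at_top" by real_asymp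
    show ?thesis by (intro tendsto_mult[OF tendsto_const] tendsto_mult[OF l2 tendsto_arctan[OF l1]])
  qed
  moreover have "arctan (1 / sqrt 3) = pi / 6"
    by (rule arctan_unique) (use pi_gt_zero in \<open>auto simp: tan_30\<close>)
  ultimately have "((\<lambda>x. 3 * (2 * x / sqrt (x\<^sup>2 - 1) * arctan (sqrt (x\<^sup>2 - 1) / sqrt (1 + x * x + x * x + x * x)))) \<longlongrightarrow> pi) at_top" by simp
  then show "((\<lambda>x. ctri x x x + ctri x x x + ctri x x x) \<longlongrightarrow> pi) at_top"
    by (rule Lim_transform_eventually) (use ev in \<open>eventually_elim, simp add: ctri_high tri_w_def\<close>)
qed

section \<open>Lipschitz bounds in logarithmic coordinates\<close>

lemma darea_bound:
  assumes a: "0 < a" and w: "w \<ge> 1" shows "a * darea a w \<le> 1"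
proof -
  \<comment> \<open>The value at 1 is changed to 0 because the majorant
    \<open>s / sqrt (1 - s\<^sup>2)\<close> is 0 there through division by zero.\<close>
  define f where "f = (\<lambda>s. if s = 1 then 0 else a * (2 * s\<^sup>2 / (w * (w\<^sup>2 + (a\<^sup>2 - 1) * s\<^sup>2))))"
  have "((\<lambda>s. 2 * s\<^sup>2 / (w * (w\<^sup>2 + (a\<^sup>2 - 1) * s\<^sup>2))) has_integral darea a w) {0..1}"
    unfolding darea_def using integrable_continuous_real[OF darea_cont[OF a w]] by (simp add: has_integral_integral)
  then have "((\<lambda>s. a * (2 * s\<^sup>2 / (w * (w\<^sup>2 + (a\<^sup>2 - 1) * s\<^sup>2)))) has_integral a * darea a w) {0..1}"
    by (rule has_integral_mult_right)
  then have f: "(f has_integral a * darea a w) {0..1}"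
    by (rule has_integral_spike_finite[of "{1}", rotated 2]) (auto simp: f_def)
  have g: "((\<lambda>s. s / sqrt (1 - s\<^sup>2)) has_integral (- sqrt (1 - 1\<^sup>2) - - sqrt (1 - 0\<^sup>2))) {0..1::real}"
  proof (rule fundamental_theorem_of_calculus_interior)
    show "continuous_on {0..1} (\<lambda>s::real. - sqrt (1 - s\<^sup>2))" by (intro continuous_intros)
    fix s :: real assume s: "s \<in> {0<..<1}"
    then have p: "1 - s\<^sup>2 > 0" by (simp add: abs_square_less_1)
    have "((\<lambda>s. 1 - s\<^sup>2) has_real_derivative (- 2 * s)) (at s)" by (auto intro!: derivative_eq_intros)
    note d = DERIV_minus[OF DERIV_chain2[OF DERIV_real_sqrt[OF p] this]]
    have e: "- (inverse r / 2 * (- 2 * s)) = s / r" for r :: real by (cases "r = 0") (simp_all add: field_simps)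
    have "((\<lambda>s. - sqrt (1 - s\<^sup>2)) has_real_derivative (s / sqrt (1 - s\<^sup>2))) (at s)" by (rule DERIV_cong[OF d e])
    then show "((\<lambda>s. - sqrt (1 - s\<^sup>2)) has_vector_derivative (s / sqrt (1 - s\<^sup>2))) (at s)"
      by (simp add: has_real_derivative_iff_has_vector_derivative)
  qed simp
  have "a * darea a w \<le> - sqrt (1 - 1\<^sup>2) - - sqrt (1 - 0\<^sup>2)"
  proof (rule has_integral_le[OF f g])
    fix s :: real assume s: "s \<in> {0..1}"
    show "f s \<le> s / sqrt (1 - s\<^sup>2)"
    proof (cases "s = 0 \<or> s = 1")
      case False
      then have s': "0 < s" "s < 1" using s by auto
      define r where "r = sqrt (1 - s\<^sup>2)"
      have "1 - s\<^sup>2 > 0" using s' by (simp add: abs_square_less_1)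
      then have r: "r > 0" "r\<^sup>2 = 1 - s\<^sup>2" by (auto simp: r_def)
      \<comment> \<open>The arithmetic-geometric mean inequality bounds the denominator below by
        \<open>2 * (a * s * r)\<close>. The factor \<open>a\<close> then cancels, and the remaining
        majorant, free of \<open>a\<close> and \<open>w\<close>, has integral 1.\<close>
      have "0 \<le> (r - a * s)\<^sup>2" by simp
      then have am: "2 * (a * s * r) \<le> r\<^sup>2 + a\<^sup>2 * s\<^sup>2" by (simp add: power2_eq_square algebra_simps)
      have "1 \<le> w\<^sup>2" using w by simp
      then have "2 * (a * s * r) \<le> w\<^sup>2 + (a\<^sup>2 - 1) * s\<^sup>2" using am r(2) by (simp add: algebra_simps)
      also have "\<dots> \<le> w * (w\<^sup>2 + (a\<^sup>2 - 1) * s\<^sup>2)"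
        using den_pos[OF a w, of s] s w by (simp add: mult_le_cancel_right1)
      finally have "2 * (a * s * r) \<le> w * (w\<^sup>2 + (a\<^sup>2 - 1) * s\<^sup>2)" .
      moreover have lp: "0 < 2 * (a * s * r)" using a s' r by simp
      ultimately have "a * (2 * s\<^sup>2) / (w * (w\<^sup>2 + (a\<^sup>2 - 1) * s\<^sup>2)) \<le> a * (2 * s\<^sup>2) / (2 * (a * s * r))"
        using a by (intro divide_left_mono mult_pos_pos[OF less_le_trans[OF lp] lp]) auto
      also have "\<dots> = s / r" using a s' r(1) by (simp add: power2_eq_square)
      finally show ?thesis using False by (simp add: f_def r_def)
    qed (auto simp: f_def)
  qed
  then show ?thesis by simp
qed

text \<open>Both \<open>w\<close> and half of \<open>a + b\<close> are at least the square root of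
  \<open>a * b\<close>.\<close>

lemma mix_bound:
  assumes "0 < a" "0 \<le> b" "0 \<le> c" shows "a * (b / (tri_w a b c * (a + b))) \<le> 1 / 2"
proof -
  define w where "w = tri_w a b c"
  have w: "w \<ge> 1" unfolding w_def using tri_w_ge_1 assms by simp
  have "w\<^sup>2 \<ge> a * b" unfolding w_def using tri_w_sq[of a b c] assms by simp
  moreover have "(a + b)\<^sup>2 \<ge> 4 * (a * b)"
    using zero_le_power2[of "a - b"] by (simp add: power2_eq_square algebra_simps)
  ultimately have "(a * b) * (4 * (a * b)) \<le> w\<^sup>2 * (a + b)\<^sup>2" using assms by (intro mult_mono) auto
  moreover have "(2 * (a * b))\<^sup>2 = (a * b) * (4 * (a * b))" by (simp add: power2_eq_square)
  ultimately have "(2 * (a * b))\<^sup>2 \<le> (w * (a + b))\<^sup>2" unfolding power_mult_distrib[of w "a + b"] by simp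
  then have "2 * (a * b) \<le> w * (a + b)" by (rule power2_le_imp_le) (use w assms in simp)
  moreover have "0 < w * (a + b)" using w assms by (intro mult_pos_pos) auto
  ultimately show ?thesis unfolding w_def[symmetric] by (simp add: pos_divide_le_eq)
qed

lemma log_lipschitz:
  fixes f :: "real \<Rightarrow> real"
  assumes d: "\<And>x. 0 < x \<Longrightarrow> (f has_real_derivative f' x) (at x)" and b: "\<And>x. 0 < x \<Longrightarrow> \<bar>x * f' x\<bar> \<le> L"
  shows "\<bar>f (exp u) - f (exp v)\<bar> \<le> L * \<bar>u - v\<bar>"
proof -
  have "norm ((\<lambda>t. f (exp t)) u - (\<lambda>t. f (exp t)) v) \<le> L * norm (u - v)"
  proof (rule field_differentiable_bound[of UNIV])
    show "((\<lambda>t. f (exp t)) has_field_derivative (f' (exp t) * exp t)) (at t within UNIV)" for t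
      by (rule DERIV_chain2[OF d]) auto
    show "norm (f' (exp t) * exp t) \<le> L" for t using b[of "exp t"] by (simp add: mult.commute)
  qed auto
  then show ?thesis by simp
qed

lemma ctri_lip_own:
  assumes "0 \<le> b" "0 \<le> c" shows "\<bar>ctri (exp u) b c - ctri (exp v) b c\<bar> \<le> 2 * \<bar>u - v\<bar>"
proof (rule log_lipschitz[where f = "\<lambda>a. ctri a b c"])
  fix a :: real assume a: "0 < a"
  show "((\<lambda>a. ctri a b c) has_real_derivative (darea a (tri_w a b c) + (b / (a + b) + c / (a + c)) / tri_w a b c)) (at a)"
    using ctri_deriv_own a assms by blast
  have w: "tri_w a b c \<ge> 1" using tri_w_ge_1 a assms by simp
  have "a * (darea a (tri_w a b c) + (b / (a + b) + c / (a + c)) / tri_w a b c)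
    = a * darea a (tri_w a b c) + a * (b / (tri_w a b c * (a + b))) + a * (c / (tri_w a c b * (a + c)))"
    unfolding tri_w_sym(1)[of a c b] by (simp add: add_divide_distrib distrib_left mult.commute)
  moreover have "0 \<le> a * (b / (tri_w a b c * (a + b)))" "0 \<le> a * (c / (tri_w a c b * (a + c)))"
    using a assms w tri_w_sym(1)[of a c b] by auto
  moreover have "0 \<le> a * darea a (tri_w a b c)" using a darea_pos[OF a w] by simp
  \<comment> \<open>The Lipschitz constant 2 is 1 for the term with \<open>darea\<close> plus 1/2
    for each mixed term.\<close>
  moreover have "a * (b / (tri_w a b c * (a + b))) \<le> 1 / 2" "a * (c / (tri_w a c b * (a + c))) \<le> 1 / 2"
    using mix_bound a assms by blast+
  ultimately have "0 \<le> a * (darea a (tri_w a b c) + (b / (a + b) + c / (a + c)) / tri_w a b c)"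
    "a * (darea a (tri_w a b c) + (b / (a + b) + c / (a + c)) / tri_w a b c) \<le> 2"
    using darea_bound[OF a w] by linarith+
  then show "\<bar>a * (darea a (tri_w a b c) + (b / (a + b) + c / (a + c)) / tri_w a b c)\<bar> \<le> 2"
    by (simp only: abs_of_nonneg)
qed

lemma ctri_lip_other:
  assumes "0 \<le> b" "0 \<le> c" shows "\<bar>ctri b c (exp u) - ctri b c (exp v)\<bar> \<le> 2 * \<bar>u - v\<bar>"
proof (cases "b = 0")
  case False
  then have b: "0 < b" using assms by simp
  show ?thesis
  proof (rule log_lipschitz[where f = "\<lambda>a. ctri b c a"])
    fix a :: real assume a: "0 < a"
    show "((\<lambda>a. ctri b c a) has_real_derivative (- b / (tri_w a b c * (a + b)))) (at a)"
      using ctri_deriv_other a b assms by blast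
    have w: "tri_w a b c \<ge> 1" using tri_w_ge_1 a assms by simp
    have "\<bar>a * (- b / (tri_w a b c * (a + b)))\<bar> = a * (b / (tri_w a b c * (a + b)))"
    proof -
      have "0 \<le> a * (b / (tri_w a b c * (a + b)))" using a b w by simp
      moreover have "a * (- b / (tri_w a b c * (a + b))) = - (a * (b / (tri_w a b c * (a + b))))" by simp
      ultimately show ?thesis by (simp only: abs_minus_cancel abs_of_nonneg)
    qed
    moreover have "a * (b / (tri_w a b c * (a + b))) \<le> 1 / 2" using mix_bound a assms by blast
    ultimately show "\<bar>a * (- b / (tri_w a b c * (a + b)))\<bar> \<le> 2" by linarith
  qed
qed simp

lemma ctri_lip_own':
  assumes "0 \<le> b" "0 \<le> c" "0 < x" "0 < y" shows "\<bar>ctri x b c - ctri y b c\<bar> \<le> 2 * \<bar>ln x - ln y\<bar>"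
  using ctri_lip_own[of b c "ln x" "ln y"] assms by simp

lemma ctri_lip_other':
  assumes "0 \<le> b" "0 \<le> c" "0 < x" "0 < y" shows "\<bar>ctri b c x - ctri b c y\<bar> \<le> 2 * \<bar>ln x - ln y\<bar>"
  using ctri_lip_other[of b c "ln x" "ln y"] assms by simp

definition logdist :: "real \<Rightarrow> real \<Rightarrow> real" where
  "logdist x y = (if x = y then 0 else \<bar>ln x - ln y\<bar>)"

lemma ctri_lip:
  assumes p: "0 \<le> a" "0 \<le> b" "0 \<le> c" "0 \<le> a'" "0 \<le> b'" "0 \<le> c'"
    and z: "a = 0 \<longleftrightarrow> a' = 0" "b = 0 \<longleftrightarrow> b' = 0" "c = 0 \<longleftrightarrow> c' = 0"
  shows "\<bar>ctri a b c - ctri a' b' c'\<bar> \<le> 2 * (logdist a a' + logdist b b' + logdist c c')"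
proof -
  have "\<bar>ctri a b c - ctri a' b c\<bar> \<le> 2 * logdist a a'"
    using ctri_lip_own'[of b c a a'] p z by (cases "a = a'") (auto simp: logdist_def)
  moreover have "\<bar>ctri a' b c - ctri a' b' c\<bar> \<le> 2 * logdist b b'"
    using ctri_lip_other'[of a' c b b'] p z ctri_sym by (cases "b = b'") (auto simp: logdist_def)
  moreover have "\<bar>ctri a' b' c - ctri a' b' c'\<bar> \<le> 2 * logdist c c'"
    using ctri_lip_other'[of a' b' c c'] p z by (cases "c = c'") (auto simp: logdist_def)
  ultimately show ?thesis by (smt (verit))
qed

section \<open>Prescribed total curvatures\<close>

locale tri_graph =
  fixes V :: "'a set" and F :: "'a triangle set"
  assumes finV: "finite V" and finF: "finite F"
    and faces: "\<And>a b c. (a, b, c) \<in> F \<Longrightarrow> a \<in> V \<and> b \<in> V \<and> c \<in> V \<and> a \<noteq> b \<and> b \<noteq> c \<and> c \<noteq> a"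
begin

fun fc :: "('a \<Rightarrow> real) \<Rightarrow> 'a triangle \<Rightarrow> 'a \<Rightarrow> real" where
  "fc k (a, b, c) v = (if v = a then ctri (k a) (k b) (k c) else if v = b then ctri (k b) (k c) (k a)
     else if v = c then ctri (k c) (k a) (k b) else 0)"

definition tc :: "('a \<Rightarrow> real) \<Rightarrow> 'a \<Rightarrow> real" where
  "tc k v = (\<Sum>f\<in>F. fc k f v)"

definition nonneg_on :: "('a \<Rightarrow> real) \<Rightarrow> bool" where
  "nonneg_on k \<longleftrightarrow> (\<forall>v\<in>V. 0 \<le> k v)"

definition covered :: "'a \<Rightarrow> bool" where
  "covered v \<longleftrightarrow> (\<exists>f\<in>F. v \<in> tri_vertices f)"

lemma nonneg_onD: "nonneg_on k \<Longrightarrow> v \<in> V \<Longrightarrow> 0 \<le> k v"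
  by (simp add: nonneg_on_def)

lemma vertex_curv_tc:
  assumes "nonneg_on k" shows "vertex_curv F k v = tc k v"
proof -
  have z: "fc k f v = 0" if "f \<in> F" "v \<notin> tri_vertices f" for f
    using that by (cases f) auto
  have e: "face_curv k f v = fc k f v" if "f \<in> F" for f
  proof -
    obtain a b c where f: "f = (a, b, c)" by (cases f)
    have "0 \<le> k a" "0 \<le> k b" "0 \<le> k c" using faces that f nonneg_onD[OF assms] by blast+
    then show ?thesis unfolding f by (simp add: tri_curv_eq ctri_def)
  qed
  have "vertex_curv F k v = (\<Sum>f | f \<in> F \<and> v \<in> tri_vertices f. fc k f v)"
    unfolding vertex_curv_def by (rule sum.cong) (auto simp: e)
  also have "\<dots> = tc k v" unfolding tc_def
    by (rule sum.mono_neutral_left[OF finF]) (auto simp: z)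
  finally show ?thesis .
qed

lemma tc_cong: "(\<And>w. w \<in> V \<Longrightarrow> k w = k' w) \<Longrightarrow> tc k v = tc k' v"
proof -
  assume e: "\<And>w. w \<in> V \<Longrightarrow> k w = k' w"
  have "fc k f v = fc k' f v" if "f \<in> F" for f
  proof -
    obtain a b c where f: "f = (a, b, c)" by (cases f)
    have "a \<in> V" "b \<in> V" "c \<in> V" using faces that f by blast+
    then show ?thesis unfolding f by (simp add: e)
  qed
  then show ?thesis unfolding tc_def by (rule sum.cong[OF refl])
qed

text \<open>The discrete maximum principle. Together with \<open>tc_scale\<close> it yields the
  comparison at a contact point in both barrier arguments.\<close>

lemma tc_antimono:
  assumes "nonneg_on k" "\<And>w. w \<in> V \<Longrightarrow> k w \<le> k' w" "k v = k' v"
  shows "tc k' v \<le> tc k v"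
  unfolding tc_def
proof (rule sum_mono)
  fix f assume "f \<in> F"
  obtain a b c where f: "f = (a, b, c)" by (cases f)
  have "a \<in> V" "b \<in> V" "c \<in> V" using faces \<open>f \<in> F\<close> f by blast+
  then show "fc k' f v \<le> fc k f v"
    unfolding f using assms(2) assms(3)[symmetric] nonneg_onD[OF assms(1)] by (auto intro!: ctri_antimono2)
qed

lemma tc_zero: "k v = 0 \<Longrightarrow> tc k v = 0"
  unfolding tc_def
proof (rule sum.neutral, rule ballI)
  fix f assume "k v = 0"
  then show "fc k f v = 0" by (cases f) auto
qed

lemma tc_pos: assumes "nonneg_on k" "k v > 0" "covered v" shows "tc k v > 0"
proof -
  obtain f where f: "f \<in> F" "v \<in> tri_vertices f" using assms by (auto simp: covered_def)
  obtain a b c where abc: "f = (a, b, c)" by (cases f)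
  have V: "a \<in> V" "b \<in> V" "c \<in> V" using faces f abc by blast+
  have "0 < fc k f v" unfolding abc using f(2) abc assms nonneg_onD[OF assms(1)] V by (auto intro!: ctri_pos)
  moreover have "0 \<le> fc k g v" if "g \<in> F" for g
  proof -
    obtain a b c where g: "g = (a, b, c)" by (cases g)
    have "a \<in> V" "b \<in> V" "c \<in> V" using faces that g by blast+
    then show ?thesis unfolding g using nonneg_onD[OF assms(1)] by (auto intro!: ctri_nonneg)
  qed
  ultimately show ?thesis unfolding tc_def using finF f(1) by (intro sum_pos2) auto
qed

lemma tc_scale:
  assumes "nonneg_on k" "1 \<le> r" shows "tc k v \<le> tc (\<lambda>w. r * k w) v"
  unfolding tc_def
proof (rule sum_mono)
  fix f assume "f \<in> F"
  obtain a b c where f: "f = (a, b, c)" by (cases f)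
  have "a \<in> V" "b \<in> V" "c \<in> V" using faces \<open>f \<in> F\<close> f by blast+
  then show "fc k f v \<le> fc (\<lambda>w. r * k w) f v" unfolding f using nonneg_onD[OF assms(1)] assms(2) by (auto intro!: ctri_scale)
qed

lemma tc_cont_own:
  assumes k: "nonneg_on k" and v: "v \<in> V" shows "continuous_on {0..} (\<lambda>x. tc (k(v := x)) v)"
  unfolding tc_def
proof (rule continuous_on_sum)
  fix f assume "f \<in> F"
  obtain a b c where f: "f = (a, b, c)" by (cases f)
  have V: "a \<in> V" "b \<in> V" "c \<in> V" "a \<noteq> b" "b \<noteq> c" "c \<noteq> a" using faces \<open>f \<in> F\<close> f by blast+
  consider "v = a" | "v = b" | "v = c" | "v \<notin> {a, b, c}" by blast
  then show "continuous_on {0..} (\<lambda>x. fc (k(v := x)) f v)"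
    unfolding f using V nonneg_onD[OF k] by cases (auto intro!: ctri_cont_own)
qed

lemma face_sum:
  assumes "(a, b, c) \<in> F" shows "(\<Sum>v\<in>V. fc k (a, b, c) v) = csum (k a) (k b) (k c)"
proof -
  have V: "a \<in> V" "b \<in> V" "c \<in> V" "a \<noteq> b" "b \<noteq> c" "c \<noteq> a" using faces assms by blast+
  have "(\<Sum>v\<in>V. fc k (a, b, c) v) = (\<Sum>v\<in>{a, b, c}. fc k (a, b, c) v)"
    by (rule sum.mono_neutral_right[OF finV]) (use V in auto)
  also have "\<dots> = csum (k a) (k b) (k c)" using V by (auto simp: csum_def)
  finally show ?thesis .
qed

lemma tc_total: "(\<Sum>v\<in>V. tc k v) = (\<Sum>f\<in>F. case f of (a, b, c) \<Rightarrow> csum (k a) (k b) (k c))"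
proof -
  have "(\<Sum>v\<in>V. tc k v) = (\<Sum>f\<in>F. \<Sum>v\<in>V. fc k f v)" unfolding tc_def by (rule sum.swap)
  also have "\<dots> = (\<Sum>f\<in>F. case f of (a, b, c) \<Rightarrow> csum (k a) (k b) (k c))"
    by (rule sum.cong) (auto simp: face_sum simp del: fc.simps)
  finally show ?thesis .
qed

lemma tc_total_mono:
  assumes k: "nonneg_on k" and le: "\<And>w. w \<in> V \<Longrightarrow> k w \<le> k' w"
  shows "(\<Sum>v\<in>V. tc k v) \<le> (\<Sum>v\<in>V. tc k' v)"
    and "v \<in> V \<Longrightarrow> covered v \<Longrightarrow> k v < k' v \<Longrightarrow> (\<Sum>v\<in>V. tc k v) < (\<Sum>v\<in>V. tc k' v)"
proof -
  have m: "(case f of (a, b, c) \<Rightarrow> csum (k a) (k b) (k c)) \<le> (case f of (a, b, c) \<Rightarrow> csum (k' a) (k' b) (k' c))" if "f \<in> F" for f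
  proof -
    obtain a b c where f: "f = (a, b, c)" by (cases f)
    have "a \<in> V" "b \<in> V" "c \<in> V" using faces that f by blast+
    then show ?thesis unfolding f using nonneg_onD[OF k] le by (auto intro!: csum_mono(1))
  qed
  show "(\<Sum>v\<in>V. tc k v) \<le> (\<Sum>v\<in>V. tc k' v)" unfolding tc_total using m by (rule sum_mono)
  assume v: "v \<in> V" "covered v" "k v < k' v"
  then obtain f where f: "f \<in> F" "v \<in> tri_vertices f" by (auto simp: covered_def)
  obtain a b c where abc: "f = (a, b, c)" by (cases f)
  have V: "a \<in> V" "b \<in> V" "c \<in> V" using faces f abc by blast+
  have "csum (k a) (k b) (k c) < csum (k' a) (k' b) (k' c)"
    using V nonneg_onD[OF k] le v f(2) abc by (intro csum_mono(2)) auto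
  then have "(case f of (a, b, c) \<Rightarrow> csum (k a) (k b) (k c)) < (case f of (a, b, c) \<Rightarrow> csum (k' a) (k' b) (k' c))"
    by (simp add: abc)
  then show "(\<Sum>v\<in>V. tc k v) < (\<Sum>v\<in>V. tc k' v)"
    unfolding tc_total using m f(1) finF by (intro sum_strict_mono_ex1) auto
qed

text \<open>Passing from \<open>k\<close> to the maximum of \<open>k\<close> and \<open>k'\<close> raises the total curvature but lowers it outside
  the set where \<open>k < k'\<close>.\<close>

lemma tc_compare:
  assumes k: "nonneg_on k" "nonneg_on k'" and c: "\<And>v. v \<in> V \<Longrightarrow> covered v"
    and A: "A = {v \<in> V. k v < k' v}" "A \<noteq> {}"
  shows "(\<Sum>v\<in>A. tc k v) < (\<Sum>v\<in>A. tc k' v)"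
proof -
  define m where "m = (\<lambda>v. max (k v) (k' v))"
  have m: "nonneg_on m" using k by (auto simp: nonneg_on_def m_def le_max_iff_disj)
  obtain a where a: "a \<in> A" using A by blast
  have s: "(\<Sum>v\<in>V. tc k v) < (\<Sum>v\<in>V. tc m v)"
    using tc_total_mono(2)[OF k(1), of m a] a c A by (auto simp: m_def)
  have AV: "A \<subseteq> V" using A by auto
  have split: "(\<Sum>v\<in>V. tc h v) = (\<Sum>v\<in>V - A. tc h v) + (\<Sum>v\<in>A. tc h v)" for h
    using sum.subset_diff[OF AV finV] by blast
  have "(\<Sum>v\<in>V - A. tc m v) \<le> (\<Sum>v\<in>V - A. tc k v)"
    using A by (intro sum_mono tc_antimono[OF k(1)]) (auto simp: m_def)
  moreover have "(\<Sum>v\<in>A. tc m v) \<le> (\<Sum>v\<in>A. tc k' v)"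
    using A by (intro sum_mono tc_antimono[OF k(2)]) (auto simp: m_def)
  ultimately show ?thesis using s split[of k] split[of m] by linarith
qed

text \<open>On the set where one of two solutions is smaller, \<open>tc_compare\<close> gives
  strictly different sums of curvatures, although these agree vertex by vertex. Applied in both
  directions, this leaves no such set.\<close>

lemma tc_inj:
  assumes k: "nonneg_on k" "nonneg_on k'" and c: "\<And>v. v \<in> V \<Longrightarrow> covered v"
    and e: "\<And>v. v \<in> V \<Longrightarrow> tc k v = tc k' v" and v: "v \<in> V"
  shows "k v = k' v"
proof -
  have *: "{v \<in> V. k v < k' v} = {}" if "nonneg_on k" "nonneg_on k'" "\<And>v. v \<in> V \<Longrightarrow> tc k v = tc k' v" for k k'
  proof (rule ccontr)
    assume "{v \<in> V. k v < k' v} \<noteq> {}"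
    from tc_compare[OF that(1,2) c refl this]
    have "(\<Sum>v\<in>{v \<in> V. k v < k' v}. tc k v) < (\<Sum>v\<in>{v \<in> V. k v < k' v}. tc k' v)" by simp
    moreover have "(\<Sum>v\<in>{v \<in> V. k v < k' v}. tc k v) = (\<Sum>v\<in>{v \<in> V. k v < k' v}. tc k' v)"
      by (rule sum.cong) (use that(3) in auto)
    ultimately show False by simp
  qed
  have "\<not> k v < k' v" using *[OF k e] v by blast
  moreover have "\<not> k' v < k v" using *[OF k(2,1)] e v by fastforce
  ultimately show ?thesis by linarith
qed

text \<open>One, two or three vertices of the face lie in \<open>I\<close>. Monotonicity reduces
  each case to the extreme configuration with values \<open>M\<close> and \<open>B\<close>, which
  \<open>ctri_limits\<close> covers, so that \<open>M\<close> is uniform in \<open>k\<close> and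
  \<open>I\<close>.\<close>

lemma face_limit:
  assumes B: "0 < B" and d: "0 < \<delta>"
  obtains M where "0 < M" "\<And>I k f. \<lbrakk>f \<in> F; nonneg_on k; \<forall>i\<in>I. M \<le> k i; \<forall>j\<in>V - I. k j \<le> B; tri_vertices f \<inter> I \<noteq> {}; I \<subseteq> V\<rbrakk>
    \<Longrightarrow> pi - \<delta> < (\<Sum>v\<in>I. fc k f v)"
proof -
  have "\<forall>\<^sub>F x in at_top. pi - \<delta> < ctri x B B" "\<forall>\<^sub>F x in at_top. pi - \<delta> < ctri x x B + ctri x B x"
    "\<forall>\<^sub>F x in at_top. pi - \<delta> < ctri x x x + ctri x x x + ctri x x x"
    using order_tendstoD(1)[OF ctri_limits(1)[OF B], of "pi - \<delta>"] order_tendstoD(1)[OF ctri_limits(2)[OF B], of "pi - \<delta>"]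
      order_tendstoD(1)[OF ctri_limits(3)[OF B], of "pi - \<delta>"] d by auto
  then have "\<forall>\<^sub>F x in at_top. 0 < x \<and> pi - \<delta> < ctri x B B \<and> pi - \<delta> < ctri x x B + ctri x B x
     \<and> pi - \<delta> < ctri x x x + ctri x x x + ctri x x x"
    using eventually_gt_at_top[of "0::real"] by eventually_elim auto
  then obtain M where M: "0 < M" "pi - \<delta> < ctri M B B" "pi - \<delta> < ctri M M B + ctri M B M"
     "pi - \<delta> < ctri M M M + ctri M M M + ctri M M M" by (auto simp: eventually_at_top_linorder)
  have one: "pi - \<delta> < ctri x y z" if "M \<le> x" "0 \<le> y" "y \<le> B" "0 \<le> z" "z \<le> B" for x y z
  proof -
    have "ctri M B B \<le> ctri x B B" using that M B by (intro ctri_mono_own) auto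
    also have "\<dots> \<le> ctri x y z" using that M B by (intro ctri_antimono2) auto
    finally show ?thesis using M by simp
  qed
  have two: "pi - \<delta> < ctri x y z + ctri y z x" if "M \<le> x" "M \<le> y" "0 \<le> z" "z \<le> B" for x y z
  proof -
    have "ctri M M B + ctri M B M \<le> ctri M M z + ctri M z M" using that M B by (intro add_mono ctri_antimono2) auto
    \<comment> \<open>Two large curvatures cannot be compared one by one, because raising one lowers
      the other. Their sum is \<open>csum\<close> minus the third term, and both parts move the
      right way.\<close>
    moreover have "csum M M z \<le> csum x y z" using that M by (intro csum_mono(1)) auto
    moreover have "ctri z x y \<le> ctri z M M" using that M by (intro ctri_antimono2) auto
    ultimately show ?thesis using M by (simp add: csum_def)
  qed
  have three: "pi - \<delta> < csum x y z" if "M \<le> x" "M \<le> y" "M \<le> z" for x y z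
  proof -
    have "csum M M M \<le> csum x y z" using that M by (intro csum_mono(1)) auto
    then show ?thesis using M by (simp add: csum_def)
  qed
  have "pi - \<delta> < (\<Sum>v\<in>I. fc k f v)"
    if f: "f \<in> F" and h: "nonneg_on k" "\<forall>i\<in>I. M \<le> k i" "\<forall>j\<in>V - I. k j \<le> B" "tri_vertices f \<inter> I \<noteq> {}" "I \<subseteq> V" for I k f
  proof -
    obtain a b c where abc: "f = (a, b, c)" by (cases f)
    have V: "a \<in> V" "b \<in> V" "c \<in> V" and ne: "a \<noteq> b" "b \<noteq> c" "c \<noteq> a" using faces f abc by blast+
    note n = nonneg_onD[OF h(1) V(1)] nonneg_onD[OF h(1) V(2)] nonneg_onD[OF h(1) V(3)]
    have fI: "finite I" using h(5) finV finite_subset by blast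
    have "(\<Sum>v\<in>I. fc k f v) = (\<Sum>v\<in>I \<inter> {a, b, c}. fc k f v)"
      by (rule sum.mono_neutral_right[OF fI]) (auto simp: abc)
    also have "\<dots> = (\<Sum>v\<in>{a, b, c}. if v \<in> I then fc k f v else 0)"
      by (subst sum.inter_restrict[symmetric]) (auto simp: Int_commute)
    also have "\<dots> = (if a \<in> I then ctri (k a) (k b) (k c) else 0) + (if b \<in> I then ctri (k b) (k c) (k a) else 0)
      + (if c \<in> I then ctri (k c) (k a) (k b) else 0)" using ne by (simp add: abc)
    finally have s: "(\<Sum>v\<in>I. fc k f v) = \<dots>" .
    have dich: "w \<in> V \<Longrightarrow> (w \<in> I \<and> M \<le> k w) \<or> (w \<notin> I \<and> k w \<le> B)" for w using h by blast
    have r: "csum (k a) (k b) (k c) = ctri (k a) (k b) (k c) + ctri (k b) (k c) (k a) + ctri (k c) (k a) (k b)"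
      by (simp add: csum_def)
    show ?thesis unfolding s
      using dich[OF V(1)] dich[OF V(2)] dich[OF V(3)] h(4) n one[of "k a" "k b" "k c"] one[of "k b" "k c" "k a"] one[of "k c" "k a" "k b"]
        two[of "k a" "k b" "k c"] two[of "k b" "k c" "k a"] two[of "k c" "k a" "k b"] three[of "k a" "k b" "k c"] r
      by (auto simp: abc)
  qed
  with M(1) show ?thesis by (rule that)
qed

lemma tc_limit:
  assumes B: "0 < B" and d: "0 < \<delta>"
  obtains M where "0 < M" "\<And>I k. \<lbrakk>nonneg_on k; \<forall>i\<in>I. M \<le> k i; \<forall>j\<in>V - I. k j \<le> B; I \<subseteq> V\<rbrakk>
    \<Longrightarrow> pi * card {f \<in> F. tri_vertices f \<inter> I \<noteq> {}} - \<delta> \<le> (\<Sum>v\<in>I. tc k v)"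
proof -
  define \<delta>' where "\<delta>' = \<delta> / (card F + 1)"
  have d': "0 < \<delta>'" using d by (simp add: \<delta>'_def)
  obtain M where M: "0 < M" and H: "\<And>I k f. \<lbrakk>f \<in> F; nonneg_on k; \<forall>i\<in>I. M \<le> k i; \<forall>j\<in>V - I. k j \<le> B; tri_vertices f \<inter> I \<noteq> {}; I \<subseteq> V\<rbrakk>
    \<Longrightarrow> pi - \<delta>' < (\<Sum>v\<in>I. fc k f v)" using that by (rule face_limit[OF B d'])
  have "pi * card {f \<in> F. tri_vertices f \<inter> I \<noteq> {}} - \<delta> \<le> (\<Sum>v\<in>I. tc k v)"
    if h: "nonneg_on k" "\<forall>i\<in>I. M \<le> k i" "\<forall>j\<in>V - I. k j \<le> B" "I \<subseteq> V" for I k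
  proof -
    let ?G = "{f \<in> F. tri_vertices f \<inter> I \<noteq> {}}"
    have nonneg: "0 \<le> fc k f v" if "f \<in> F" for f v
    proof -
      obtain a b c where g: "f = (a, b, c)" by (cases f)
      have "a \<in> V" "b \<in> V" "c \<in> V" using faces that g by blast+
      then show ?thesis unfolding g using nonneg_onD[OF h(1)] by (auto intro!: ctri_nonneg)
    qed
    have "card ?G \<le> card F" using finF by (intro card_mono) auto
    then have "real (card ?G) * \<delta>' \<le> (card F + 1) * \<delta>'" using d' by (intro mult_right_mono) auto
    also have "\<dots> = \<delta>" by (simp add: \<delta>'_def)
    finally have "pi * card ?G - \<delta> \<le> (\<Sum>f\<in>?G. pi - \<delta>')" by (simp add: algebra_simps)
    also have "\<dots> \<le> (\<Sum>f\<in>?G. \<Sum>v\<in>I. fc k f v)" 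
    proof (rule sum_mono)
      fix f assume "f \<in> ?G"
      then show "pi - \<delta>' \<le> (\<Sum>v\<in>I. fc k f v)" using less_imp_le[OF H[OF _ h(1,2,3) _ h(4), of f]] by simp
    qed
    also have "\<dots> \<le> (\<Sum>f\<in>F. \<Sum>v\<in>I. fc k f v)"
      using finF nonneg by (intro sum_mono2) (auto intro!: sum_nonneg)
    also have "\<dots> = (\<Sum>v\<in>I. tc k v)" unfolding tc_def by (rule sum.swap)
    finally show ?thesis .
  qed
  with M show ?thesis by (rule that)
qed

definition admissible :: "('a \<Rightarrow> real) \<Rightarrow> bool" where
  "admissible T \<longleftrightarrow> nonneg_on T \<and> (\<forall>I. I \<noteq> {} \<and> I \<subseteq> V \<longrightarrow> eta F I T > 0)"

text \<open>At a vertex in no face the condition for the singleton would read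
  \<open>- T v > 0\<close>.\<close>

lemma admissible_covered: assumes "admissible T" "v \<in> V" shows "covered v"
proof -
  have "eta F {v} T > 0" using assms unfolding admissible_def by blast
  moreover have "T v \<ge> 0" using assms by (simp add: admissible_def nonneg_on_def)
  moreover have "eta F {v} T = pi * card {f \<in> F. tri_vertices f \<inter> {v} \<noteq> {}} - T v" by (simp add: eta_def)
  ultimately have "card {f \<in> F. tri_vertices f \<inter> {v} \<noteq> {}} \<noteq> 0" by (intro notI) simp
  then have "{f \<in> F. tri_vertices f \<inter> {v} \<noteq> {}} \<noteq> {}" by (metis card.empty)
  then show ?thesis unfolding covered_def by blast
qed

section \<open>Perron's method\<close>

definition subsol :: "('a \<Rightarrow> real) \<Rightarrow> ('a \<Rightarrow> real) set" where
  "subsol T = {k. nonneg_on k \<and> (\<forall>v\<in>V. tc k v \<le> T v)}"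

text \<open>At each vertex the maximum agrees with one of the two functions and is at least as large
  at the neighbours, which only lowers the curvature.\<close>

lemma subsol_max: assumes "k \<in> subsol T" "k' \<in> subsol T" shows "(\<lambda>v. max (k v) (k' v)) \<in> subsol T"
proof -
  have n: "nonneg_on k" "nonneg_on k'" using assms by (auto simp: subsol_def)
  have "tc (\<lambda>v. max (k v) (k' v)) v \<le> T v" if v: "v \<in> V" for v
  proof (cases "k' v \<le> k v")
    case True
    have "tc (\<lambda>v. max (k v) (k' v)) v \<le> tc k v" by (rule tc_antimono[OF n(1)]) (use True in auto)
    then show ?thesis using assms v by (force simp: subsol_def)
  next
    case False
    have "tc (\<lambda>v. max (k v) (k' v)) v \<le> tc k' v" by (rule tc_antimono[OF n(2)]) (use False in auto)
    then show ?thesis using assms v by (force simp: subsol_def)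
  qed
  then show ?thesis using n by (auto simp: subsol_def nonneg_on_def le_max_iff_disj)
qed

lemma subsol_zero: "nonneg_on T \<Longrightarrow> (\<lambda>_. 0) \<in> subsol T"
  by (auto simp: subsol_def nonneg_on_def tc_zero)

text \<open>Taking maxima turns largeness at each vertex of \<open>I\<close> separately into
  largeness at all of them at once.\<close>

lemma subsol_common:
  assumes "finite I" "nonneg_on T" "\<And>v. v \<in> I \<Longrightarrow> \<exists>k\<in>subsol T. M \<le> k v"
  shows "\<exists>k\<in>subsol T. \<forall>v\<in>I. M \<le> k v"
  using assms(1,3)
proof (induction I)
  case empty
  then show ?case using subsol_zero[OF assms(2)] by auto
next
  case (insert x I)
  then obtain k k' where k: "k \<in> subsol T" "\<forall>v\<in>I. M \<le> k v" "k' \<in> subsol T" "M \<le> k' x" by (metis insertCI)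
  then show ?case using subsol_max[OF k(1,3)]
    by (intro bexI[of _ "\<lambda>v. max (k v) (k' v)"]) (auto simp: le_max_iff_disj)
qed

text \<open>Here the conditions on \<open>eta\<close> act. If \<open>I\<close> is the set of
  vertices at which subsolutions are unbounded, a single subsolution is huge on \<open>I\<close> and
  bounded elsewhere. Its curvatures on \<open>I\<close> then add up to nearly pi times the number of
  faces meeting \<open>I\<close>, more than \<open>T\<close> allows.\<close>

lemma subsol_bdd:
  assumes T: "admissible T" and v: "v \<in> V" shows "bdd_above ((\<lambda>k. k v) ` subsol T)"
proof (rule ccontr)
  assume nb: "\<not> bdd_above ((\<lambda>k. k v) ` subsol T)"
  define I where "I = {v \<in> V. \<not> bdd_above ((\<lambda>k. k v) ` subsol T)}"
  have I: "I \<noteq> {}" "I \<subseteq> V" "finite I" using nb v finV by (auto simp: I_def)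
  have nT: "nonneg_on T" using T by (simp add: admissible_def)
  have "\<exists>b. \<forall>k\<in>subsol T. k j \<le> b" if "j \<in> V - I" for j using that by (auto simp: I_def bdd_above_def)
  then obtain b where b: "\<And>j k. j \<in> V - I \<Longrightarrow> k \<in> subsol T \<Longrightarrow> k j \<le> b j" by metis
  \<comment> \<open>The 1 keeps \<open>B\<close> positive, as \<open>tc_limit\<close> requires, also
    when \<open>V - I\<close> is empty.\<close>
  define B where "B = Max (insert 1 (b ` (V - I)))"
  have fin: "finite (insert 1 (b ` (V - I)))" using finV by simp
  have "1 \<le> B" unfolding B_def by (rule Max_ge[OF fin]) simp
  then have B: "0 < B" by simp
  have bB: "k j \<le> B" if "j \<in> V - I" "k \<in> subsol T" for j k
  proof -
    have "b j \<le> B" unfolding B_def by (rule Max_ge[OF fin]) (use that in simp)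
    then show ?thesis using b[OF that] by simp
  qed
  have e: "eta F I T > 0" using T I by (simp add: admissible_def)
  have e2: "0 < eta F I T / 2" using e by simp
  obtain M where M: "0 < M" and H: "\<And>J k. \<lbrakk>nonneg_on k; \<forall>i\<in>J. M \<le> k i; \<forall>j\<in>V - J. k j \<le> B; J \<subseteq> V\<rbrakk>
    \<Longrightarrow> pi * card {f \<in> F. tri_vertices f \<inter> J \<noteq> {}} - eta F I T / 2 \<le> (\<Sum>v\<in>J. tc k v)"
    using that by (rule tc_limit[OF B e2])
  have "\<exists>k\<in>subsol T. M \<le> k v" if "v \<in> I" for v
  proof -
    have "\<not> bdd_above ((\<lambda>k. k v) ` subsol T)" using that by (simp add: I_def)
    then have "\<not> (\<forall>x\<in>(\<lambda>k. k v) ` subsol T. x \<le> M)" unfolding bdd_above_def by blast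
    then show ?thesis by force
  qed
  then obtain k where k: "k \<in> subsol T" "\<forall>v\<in>I. M \<le> k v" using subsol_common[OF I(3) nT] by blast
  have "nonneg_on k" using k by (simp add: subsol_def)
  then have "pi * card {f \<in> F. tri_vertices f \<inter> I \<noteq> {}} - eta F I T / 2 \<le> (\<Sum>v\<in>I. tc k v)"
    by (rule H) (use k bB I in auto)
  also have "\<dots> \<le> (\<Sum>v\<in>I. T v)" using k I by (intro sum_mono) (auto simp: subsol_def)
  finally have "pi * card {f \<in> F. tri_vertices f \<inter> I \<noteq> {}} - eta F I T / 2 \<le> (\<Sum>v\<in>I. T v)" .
  moreover have "P - (P - S) / 2 \<le> S \<Longrightarrow> \<not> 0 < P - S" for P S :: real by (simp add: field_simps)
  ultimately show False using e unfolding eta_def by blast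
qed

definition max_subsol :: "('a \<Rightarrow> real) \<Rightarrow> 'a \<Rightarrow> real" where
  "max_subsol T v = (SUP k\<in>subsol T. k v)"

lemma max_subsol_upper: "admissible T \<Longrightarrow> v \<in> V \<Longrightarrow> k \<in> subsol T \<Longrightarrow> k v \<le> max_subsol T v"
  unfolding max_subsol_def by (rule cSUP_upper[OF _ subsol_bdd])

lemma max_subsol_nn: "admissible T \<Longrightarrow> nonneg_on (max_subsol T)"
  unfolding nonneg_on_def
proof
  fix v assume "admissible T" "v \<in> V"
  then show "0 \<le> max_subsol T v" using max_subsol_upper[of T v "\<lambda>_. 0"] subsol_zero[of T] by (simp add: admissible_def)
qed

lemma max_subsol_approx:
  assumes T: "admissible T" and v: "v \<in> V" and e: "e > 0"
  shows "\<exists>k\<in>subsol T. max_subsol T v - e < k v"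
proof -
  have "(\<lambda>k. k v) ` subsol T \<noteq> {}" using subsol_zero T by (auto simp: admissible_def)
  then show ?thesis
    using less_cSupD[of "(\<lambda>k. k v) ` subsol T" "max_subsol T v - e"] e unfolding max_subsol_def by auto
qed

lemma own_cont:
  assumes k: "nonneg_on k" and v: "v \<in> V" and e: "0 < e"
  shows "\<exists>d>0. \<forall>x. x \<ge> 0 \<longrightarrow> \<bar>x - k v\<bar> < d \<longrightarrow> \<bar>tc (k(v := x)) v - tc k v\<bar> < e"
proof -
  have "k v \<in> {0..}" using nonneg_onD[OF k v] by simp
  with tc_cont_own[OF k v] e obtain d where d: "d > 0"
    "\<forall>x\<in>{0..}. dist x (k v) < d \<longrightarrow> dist (tc (k(v := x)) v) (tc (k(v := k v)) v) < e"
    unfolding continuous_on_iff by blast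
  then show ?thesis by (intro exI[of _ d]) (auto simp: dist_real_def)
qed

text \<open>Continuity in the own variable suffices: lowering the supremum at \<open>v\<close> to
  the value of a nearly optimal subsolution \<open>k\<close> leaves its other entries above those of
  \<open>k\<close>, and \<open>tc_antimono\<close> compares the curvatures at
  \<open>v\<close>.\<close>

lemma max_subsol_le:
  assumes T: "admissible T" and v: "v \<in> V" shows "tc (max_subsol T) v \<le> T v"
proof (rule field_le_epsilon)
  fix e :: real assume e: "e > 0"
  let ?K = "max_subsol T"
  note n = max_subsol_nn[OF T]
  obtain d where d: "d > 0" and D: "\<And>x. x \<ge> 0 \<Longrightarrow> \<bar>x - ?K v\<bar> < d \<Longrightarrow> \<bar>tc (?K(v := x)) v - tc ?K v\<bar> < e"
    using own_cont[OF n v e] by blast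
  obtain k where k: "k \<in> subsol T" "?K v - d < k v" using max_subsol_approx[OF T v d] by blast
  have nk: "nonneg_on k" using k by (simp add: subsol_def)
  have "\<bar>k v - ?K v\<bar> < d" using k(2) max_subsol_upper[OF T v k(1)] d by simp
  then have "tc ?K v < tc (?K(v := k v)) v + e" using D[of "k v"] nonneg_onD[OF nk v] by linarith
  also have "tc (?K(v := k v)) v \<le> tc k v"
    by (rule tc_antimono[OF nk]) (use max_subsol_upper[OF T _ k(1)] in auto)
  also have "\<dots> \<le> T v" using k v by (simp add: subsol_def)
  finally show "tc ?K v \<le> T v + e" by simp
qed

text \<open>If the curvature fell short at \<open>v\<close>, the function could be raised slightly
  there: the curvature at \<open>v\<close> stays below \<open>T v\<close> by continuity and does not
  increase at other vertices, which contradicts maximality.\<close>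

lemma max_subsol_eq:
  assumes T: "admissible T" and v: "v \<in> V" shows "tc (max_subsol T) v = T v"
proof (rule ccontr)
  let ?K = "max_subsol T"
  note n = max_subsol_nn[OF T]
  assume "tc ?K v \<noteq> T v"
  then have l: "T v - tc ?K v > 0" using max_subsol_le[OF T v] by simp
  obtain d where d: "d > 0" and D: "\<And>x. x \<ge> 0 \<Longrightarrow> \<bar>x - ?K v\<bar> < d \<Longrightarrow> \<bar>tc (?K(v := x)) v - tc ?K v\<bar> < T v - tc ?K v"
    using own_cont[OF n v l] by blast
  define x where "x = ?K v + d / 2"
  have x: "x \<ge> 0" "\<bar>x - ?K v\<bar> < d" "?K v < x" using d nonneg_onD[OF n v] by (auto simp: x_def)
  have "?K(v := x) \<in> subsol T"
    unfolding subsol_def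
  proof (intro CollectI conjI ballI)
    show "nonneg_on (?K(v := x))" using n x by (simp add: nonneg_on_def)
    fix w assume w: "w \<in> V"
    show "tc (?K(v := x)) w \<le> T w"
    proof (cases "w = v")
      case True
      then show ?thesis using D[OF x(1,2)] by simp
    next
      case False
      then have "tc (?K(v := x)) w \<le> tc ?K w" using x by (intro tc_antimono[OF n]) auto
      then show ?thesis using max_subsol_le[OF T w] by simp
    qed
  qed
  then show False using max_subsol_upper[OF T v, of "?K(v := x)"] x by simp
qed

lemma max_subsol_mono:
  assumes "admissible T" "admissible T'" "\<And>v. v \<in> V \<Longrightarrow> T v \<le> T' v" "v \<in> V"
  shows "max_subsol T v \<le> max_subsol T' v"
proof (rule field_le_epsilon)
  fix e :: real assume "e > 0"
  then obtain k where k: "k \<in> subsol T" "max_subsol T v - e < k v" using max_subsol_approx assms by blast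
  then have "k \<in> subsol T'" using assms(3) by (force simp: subsol_def)
  then show "max_subsol T v \<le> max_subsol T' v + e" using max_subsol_upper[OF assms(2,4), of k] k by simp
qed

lemma max_subsol_zero_iff:
  assumes T: "admissible T" and v: "v \<in> V" shows "max_subsol T v = 0 \<longleftrightarrow> T v = 0"
  using max_subsol_eq[OF T v] tc_zero[of "max_subsol T" v] tc_pos[OF max_subsol_nn[OF T] _ admissible_covered[OF T v]] nonneg_onD[OF max_subsol_nn[OF T] v]
  by (metis less_eq_real_def less_irrefl)

end

section \<open>Global solutions of Lipschitz systems\<close>

lemma geometric_limit:
  fixes a :: "nat \<Rightarrow> real"
  assumes "\<And>n. \<bar>a (Suc n) - a n\<bar> \<le> c * (1 / 2) ^ n"
  shows "a \<longlonglongrightarrow> lim a" and "\<bar>lim a - a n\<bar> \<le> 2 * c * (1 / 2) ^ n"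
proof -
  have step: "\<bar>a (n + m) - a n\<bar> \<le> 2 * c * (1 / 2) ^ n - 2 * c * (1 / 2) ^ (n + m)" for n m
  proof (induction m)
    case (Suc m)
    have "\<bar>a (n + Suc m) - a n\<bar> \<le> \<bar>a (Suc (n + m)) - a (n + m)\<bar> + \<bar>a (n + m) - a n\<bar>" by simp
    also have "\<dots> \<le> c * (1 / 2) ^ (n + m) + (2 * c * (1 / 2) ^ n - 2 * c * (1 / 2) ^ (n + m))"
      by (rule add_mono[OF assms Suc.IH])
    also have "\<dots> = 2 * c * (1 / 2) ^ n - 2 * c * (1 / 2) ^ (n + Suc m)" by simp
    finally show ?case .
  qed simp
  have "\<bar>a 1 - a 0\<bar> \<le> c" using assms[of 0] by simp
  then have c: "c \<ge> 0" by linarith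
  have b: "\<bar>a (n + m) - a n\<bar> \<le> 2 * c * (1 / 2) ^ n" for n m
  proof -
    have "0 \<le> 2 * c * (1 / 2) ^ (n + m)" using c by simp
    then show ?thesis using step[of n m] by linarith
  qed
  have "Cauchy a"
  proof (rule metric_CauchyI)
    fix e :: real assume e: "e > 0"
    have "(\<lambda>n. 2 * c * (1 / 2) ^ n) \<longlonglongrightarrow> 2 * c * 0" by (intro tendsto_intros LIMSEQ_realpow_zero) auto
    then have "\<forall>\<^sub>F n in sequentially. 2 * c * (1 / 2) ^ n < e / 2" using e by (intro order_tendstoD(2)) auto
    then obtain M where M: "2 * c * (1 / 2) ^ M < e / 2" by (auto simp: eventually_sequentially)
    have "dist (a m) (a n) < e" if "m \<ge> M" "n \<ge> M" for m n
    proof -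
      have "\<bar>a m - a M\<bar> < e / 2" "\<bar>a n - a M\<bar> < e / 2"
        using b[of M "m - M"] b[of M "n - M"] M that by auto
      then show ?thesis unfolding dist_real_def by linarith
    qed
    then show "\<exists>M. \<forall>m\<ge>M. \<forall>n\<ge>M. dist (a m) (a n) < e" by blast
  qed
  then show l: "a \<longlonglongrightarrow> lim a" by (simp add: Cauchy_convergent_iff convergent_LIMSEQ_iff)
  have "(\<lambda>m. \<bar>a (n + m) - a n\<bar>) \<longlonglongrightarrow> \<bar>lim a - a n\<bar>"
    using LIMSEQ_ignore_initial_segment[OF l, of n] by (intro tendsto_intros) (simp add: add.commute)
  then show "\<bar>lim a - a n\<bar> \<le> 2 * c * (1 / 2) ^ n" by (rule LIMSEQ_le_const2) (use b in auto)
qed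

text \<open>Integration against an exponential weight gains the factor 1/\<mu>. In such a weighted
  norm Picard iteration contracts on the whole half-line and no solution has to be
  continued.\<close>

lemma integral_exp_bound:
  fixes f :: "real \<Rightarrow> real"
  assumes t: "0 \<le> t" and l: "\<mu> > 0" and f: "f integrable_on {0..t}" and b: "\<And>s. s \<in> {0..t} \<Longrightarrow> \<bar>f s\<bar> \<le> K * exp (\<mu> * s)" and K: "K \<ge> 0"
  shows "\<bar>integral {0..t} f\<bar> \<le> K * exp (\<mu> * t) / \<mu>"
proof -
  have "((\<lambda>s. K * exp (\<mu> * s)) has_integral (K * exp (\<mu> * t) / \<mu> - K * exp (\<mu> * 0) / \<mu>)) {0..t}"
  proof (rule fundamental_theorem_of_calculus[OF t])
    fix s assume "s \<in> {0..t}"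
    have "((\<lambda>s. K * exp (\<mu> * s) / \<mu>) has_real_derivative (K * exp (\<mu> * s))) (at s within {0..t})"
      using l by (auto intro!: derivative_eq_intros)
    then show "((\<lambda>s. K * exp (\<mu> * s) / \<mu>) has_vector_derivative (K * exp (\<mu> * s))) (at s within {0..t})"
      by (simp add: has_real_derivative_iff_has_vector_derivative)
  qed
  then have h: "(\<lambda>s. K * exp (\<mu> * s)) integrable_on {0..t}"
    "integral {0..t} (\<lambda>s. K * exp (\<mu> * s)) = K * exp (\<mu> * t) / \<mu> - K * exp (\<mu> * 0) / \<mu>"
    by (auto simp: has_integral_iff)
  have "norm (integral {0..t} f) \<le> integral {0..t} (\<lambda>s. K * exp (\<mu> * s))"
    by (rule integral_norm_bound_integral[OF f h(1)]) (use b in auto)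
  moreover have "K * exp (\<mu> * 0) / \<mu> \<ge> 0" using K l by simp
  ultimately show ?thesis unfolding h(2) by simp
qed

text \<open>Picard iteration; its increments are bounded by \<open>2^-n\<close> times an exponential weight.\<close>

lemma global_flow_exists:
  fixes G :: "('a \<Rightarrow> real) \<Rightarrow> 'a \<Rightarrow> real"
  assumes W: "finite W" and L: "0 \<le> L"
    and lip: "\<And>u u' v. v \<in> W \<Longrightarrow> \<bar>G u v - G u' v\<bar> \<le> L * (\<Sum>w\<in>W. \<bar>u w - u' w\<bar>)"
  obtains x where "\<And>v. v \<in> W \<Longrightarrow> x 0 v = x0 v"
    "\<And>t v. 0 \<le> t \<Longrightarrow> v \<in> W \<Longrightarrow> ((\<lambda>s. x s v) has_real_derivative G (x t) v) (at t within {0..})"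
proof -
  define X :: "nat \<Rightarrow> real \<Rightarrow> 'a \<Rightarrow> real" where "X = rec_nat (\<lambda>t v. x0 v) (\<lambda>_ y t v. x0 v + integral {0..t} (\<lambda>s. G (y s) v))"
  have X0: "X 0 t v = x0 v" and XS: "X (Suc n) t v = x0 v + integral {0..t} (\<lambda>s. G (X n s) v)" for n t v
    by (simp_all add: X_def)
  have Gcont: "continuous_on S (\<lambda>s. G (y s) v)"
    if v: "v \<in> W" and y: "\<And>w. w \<in> W \<Longrightarrow> continuous_on S (\<lambda>s. y s w)" for y :: "real \<Rightarrow> 'a \<Rightarrow> real" and v S
    unfolding continuous_on_def
  proof
    fix s assume s: "s \<in> S"
    have "((\<lambda>r. L * (\<Sum>w\<in>W. \<bar>y r w - y s w\<bar>)) \<longlongrightarrow> L * (\<Sum>w\<in>W. \<bar>y s w - y s w\<bar>)) (at s within S)"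
      using y s unfolding continuous_on_def by (intro tendsto_intros) auto
    then have "((\<lambda>r. L * (\<Sum>w\<in>W. \<bar>y r w - y s w\<bar>)) \<longlongrightarrow> 0) (at s within S)" by simp
    then have "((\<lambda>r. G (y r) v - G (y s) v) \<longlongrightarrow> 0) (at s within S)"
      by (rule Lim_null_comparison[rotated]) (use lip[OF v] in auto)
    then show "((\<lambda>s. G (y s) v) \<longlongrightarrow> G (y s) v) (at s within S)" by (rule Lim_null[THEN iffD2])
  qed
  have Xcont: "\<forall>w\<in>W. continuous_on {0..T} (\<lambda>s. X n s w)" for n T
  proof (induction n)
    case 0
    then show ?case by (simp add: X0)
  next
    case (Suc n)
    show ?case
    proof
      fix w assume w: "w \<in> W"
      have "(\<lambda>s. G (X n s) w) integrable_on {0..T}"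
        by (rule integrable_continuous_real[OF Gcont[OF w]]) (use Suc in auto)
      then show "continuous_on {0..T} (\<lambda>s. X (Suc n) s w)" unfolding XS
        by (intro continuous_intros indefinite_integral_continuous_1)
    qed
  qed
  have Gint: "(\<lambda>s. G (X n s) v) integrable_on {0..t}" if "v \<in> W" for n t v
    by (rule integrable_continuous_real[OF Gcont[OF that]]) (use Xcont in auto)
  \<comment> \<open>Makes the contraction factor \<open>L * card W / \<mu>\<close> at most 1/2 and
    \<mu> at least 1.\<close>
  define \<mu> where "\<mu> = 2 * L * card W + 1"
  have lam: "\<mu> \<ge> 1" using L by (simp add: \<mu>_def)
  define C where "C = (\<Sum>v\<in>W. \<bar>G x0 v\<bar>)"
  have C: "C \<ge> 0" by (simp add: C_def sum_nonneg)
  have incr: "(\<Sum>v\<in>W. \<bar>X (Suc n) t v - X n t v\<bar>) \<le> C * (1 / 2) ^ n * exp (\<mu> * t)" if t: "0 \<le> t" for n t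
    using t
  proof (induction n arbitrary: t)
    case 0
    have "t \<le> exp (\<mu> * t)"
    proof -
      have "t \<le> \<mu> * t" using lam 0 by (simp add: mult_le_cancel_right1)
      also have "\<dots> \<le> exp (\<mu> * t)" using exp_ge_add_one_self[of "\<mu> * t"] by linarith
      finally show ?thesis .
    qed
    have X1: "X (Suc 0) t v - X 0 t v = t * G x0 v" for v
    proof -
      have "X 0 = (\<lambda>s. x0)" by (simp add: fun_eq_iff X0)
      then show ?thesis unfolding XS X0 using 0 by simp
    qed
    have "(\<Sum>v\<in>W. \<bar>X (Suc 0) t v - X 0 t v\<bar>) = t * C"
      unfolding X1 C_def using 0 by (simp add: abs_mult sum_distrib_left)
    also have "\<dots> \<le> exp (\<mu> * t) * C" using \<open>t \<le> exp (\<mu> * t)\<close> C by (rule mult_right_mono)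
    finally show ?case by (simp add: mult.commute)
  next
    case (Suc n)
    have "\<bar>X (Suc (Suc n)) t v - X (Suc n) t v\<bar> \<le> L * (C * (1 / 2) ^ n) * exp (\<mu> * t) / \<mu>" if v: "v \<in> W" for v
    proof -
      have e: "X (Suc (Suc n)) t v - X (Suc n) t v = integral {0..t} (\<lambda>s. G (X (Suc n) s) v - G (X n s) v)"
        unfolding XS[of "Suc n" t v] XS[of n t v] integral_diff[OF Gint[OF v] Gint[OF v]] by simp
      show ?thesis unfolding e
      proof (rule integral_exp_bound)
        show "(\<lambda>s. G (X (Suc n) s) v - G (X n s) v) integrable_on {0..t}" by (intro integrable_diff Gint v)
        fix s assume s: "s \<in> {0..t}"
        have "\<bar>G (X (Suc n) s) v - G (X n s) v\<bar> \<le> L * (\<Sum>w\<in>W. \<bar>X (Suc n) s w - X n s w\<bar>)" by (rule lip[OF v])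
        also have "\<dots> \<le> L * (C * (1 / 2) ^ n * exp (\<mu> * s))" using Suc.IH[of s] s L by (intro mult_left_mono) auto
        finally show "\<bar>G (X (Suc n) s) v - G (X n s) v\<bar> \<le> L * (C * (1 / 2) ^ n) * exp (\<mu> * s)" by (simp add: mult.assoc)
      qed (use Suc.prems lam L C in auto)
    qed
    then have "(\<Sum>v\<in>W. \<bar>X (Suc (Suc n)) t v - X (Suc n) t v\<bar>) \<le> card W * (L * (C * (1 / 2) ^ n) * exp (\<mu> * t) / \<mu>)"
      by (intro sum_bounded_above)
    also have "\<dots> = (card W * L / \<mu>) * (C * (1 / 2) ^ n * exp (\<mu> * t))" by simp
    also have "\<dots> \<le> (1 / 2) * (C * (1 / 2) ^ n * exp (\<mu> * t))"
    proof (rule mult_right_mono)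
      show "card W * L / \<mu> \<le> 1 / 2" using lam by (simp add: pos_divide_le_eq) (simp add: \<mu>_def)
    qed (use C in simp)
    finally show ?case by simp
  qed
  define x where "x = (\<lambda>t v. lim (\<lambda>n. X n t v))"
  have incr1: "\<bar>X (Suc n) t v - X n t v\<bar> \<le> C * exp (\<mu> * t) * (1 / 2) ^ n" if "0 \<le> t" "v \<in> W" for n t v
  proof -
    have "\<bar>X (Suc n) t v - X n t v\<bar> \<le> (\<Sum>v\<in>W. \<bar>X (Suc n) t v - X n t v\<bar>)"
      using that W by (intro member_le_sum) auto
    then show ?thesis using incr[OF that(1), of n] by (simp add: mult_ac)
  qed
  have xlim: "(\<lambda>n. X n t v) \<longlonglongrightarrow> x t v" if "0 \<le> t" "v \<in> W" for t v
    unfolding x_def by (rule geometric_limit(1)[OF incr1[OF that]])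
  have xb: "\<bar>x t v - X n t v\<bar> \<le> 2 * (C * exp (\<mu> * t)) * (1 / 2) ^ n" if "0 \<le> t" "v \<in> W" for t v n
    unfolding x_def by (rule geometric_limit(2)[OF incr1[OF that]])
  have half0: "(\<lambda>n. a * (1 / 2) ^ n) \<longlonglongrightarrow> 0" for a :: real
    using tendsto_mult_right_zero[OF LIMSEQ_realpow_zero[of "1 / 2 :: real"], of a] by simp
  \<comment> \<open>The bound grows with \<open>t\<close>, so convergence is uniform on bounded
    intervals, which is enough for continuity of the limit.\<close>
  have unif: "uniform_limit {0..T} (\<lambda>n t. X n t v) (\<lambda>t. x t v) sequentially" if v: "v \<in> W" for T v
  proof (rule uniform_limitI)
    fix e :: real assume e: "e > 0"
    have "\<forall>\<^sub>F n in sequentially. 2 * (C * exp (\<mu> * T)) * (1 / 2) ^ n < e" using half0 e by (rule order_tendstoD(2))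
    then show "\<forall>\<^sub>F n in sequentially. \<forall>t\<in>{0..T}. dist (X n t v) (x t v) < e"
    proof (rule eventually_mono, intro ballI)
      fix n t assume n: "2 * (C * exp (\<mu> * T)) * (1 / 2) ^ n < e" and t: "t \<in> {0..T}"
      have "\<bar>x t v - X n t v\<bar> \<le> 2 * (C * exp (\<mu> * t)) * (1 / 2) ^ n" using xb v t by simp
      also have "\<dots> \<le> 2 * (C * exp (\<mu> * T)) * (1 / 2) ^ n"
        using t lam C by (intro mult_right_mono mult_left_mono) auto
      finally show "dist (X n t v) (x t v) < e" using n by (simp add: dist_real_def)
    qed
  qed
  have xcont: "continuous_on {0..T} (\<lambda>t. x t v)" if "v \<in> W" for T v
    by (rule uniform_limit_theorem[OF _ unif[OF that]]) (use Xcont that in auto)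
  have xGint: "(\<lambda>s. G (x s) v) integrable_on {0..t}" if "v \<in> W" for t v
    by (rule integrable_continuous_real[OF Gcont[OF that]]) (use xcont in auto)
  have xeq: "x t v = x0 v + integral {0..t} (\<lambda>s. G (x s) v)" if t: "0 \<le> t" and v: "v \<in> W" for t v
  proof -
    have "\<bar>X (Suc n) t v - (x0 v + integral {0..t} (\<lambda>s. G (x s) v))\<bar> \<le> (L * card W * (2 * C) * exp (\<mu> * t) / \<mu>) * (1 / 2) ^ n" for n
    proof -
      have e: "X (Suc n) t v - (x0 v + integral {0..t} (\<lambda>s. G (x s) v)) = integral {0..t} (\<lambda>s. G (X n s) v - G (x s) v)"
        unfolding XS[of n t v] integral_diff[OF Gint[OF v] xGint[OF v]] by simp
      have "\<bar>integral {0..t} (\<lambda>s. G (X n s) v - G (x s) v)\<bar> \<le> (L * card W * (2 * C) * (1 / 2) ^ n) * exp (\<mu> * t) / \<mu>"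
      proof (rule integral_exp_bound[OF t])
        show "(\<lambda>s. G (X n s) v - G (x s) v) integrable_on {0..t}" by (intro integrable_diff Gint xGint v)
        fix s assume s: "s \<in> {0..t}"
        have "(\<Sum>w\<in>W. \<bar>X n s w - x s w\<bar>) \<le> card W * (2 * (C * exp (\<mu> * s)) * (1 / 2) ^ n)"
          using xb[of s] s by (intro sum_bounded_above) (simp add: abs_minus_commute)
        then have "L * (\<Sum>w\<in>W. \<bar>X n s w - x s w\<bar>) \<le> L * (card W * (2 * (C * exp (\<mu> * s)) * (1 / 2) ^ n))" using L by (rule mult_left_mono)
        then show "\<bar>G (X n s) v - G (x s) v\<bar> \<le> (L * card W * (2 * C) * (1 / 2) ^ n) * exp (\<mu> * s)"
          using lip[OF v, of "X n s" "x s"] by (simp add: mult_ac)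
      qed (use lam L C in auto)
      then show ?thesis unfolding e by (simp add: mult_ac)
    qed
    then have "(\<lambda>n. X (Suc n) t v - (x0 v + integral {0..t} (\<lambda>s. G (x s) v))) \<longlonglongrightarrow> 0"
      by (intro Lim_null_comparison[OF _ half0[of "L * card W * (2 * C) * exp (\<mu> * t) / \<mu>"]] eventuallyI)
        (simp only: real_norm_def)
    then have "(\<lambda>n. X (Suc n) t v) \<longlonglongrightarrow> x0 v + integral {0..t} (\<lambda>s. G (x s) v)" by (rule Lim_null[THEN iffD2])
    moreover have "(\<lambda>n. X (Suc n) t v) \<longlonglongrightarrow> x t v" using xlim[OF t v] by (rule LIMSEQ_Suc)
    ultimately show ?thesis using LIMSEQ_unique by blast
  qed
  show ?thesis
  proof
    show "x 0 v = x0 v" if "v \<in> W" for v using xeq[of 0 v] that by simp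
    fix t v assume t: "0 \<le> (t::real)" and v: "v \<in> W"
    have "((\<lambda>s. integral {0..s} (\<lambda>s. G (x s) v)) has_real_derivative G (x t) v) (at t within {0..t + 1})"
      by (rule integral_has_real_derivative[OF Gcont[OF v]]) (use xcont t in auto)
    then have "((\<lambda>s. x0 v + integral {0..s} (\<lambda>s. G (x s) v)) has_real_derivative G (x t) v) (at t within {0..t + 1})"
      by (auto intro!: derivative_eq_intros)
    then have "((\<lambda>s. x s v) has_real_derivative G (x t) v) (at t within {0..t + 1})"
      by (rule has_field_derivative_transform_within[OF _ zero_less_one]) (use xeq v t in auto)
    \<comment> \<open>The integral equation gives the derivative within \<open>{0..t + 1}\<close>, a
      set that agrees with \<open>{0..}\<close> near \<open>t\<close>.\<close>
    moreover have "at t within {0..t + 1} = at t within {0..}"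
      by (rule at_within_nhd[of t "{..<t + 1}"]) auto
    ultimately show "((\<lambda>s. x s v) has_real_derivative G (x t) v) (at t within {0..})" by simp
  qed
qed

section \<open>Convergence of the flow\<close>

text \<open>At the first time at which one of the functions reaches \<open>0\<close> its derivative would be nonnegative.\<close>

lemma barrier:
  fixes g g' :: "'v \<Rightarrow> real \<Rightarrow> real"
  assumes W: "finite W" and d: "\<And>v t. v \<in> W \<Longrightarrow> 0 \<le> t \<Longrightarrow> (g v has_real_derivative g' v t) (at t within {0..})"
    and i: "\<And>v. v \<in> W \<Longrightarrow> g v 0 < 0"
    and neg: "\<And>v t. v \<in> W \<Longrightarrow> 0 \<le> t \<Longrightarrow> g v t = 0 \<Longrightarrow> (\<forall>w\<in>W. g w t \<le> 0) \<Longrightarrow> g' v t < 0"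
    and v: "v \<in> W" and t: "0 \<le> t"
  shows "g v t < 0"
proof (rule ccontr)
  assume "\<not> g v t < 0"
  have cont: "continuous_on {0..} (g w)" if "w \<in> W" for w
    using d[OF that] by (auto simp: continuous_on_eq_continuous_within intro: DERIV_continuous)
  define Z where "Z = (\<Union>w\<in>W. {s \<in> {0..}. 0 \<le> g w s})"
  have "closed {s \<in> {0..}. 0 \<le> g w s}" if "w \<in> W" for w
    using continuous_closedin_preimage[OF cont[OF that], of "{0..}"] closedin_closed_trans[of "{0::real..}"]
    by (simp add: vimage_def Int_def)
  then have Z: "closed Z" unfolding Z_def using W by (intro closed_UN) auto
  have tZ: "t \<in> Z" unfolding Z_def using \<open>\<not> g v t < 0\<close> t v by (intro UN_I[of v]) (simp_all add: not_less)
  have bd: "bdd_below Z" by (rule bdd_belowI[of _ 0]) (auto simp: Z_def)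
  define s where "s = Inf Z"
  have sZ: "s \<in> Z" unfolding s_def using closed_contains_Inf[OF _ bd Z] tZ by blast
  then obtain w where w: "w \<in> W" "0 \<le> s" "0 \<le> g w s" by (auto simp: Z_def)
  have before: "g u r < 0" if "u \<in> W" "0 \<le> r" "r < s" for u r
  proof (rule ccontr)
    assume "\<not> g u r < 0"
    then have "r \<in> Z" unfolding Z_def using that by (intro UN_I[of u]) (simp_all add: not_less)
    then have "s \<le> r" unfolding s_def using bd by (rule cInf_lower)
    then show False using that by simp
  qed
  have s0: "0 < s" using w i[OF w(1)] by (cases "s = 0") auto
  have le: "g u s \<le> 0" if u: "u \<in> W" for u
  proof (rule ccontr)
    assume "\<not> g u s \<le> 0"
    then have p: "g u s > 0" by simp
    have "continuous_on {0..s} (g u)" using cont[OF u] by (rule continuous_on_subset) auto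
    then obtain r where r: "0 \<le> r" "r \<le> s" "g u r = 0"
      using IVT'[of "g u" 0 0 s] i[OF u] p s0 by auto
    then have "r \<noteq> s" using p by auto
    then show False using before[OF u, of r] r by simp
  qed
  then have z: "g w s = 0" using w by (meson order_antisym)
  then have n: "g' w s < 0" using neg[OF w(1,2)] le by blast
  have "(g w has_real_derivative g' w s) (at s within {0<..})"
    using d[OF w(1,2)] by (rule DERIV_subset) auto
  then have "(g w has_real_derivative g' w s) (at s)" using s0 by (simp add: at_within_open[of s "{0<..}"])
  \<comment> \<open>A negative derivative at a zero makes the function positive just before it,
    where all functions are still negative.\<close>
  from DERIV_neg_dec_left[OF this n] obtain e where e: "e > 0" "\<And>h. 0 < h \<Longrightarrow> h < e \<Longrightarrow> g w s < g w (s - h)" by blast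
  define h where "h = min (e / 2) (s / 2)"
  have h: "0 < h" "h < e" "h \<le> s" using e s0 by (auto simp: h_def)
  have "g w (s - h) < 0" using before[OF w(1), of "s - h"] h by simp
  then show False using e(2)[OF h(1,2)] z by simp
qed

context tri_graph
begin

section \<open>Dependence of the solution on the prescribed values\<close>

lemma admissible_perturb:
  assumes T: "admissible T"
  shows "\<exists>\<epsilon>0>0. \<forall>T'. (\<forall>v\<in>V. 0 \<le> T' v \<and> T' v \<le> T v + \<epsilon>0) \<longrightarrow> admissible T'"
proof -
  define E where "E = (\<lambda>I. eta F I T) ` {I. I \<noteq> {} \<and> I \<subseteq> V}"
  have fin: "finite E" unfolding E_def using finV by simp
  \<comment> \<open>The smallest slack in the finitely many conditions; the 1 keeps the minimum
    defined when \<open>V\<close> is empty.\<close>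
  define m where "m = Min (insert 1 E)"
  have m: "m > 0" unfolding m_def using fin T by (auto simp: E_def admissible_def)
  have me: "m \<le> eta F I T" if "I \<noteq> {}" "I \<subseteq> V" for I
    unfolding m_def using fin that by (intro Min_le) (auto simp: E_def)
  define \<epsilon> where "\<epsilon> = m / (card V + 1)"
  have e: "\<epsilon> > 0" using m by (simp add: \<epsilon>_def)
  have "admissible T'" if h: "\<forall>v\<in>V. 0 \<le> T' v \<and> T' v \<le> T v + \<epsilon>" for T'
    unfolding admissible_def
  proof (intro conjI allI impI)
    show "nonneg_on T'" using h by (simp add: nonneg_on_def)
    fix I assume I: "I \<noteq> {} \<and> I \<subseteq> V"
    then have "card I \<le> card V" using finV by (intro card_mono) auto
    have "(\<Sum>i\<in>I. T' i) \<le> (\<Sum>i\<in>I. T i + \<epsilon>)" using h I by (intro sum_mono) auto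
    also have "\<dots> = (\<Sum>i\<in>I. T i) + card I * \<epsilon>" by (simp add: sum.distrib)
    also have "card I * \<epsilon> \<le> card V * \<epsilon>" using \<open>card I \<le> card V\<close> e by (intro mult_right_mono) auto
    also have "card V * \<epsilon> < (card V + 1) * \<epsilon>" using e by simp
    also have "(card V + 1) * \<epsilon> = m" by (simp add: \<epsilon>_def)
    finally have "(\<Sum>i\<in>I. T' i) < (\<Sum>i\<in>I. T i) + m" by simp
    then show "eta F I T' > 0" using me[of I] I by (simp add: eta_def)
  qed
  then show ?thesis using e by blast
qed

text \<open>A jump of the solution at a single vertex would already change the total curvature of the surface.\<close>

lemma max_subsol_near:
  assumes T: "admissible T" and v: "v \<in> V" and \<delta>: "\<delta> > 0"
  shows "\<exists>\<epsilon>>0. \<forall>T'. admissible T' \<and> (\<forall>w\<in>V. T w \<le> T' w \<and> T' w \<le> T w + \<epsilon>) \<longrightarrow> max_subsol T' v < max_subsol T v + \<delta>"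
    and "\<delta> \<le> max_subsol T v \<Longrightarrow> \<exists>\<epsilon>>0. \<forall>T'. admissible T' \<and> (\<forall>w\<in>V. T' w \<le> T w \<and> T w \<le> T' w + \<epsilon>) \<longrightarrow> max_subsol T v - \<delta> < max_subsol T' v"
proof -
  let ?K = "max_subsol T"
  note n = max_subsol_nn[OF T] and c = admissible_covered[OF T v]
  have tot: "(\<Sum>w\<in>V. tc (max_subsol T') w) = (\<Sum>w\<in>V. T' w)" if "admissible T'" for T'
    by (rule sum.cong) (use max_subsol_eq[OF that] in auto)
  have sum_le: "(\<Sum>w\<in>V. A w) < (\<Sum>w\<in>V. B w) + C"
    if "\<forall>w\<in>V. A w \<le> B w + C / (card V + 1)" "C > 0" for A B :: "'a \<Rightarrow> real" and C
  proof -
    have "(\<Sum>w\<in>V. A w) \<le> (\<Sum>w\<in>V. B w + C / (card V + 1))" using that by (intro sum_mono) auto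
    also have "\<dots> = (\<Sum>w\<in>V. B w) + card V * (C / (card V + 1))" by (simp add: sum.distrib)
    also have "card V * (C / (card V + 1)) < C" using that(2) by (simp add: divide_less_eq)
    finally show ?thesis by simp
  qed
  {
    define K' where "K' = ?K(v := ?K v + \<delta>)"
    have n': "nonneg_on K'" using n \<delta> v by (auto simp: nonneg_on_def K'_def)
    have "(\<Sum>w\<in>V. tc ?K w) < (\<Sum>w\<in>V. tc K' w)"
      by (rule tc_total_mono(2)[OF n _ v c]) (use \<delta> in \<open>auto simp: K'_def\<close>)
    then have C: "(\<Sum>w\<in>V. tc K' w) - (\<Sum>w\<in>V. tc ?K w) > 0" (is "?C > 0") by simp
    \<comment> \<open>Summed over \<open>V\<close>, perturbations of at most
      \<open>?C / (card V + 1)\<close> at each vertex stay below \<open>?C\<close>, the change of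
      total curvature caused by the jump at \<open>v\<close>.\<close>
    have "max_subsol T' v < ?K v + \<delta>"
      if h: "admissible T'" "\<forall>w\<in>V. T w \<le> T' w \<and> T' w \<le> T w + ?C / (card V + 1)" for T'
    proof (rule ccontr)
      assume "\<not> max_subsol T' v < ?K v + \<delta>"
      then have "K' w \<le> max_subsol T' w" if "w \<in> V" for w
        using max_subsol_mono[OF T h(1) _ that] h(2) by (auto simp: K'_def)
      then have "(\<Sum>w\<in>V. tc K' w) \<le> (\<Sum>w\<in>V. tc (max_subsol T') w)" by (rule tc_total_mono(1)[OF n'])
      moreover have "(\<Sum>w\<in>V. T' w) < (\<Sum>w\<in>V. T w) + ?C" using h(2) C by (intro sum_le) auto
      ultimately show False using tot[OF h(1)] tot[OF T] by linarith
    qed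
    moreover have "?C / (card V + 1) > 0" using C by simp
    ultimately show "\<exists>\<epsilon>>0. \<forall>T'. admissible T' \<and> (\<forall>w\<in>V. T w \<le> T' w \<and> T' w \<le> T w + \<epsilon>) \<longrightarrow> max_subsol T' v < max_subsol T v + \<delta>"
      by blast
  }
  {
    assume le: "\<delta> \<le> ?K v"
    define K' where "K' = ?K(v := ?K v - \<delta>)"
    have n': "nonneg_on K'" using n le v by (auto simp: nonneg_on_def K'_def)
    have "(\<Sum>w\<in>V. tc K' w) < (\<Sum>w\<in>V. tc ?K w)"
      by (rule tc_total_mono(2)[OF n' _ v c]) (use \<delta> in \<open>auto simp: K'_def\<close>)
    then have C: "(\<Sum>w\<in>V. tc ?K w) - (\<Sum>w\<in>V. tc K' w) > 0" (is "?C > 0") by simp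
    have "?K v - \<delta> < max_subsol T' v"
      if h: "admissible T'" "\<forall>w\<in>V. T' w \<le> T w \<and> T w \<le> T' w + ?C / (card V + 1)" for T'
    proof (rule ccontr)
      assume "\<not> ?K v - \<delta> < max_subsol T' v"
      then have "max_subsol T' w \<le> K' w" if "w \<in> V" for w
        using max_subsol_mono[OF h(1) T _ that] h(2) by (auto simp: K'_def)
      then have "(\<Sum>w\<in>V. tc (max_subsol T') w) \<le> (\<Sum>w\<in>V. tc K' w)" by (rule tc_total_mono(1)[OF max_subsol_nn[OF h(1)]])
      moreover have "(\<Sum>w\<in>V. T w) < (\<Sum>w\<in>V. T' w) + ?C" using h(2) C by (intro sum_le) auto
      ultimately show False using tot[OF h(1)] tot[OF T] by linarith
    qed
    moreover have "?C / (card V + 1) > 0" using C by simp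
    ultimately show "\<exists>\<epsilon>>0. \<forall>T'. admissible T' \<and> (\<forall>w\<in>V. T' w \<le> T w \<and> T w \<le> T' w + \<epsilon>) \<longrightarrow> max_subsol T v - \<delta> < max_subsol T' v"
      by blast
  }
qed

section \<open>Barriers for the flow and convergence\<close>

definition flow :: "'a set \<Rightarrow> ('a \<Rightarrow> real) \<Rightarrow> (real \<Rightarrow> 'a \<Rightarrow> real) \<Rightarrow> bool" where
  "flow J T k \<longleftrightarrow> (\<forall>t\<ge>0. (\<forall>v\<in>V. 0 \<le> k t v \<and> (k t v = 0 \<longleftrightarrow> v \<in> J)) \<and>
     (\<forall>v\<in>V - J. ((\<lambda>s. k s v) has_real_derivative - (tc (k t) v - T v) * k t v) (at t within {0..})))"

text \<open>The factor \<open>1 + C exp (- e t / 2)\<close> of the barriers decays slower than the rate \<open>e\<close> forced by the gap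
  between the prescribed curvatures.\<close>

lemma log_factor:
  assumes "C > 0" "e > 0"
  shows "((\<lambda>t. ln (1 + C * exp (- e * t / 2))) has_real_derivative (- (C * e / 2 * exp (- e * t / 2)) / (1 + C * exp (- e * t / 2)))) (at t within S)"
    and "- e / 2 < - (C * e / 2 * exp (- e * t / 2)) / (1 + C * exp (- e * t / 2))"
proof -
  have p: "1 + C * exp (- e * t / 2) > 0" using assms by (simp add: add_pos_pos)
  have d: "((\<lambda>t. 1 + C * exp (- e * t / 2)) has_real_derivative (- (C * e / 2 * exp (- e * t / 2)))) (at t within S)"
    by (auto intro!: derivative_eq_intros)
  show "((\<lambda>t. ln (1 + C * exp (- e * t / 2))) has_real_derivative (- (C * e / 2 * exp (- e * t / 2)) / (1 + C * exp (- e * t / 2)))) (at t within S)"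
    by (rule DERIV_cong[OF DERIV_chain2[OF DERIV_ln[OF p] d]]) (rule divide_inverse_commute[symmetric])
  have "e / 2 * (1 + C * x) = e / 2 + C * e / 2 * x" for x by (simp add: field_simps)
  then have "C * e / 2 * exp (- e * t / 2) < e / 2 * (1 + C * exp (- e * t / 2))" using assms(2) by simp
  then have "C * e / 2 * exp (- e * t / 2) / (1 + C * exp (- e * t / 2)) < e / 2" by (simp only: pos_divide_less_eq[OF p])
  then show "- e / 2 < - (C * e / 2 * exp (- e * t / 2)) / (1 + C * exp (- e * t / 2))"
    by (simp only: minus_divide_left[symmetric] neg_less_iff_less)
qed

lemma flow_log_deriv:
  assumes f: "flow J T k" and t: "0 \<le> t" and v: "v \<in> V - J"
  shows "((\<lambda>s. ln (k s v)) has_real_derivative - (tc (k t) v - T v)) (at t within {0..})"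
proof -
  have p: "k t v > 0" using f t v unfolding flow_def by (metis DiffD1 DiffD2 less_eq_real_def)
  have "((\<lambda>s. k s v) has_real_derivative - (tc (k t) v - T v) * k t v) (at t within {0..})"
    using f t v unfolding flow_def by blast
  from DERIV_chain2[OF DERIV_ln[OF p] this] show ?thesis by (rule DERIV_cong) (use p in \<open>simp add: field_simps\<close>)
qed

lemma flow_pos: "flow J T k \<Longrightarrow> 0 \<le> t \<Longrightarrow> v \<in> V - J \<Longrightarrow> k t v > 0"
  unfolding flow_def by (metis DiffD1 DiffD2 less_eq_real_def)

lemma flow_nn: "flow J T k \<Longrightarrow> 0 \<le> t \<Longrightarrow> nonneg_on (k t)"
  unfolding flow_def nonneg_on_def by blast

text \<open>The barrier is \<phi> K with a decreasing factor \<phi> > 1. At a first contact at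
  \<open>v\<close> the flow lies below it everywhere, so its curvature at \<open>v\<close> is at
  least that of \<phi> K, hence at least that of K, which exceeds \<open>T v\<close> by
  \<open>e\<close>. Thus ln k falls at least at rate \<open>e\<close>, but the logarithm of the
  barrier at a rate below \<open>e / 2\<close>.\<close>

lemma flow_upper:
  assumes f: "flow J T k" and K: "nonneg_on K" "\<And>v. v \<in> V - J \<Longrightarrow> 0 < K v" and e: "e > 0"
    and TK: "\<And>v. v \<in> V - J \<Longrightarrow> T v + e \<le> tc K v"
  shows "\<exists>C>0. \<forall>t\<ge>0. \<forall>v\<in>V - J. k t v < K v * (1 + C * exp (- e * t / 2))"
proof -
  \<comment> \<open>Puts the barrier above the initial value at every vertex; the 1 keeps
    \<open>C\<close> positive when \<open>V - J\<close> is empty.\<close>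
  define C where "C = (\<Sum>v\<in>V - J. k 0 v / K v) + 1"
  have nonneg: "0 \<le> k 0 v / K v" if "v \<in> V - J" for v
    using flow_pos[OF f _ that, of 0] K(2)[OF that] by simp
  then have C: "C \<ge> 1" unfolding C_def by (simp only: le_add_same_cancel2 sum_nonneg)
  then have C0: "C > 0" by simp
  define \<phi> where "\<phi> = (\<lambda>t. 1 + C * exp (- e * t / 2))"
  have \<phi>: "\<phi> t > 1" for t using C by (simp add: \<phi>_def)
  define g where "g = (\<lambda>v t. ln (k t v) - ln (K v) - ln (\<phi> t))"
  have lt: "k t v < K v * \<phi> t \<longleftrightarrow> g v t < 0" "k t v \<le> K v * \<phi> t \<longleftrightarrow> g v t \<le> 0" "k t v = K v * \<phi> t \<longleftrightarrow> g v t = 0"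
    if "0 \<le> t" "v \<in> V - J" for t v
  proof -
    have p: "0 < k t v" "0 < K v * \<phi> t" "0 < K v" "0 < \<phi> t" using flow_pos[OF f that] K(2)[OF that(2)] \<phi>[of t] by auto
    have "g v t = ln (k t v) - ln (K v * \<phi> t)" unfolding g_def using p by (simp add: ln_mult)
    then show "k t v < K v * \<phi> t \<longleftrightarrow> g v t < 0" "k t v \<le> K v * \<phi> t \<longleftrightarrow> g v t \<le> 0" "k t v = K v * \<phi> t \<longleftrightarrow> g v t = 0"
      using p by auto
  qed
  have "g v t < 0" if v: "v \<in> V - J" and t: "0 \<le> t" for v t
  proof (rule barrier[of "V - J" g "\<lambda>v t. - (tc (k t) v - T v) - (- (C * e / 2 * exp (- e * t / 2)) / (1 + C * exp (- e * t / 2)))"])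
    show "finite (V - J)" using finV by simp
    show "(g v has_real_derivative - (tc (k t) v - T v) - (- (C * e / 2 * exp (- e * t / 2)) / (1 + C * exp (- e * t / 2)))) (at t within {0..})"
      if v: "v \<in> V - J" and t: "0 \<le> t" for v t
      unfolding g_def \<phi>_def
      by (rule DERIV_cong[OF DERIV_diff[OF DERIV_diff[OF flow_log_deriv[OF f t v] DERIV_const] log_factor(1)[OF C0 e]]])
        (simp only: diff_0_right)
    show "g v 0 < 0" if v: "v \<in> V - J" for v
    proof -
      have "k 0 v / K v \<le> (\<Sum>v\<in>V - J. k 0 v / K v)" using nonneg finV v by (intro member_le_sum) auto
      then have "k 0 v / K v < \<phi> 0" by (simp add: C_def \<phi>_def)
      then have "k 0 v < K v * \<phi> 0" using K(2)[OF v] by (simp add: pos_divide_less_eq mult.commute)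
      then show ?thesis using lt[OF _ v, of 0] by simp
    qed
    show "- (tc (k t) v - T v) - (- (C * e / 2 * exp (- e * t / 2)) / (1 + C * exp (- e * t / 2))) < 0"
      if v: "v \<in> V - J" and t: "0 \<le> t" and z: "g v t = 0" and le: "\<forall>w\<in>V - J. g w t \<le> 0" for v t
    proof -
      have kv: "k t v = \<phi> t * K v" using lt(3)[OF t v] z by simp
      have "tc (\<lambda>w. \<phi> t * K w) v \<le> tc (k t) v"
      proof (rule tc_antimono[OF flow_nn[OF f t], where k' = "\<lambda>w. \<phi> t * K w"])
        fix w assume w: "w \<in> V"
        show "k t w \<le> \<phi> t * K w"
        proof (cases "w \<in> J")
          case True
          then have "k t w = 0" using f t w unfolding flow_def by blast
          then show ?thesis using \<phi>[of t] nonneg_onD[OF K(1) w] by simp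
        next
          case False
          then show ?thesis using lt(2)[OF t, of w] w le by (simp add: mult.commute)
        qed
      qed (rule kv)
      moreover have "tc K v \<le> tc (\<lambda>w. \<phi> t * K w) v" by (rule tc_scale[OF K(1)]) (use \<phi>[of t] in simp)
      ultimately have "T v + e \<le> tc (k t) v" using TK[OF v] by simp
      moreover have "- e / 2 < - (C * e / 2 * exp (- e * t / 2)) / (1 + C * exp (- e * t / 2))"
        by (rule log_factor(2)[OF C0 e])
      ultimately show ?thesis using e by linarith
    qed
  qed (fact v t)+
  then have "k t v < K v * \<phi> t" if "0 \<le> t" "v \<in> V - J" for t v using lt(1)[OF that] that by blast
  with C0 show ?thesis unfolding \<phi>_def by blast
qed

text \<open>The mirror image of \<open>flow_upper\<close>, comparing K with \<phi> k. It runs over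
  \<open>V - I\<close> only: on \<open>I\<close> the function K is 0 and the bound at contact is
  automatic, even where the flow itself is positive.\<close>

lemma flow_lower:
  assumes f: "flow J T k" and JI: "J \<subseteq> I" and K: "nonneg_on K" "\<And>v. v \<in> V - I \<Longrightarrow> 0 < K v" "\<And>v. v \<in> V \<inter> I \<Longrightarrow> K v = 0" and e: "e > 0"
    and TK: "\<And>v. v \<in> V - I \<Longrightarrow> tc K v \<le> T v - e"
  shows "\<exists>C>0. \<forall>t\<ge>0. \<forall>v\<in>V - I. K v < k t v * (1 + C * exp (- e * t / 2))"
proof -
  have VI: "v \<in> V - J" if "v \<in> V - I" for v using that JI by auto
  define C where "C = (\<Sum>v\<in>V - I. K v / k 0 v) + 1"
  have nonneg: "0 \<le> K v / k 0 v" if "v \<in> V - I" for v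
    using flow_pos[OF f _ VI[OF that], of 0] K(2)[OF that] by simp
  then have C: "C \<ge> 1" unfolding C_def by (simp only: le_add_same_cancel2 sum_nonneg)
  then have C0: "C > 0" by simp
  define \<phi> where "\<phi> = (\<lambda>t. 1 + C * exp (- e * t / 2))"
  have \<phi>: "\<phi> t > 1" for t using C by (simp add: \<phi>_def)
  define g where "g = (\<lambda>v t. ln (K v) - ln (k t v) - ln (\<phi> t))"
  have lt: "K v < k t v * \<phi> t \<longleftrightarrow> g v t < 0" "K v \<le> k t v * \<phi> t \<longleftrightarrow> g v t \<le> 0" "K v = k t v * \<phi> t \<longleftrightarrow> g v t = 0"
    if "0 \<le> t" "v \<in> V - I" for t v
  proof -
    have p: "0 < K v" "0 < k t v * \<phi> t" "0 < k t v" "0 < \<phi> t" using flow_pos[OF f that(1) VI[OF that(2)]] K(2)[OF that(2)] \<phi>[of t] by auto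
    have "g v t = ln (K v) - ln (k t v * \<phi> t)" unfolding g_def using p by (simp add: ln_mult)
    then show "K v < k t v * \<phi> t \<longleftrightarrow> g v t < 0" "K v \<le> k t v * \<phi> t \<longleftrightarrow> g v t \<le> 0" "K v = k t v * \<phi> t \<longleftrightarrow> g v t = 0"
      using p by auto
  qed
  have "g v t < 0" if v: "v \<in> V - I" and t: "0 \<le> t" for v t
  proof (rule barrier[of "V - I" g "\<lambda>v t. (tc (k t) v - T v) - (- (C * e / 2 * exp (- e * t / 2)) / (1 + C * exp (- e * t / 2)))"])
    show "finite (V - I)" using finV by simp
    show "(g v has_real_derivative (tc (k t) v - T v) - (- (C * e / 2 * exp (- e * t / 2)) / (1 + C * exp (- e * t / 2)))) (at t within {0..})"
      if v: "v \<in> V - I" and t: "0 \<le> t" for v t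
      unfolding g_def \<phi>_def
      by (rule DERIV_cong[OF DERIV_diff[OF DERIV_diff[OF DERIV_const flow_log_deriv[OF f t VI[OF v]]] log_factor(1)[OF C0 e]]])
        (simp only: diff_0 minus_minus)
    show "g v 0 < 0" if v: "v \<in> V - I" for v
    proof -
      have "K v / k 0 v \<le> (\<Sum>v\<in>V - I. K v / k 0 v)" using nonneg finV v by (intro member_le_sum) auto
      then have "K v / k 0 v < \<phi> 0" by (simp add: C_def \<phi>_def)
      then have "K v < k 0 v * \<phi> 0" using flow_pos[OF f _ VI[OF v], of 0] by (simp add: pos_divide_less_eq mult.commute)
      then show ?thesis using lt[OF _ v, of 0] by simp
    qed
    show "(tc (k t) v - T v) - (- (C * e / 2 * exp (- e * t / 2)) / (1 + C * exp (- e * t / 2))) < 0"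
      if v: "v \<in> V - I" and t: "0 \<le> t" and z: "g v t = 0" and le: "\<forall>w\<in>V - I. g w t \<le> 0" for v t
    proof -
      note n = flow_nn[OF f t]
      have kv: "K v = \<phi> t * k t v" using lt(3)[OF t v] z by simp
      have "tc (\<lambda>w. \<phi> t * k t w) v \<le> tc K v"
      proof (rule tc_antimono[OF K(1), where k' = "\<lambda>w. \<phi> t * k t w"])
        fix w assume w: "w \<in> V"
        show "K w \<le> \<phi> t * k t w"
        proof (cases "w \<in> I")
          case True
          then show ?thesis using \<phi>[of t] nonneg_onD[OF n w] K(3)[of w] w by simp
        next
          case False
          then show ?thesis using lt(2)[OF t, of w] w le by (simp add: mult.commute)
        qed
      qed (rule kv)
      moreover have "tc (k t) v \<le> tc (\<lambda>w. \<phi> t * k t w) v" by (rule tc_scale[OF n]) (use \<phi>[of t] in simp)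
      ultimately have "tc (k t) v \<le> T v - e" using TK[OF v] by simp
      moreover have "- e / 2 < - (C * e / 2 * exp (- e * t / 2)) / (1 + C * exp (- e * t / 2))"
        by (rule log_factor(2)[OF C0 e])
      ultimately show ?thesis using e by linarith
    qed
  qed (fact v t)+
  then have "K v < k t v * \<phi> t" if "0 \<le> t" "v \<in> V - I" for t v using lt(1)[OF that] that by blast
  with C0 show ?thesis unfolding \<phi>_def by blast
qed

lemma factor_tendsto: "e > 0 \<Longrightarrow> ((\<lambda>t. 1 + C * exp (- e * t / 2)) \<longlongrightarrow> (1::real)) at_top"
  by real_asymp

text \<open>For each bound on one side of the limit a perturbed solution still respects it, by
  continuity in the prescribed values. The barrier built from that solution tends to it, since its
  factor tends to 1.\<close>

lemma flow_converges:
  assumes f: "flow J T k" and JI: "J \<subseteq> I" "I \<subseteq> V" and T: "admissible T" and z: "\<And>v. v \<in> V \<Longrightarrow> T v = 0 \<longleftrightarrow> v \<in> I"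
    and v: "v \<in> V"
  shows "((\<lambda>t. k t v) \<longlongrightarrow> max_subsol T v) at_top"
proof (rule order_tendstoI)
  have nT: "nonneg_on T" using T by (simp add: admissible_def)
  obtain e0 where e0: "e0 > 0" and adm: "\<And>T'. (\<forall>v\<in>V. 0 \<le> T' v \<and> T' v \<le> T v + e0) \<Longrightarrow> admissible T'"
    using admissible_perturb[OF T] by blast
  fix x assume x: "max_subsol T v < x"
  show "\<forall>\<^sub>F t in at_top. k t v < x"
  proof (cases "v \<in> J")
    case True
    have "max_subsol T v \<ge> 0" using nonneg_onD[OF max_subsol_nn[OF T] v] .
    then have "0 < x" using x by simp
    moreover have "k t v = 0" if "0 \<le> t" for t using f that v True unfolding flow_def by blast
    ultimately show ?thesis using eventually_ge_at_top[of "0::real"] by (metis (mono_tags, lifting) eventually_mono)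
  next
    case False
    then have vJ: "v \<in> V - J" using v by simp
    obtain e1 where e1: "e1 > 0" and near: "\<And>T'. admissible T' \<Longrightarrow> (\<forall>w\<in>V. T w \<le> T' w \<and> T' w \<le> T w + e1) \<Longrightarrow> max_subsol T' v < x"
      using max_subsol_near(1)[OF T v, of "x - max_subsol T v"] x by auto
    define e where "e = min e0 e1"
    have e: "e > 0" using e0 e1 by (simp add: e_def)
    \<comment> \<open>On \<open>J\<close> the flow stays 0 and nothing is raised. On
      \<open>I - J\<close> the raised value is positive although \<open>T\<close> is 0, which makes
      the comparison function positive there, as \<open>flow_upper\<close> demands.\<close>
    define T' where "T' = (\<lambda>w. if w \<in> J then T w else T w + e)"
    have T': "admissible T'" using nonneg_onD[OF nT] e0 e by (intro adm) (auto simp: T'_def e_def)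
    have "\<forall>w\<in>V. T w \<le> T' w \<and> T' w \<le> T w + e1" using e1 e by (auto simp: T'_def e_def)
    then have lt: "max_subsol T' v < x" using near T' by blast
    have pos: "0 < max_subsol T' w" if "w \<in> V - J" for w
    proof -
      have "T' w > 0" using that nonneg_onD[OF nT, of w] e by (simp add: T'_def)
      then show ?thesis using max_subsol_zero_iff[OF T', of w] nonneg_onD[OF max_subsol_nn[OF T'], of w] that by auto
    qed
    obtain C where C: "\<And>t. 0 \<le> t \<Longrightarrow> k t v < max_subsol T' v * (1 + C * exp (- e * t / 2))"
      using flow_upper[OF f max_subsol_nn[OF T'] pos e] max_subsol_eq[OF T'] vJ by (auto simp: T'_def)
    have "((\<lambda>t. max_subsol T' v * (1 + C * exp (- e * t / 2))) \<longlongrightarrow> max_subsol T' v * 1) at_top"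
      by (intro tendsto_intros factor_tendsto e)
    then have "\<forall>\<^sub>F t in at_top. max_subsol T' v * (1 + C * exp (- e * t / 2)) < x" using lt by (intro order_tendstoD(2)) auto
    then show ?thesis using eventually_ge_at_top[of 0] by eventually_elim (use C in force)
  qed
next
  have nT: "nonneg_on T" using T by (simp add: admissible_def)
  fix x assume x: "x < max_subsol T v"
  show "\<forall>\<^sub>F t in at_top. x < k t v"
  proof (cases "x < 0")
    case True
    have "0 \<le> k t v" if "0 \<le> t" for t using flow_nn[OF f that] v by (simp add: nonneg_on_def)
    then show ?thesis using True by (intro eventually_mono[OF eventually_ge_at_top[of "0::real"]]) force
  next
    case False
    then have Kv: "max_subsol T v > 0" using x by simp
    then have "T v \<noteq> 0" using max_subsol_zero_iff[OF T v] by simp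
    then have vI: "v \<in> V - I" using z v by simp
    obtain e1 where e1: "e1 > 0" and near: "\<And>T'. admissible T' \<Longrightarrow> (\<forall>w\<in>V. T' w \<le> T w \<and> T w \<le> T' w + e1) \<Longrightarrow> x < max_subsol T' v"
      using max_subsol_near(2)[OF T v, of "max_subsol T v - x"] x False by auto
    obtain e0 where e0: "e0 > 0" and adm: "\<And>T'. (\<forall>v\<in>V. 0 \<le> T' v \<and> T' v \<le> T v + e0) \<Longrightarrow> admissible T'"
      using admissible_perturb[OF T] by blast
    define m where "m = Min (T ` (V - I))"
    have fin: "finite (T ` (V - I))" "T ` (V - I) \<noteq> {}" using finV vI by auto
    have "\<forall>y\<in>T ` (V - I). 0 < y" using z nonneg_onD[OF nT] by (force simp: less_le)
    then have m: "m > 0" unfolding m_def using Min_gr_iff[OF fin] by blast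
    have mT: "m \<le> T w" if "w \<in> V - I" for w unfolding m_def using fin that by (intro Min_le) auto
    \<comment> \<open>At most half of the smallest positive prescribed value, so that the lowered
      values on \<open>V - I\<close> stay positive and have the same zero set as
      \<open>T\<close>.\<close>
    define e where "e = min (m / 2) e1"
    have e: "e > 0" using m e1 by (simp add: e_def)
    define T' where "T' = (\<lambda>w. if w \<in> I then T w else T w - e)"
    have eT: "e < T w" if "w \<in> V - I" for w using mT[OF that] m by (simp add: e_def min_def)
    have T': "admissible T'"
    proof (rule adm, intro ballI conjI)
      fix w assume w: "w \<in> V"
      show "0 \<le> T' w" using w eT[of w] nonneg_onD[OF nT w] by (auto simp: T'_def)
      show "T' w \<le> T w + e0" using e e0 by (simp add: T'_def)
    qed
    have "\<forall>w\<in>V. T' w \<le> T w \<and> T w \<le> T' w + e1" using e e1 by (auto simp: T'_def e_def)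
    then have lt: "x < max_subsol T' v" using near T' by blast
    have pos: "0 < max_subsol T' w" if "w \<in> V - I" for w
      using max_subsol_zero_iff[OF T', of w] nonneg_onD[OF max_subsol_nn[OF T'], of w] that eT[OF that] by (auto simp: T'_def less_le)
    have zero: "max_subsol T' w = 0" if "w \<in> V \<inter> I" for w
      using max_subsol_zero_iff[OF T', of w] that z[of w] by (simp add: T'_def)
    obtain C where C0: "C > 0" and C: "\<And>t. 0 \<le> t \<Longrightarrow> max_subsol T' v < k t v * (1 + C * exp (- e * t / 2))"
      using flow_lower[OF f JI(1) max_subsol_nn[OF T'] pos zero e] max_subsol_eq[OF T'] vI by (auto simp: T'_def)
    have "((\<lambda>t. max_subsol T' v / (1 + C * exp (- e * t / 2))) \<longlongrightarrow> max_subsol T' v / 1) at_top"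
      by (intro tendsto_intros factor_tendsto e) simp
    then have "\<forall>\<^sub>F t in at_top. x < max_subsol T' v / (1 + C * exp (- e * t / 2))" using lt by (intro order_tendstoD(1)) auto
    then show ?thesis using eventually_ge_at_top[of 0]
    proof eventually_elim
      case (elim t)
      have "1 + C * exp (- e * t / 2) > 0" using C0 by (simp add: add_pos_pos)
      then have "max_subsol T' v / (1 + C * exp (- e * t / 2)) < k t v" using C[of t] elim by (simp add: pos_divide_less_eq)
      then show ?case using elim by simp
    qed
  qed
qed

end

section \<open>From the triangulated surface to the combinatorial setting\<close>

lemma tri_graph_triangulation:
  assumes "oriented_simple_triangulation S V E F"
  shows "tri_graph V F"
proof
  have o: "finite V \<and> (\<forall>e\<in>E. e \<subseteq> V \<and> card e = 2) \<and> (\<forall>f\<in>F. tri_vertices f \<subseteq> V \<and> tri_edges f \<subseteq> E)"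
    using assms unfolding oriented_simple_triangulation_def by (elim conjE) (intro conjI; assumption)
  then show finV: "finite V" by (rule conjunct1)
  have sub: "tri_vertices f \<subseteq> V" "tri_edges f \<subseteq> E" if "f \<in> F" for f using o that by blast+
  have ne: "u \<noteq> v" if "{u, v} \<in> E" for u v
  proof
    assume "u = v"
    then have "{v} \<in> E" using that by simp
    then have "card {v} = 2" using o by blast
    then show False by simp
  qed
  have "F \<subseteq> V \<times> V \<times> V"
  proof
    fix f assume "f \<in> F"
    then show "f \<in> V \<times> V \<times> V" using sub(1)[of f] by (cases f) auto
  qed
  then show "finite F" using finV by (meson finite_SigmaI finite_subset)
  fix a b c assume "(a, b, c) \<in> F"
  then show "a \<in> V \<and> b \<in> V \<and> c \<in> V \<and> a \<noteq> b \<and> b \<noteq> c \<and> c \<noteq> a"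
    using sub[of "(a, b, c)"] ne[of a b] ne[of b c] ne[of c a] by simp
qed

lemma logdist_exp: "logdist (exp x) (exp y) = \<bar>x - y\<bar>"
  by (simp add: logdist_def)

context tri_graph
begin

lemma tc_lip:
  fixes D :: real
  assumes n: "nonneg_on k" "nonneg_on k'" and z: "\<And>w. w \<in> V \<Longrightarrow> k w = 0 \<longleftrightarrow> k' w = 0"
    and D: "\<And>w. w \<in> V \<Longrightarrow> logdist (k w) (k' w) \<le> D" "0 \<le> D"
  shows "\<bar>tc k v - tc k' v\<bar> \<le> card F * (6 * D)"
proof -
  \<comment> \<open>Three corners, each contributing the constant 2 of
    \<open>ctri_lip\<close>.\<close>
  have tri: "\<bar>ctri (k a) (k b) (k c) - ctri (k' a) (k' b) (k' c)\<bar> \<le> 6 * D"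
    if "a \<in> V" "b \<in> V" "c \<in> V" for a b c
    using ctri_lip[of "k a" "k b" "k c" "k' a" "k' b" "k' c"] nonneg_onD[OF n(1)] nonneg_onD[OF n(2)] z that D(1)[OF that(1)] D(1)[OF that(2)] D(1)[OF that(3)]
    by fastforce
  have "\<bar>fc k f v - fc k' f v\<bar> \<le> 6 * D" if "f \<in> F" for f
  proof -
    obtain a b c where f: "f = (a, b, c)" by (cases f)
    have "a \<in> V" "b \<in> V" "c \<in> V" using faces that f by blast+
    then show ?thesis unfolding f using tri D(2) by simp
  qed
  then have "(\<Sum>f\<in>F. \<bar>fc k f v - fc k' f v\<bar>) \<le> card F * (6 * D)" by (rule sum_bounded_above)
  moreover have "\<bar>tc k v - tc k' v\<bar> \<le> (\<Sum>f\<in>F. \<bar>fc k f v - fc k' f v\<bar>)"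
    unfolding tc_def sum_subtractf[symmetric] by (rule sum_abs)
  ultimately show ?thesis by linarith
qed

text \<open>In the coordinates \<open>ln k\<close> the flow has a globally Lipschitz vector field.\<close>

lemma flow_ray_exists:
  assumes k0: "k0 \<in> bd_Omega_k V J"
  shows "\<exists>k. flow_ray V F J T k0 k"
proof -
  define W where "W = V - J"
  \<comment> \<open>Entries outside \<open>W\<close> are pinned at 0 instead of being given a
    logarithm, and the exponential keeps the others positive. Every solution of the system therefore
    stays in the prescribed stratum.\<close>
  define \<kappa> where "\<kappa> = (\<lambda>u w. if w \<in> W then exp (u w :: real) else 0)"
  define G where "G = (\<lambda>u v. T v - tc (\<kappa> u) v)"
  have fW: "finite W" using finV by (simp add: W_def)
  have n: "nonneg_on (\<kappa> u)" for u by (simp add: nonneg_on_def \<kappa>_def)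
  have lip: "\<bar>G u v - G u' v\<bar> \<le> (card F * 6) * (\<Sum>w\<in>W. \<bar>u w - u' w\<bar>)" for u u' :: "'a \<Rightarrow> real" and v
  proof -
    have ld: "logdist (\<kappa> u' w) (\<kappa> u w) \<le> (\<Sum>w\<in>W. \<bar>u w - u' w\<bar>)" for w
    proof (cases "w \<in> W")
      case True
      then have "\<bar>u w - u' w\<bar> \<le> (\<Sum>w\<in>W. \<bar>u w - u' w\<bar>)" using fW by (intro member_le_sum) auto
      then show ?thesis using True by (simp add: \<kappa>_def logdist_exp abs_minus_commute[of "u' w" "u w"])
    qed (simp add: \<kappa>_def logdist_def sum_nonneg)
    have "\<bar>tc (\<kappa> u') v - tc (\<kappa> u) v\<bar> \<le> card F * (6 * (\<Sum>w\<in>W. \<bar>u w - u' w\<bar>))"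
      by (rule tc_lip[OF n n _ ld]; simp add: \<kappa>_def sum_nonneg)
    then show ?thesis by (simp add: G_def mult.assoc)
  qed
  obtain x where x0: "\<And>v. v \<in> W \<Longrightarrow> x 0 v = ln (k0 v)"
    and x: "\<And>t v. 0 \<le> t \<Longrightarrow> v \<in> W \<Longrightarrow> ((\<lambda>s. x s v) has_real_derivative G (x t) v) (at t within {0..})"
  proof (rule global_flow_exists[OF fW, where L = "card F * 6" and G = G and ?x0.0 = "\<lambda>v. ln (k0 v)"])
    show "\<bar>G u v - G u' v\<bar> \<le> real (card F * 6) * (\<Sum>w\<in>W. \<bar>u w - u' w\<bar>)" for u u' v
      using lip[of u v u'] by simp
  qed auto
  define k where "k = (\<lambda>t. \<lambda>v\<in>V. \<kappa> (x t) v)"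
  have kV: "k0 v \<ge> 0" "k0 v = 0 \<longleftrightarrow> v \<in> J" if "v \<in> V" for v
    using k0 that by (auto simp: bd_Omega_k_def Omega_k_def)
  have "k 0 v = k0 v" for v
  proof (cases "v \<in> V")
    case True
    show ?thesis
    proof (cases "v \<in> J")
      case False
      then show ?thesis using True kV[OF True] x0[of v] by (simp add: k_def \<kappa>_def W_def less_le)
    qed (use True kV[OF True] in \<open>simp add: k_def \<kappa>_def W_def\<close>)
  next
    case False
    then show ?thesis using k0 by (auto simp: k_def bd_Omega_k_def Omega_k_def PiE_def extensional_def)
  qed
  then have "k 0 = k0" by (rule ext)
  moreover have "k t \<in> bd_Omega_k V J" for t
    by (auto simp: k_def bd_Omega_k_def Omega_k_def \<kappa>_def W_def)
  moreover have "((\<lambda>s. k s v) has_real_derivative - (vertex_curv F (k t) v - T v) * k t v) (at t within {0..})"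
    if t: "0 \<le> t" and v: "v \<in> V - J" for t v
  proof -
    have vW: "v \<in> W" using v by (simp add: W_def)
    have e: "(\<lambda>s. k s v) = (\<lambda>s. exp (x s v))" using v vW by (simp add: k_def \<kappa>_def)
    have "nonneg_on (k t)" using n[of "x t"] by (simp add: nonneg_on_def k_def)
    then have c: "vertex_curv F (k t) v = tc (\<kappa> (x t)) v"
      unfolding vertex_curv_tc[OF \<open>nonneg_on (k t)\<close>] by (intro tc_cong) (simp add: k_def)
    have "((\<lambda>s. exp (x s v)) has_real_derivative exp (x t v) * G (x t) v) (at t within {0..})"
      by (rule DERIV_chain2[OF DERIV_exp x[OF t vW]])
    moreover have "exp (x t v) * G (x t) v = - (vertex_curv F (k t) v - T v) * k t v"
      unfolding c using v vW by (simp add: k_def \<kappa>_def G_def mult.commute)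
    ultimately show ?thesis unfolding e by simp
  qed
  ultimately have "flow_ray V F J T k0 k" by (simp add: flow_ray_def)
  then show ?thesis by blast
qed

lemma flow_ray_flow: "flow_ray V F J T k0 k \<Longrightarrow> flow J T k"
  unfolding flow_def
proof (intro allI impI conjI ballI)
  fix t :: real and v
  assume f: "flow_ray V F J T k0 k" and t: "0 \<le> t"
  have b: "k t \<in> bd_Omega_k V J" using f t by (simp add: flow_ray_def)
  { assume "v \<in> V"
    then show "0 \<le> k t v" "k t v = 0 \<longleftrightarrow> v \<in> J" using b by (auto simp: bd_Omega_k_def Omega_k_def) }
  assume v: "v \<in> V - J"
  have "nonneg_on (k t)" using b by (auto simp: nonneg_on_def bd_Omega_k_def Omega_k_def)
  from vertex_curv_tc[OF this, of v, symmetric]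
  show "((\<lambda>s. k s v) has_real_derivative - (tc (k t) v - T v) * k t v) (at t within {0..})"
    using f t v by (simp only: flow_ray_def)
qed

lemma admissible_Omega_T: "T \<in> Omega_T V F \<Longrightarrow> admissible T"
  by (auto simp: Omega_T_def admissible_def nonneg_on_def)

text \<open>Perron's solution gives a preimage and \<open>tc_inj\<close> its uniqueness; together
  they determine the value of the definite description behind \<open>the_inv_into\<close>.\<close>

lemma Phi_max_subsol:
  assumes T: "T \<in> bd_Omega_T V F I"
  shows "restrict (max_subsol T) V \<in> bd_Omega_k V I" "Phi V F (restrict (max_subsol T) V) = T"
    "Phi_inv V F T = restrict (max_subsol T) V"
proof -
  let ?K = "restrict (max_subsol T) V"
  have TO: "T \<in> Omega_T V F" using T by (simp add: bd_Omega_T_def)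
  have adm: "admissible T" by (rule admissible_Omega_T[OF TO])
  have Te: "T \<in> extensional V" using TO by (simp add: Omega_T_def PiE_def)
  have nK: "nonneg_on ?K" using max_subsol_nn[OF adm] by (simp add: nonneg_on_def)
  show K: "?K \<in> bd_Omega_k V I"
    using T max_subsol_zero_iff[OF adm] nonneg_onD[OF max_subsol_nn[OF adm]] by (auto simp: bd_Omega_k_def Omega_k_def bd_Omega_T_def)
  have tcK: "tc ?K v = T v" if "v \<in> V" for v
    unfolding max_subsol_eq[OF adm that, symmetric] by (rule tc_cong) simp
  show PK: "Phi V F ?K = T"
    by (rule extensionalityI[of _ V]) (use Te tcK in \<open>auto simp: Phi_def vertex_curv_tc[OF nK]\<close>)
  show "Phi_inv V F T = ?K"
    unfolding Phi_inv_def the_inv_into_def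
  proof (rule the_equality)
    show "?K \<in> Omega_k V \<and> Phi V F ?K = T" using K PK by (simp add: bd_Omega_k_def)
    fix k assume k: "k \<in> Omega_k V \<and> Phi V F k = T"
    then have n: "nonneg_on k" by (auto simp: nonneg_on_def Omega_k_def)
    have "tc k v = T v" if "v \<in> V" for v
    proof -
      have "Phi V F k v = T v" using k by simp
      then show ?thesis unfolding Phi_def using that by (simp add: vertex_curv_tc[OF n])
    qed
    then have "k v = ?K v" if "v \<in> V" for v
      using tc_inj[OF n nK _ _ that] admissible_covered[OF adm] tcK by simp
    then show "k = ?K"
      by (intro extensionalityI[of _ V]) (use k in \<open>auto simp: Omega_k_def PiE_def\<close>)
  qed
qed

end

lemma limitin_product_nonneg:
  assumes e: "\<And>t. 0 \<le> t \<Longrightarrow> k t \<in> V \<rightarrow>\<^sub>E {0..}" and l: "l \<in> V \<rightarrow>\<^sub>E {0..}"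
    and c: "\<And>v. v \<in> V \<Longrightarrow> ((\<lambda>t. k t v) \<longlongrightarrow> l v) at_top"
  shows "limitin (product_topology (\<lambda>_. top_of_set {0..}) V) (k :: real \<Rightarrow> 'a \<Rightarrow> real) l at_top"
  unfolding limitin_componentwise
proof (intro conjI ballI)
  show "l \<in> extensional V" using l by (simp add: PiE_def)
  show "\<forall>\<^sub>F t in at_top. k t \<in> topspace (product_topology (\<lambda>_. top_of_set {0..}) V)"
    using eventually_ge_at_top[of "0::real"] by eventually_elim (use e in simp)
  fix v assume v: "v \<in> V"
  have "\<forall>\<^sub>F t in at_top. k t v \<in> {0..}"
    using eventually_ge_at_top[of "0::real"] by eventually_elim (use e v in blast)
  moreover have "l v \<in> {0..}" using l v by blast
  ultimately show "limitin (top_of_set {0..}) (\<lambda>t. k t v) (l v) at_top"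
    using c[OF v] unfolding limitin_subtopology limitin_canonical_iff by blast
qed

text \<open>Existence of a flow ray is asserted along with the convergence of all of them, so that
  the latter is not vacuous. In the product topology over the finite set \<open>V\<close>
  convergence is coordinatewise, and each coordinate is settled by
  \<open>flow_converges\<close>.\<close>

theorem theorem1p4:
  fixes S :: "'a topology" and V :: "'a set" and E :: "'a set set" and F :: "'a triangle set"
    and I J :: "'a set" and T k0 :: "'a \<Rightarrow> real"
  assumes "connected_closed_surface S"
    and "oriented_simple_triangulation S V E F"
    and "J \<subseteq> I" and "I \<subseteq> V"
    and "T \<in> bd_Omega_T V F I"
    and "k0 \<in> bd_Omega_k V J"
  shows "Phi_inv V F T \<in> bd_Omega_k V I \<and> Phi V F (Phi_inv V F T) = T \<and>
    (\<exists>k. flow_ray V F J T k0 k) \<and>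
    (\<forall>k. flow_ray V F J T k0 k \<longrightarrow>
       limitin (product_topology (\<lambda>_. top_of_set {0..}) V) k (Phi_inv V F T) at_top)"
proof -
  interpret tri_graph V F by (rule tri_graph_triangulation[OF assms(2)])
  note K = Phi_max_subsol[OF assms(5)]
  have adm: "admissible T" using assms(5) admissible_Omega_T by (simp add: bd_Omega_T_def)
  have "limitin (product_topology (\<lambda>_. top_of_set {0..}) V) k (Phi_inv V F T) at_top"
    if f: "flow_ray V F J T k0 k" for k
  proof (rule limitin_product_nonneg)
    show "k t \<in> V \<rightarrow>\<^sub>E {0..}" if "0 \<le> t" for t
      using f that by (simp add: flow_ray_def bd_Omega_k_def Omega_k_def)
    show "Phi_inv V F T \<in> V \<rightarrow>\<^sub>E {0..}" using K(1) unfolding K(3) by (simp add: bd_Omega_k_def Omega_k_def)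
    fix v assume v: "v \<in> V"
    have "((\<lambda>t. k t v) \<longlongrightarrow> max_subsol T v) at_top"
      by (rule flow_converges[OF flow_ray_flow[OF f] assms(3,4) adm _ v]) (use assms(5) in \<open>simp add: bd_Omega_T_def\<close>)
    then show "((\<lambda>t. k t v) \<longlongrightarrow> Phi_inv V F T v) at_top" unfolding K(3) using v by simp
  qed
  then show ?thesis using K flow_ray_exists[OF assms(6)] unfolding K(3) by blast
qed

end
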